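(* Let $H$ be a real-analytic $2$-nondegenerate CR structure of hypersurface type whose Levi kernel $K$ has constant rank equal to $1$. Then the CR structure given by $H$ is recoverable if and only if, for a generic point $p$, the space $\mathrm{ad}\,\overline K_p\subset\mathrm{Hom}(H_p/K_p,\overline H_p/\overline K_p)$ is generated by an operator of rank greater than $1$.
   Context: CR structures. All objects are real-analytic and all considerations are local. $\mathbb{C}TM=TM\otimes\mathbb{C}$, $\Gamma(E)$ denotes sections of $E$. A CR structure of hypersurface type on a $(2n+1)$-dimensional real manifold $M$ is a complex rank $n$ subbundle $H\subset\mathbb{C}TM$ with $[H,H]\subset H$ and $H\cap\overline H=0$. The Levi form is $\mathcal L(X_p,Y_p)=\frac{i}{2}[X,\overline Y]_p \bmod H_p\oplus\overline H_p$ for $X,Y\in\Gamma(H)$, and $K$ denotes its kernel. For $v\in K_p$ define $\mathrm{ad}_v:\overline H_p/\overline K_p\to H_p/K_p$ by $y\mapsto [V,Y]_p \bmod K_p\oplus\overline H_p$, where $V\in\Gamma(K)$, $V(p)=v$, $Y\in\Gamma(\overline H)$, $Y(p)\equiv y \bmod \overline K$; for $v\in\overline K_p$ define $\mathrm{ad}_v:H_p/K_p\to\overline H_p/\overline K_p$ analogously (by complex conjugation). The structure is $2$-nondegenerate if $K\neq0$ and at every point $p$ there is no nonzero $v\in K_p$ with $\mathrm{ad}_v=0$. Put $\mathrm{ad}\,\overline K_p=\{\mathrm{ad}_v : v\in\overline K_p\}$. Complexification and recoverability. After shrinking, $M$ is the fixed point set of an antiholomorphic involution $\tau$ of a complexification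 $\mathbb{C}M$; $H,K$ extend to holomorphic distributions on $\mathbb{C}M$ denoted by the same letters, and $\overline H:=\tau_*H$, $\overline K:=\tau_*K$; the operators $\mathrm{ad}_v$ are defined by the same formulas at points of $\mathbb{C}M$. The distributions $K,\overline K,K\oplus\overline K$ are involutive. The Levi leaf space is $\mathcal N=\mathbb{C}M/\mathrm{Fol}(K\oplus\overline K)$ with projection $\pi$; $\mathcal D=\pi_*(H\oplus\overline H)$ is a contact distribution on $\mathcal N$, so each $\mathcal D_\gamma$ has a canonical conformal symplectic form. For $\gamma=\pi(q)$ set $J^-_\gamma(q)=\pi_*H_q$, $J^+_\gamma(q)=\pi_*\overline H_q$, Lagrangian subspaces of $\mathcal D_\gamma$; $J^\pm_\gamma=\{J^\pm_\gamma(q): q\in\pi^{-1}(\gamma)\}$ are submanifolds of the Lagrangian Grassmannian $\mathrm{LG}(\mathcal D_\gamma)$. The triple $(\mathcal D,J^-,J^+)$ with the involution induced by $\tau$ is the dynamical Legendrian contact structure associated with (the germ of) $H$. The canonical local diffeomorphism $F:\mathbb{C}M\to J^-\times J^+$, $F(q)=(J^-_\gamma(q),J^+_\gamma(q))$, onto the bundle over $\mathcal N$ with fibers $J^-_\gamma\times J^+_\gamma$ shows that the dynamical Legendrian contact structure determines $\mathbb{C}M$, $K$, $\overline K$, $H+\overline K$ and $\overline H+K$. The CR structure $H$ is called recoverable if it can be uniquely reconstructed from its dynamical Legendrian contact structure; concretely, this means that $H$ is the unique involutive rank $n$ subdistribution of $H+\overline K$ that contains $K$ and is transversal to $\overline K$.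 "For a generic point $p$" means for all $p$ in some open dense subset. *)

theory Defs
  imports "HOL-Analysis.Analysis"
begin

(* Everything is local, so a real-analytic manifold M of dimension CARD('m) is an open subset of
   real^'m, its complexified tangent bundle is M x complex^'m, and its complexification is an open
   subset of complex^'m on which the antiholomorphic involution tau is coordinatewise conjugation.
   Complex subspaces, spans and dimensions in complex^'m are those of the vector space structure
   vec, i.e. of the scalar multiplication *s.  A + B is the Minkowski sum of sets. *)

section \<open>Analytic vector fields\<close>

definition real_analytic_on :: "(real^'m) set \<Rightarrow> (real^'m \<Rightarrow> complex) \<Rightarrow> bool" where
  "real_analytic_on U f \<longleftrightarrow>
     (\<forall>p\<in>U. \<exists>c :: ('m \<Rightarrow> nat) \<Rightarrow> complex. \<exists>e>0. \<forall>x\<in>ball p e.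
        ((\<lambda>\<alpha>. c \<alpha> * (\<Prod>i\<in>UNIV. complex_of_real (x $ i - p $ i) ^ \<alpha> i)) has_sum f x) UNIV)"

definition analytic_field :: "(real^'m) set \<Rightarrow> (real^'m \<Rightarrow> complex^'m) \<Rightarrow> bool" where
  "analytic_field U X \<longleftrightarrow> (\<forall>i. real_analytic_on U (\<lambda>x. X x $ i))"

definition holomorphic_field :: "(complex^'m) set \<Rightarrow> (complex^'m \<Rightarrow> complex^'m) \<Rightarrow> bool" where
  "holomorphic_field U X \<longleftrightarrow>
     (\<forall>z\<in>U. \<exists>D. (X has_derivative D) (at z) \<and> (\<forall>c v. D (c *s v) = c *s D v))"

(* [X, Y] = sum_j X^j d_j Y - Y^j d_j X.  For 'a = real these are complex vector fields on a real
   manifold, d_j being the real partial derivatives; for 'a = complex and holomorphic X, Y,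
   d_j is the holomorphic partial derivative. *)
definition lie_bracket ::
  "('a::real_normed_field^'m \<Rightarrow> complex^'m) \<Rightarrow> ('a^'m \<Rightarrow> complex^'m) \<Rightarrow> 'a^'m \<Rightarrow> complex^'m" where
  "lie_bracket X Y p =
     (\<Sum>j\<in>UNIV. (X p $ j) *s frechet_derivative Y (at p) (axis j 1)
             - (Y p $ j) *s frechet_derivative X (at p) (axis j 1))"


section \<open>Distributions\<close>

(* A distribution is a pointwise family of subspaces.  The parameter reg is analytic_field on
   real manifolds and holomorphic_field on complexifications. *)

definition local_sections ::
  "('p::topological_space set \<Rightarrow> ('p \<Rightarrow> 'v) \<Rightarrow> bool) \<Rightarrow> 'p set \<Rightarrow> ('p \<Rightarrow> 'v set) \<Rightarrow> 'p \<Rightarrow> ('p \<Rightarrow> 'v) set"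
  where "local_sections reg M D p =
     {X. \<exists>U. open U \<and> p \<in> U \<and> U \<subseteq> M \<and> reg U X \<and> (\<forall>x\<in>U. X x \<in> D x)}"

definition subbundle ::
  "('p::topological_space set \<Rightarrow> ('p \<Rightarrow> complex^'m) \<Rightarrow> bool) \<Rightarrow> nat \<Rightarrow> 'p set \<Rightarrow>
   ('p \<Rightarrow> (complex^'m) set) \<Rightarrow> bool" where
  "subbundle reg k M D \<longleftrightarrow>
     (\<forall>p\<in>M. \<exists>U X. open U \<and> p \<in> U \<and> U \<subseteq> M \<and> (\<forall>i<k. reg U (X i)) \<and>
        (\<forall>x\<in>U. vec.dim (D x) = k \<and> D x = vec.span ((\<lambda>i::nat. X i x) ` {..<k})))"

definition involutive ::
  "(('a::real_normed_field^'m) set \<Rightarrow> ('a^'m \<Rightarrow> complex^'m) \<Rightarrow> bool) \<Rightarrow> ('a^'m) set \<Rightarrow>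
   ('a^'m \<Rightarrow> (complex^'m) set) \<Rightarrow> bool" where
  "involutive reg M D \<longleftrightarrow>
     (\<forall>p\<in>M. \<forall>X\<in>local_sections reg M D p. \<forall>Y\<in>local_sections reg M D p. lie_bracket X Y p \<in> D p)"


section \<open>CR structures and 2-nondegeneracy\<close>

definition cnjv :: "complex^'m \<Rightarrow> complex^'m" where
  "cnjv v = (\<chi> i. cnj (v $ i))"

definition bar :: "(real^'m \<Rightarrow> (complex^'m) set) \<Rightarrow> real^'m \<Rightarrow> (complex^'m) set" where
  "bar D p = cnjv ` D p"

definition cr_structure :: "nat \<Rightarrow> (real^'m) set \<Rightarrow> (real^'m \<Rightarrow> (complex^'m) set) \<Rightarrow> bool" where
  "cr_structure n M H \<longleftrightarrow>
     CARD('m) = 2 * n + 1 \<and> open M \<and> subbundle analytic_field n M H \<and>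
     involutive analytic_field M H \<and> (\<forall>p\<in>M. H p \<inter> bar H p = {0})"

(* Elements of quotient spaces are represented by cosets. *)
definition quot :: "(complex^'m) set \<Rightarrow> (complex^'m) set \<Rightarrow> (complex^'m) set set" where
  "quot A W = (\<lambda>a. {a} + W) ` A"

(* The value is a coset of H p + bar H p. *)
definition levi_form ::
  "(real^'m) set \<Rightarrow> (real^'m \<Rightarrow> (complex^'m) set) \<Rightarrow> real^'m \<Rightarrow> complex^'m \<Rightarrow> complex^'m \<Rightarrow>
   (complex^'m) set" where
  "levi_form M H p v w =
     {u. \<exists>X\<in>local_sections analytic_field M H p. \<exists>Y\<in>local_sections analytic_field M H p.
           X p = v \<and> Y p = w \<and>
           u - (\<i> / 2) *s lie_bracket X (\<lambda>x. cnjv (Y x)) p \<in> H p + bar H p}"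

definition levi_kernel ::
  "(real^'m) set \<Rightarrow> (real^'m \<Rightarrow> (complex^'m) set) \<Rightarrow> real^'m \<Rightarrow> (complex^'m) set" where
  "levi_kernel M H p = {v \<in> H p. \<forall>w\<in>H p. levi_form M H p v w = H p + bar H p}"

(* The operator E p / L p -> D p / K p, y |-> [V, Y] mod K p + E p, for v in K p.  The class of
   [V, Y] in (D p + E p) / (K p + E p) is identified with the corresponding coset of K p in D p.
   It is used with (D, E, K, L) = (H, bar H, levi kernel, its conjugate) and with the conjugate
   data. *)
definition ad_op ::
  "(real^'m) set \<Rightarrow> (real^'m \<Rightarrow> (complex^'m) set) \<Rightarrow> (real^'m \<Rightarrow> (complex^'m) set) \<Rightarrow>
   (real^'m \<Rightarrow> (complex^'m) set) \<Rightarrow> (real^'m \<Rightarrow> (complex^'m) set) \<Rightarrow> real^'m \<Rightarrow> complex^'m \<Rightarrow>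
   (complex^'m) set \<Rightarrow> (complex^'m) set" where
  "ad_op M D E K L p v =
     (\<lambda>C \<in> quot (E p) (L p).
        {w \<in> D p. \<exists>V\<in>local_sections analytic_field M K p. \<exists>Y\<in>local_sections analytic_field M E p.
             V p = v \<and> Y p \<in> C \<and> w - lie_bracket V Y p \<in> K p + E p})"

definition ad ::
  "(real^'m) set \<Rightarrow> (real^'m \<Rightarrow> (complex^'m) set) \<Rightarrow> real^'m \<Rightarrow> complex^'m \<Rightarrow>
   (complex^'m) set \<Rightarrow> (complex^'m) set" where
  "ad M H = ad_op M H (bar H) (levi_kernel M H) (bar (levi_kernel M H))"

definition ad_conj ::
  "(real^'m) set \<Rightarrow> (real^'m \<Rightarrow> (complex^'m) set) \<Rightarrow> real^'m \<Rightarrow> complex^'m \<Rightarrow>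
   (complex^'m) set \<Rightarrow> (complex^'m) set" where
  "ad_conj M H = ad_op M (bar H) H (bar (levi_kernel M H)) (levi_kernel M H)"

definition two_nondegenerate ::
  "(real^'m) set \<Rightarrow> (real^'m \<Rightarrow> (complex^'m) set) \<Rightarrow> bool" where
  "two_nondegenerate M H \<longleftrightarrow>
     (\<forall>p\<in>M. levi_kernel M H p \<noteq> {0} \<and>
        \<not> (\<exists>v\<in>levi_kernel M H p. v \<noteq> 0 \<and>
             (\<forall>C\<in>quot (bar H p) (bar (levi_kernel M H) p). ad M H p v C = levi_kernel M H p)))"

definition ad_Kbar ::
  "(real^'m) set \<Rightarrow> (real^'m \<Rightarrow> (complex^'m) set) \<Rightarrow> real^'m \<Rightarrow>
   ((complex^'m) set \<Rightarrow> (complex^'m) set) set" where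
  "ad_Kbar M H p = ad_conj M H p ` bar (levi_kernel M H) p"

(* Scalar multiples and rank of operators H p / K p -> bar H p / bar K p.  The sum with bar K p
   only matters for c = 0.  The union of the image is the preimage in bar H p of the image
   subspace of bar H p / bar K p. *)
definition scale_op ::
  "(real^'m) set \<Rightarrow> (real^'m \<Rightarrow> (complex^'m) set) \<Rightarrow> real^'m \<Rightarrow> complex \<Rightarrow>
   ((complex^'m) set \<Rightarrow> (complex^'m) set) \<Rightarrow> (complex^'m) set \<Rightarrow> (complex^'m) set" where
  "scale_op M H p c T =
     (\<lambda>C \<in> quot (H p) (levi_kernel M H p). (*s) c ` T C + bar (levi_kernel M H) p)"

definition rank_op ::
  "(real^'m) set \<Rightarrow> (real^'m \<Rightarrow> (complex^'m) set) \<Rightarrow> real^'m \<Rightarrow>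
   ((complex^'m) set \<Rightarrow> (complex^'m) set) \<Rightarrow> nat" where
  "rank_op M H p T =
     vec.dim (\<Union>(T ` quot (H p) (levi_kernel M H p))) - vec.dim (bar (levi_kernel M H) p)"


section \<open>Complexification and recoverability\<close>

definition cvec :: "real^'m \<Rightarrow> complex^'m" where
  "cvec x = (\<chi> i. complex_of_real (x $ i))"

(* tau is an involution with differential cnjv, so (tau_* D)_z = cnjv (D_(tau z)). *)
definition tau_push :: "(complex^'m \<Rightarrow> (complex^'m) set) \<Rightarrow> complex^'m \<Rightarrow> (complex^'m) set" where
  "tau_push D z = cnjv ` D (cnjv z)"

definition complexification_at ::
  "nat \<Rightarrow> (real^'m) set \<Rightarrow> (real^'m \<Rightarrow> (complex^'m) set) \<Rightarrow> real^'m \<Rightarrow> (complex^'m) set \<Rightarrow>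
   (complex^'m \<Rightarrow> (complex^'m) set) \<Rightarrow> (complex^'m \<Rightarrow> (complex^'m) set) \<Rightarrow> bool" where
  "complexification_at n M H p \<Omega> Hc Kc \<longleftrightarrow>
     open \<Omega> \<and> cvec p \<in> \<Omega> \<and> cnjv ` \<Omega> = \<Omega> \<and>
     subbundle holomorphic_field n \<Omega> Hc \<and> (\<exists>k. subbundle holomorphic_field k \<Omega> Kc) \<and>
     (\<forall>x. cvec x \<in> \<Omega> \<longrightarrow> x \<in> M \<and> Hc (cvec x) = H x \<and> Kc (cvec x) = levi_kernel M H x)"

definition reconstruction ::
  "nat \<Rightarrow> (complex^'m) set \<Rightarrow> (complex^'m \<Rightarrow> (complex^'m) set) \<Rightarrow> (complex^'m \<Rightarrow> (complex^'m) set) \<Rightarrow>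
   (complex^'m \<Rightarrow> (complex^'m) set) \<Rightarrow> bool" where
  "reconstruction n U Hc Kc H' \<longleftrightarrow>
     subbundle holomorphic_field n U H' \<and> involutive holomorphic_field U H' \<and>
     (\<forall>z\<in>U. Kc z \<subseteq> H' z \<and> H' z \<subseteq> Hc z + tau_push Kc z \<and> H' z \<inter> tau_push Kc z = {0})"

(* Recoverability of the germ at p: uniqueness is uniqueness of germs of distributions at p on
   the complexification. *)
definition recoverable_at ::
  "nat \<Rightarrow> (real^'m) set \<Rightarrow> (real^'m \<Rightarrow> (complex^'m) set) \<Rightarrow> real^'m \<Rightarrow> bool" where
  "recoverable_at n M H p \<longleftrightarrow>
     (\<exists>\<Omega> Hc Kc. complexification_at n M H p \<Omega> Hc Kc \<and> reconstruction n \<Omega> Hc Kc Hc \<and>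
        (\<forall>U H'. open U \<and> cvec p \<in> U \<and> U \<subseteq> \<Omega> \<and> reconstruction n U Hc Kc H' \<longrightarrow>
           (\<exists>W. open W \<and> cvec p \<in> W \<and> W \<subseteq> U \<and> (\<forall>z\<in>W. H' z = Hc z))))"

end

theory Submission
  imports Defs "HOL-Complex_Analysis.Conformal_Mappings"
begin

text \<open>
  Let \<open>e\<close> be a section of \<open>K\<^sup>-\<close>.  A distribution in \<open>H + K\<^sup>-\<close> transversal to \<open>K\<^sup>-\<close> is spanned by
  sections \<open>h\<^sub>i + \<nu>\<^sub>i e\<close> with \<open>h\<^sub>i\<close> a frame of \<open>H\<close>.  Since \<open>[H, H] \<subseteq> H\<close>, its involutivity forces
  \<open>\<nu>\<^sub>i ad\<^sub>e h\<^sub>j = \<nu>\<^sub>j ad\<^sub>e h\<^sub>i\<close>.  Where \<open>ad\<^sub>e\<close> has rank greater than one this implies \<open>\<nu> = 0\<close>; if the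
  set of such points is dense, then \<open>\<nu> = 0\<close> on all real points and hence on the complexification.

  If it is not dense, the two by two minors of \<open>ad\<^sub>e\<close> vanish on an open set of real points, hence
  identically.  By 2-nondegeneracy \<open>ad\<^sub>e\<close> is not zero at the given point, so near it the kernel
  \<open>L\<close> of \<open>ad\<^sub>e\<close> in \<open>H\<close> has rank \<open>n - 1\<close>; it contains \<open>K\<close> and is involutive.  For a first integral \<open>u\<close> of \<open>L\<close> with \<open>du \<noteq> 0\<close> on \<open>H\<close>
  and on \<open>K\<^sup>-\<close>, the kernel of \<open>du\<close> in \<open>H + K\<^sup>-\<close> differs from \<open>H\<close> but satisfies the same
  conditions.\<close>

section \<open>Holomorphic functions of several variables\<close>

text \<open>Distributions are handled through annihilators: for a holomorphic covector field q that
  kills X and Y, q([X, Y]) equals -dq(X, Y) and so depends only on the values of X and Y. This turns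
  the Levi form, ad and every involutivity condition into pointwise bilinear algebra with
  holomorphic coefficients. The hypotheses on M concern real points only, so identities are proved
  there and carried to the complexification by the identity theorem. Two points are hidden in the
  second distribution. That L contains K means that [K, bar K] lies in H + bar K. And ker du is
  involutive inside H + bar K because du and ad_e both vanish on L, which has corank one in H; hence
  they are proportional on H, and this is the relation between \<nu> and ad_e with \<nu>_i = -
  du(h_i) / du(e). The first integral is found by flowing along a single radial field. Holomorphy in
  several variables is derived from one-variable theory on complex lines.\<close>

abbreviation dd :: "('a::real_normed_vector \<Rightarrow> 'b::real_normed_vector) \<Rightarrow> 'a \<Rightarrow> 'a \<Rightarrow> 'b" where
  "dd f z \<equiv> frechet_derivative f (at z)"

text \<open>The scalar counterpart of \<open>holomorphic_field\<close>: a real Frechet derivative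
  that is complex linear at each point. Continuity of the derivative is not part of the notion; it
  is recovered from Cauchy estimates.\<close>

definition hol :: "(complex^'m) set \<Rightarrow> (complex^'m \<Rightarrow> complex) \<Rightarrow> bool" where
  "hol U f \<longleftrightarrow> (\<forall>z\<in>U. \<exists>D. (f has_derivative D) (at z) \<and> (\<forall>c v. D (c *s v) = c * D v))"

lemma norm_vec_smult: "norm (c *s (v::complex^'m)) = cmod c * norm v"
  by (simp add: norm_vec_def norm_mult L2_set_right_distrib)

lemma scaleR_vec_smult: "t *\<^sub>R (v::complex^'m) = complex_of_real t *s v"
  by (vector scaleR_conv_of_real)

lemma bounded_linear_vec_smult: "bounded_linear (\<lambda>c. c *s (v::complex^'m))"
  by (rule bounded_linear_intro[where K="norm v"])
     (auto simp: norm_vec_smult vec_eq_iff algebra_simps)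

lemma bounded_linear_vec_smult_right: "bounded_linear (\<lambda>v. c *s (v::complex^'m))"
  by (rule bounded_linear_intro[where K="cmod c"])
     (auto simp: norm_vec_smult vec_eq_iff algebra_simps)

lemma hol_derivative: "hol U f \<Longrightarrow> z \<in> U \<Longrightarrow> (f has_derivative dd f z) (at z)"
  unfolding hol_def by (metis frechet_derivative_at)

lemma hol_dd_smult: "hol U f \<Longrightarrow> z \<in> U \<Longrightarrow> dd f z (c *s v) = c * dd f z v"
  unfolding hol_def by (metis frechet_derivative_at)

lemma hol_dd_linear: "hol U f \<Longrightarrow> z \<in> U \<Longrightarrow> linear (dd f z)"
  using hol_derivative has_derivative_linear by blast

lemma hol_dd_add: "hol U f \<Longrightarrow> z \<in> U \<Longrightarrow> dd f z (u + v) = dd f z u + dd f z v"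
  using hol_dd_linear linear_add by blast

lemma hol_dd_diff: "hol U f \<Longrightarrow> z \<in> U \<Longrightarrow> dd f z (u - v) = dd f z u - dd f z v"
  using hol_dd_linear linear_diff by blast

lemma hol_dd_sum: "hol U f \<Longrightarrow> z \<in> U \<Longrightarrow> dd f z (\<Sum>i\<in>I. g i) = (\<Sum>i\<in>I. dd f z (g i))"
  using hol_dd_linear linear_sum by blast

lemma dd_eqI: "(f has_derivative D) (at z) \<Longrightarrow> dd f z v = D v"
  using frechet_derivative_at by metis

lemma holI: "(\<And>z. z \<in> U \<Longrightarrow> (f has_derivative D z) (at z)) \<Longrightarrow>
    (\<And>z c v. z \<in> U \<Longrightarrow> D z (c *s v) = c * D z v) \<Longrightarrow> hol U f"
  unfolding hol_def by blast

lemma hol_subset: "hol U f \<Longrightarrow> V \<subseteq> U \<Longrightarrow> hol V f"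
  unfolding hol_def by blast

lemma hol_local: "(\<And>z. z \<in> U \<Longrightarrow> \<exists>V. z \<in> V \<and> hol V f) \<Longrightarrow> hol U f"
  unfolding hol_def by blast

lemma hol_continuous_on: "hol U f \<Longrightarrow> continuous_on U f"
  using hol_derivative has_derivative_continuous continuous_at_imp_continuous_on by metis

lemma hol_cong: "open U \<Longrightarrow> (\<And>z. z \<in> U \<Longrightarrow> f z = g z) \<Longrightarrow> hol U f \<Longrightarrow> hol U g"
  unfolding hol_def by (metis has_derivative_transform_within_open)

lemma hol_const [intro]: "hol U (\<lambda>z. c)"
  by (rule holI[where D="\<lambda>z v. 0"]) auto

lemma hol_nth [intro]: "hol U (\<lambda>z. z $ i)"
  by (rule holI[where D="\<lambda>z v. v $ i"])
     (auto intro!: bounded_linear_imp_has_derivative bounded_linear_vec_nth)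

lemma hol_add [intro]:
  assumes "hol U f" "hol U g" shows "hol U (\<lambda>z. f z + g z)"
  by (rule holI[where D="\<lambda>z v. dd f z v + dd g z v"])
     (auto intro!: has_derivative_add hol_derivative assms
        simp: hol_dd_smult[OF assms(1)] hol_dd_smult[OF assms(2)] algebra_simps)

lemma hol_mult [intro]:
  assumes "hol U f" "hol U g" shows "hol U (\<lambda>z. f z * g z)"
proof (rule holI[where D="\<lambda>z v. f z * dd g z v + dd f z v * g z"])
  fix z assume "z \<in> U"
  then show "((\<lambda>z. f z * g z) has_derivative (\<lambda>v. f z * dd g z v + dd f z v * g z)) (at z)"
    by (intro has_derivative_mult hol_derivative[OF assms(1)] hol_derivative[OF assms(2)])
qed (simp add: hol_dd_smult[OF assms(1)] hol_dd_smult[OF assms(2)] algebra_simps)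

lemma hol_minus [intro]: "hol U f \<Longrightarrow> hol U (\<lambda>z. - f z)"
  using hol_mult[OF hol_const[of U "-1"], of f] by simp

lemma hol_diff [intro]: "hol U f \<Longrightarrow> hol U g \<Longrightarrow> hol U (\<lambda>z. f z - g z)"
  using hol_add[OF _ hol_minus, of U f g] by simp

lemma hol_sum [intro]: "(\<And>i. i \<in> I \<Longrightarrow> hol U (f i)) \<Longrightarrow> hol U (\<lambda>z. \<Sum>i\<in>I. f i z)"
  by (induction I rule: infinite_finite_induct) auto

lemma hol_prod [intro]: "(\<And>i. i \<in> I \<Longrightarrow> hol U (f i)) \<Longrightarrow> hol U (\<lambda>z. \<Prod>i\<in>I. f i z)"
  by (induction I rule: infinite_finite_induct) auto

lemma hol_power [intro]: "hol U f \<Longrightarrow> hol U (\<lambda>z. f z ^ k)"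
  by (induction k) auto

lemma hol_inverse [intro]:
  assumes "hol U f" "\<And>z. z \<in> U \<Longrightarrow> f z \<noteq> 0" shows "hol U (\<lambda>z. inverse (f z))"
proof (rule holI[where D="\<lambda>z v. - (inverse (f z) * dd f z v * inverse (f z))"])
  fix z assume "z \<in> U"
  then show "((\<lambda>z. inverse (f z)) has_derivative (\<lambda>v. - (inverse (f z) * dd f z v * inverse (f z)))) (at z)"
    by (intro Deriv.has_derivative_inverse hol_derivative[OF assms(1)] assms(2))
qed (simp add: hol_dd_smult[OF assms(1)])

lemma hol_divide [intro]:
  "hol U f \<Longrightarrow> hol U g \<Longrightarrow> (\<And>z. z \<in> U \<Longrightarrow> g z \<noteq> 0) \<Longrightarrow> hol U (\<lambda>z. f z / g z)"
  unfolding divide_inverse by (intro hol_mult hol_inverse)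

lemma holomorphic_field_iff: "holomorphic_field U X \<longleftrightarrow> (\<forall>i. hol U (\<lambda>z. X z $ i))"
proof
  assume X: "holomorphic_field U X"
  show "\<forall>i. hol U (\<lambda>z. X z $ i)"
  proof
    fix i
    show "hol U (\<lambda>z. X z $ i)" unfolding hol_def
    proof
      fix z assume "z \<in> U"
      then obtain D where D: "(X has_derivative D) (at z)" "\<forall>c v. D (c *s v) = c *s D v"
        using X unfolding holomorphic_field_def by blast
      show "\<exists>D. ((\<lambda>z. X z $ i) has_derivative D) (at z) \<and> (\<forall>c v. D (c *s v) = c * D v)"
        by (rule exI[where x="\<lambda>v. D v $ i"])
           (use D in \<open>auto intro!: bounded_linear.has_derivative[OF bounded_linear_vec_nth]\<close>)
    qed
  qed
next
  assume X: "\<forall>i. hol U (\<lambda>z. X z $ i)"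
  show "holomorphic_field U X" unfolding holomorphic_field_def
  proof
    fix z assume z: "z \<in> U"
    have "((\<lambda>y. X y) has_derivative (\<lambda>v. \<chi> i. dd (\<lambda>z. X z $ i) z v)) (at z)"
      unfolding has_derivative_componentwise_within[of X] Basis_vec_def
      using X hol_derivative[OF X[rule_format] z]
      by (auto simp: inner_axis intro!: has_derivative_inner_left)
    then show "\<exists>D. (X has_derivative D) (at z) \<and> (\<forall>c v. D (c *s v) = c *s D v)"
      using X z by (intro exI[of _ "\<lambda>v. \<chi> i. dd (\<lambda>z. X z $ i) z v"]) (auto simp: vec_eq_iff hol_dd_smult[OF X[rule_format] z])
  qed
qed

lemma holomorphic_field_derivative:
  "holomorphic_field U X \<Longrightarrow> z \<in> U \<Longrightarrow> (X has_derivative dd X z) (at z)"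
  unfolding holomorphic_field_def by (metis frechet_derivative_at)

lemma holomorphic_field_dd_nth:
  assumes "holomorphic_field U X" "z \<in> U"
  shows "dd X z v $ i = dd (\<lambda>z. X z $ i) z v"
  by (rule dd_eqI[symmetric] bounded_linear.has_derivative[OF bounded_linear_vec_nth]
        holomorphic_field_derivative assms)+

lemma holomorphic_field_dd_smult:
  "holomorphic_field U X \<Longrightarrow> z \<in> U \<Longrightarrow> dd X z (c *s v) = c *s dd X z v"
  unfolding holomorphic_field_def by (metis frechet_derivative_at)

lemma holomorphic_field_continuous_on: "holomorphic_field U X \<Longrightarrow> continuous_on U X"
  using holomorphic_field_derivative has_derivative_continuous continuous_at_imp_continuous_on
  by metis

lemma holomorphic_field_subset: "holomorphic_field U X \<Longrightarrow> V \<subseteq> U \<Longrightarrow> holomorphic_field V X"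
  unfolding holomorphic_field_def by blast

lemma hol_compose:
  assumes "hol V f" "holomorphic_field U g" "g ` U \<subseteq> V"
  shows "hol U (\<lambda>z. f (g z))"
proof (rule holI[where D="\<lambda>z v. dd f (g z) (dd g z v)"])
  fix z assume z: "z \<in> U"
  show "((\<lambda>z. f (g z)) has_derivative (\<lambda>v. dd f (g z) (dd g z v))) (at z)"
    by (rule has_derivative_compose[OF holomorphic_field_derivative[OF assms(2) z]])
       (use assms z in \<open>auto intro!: hol_derivative\<close>)
  show "dd f (g z) (dd g z (c *s v)) = c * dd f (g z) (dd g z v)" for c v
    using assms z by (simp add: holomorphic_field_dd_smult hol_dd_smult image_subset_iff)
qed

section \<open>Restriction to complex lines, Cauchy estimates and Osgood's lemma\<close>

lemma hol_line_derivative: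
  assumes "hol U f" "z + \<zeta> *s v \<in> U"
  shows "((\<lambda>\<zeta>. f (z + \<zeta> *s v)) has_field_derivative dd f (z + \<zeta> *s v) v) (at \<zeta>)"
proof -
  have 1: "((\<lambda>\<zeta>. z + \<zeta> *s v) has_derivative (\<lambda>h. h *s v)) (at \<zeta>)"
    by (rule has_derivative_eq_rhs[OF has_derivative_add[OF has_derivative_const
          bounded_linear_imp_has_derivative[OF bounded_linear_vec_smult]]]) simp
  have "((\<lambda>\<zeta>. f (z + \<zeta> *s v)) has_derivative (\<lambda>h. dd f (z + \<zeta> *s v) (h *s v))) (at \<zeta>)"
    by (rule has_derivative_compose[OF 1]) (rule hol_derivative[OF assms])
  then show ?thesis
    unfolding has_field_derivative_def
    by (rule has_derivative_eq_rhs) (simp add: fun_eq_iff hol_dd_smult[OF assms])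
qed

lemma hol_line: "hol U f \<Longrightarrow> (\<And>\<zeta>. \<zeta> \<in> S \<Longrightarrow> z + \<zeta> *s v \<in> U) \<Longrightarrow>
    (\<lambda>\<zeta>. f (z + \<zeta> *s v)) holomorphic_on S"
  using hol_line_derivative has_field_derivative_at_within holomorphic_on_def
    field_differentiable_def by metis

text \<open>On the disc of radius R/4 the Cauchy inequality bounds the second derivative by 2 B /
  (R/4)^2 = 32 B / R^2, and R \<ge> 4 puts the segment from 0 to 1 into that disc. The decay in R is
  what later becomes a quadratic remainder.\<close>

lemma Cauchy_second_order:
  assumes hol: "g holomorphic_on ball 0 R" and R: "R \<ge> 4"
    and B: "\<And>\<zeta>. \<zeta> \<in> ball 0 R \<Longrightarrow> cmod (g \<zeta>) \<le> B"
  shows "cmod (g 1 - g 0 - deriv g 0) \<le> 32 * B / R^2"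
proof -
  define S where "S = cball (0::complex) (R/4)"
  have sub: "cball x (R/4) \<subseteq> ball 0 R" if "x \<in> S" for x
  proof
    fix y assume "y \<in> cball x (R/4)"
    then have "dist 0 y \<le> dist 0 x + dist x y" "dist x y \<le> R/4" "dist 0 x \<le> R/4"
      using that dist_triangle[of 0 y x] by (auto simp: S_def)
    then show "y \<in> ball 0 R" using R by auto
  qed
  have "cmod ((deriv ^^ 0) g 1 - (\<Sum>i\<le>1. (deriv ^^ i) g 0 * (1 - 0) ^ i / fact i))
     \<le> (32 * B / R^2) * cmod (1 - 0) ^ Suc 1 / fact 1"
  proof (rule complex_Taylor[of S])
    show "convex S" "(0::complex) \<in> S" "1 \<in> S" using R by (auto simp: S_def)
    show "((deriv ^^ i) g has_field_derivative (deriv ^^ Suc i) g x) (at x within S)"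
      if "x \<in> S" for i x
    proof -
      have "x \<in> ball 0 R" using sub[OF that] R centre_in_cball[of x "R/4"] by fastforce
      then show ?thesis
        using holomorphic_derivI[OF holomorphic_higher_deriv[OF hol, of i]] by auto
    qed
    show "cmod ((deriv ^^ Suc 1) g x) \<le> 32 * B / R^2" if "x \<in> S" for x
    proof -
      have "cmod ((deriv ^^ 2) g x) \<le> fact 2 * B / (R/4)^2"
      proof (rule Cauchy_inequality)
        show "g holomorphic_on ball x (R/4)"
          using sub[OF that] hol by (meson ball_subset_cball holomorphic_on_subset order_trans)
        show "continuous_on (cball x (R/4)) g"
          using sub[OF that] hol by (meson holomorphic_on_imp_continuous_on continuous_on_subset)
        show "0 < R/4" using R by simp
        show "cmod (g y) \<le> B" if "cmod (x - y) = R/4" for y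
          by (rule B) (use that sub[OF \<open>x \<in> S\<close>] in \<open>auto simp: dist_norm subset_iff\<close>)
      qed
      then show ?thesis by (simp add: power_divide eval_nat_numeral mult.commute)
    qed
  qed
  then show ?thesis by (simp add: algebra_simps)
qed

text \<open>A first-order Taylor estimate uniform in both z and h, from continuity (for the bound B)
  and holomorphy on lines alone. It comes from \<open>Cauchy_second_order\<close> on the line
  through z in direction h, where 1 / R^2 becomes (norm h / e)^2.\<close>

lemma line_holomorphic_Taylor:
  fixes f :: "complex^'m \<Rightarrow> complex"
  assumes "open U" "continuous_on U f" "z0 \<in> U"
    and line: "\<And>z v r. r > 0 \<Longrightarrow> (\<And>\<zeta>. \<zeta> \<in> ball 0 r \<Longrightarrow> z + \<zeta> *s v \<in> U) \<Longrightarrow>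
        (\<lambda>\<zeta>. f (z + \<zeta> *s v)) holomorphic_on ball 0 r"
  obtains e C where "e > 0" "C > 0" "ball z0 (2*e) \<subseteq> U"
    "\<And>z (h::complex^'m). z \<in> ball z0 e \<Longrightarrow> norm h \<le> e/4 \<Longrightarrow>
      cmod (f (z + h) - f z - deriv (\<lambda>\<zeta>. f (z + \<zeta> *s h)) 0) \<le> C * norm h ^ 2"
proof -
  obtain e0 where e0: "e0 > 0" "cball z0 e0 \<subseteq> U"
    using assms open_contains_cball by blast
  define e where "e = e0/2"
  have "bounded (f ` cball z0 e0)"
    using compact_imp_bounded[OF compact_continuous_image[OF continuous_on_subset[OF assms(2) e0(2)]]]
    by simp
  then obtain B where B: "B > 0" "\<And>z. z \<in> cball z0 e0 \<Longrightarrow> cmod (f z) \<le> B"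
    unfolding bounded_pos by auto
  show thesis
  proof (rule that[of e "32 * B / e^2"])
    show "e > 0" "32 * B / e^2 > 0" using e0 B by (auto simp: e_def)
    show "ball z0 (2*e) \<subseteq> U" using e0 by (auto simp: e_def)
    fix z h :: "complex^'m" assume z: "z \<in> ball z0 e" and h: "norm h \<le> e/4"
    show "cmod (f (z + h) - f z - deriv (\<lambda>\<zeta>. f (z + \<zeta> *s h)) 0) \<le> 32 * B / e^2 * norm h ^ 2"
    proof (cases "h = 0")
      case True then show ?thesis by simp
    next
      case False
      \<comment> \<open>For |\<zeta>| < R the point z + \<zeta> h stays within e of z; the bound e/4
        on norm h is exactly R \<ge> 4.\<close>
      define R where "R = e / norm h"
      have R: "R \<ge> 4" using h False by (simp add: R_def field_simps)
      have in_ball: "z + \<zeta> *s h \<in> cball z0 e0" if "\<zeta> \<in> ball 0 R" for \<zeta>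
      proof -
        have "norm (\<zeta> *s h) \<le> e"
          using that False by (simp add: norm_vec_smult R_def field_simps)
        then have "dist z0 (z + \<zeta> *s h) \<le> dist z0 z + e"
          using dist_triangle[of z0 "z + \<zeta> *s h" z] by (simp add: dist_norm)
        then show ?thesis using z by (simp add: e_def)
      qed
      have "cmod (f (z + 1 *s h) - f (z + 0 *s h) - deriv (\<lambda>\<zeta>. f (z + \<zeta> *s h)) 0) \<le> 32 * B / R^2"
        by (rule Cauchy_second_order[of "\<lambda>\<zeta>. f (z + \<zeta> *s h)" R])
           (use R in_ball e0 B in \<open>auto intro!: line\<close>)
      then show ?thesis by (simp add: R_def power_divide)
    qed
  qed
qed

text \<open>The candidate derivative D z v is the slope of f on the line through z in direction v.
  Homogeneity in v is the chain rule. Additivity comes from walking along h and then along k from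
  the displaced point, which needs D to be continuous in the base point. The Taylor estimate then
  makes D z0 a Frechet derivative.\<close>

lemma Osgood_lines:
  assumes "open U" "continuous_on U f"
    and line: "\<And>z v r. r > 0 \<Longrightarrow> (\<And>\<zeta>. \<zeta> \<in> ball 0 r \<Longrightarrow> z + \<zeta> *s v \<in> U) \<Longrightarrow>
        (\<lambda>\<zeta>. f (z + \<zeta> *s v)) holomorphic_on ball 0 r"
  shows "hol U f"
  unfolding hol_def
proof
  fix z0 assume z0: "z0 \<in> U"
  obtain e C where e: "e > 0" and C: "C > 0" and sub: "ball z0 (2*e) \<subseteq> U"
    and T: "\<And>z h. z \<in> ball z0 e \<Longrightarrow> norm h \<le> e/4 \<Longrightarrow>
      cmod (f (z + h) - f z - deriv (\<lambda>\<zeta>. f (z + \<zeta> *s h)) 0) \<le> C * norm h ^ 2"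
    using line_holomorphic_Taylor[OF assms(1,2) z0 line] by metis
  define D where "D z v = deriv (\<lambda>\<zeta>. f (z + \<zeta> *s v)) 0" for z v
  have der: "((\<lambda>\<zeta>. f (z + \<zeta> *s v)) has_field_derivative D z v) (at 0)" if "z \<in> ball z0 e" for z v
  proof -
    define r where "r = e / (norm v + 1)"
    have r: "r > 0" using e by (auto simp: r_def add_nonneg_pos)
    have "z + \<zeta> *s v \<in> U" if "\<zeta> \<in> ball 0 r" for \<zeta>
    proof -
      have "cmod \<zeta> * norm v \<le> r * (norm v + 1)" using that r by (intro mult_mono) auto
      also have "\<dots> = e" by (simp add: r_def add_nonneg_eq_0_iff)
      finally have "norm (\<zeta> *s v) \<le> e" by (simp add: norm_vec_smult)
      then have "dist z0 (z + \<zeta> *s v) \<le> dist z0 z + e"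
        using dist_triangle[of z0 "z + \<zeta> *s v" z] by (simp add: dist_norm)
      then show ?thesis using sub \<open>z \<in> ball z0 e\<close> by auto
    qed
    then have "(\<lambda>\<zeta>. f (z + \<zeta> *s v)) holomorphic_on ball 0 r" using line r by blast
    then show ?thesis unfolding D_def using holomorphic_derivI[of _ "ball 0 r" 0] r by auto
  qed
  have smult: "D z (c *s v) = c * D z v" if "z \<in> ball z0 e" for z c v
  proof -
    have "((\<lambda>\<zeta>. f (z + (c * \<zeta>) *s v)) has_field_derivative D z v * c) (at 0)"
      by (rule DERIV_chain2[where f="\<lambda>\<zeta>. f (z + \<zeta> *s v)" and g="\<lambda>\<zeta>. c * \<zeta>"])
         (use der[OF that, of v] in \<open>auto intro!: derivative_eq_intros\<close>)
    then show ?thesis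
      using der[OF that, of "c *s v"] DERIV_unique
      by (fastforce simp: vector_smult_assoc mult.commute)
  qed
  have T': "cmod (f (z + h) - f z - D z h) \<le> C * norm h ^ 2"
    if "z \<in> ball z0 e" "norm h \<le> e/4" for z h
    using T that by (simp add: D_def)
  have scaled: "((\<lambda>t. (f (z + complex_of_real t *s h) - f z) / t) \<longlongrightarrow> D z h) (at_right 0)"
    if z: "z \<in> ball z0 e" for z h
  proof -
    have "((\<lambda>\<zeta>. (f (z + \<zeta> *s h) - f z) / \<zeta>) \<longlongrightarrow> D z h) (at 0)"
      using der[OF z, of h] unfolding has_field_derivative_iff by simp
    then have "((\<lambda>t. (f (z + complex_of_real t *s h) - f z) / complex_of_real t) \<longlongrightarrow> D z h) (at_right 0)"
      by (rule filterlim_compose)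
         (auto simp: filterlim_at eventually_at_filter intro!: tendsto_eq_intros)
    then show ?thesis .
  qed
  \<comment> \<open>D z k is a limit of difference quotients with steps \<tau> n, and the Taylor
    error C (norm k)^2 \<tau> n is independent of z, so the limit is uniform and inherits
    continuity.\<close>
  have contD: "isCont (\<lambda>z. D z k) z0" for k
  proof -
    define c where "c = e / (4 * (norm k + 1))"
    have c: "c > 0" "c * norm k \<le> e/4"
    proof -
      show "c > 0" using e unfolding c_def by (intro divide_pos_pos mult_pos_pos add_nonneg_pos) auto
      have "c * norm k \<le> c * (norm k + 1)" using \<open>c > 0\<close> by (simp add: mult_left_mono)
      also have "\<dots> = e / 4" using e by (simp add: c_def field_simps add_nonneg_eq_0_iff)
      finally show "c * norm k \<le> e/4" .
    qed
    define \<tau> where "\<tau> n = c * inverse (real (Suc n))" for n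
    have \<tau>: "\<tau> n > 0" "norm (\<tau> n *\<^sub>R k) \<le> e/4" for n
    proof -
      show "\<tau> n > 0" using c by (simp add: \<tau>_def)
      have "inverse (real (Suc n)) \<le> 1" by (simp add: inverse_le_1_iff)
      then have "\<tau> n \<le> c" using c unfolding \<tau>_def by (metis mult_left_le less_imp_le)
      then have "\<tau> n * norm k \<le> e/4" using c by (meson mult_right_mono norm_ge_zero order_trans)
      then show "norm (\<tau> n *\<^sub>R k) \<le> e/4" using \<open>\<tau> n > 0\<close> by simp
    qed
    have lim0: "(\<lambda>n. C * norm k ^ 2 * \<tau> n) \<longlonglongrightarrow> 0"
    proof -
      have "(\<lambda>n. C * norm k ^ 2 * (c * inverse (real (Suc n)))) \<longlonglongrightarrow> C * norm k ^ 2 * (c * 0)"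
        by (intro tendsto_mult tendsto_const LIMSEQ_inverse_real_of_nat)
      then show ?thesis by (simp only: \<tau>_def mult_zero_right)
    qed
    have "uniform_limit (ball z0 e) (\<lambda>n z. (f (z + \<tau> n *\<^sub>R k) - f z) / \<tau> n) (\<lambda>z. D z k) sequentially"
    proof (rule uniform_limitI)
      fix \<epsilon> :: real assume "\<epsilon> > 0"
      then have "\<forall>\<^sub>F n in sequentially. C * norm k ^ 2 * \<tau> n < \<epsilon>"
        using lim0 order_tendstoD(2) by blast
      then show "\<forall>\<^sub>F n in sequentially. \<forall>z\<in>ball z0 e. dist ((f (z + \<tau> n *\<^sub>R k) - f z) / \<tau> n) (D z k) < \<epsilon>"
      proof (rule eventually_mono, intro ballI)
        fix n z assume n: "C * norm k ^ 2 * \<tau> n < \<epsilon>" and z: "z \<in> ball z0 e"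
        have "cmod (f (z + \<tau> n *\<^sub>R k) - f z - \<tau> n * D z k) \<le> C * (\<tau> n * norm k) ^ 2"
          using T'[OF z \<tau>(2)[of n]] \<tau>(1)[of n] smult[OF z] by (simp add: scaleR_vec_smult norm_vec_smult)
        then have "cmod (f (z + \<tau> n *\<^sub>R k) - f z - \<tau> n * D z k) / \<tau> n \<le> C * norm k ^ 2 * \<tau> n"
          using \<tau>(1)[of n] by (simp add: divide_simps power2_eq_square mult_ac)
        moreover have "cmod ((f (z + \<tau> n *\<^sub>R k) - f z) / \<tau> n - D z k)
            = cmod (f (z + \<tau> n *\<^sub>R k) - f z - \<tau> n * D z k) / \<tau> n"
        proof -
          have "(f (z + \<tau> n *\<^sub>R k) - f z) / \<tau> n - D z k = (f (z + \<tau> n *\<^sub>R k) - f z - \<tau> n * D z k) / \<tau> n"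
            using \<tau>(1)[of n] by (simp add: diff_divide_distrib)
          then show ?thesis using \<tau>(1)[of n] by (simp add: norm_divide)
        qed
        ultimately show "dist ((f (z + \<tau> n *\<^sub>R k) - f z) / \<tau> n) (D z k) < \<epsilon>"
          using n by (simp add: dist_norm)
      qed
    qed
    moreover have "continuous_on (ball z0 e) (\<lambda>z. (f (z + \<tau> n *\<^sub>R k) - f z) / \<tau> n)" for n
    proof -
      have "z + \<tau> n *\<^sub>R k \<in> U" if "z \<in> ball z0 e" for z
      proof -
        have "dist z0 (z + \<tau> n *\<^sub>R k) \<le> dist z0 z + e/4"
          using \<tau>(2)[of n] dist_triangle[of z0 "z + \<tau> n *\<^sub>R k" z] by (simp add: dist_norm)
        then show ?thesis using sub that e by auto
      qed
      moreover have "ball z0 e \<subseteq> U" using sub e by auto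
      ultimately show ?thesis using \<tau>(1)[of n]
        by (intro continuous_intros continuous_on_compose2[OF assms(2)]) auto
    qed
    ultimately have "continuous_on (ball z0 e) (\<lambda>z. D z k)"
      by (intro uniform_limit_theorem[where F=sequentially]) auto
    then show ?thesis using e by (metis centre_in_ball continuous_on_eq_continuous_at open_ball)
  qed
  have z0e: "z0 \<in> ball z0 e" using e by simp
  \<comment> \<open>The increment along t (h + k) is split at z0 + t h; the slope in direction k is
    then taken at a moving base point and converges by \<open>contD\<close>.\<close>
  have add: "D z0 (h + k) = D z0 h + D z0 k" for h k
  proof -
    have sm: "\<forall>\<^sub>F t in at_right (0::real). t * norm v \<le> e/4" for v :: "complex^'m"
    proof -
      have "((\<lambda>t. t * norm v) \<longlongrightarrow> 0) (at_right 0)" by (auto intro!: tendsto_eq_intros)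
      then show ?thesis using e order_tendstoD(2)[of _ 0 _ "e/4"]
        by (smt (verit) eventually_mono zero_less_divide_iff)
    qed
    have "((\<lambda>t. z0 + complex_of_real t *s h) \<longlongrightarrow> z0 + complex_of_real 0 *s h) (at_right 0)"
      by (intro tendsto_intros bounded_linear.tendsto[OF bounded_linear_vec_smult])
    then have "((\<lambda>t. D (z0 + complex_of_real t *s h) k) \<longlongrightarrow> D z0 k) (at_right 0)"
      using isCont_tendsto_compose[OF contD[of k]] by simp
    moreover have "((\<lambda>t. (f (z0 + complex_of_real t *s h + complex_of_real t *s k) - f (z0 + complex_of_real t *s h)) / t
         - D (z0 + complex_of_real t *s h) k) \<longlongrightarrow> 0) (at_right 0)"
    proof (rule Lim_null_comparison)
      show "((\<lambda>t. C * norm k ^ 2 * t) \<longlongrightarrow> 0) (at_right 0)" by (auto intro!: tendsto_eq_intros)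
      show "\<forall>\<^sub>F t in at_right 0. cmod ((f (z0 + complex_of_real t *s h + complex_of_real t *s k) - f (z0 + complex_of_real t *s h)) / t
         - D (z0 + complex_of_real t *s h) k) \<le> C * norm k ^ 2 * t"
        using sm[of h] sm[of k] eventually_at_right_less
      proof eventually_elim
        case (elim t)
        let ?z = "z0 + complex_of_real t *s h"
        have z: "?z \<in> ball z0 e" using elim e by (simp add: dist_norm norm_vec_smult)
        have "cmod (f (?z + t *s k) - f ?z - t * D ?z k) \<le> C * (t * norm k) ^ 2"
          using T'[OF z, of "t *s k"] elim smult[OF z] by (simp add: norm_vec_smult)
        then have "cmod (f (?z + t *s k) - f ?z - t * D ?z k) / t \<le> C * norm k ^ 2 * t"
          using elim by (simp add: divide_simps power2_eq_square mult_ac)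
        moreover have "(f (?z + t *s k) - f ?z) / t - D ?z k = (f (?z + t *s k) - f ?z - t * D ?z k) / t"
          using elim by (simp add: diff_divide_distrib)
        ultimately show ?case using elim by (simp add: norm_divide)
      qed
    qed
    ultimately have "((\<lambda>t. (f (z0 + complex_of_real t *s h + complex_of_real t *s k) - f (z0 + complex_of_real t *s h)) / t)
       \<longlongrightarrow> 0 + D z0 k) (at_right 0)"
      using tendsto_add by fastforce
    then have "((\<lambda>t. (f (z0 + complex_of_real t *s h + complex_of_real t *s k) - f (z0 + complex_of_real t *s h)) / t +
       (f (z0 + complex_of_real t *s h) - f z0) / t)
       \<longlongrightarrow> 0 + D z0 k + D z0 h) (at_right 0)"
      by (intro tendsto_add scaled[OF z0e])
    moreover have "((\<lambda>t. (f (z0 + complex_of_real t *s h + complex_of_real t *s k) - f (z0 + complex_of_real t *s h)) / t +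
       (f (z0 + complex_of_real t *s h) - f z0) / t)
       \<longlongrightarrow> D z0 (h + k)) (at_right 0)"
      using scaled[OF z0e, of "h + k"]
      by (simp add: vector_add_ldistrib add.assoc flip: add_divide_distrib)
    ultimately have "0 + D z0 k + D z0 h = D z0 (h + k)"
      using tendsto_unique[OF _ ] trivial_limit_at_right_real by blast
    then show ?thesis by (simp add: add.commute)
  qed
  have lin: "linear (D z0)"
    by (rule linearI) (use add smult[OF z0e] in \<open>auto simp: scaleR_vec_smult scaleR_conv_of_real\<close>)
  have "(f has_derivative D z0) (at z0)"
    unfolding has_derivative_at
  proof
    show "bounded_linear (D z0)" using lin linear_conv_bounded_linear by blast
    show "(\<lambda>h. norm (f (z0 + h) - f z0 - D z0 h) / norm h) \<midarrow>0\<rightarrow> 0"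
    proof (rule Lim_null_comparison)
      show "((\<lambda>h. C * norm h) \<longlongrightarrow> 0) (at (0::complex^'m))" by (auto intro!: tendsto_eq_intros)
      have "\<forall>\<^sub>F h in at (0::complex^'m). norm h < e/4"
        by (rule eventually_at_in_open'[of "ball 0 (e/4)", THEN eventually_mono]) (use e in auto)
      moreover have "\<forall>\<^sub>F h in at (0::complex^'m). h \<noteq> 0" by (simp add: eventually_at_filter)
      ultimately show "\<forall>\<^sub>F h in at 0. norm (norm (f (z0 + h) - f z0 - D z0 h) / norm h) \<le> C * norm h"
      proof eventually_elim
        case (elim h)
        then show ?case using T'[OF z0e, of h] by (simp add: divide_simps power2_eq_square)
      qed
    qed
  qed
  then show "\<exists>D. (f has_derivative D) (at z0) \<and> (\<forall>c v. D (c *s v) = c * D v)"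
    using smult[OF z0e] by blast
qed

section \<open>Uniform limits, difference quotients and second derivatives\<close>

lemma hol_Taylor:
  assumes "open U" "hol U f" "z0 \<in> U"
  obtains e C where "e > 0" "C > 0" "ball z0 (2*e) \<subseteq> U"
    "\<And>z h. z \<in> ball z0 e \<Longrightarrow> norm h \<le> e/4 \<Longrightarrow>
      cmod (f (z + h) - f z - dd f z h) \<le> C * norm h ^ 2"
proof -
  obtain e C where e: "e > 0" "C > 0" "ball z0 (2*e) \<subseteq> U"
    and T: "\<And>z h. z \<in> ball z0 e \<Longrightarrow> norm h \<le> e/4 \<Longrightarrow>
      cmod (f (z + h) - f z - deriv (\<lambda>\<zeta>. f (z + \<zeta> *s h)) 0) \<le> C * norm h ^ 2"
    using line_holomorphic_Taylor[OF assms(1) hol_continuous_on[OF assms(2)] assms(3) hol_line[OF assms(2)]]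
    by metis
  have "deriv (\<lambda>\<zeta>. f (z + \<zeta> *s h)) 0 = dd f z h" if "z \<in> ball z0 e" for z h
  proof (rule DERIV_imp_deriv)
    have "z \<in> U" using that e by auto
    then show "((\<lambda>\<zeta>. f (z + \<zeta> *s h)) has_field_derivative dd f z h) (at 0)"
      using hol_line_derivative[OF assms(2), of z 0 h] by simp
  qed
  then show thesis using that e T by auto
qed

text \<open>The Weierstrass theorem in several variables: on each complex line it is the classical
  one, and \<open>Osgood_lines\<close> reassembles the lines.\<close>

lemma hol_uniform_limit:
  assumes "open U" "\<And>k. hol U (f k)" "uniform_limit U f g sequentially"
  shows "hol U g"
proof (rule Osgood_lines[OF assms(1)])
  show "continuous_on U g"
    by (rule uniform_limit_theorem[OF _ assms(3)]) (auto intro!: always_eventually hol_continuous_on assms(2))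
  fix z v :: "complex^'a" and r :: real
  assume r: "r > 0" and sub: "\<And>\<zeta>. \<zeta> \<in> ball 0 r \<Longrightarrow> z + \<zeta> *s v \<in> U"
  show "(\<lambda>\<zeta>. g (z + \<zeta> *s v)) holomorphic_on ball 0 r"
  proof (rule holomorphic_uniform_sequence[where f="\<lambda>k \<zeta>. f k (z + \<zeta> *s v)"])
    show "(\<lambda>\<zeta>. f k (z + \<zeta> *s v)) holomorphic_on ball 0 r" for k
      by (rule hol_line[OF assms(2) sub])
    fix x :: complex assume "x \<in> ball 0 r"
    then obtain d where d: "d > 0" "cball x d \<subseteq> ball 0 r"
      using open_contains_cball by blast
    have "uniform_limit (cball x d) (\<lambda>k \<zeta>. f k (z + \<zeta> *s v)) (\<lambda>\<zeta>. g (z + \<zeta> *s v)) sequentially"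
      by (rule uniform_limit_compose'[OF assms(3)]) (use sub d in auto)
    then show "\<exists>d>0. cball x d \<subseteq> ball 0 r \<and>
        uniform_limit (cball x d) (\<lambda>k \<zeta>. f k (z + \<zeta> *s v)) (\<lambda>\<zeta>. g (z + \<zeta> *s v)) sequentially"
      using d by blast
  qed simp
qed

text \<open>Uniformity on a whole ball is the point: it makes a directional derivative holomorphic
  as a uniform limit, and it allows the limit to be differentiated once more.\<close>

lemma hol_difference_quotient:
  assumes "open U" "hol U f" "z0 \<in> U"
  obtains e \<tau> where "e > 0" "ball z0 (2*e) \<subseteq> U" "\<And>n. \<tau> n > (0::real)" "\<tau> \<longlonglongrightarrow> 0"
    "\<And>n z. z \<in> ball z0 e \<Longrightarrow> z + complex_of_real (\<tau> n) *s v \<in> U"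
    "uniform_limit (ball z0 e) (\<lambda>n z. (f (z + complex_of_real (\<tau> n) *s v) - f z) / \<tau> n)
      (\<lambda>z. dd f z v) sequentially"
proof -
  obtain e C where e: "e > 0" and C: "C > 0" and sub: "ball z0 (2*e) \<subseteq> U"
    and T: "\<And>z h. z \<in> ball z0 e \<Longrightarrow> norm h \<le> e/4 \<Longrightarrow>
      cmod (f (z + h) - f z - dd f z h) \<le> C * norm h ^ 2"
    using hol_Taylor[OF assms] by metis
  define c where "c = e / (4 * (norm v + 1))"
  have c: "c > 0" "c * norm v \<le> e/4"
  proof -
    show "c > 0" using e unfolding c_def by (intro divide_pos_pos mult_pos_pos add_nonneg_pos) auto
    have "c * norm v \<le> c * (norm v + 1)" using \<open>c > 0\<close> by (simp add: mult_left_mono)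
    also have "\<dots> = e / 4" using e by (simp add: c_def field_simps add_nonneg_eq_0_iff)
    finally show "c * norm v \<le> e/4" .
  qed
  define \<tau> where "\<tau> n = c * inverse (real (Suc n))" for n
  have \<tau>: "\<tau> n > 0" "\<tau> n * norm v \<le> e/4" for n
  proof -
    show "\<tau> n > 0" using c by (simp add: \<tau>_def)
    have "inverse (real (Suc n)) \<le> 1" by (simp add: inverse_le_1_iff)
    then have "\<tau> n \<le> c" using c unfolding \<tau>_def by (metis mult_left_le less_imp_le)
    then show "\<tau> n * norm v \<le> e/4" using c by (meson mult_right_mono norm_ge_zero order_trans)
  qed
  have lim: "\<tau> \<longlonglongrightarrow> 0"
  proof -
    have "(\<lambda>n. c * inverse (real (Suc n))) \<longlonglongrightarrow> c * 0"
      by (intro tendsto_mult tendsto_const LIMSEQ_inverse_real_of_nat)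
    then show ?thesis by (simp add: \<tau>_def[abs_def])
  qed
  have UL: "uniform_limit (ball z0 e) (\<lambda>n z. (f (z + complex_of_real (\<tau> n) *s v) - f z) / \<tau> n)
      (\<lambda>z. dd f z v) sequentially"
  proof (rule uniform_limitI)
    fix \<epsilon> :: real assume "\<epsilon> > 0"
    moreover have "(\<lambda>n. C * norm v ^ 2 * \<tau> n) \<longlonglongrightarrow> 0"
      using tendsto_mult[OF tendsto_const lim, of "C * norm v ^ 2"] by simp
    ultimately have "\<forall>\<^sub>F n in sequentially. C * norm v ^ 2 * \<tau> n < \<epsilon>"
      using order_tendstoD(2) by blast
    then show "\<forall>\<^sub>F n in sequentially. \<forall>z\<in>ball z0 e.
        dist ((f (z + complex_of_real (\<tau> n) *s v) - f z) / \<tau> n) (dd f z v) < \<epsilon>"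
    proof (rule eventually_mono, intro ballI)
      fix n z assume n: "C * norm v ^ 2 * \<tau> n < \<epsilon>" and z: "z \<in> ball z0 e"
      have zU: "z \<in> U" using z sub e by (auto simp: subset_iff)
      let ?N = "f (z + complex_of_real (\<tau> n) *s v) - f z - complex_of_real (\<tau> n) * dd f z v"
      have "cmod ?N \<le> C * (\<tau> n * norm v) ^ 2"
        using T[OF z, of "complex_of_real (\<tau> n) *s v"] \<tau>[of n] hol_dd_smult[OF assms(2) zU]
        by (simp add: norm_vec_smult)
      then have "cmod ?N / \<tau> n \<le> C * norm v ^ 2 * \<tau> n"
        using \<tau>(1)[of n] by (simp add: divide_simps power2_eq_square mult_ac)
      moreover have "(f (z + complex_of_real (\<tau> n) *s v) - f z) / \<tau> n - dd f z v = ?N / \<tau> n"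
        using \<tau>(1)[of n] by (simp add: diff_divide_distrib)
      ultimately show "dist ((f (z + complex_of_real (\<tau> n) *s v) - f z) / \<tau> n) (dd f z v) < \<epsilon>"
        using n \<tau>(1)[of n] by (simp add: dist_norm norm_divide)
    qed
  qed
  have IN: "z + complex_of_real (\<tau> n) *s v \<in> U" if "z \<in> ball z0 e" for n z
  proof -
    have "norm (complex_of_real (\<tau> n) *s v) \<le> e/4"
      using \<tau>[of n] by (simp add: norm_vec_smult)
    then have "dist z0 (z + complex_of_real (\<tau> n) *s v) < 2 * e"
      using that e dist_triangle[of z0 "z + complex_of_real (\<tau> n) *s v" z] by (simp add: dist_norm)
    then show ?thesis using sub by auto
  qed
  show thesis by (rule that[of e \<tau>, OF e sub \<tau>(1) lim IN UL])
qed

lemma hol_shift: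
  assumes "hol U f" "\<And>z. z \<in> V \<Longrightarrow> z + a \<in> U"
  shows "hol V (\<lambda>z. f (z + a))"
  by (rule hol_compose[OF assms(1)]) (use assms(2) in \<open>auto simp: holomorphic_field_iff\<close>)

lemma dd_shift:
  assumes "hol U f" "z + a \<in> U"
  shows "dd (\<lambda>z. f (z + a)) z = dd f (z + a)"
proof -
  have "((\<lambda>z. f (z + a)) has_derivative (\<lambda>h. dd f (z + a) h)) (at z)"
    by (rule has_derivative_compose[where f="\<lambda>z. z + a" and f'="\<lambda>h. h"])
       (auto intro!: derivative_eq_intros hol_derivative[OF assms])
  then show ?thesis using frechet_derivative_at by (metis (no_types, lifting) ext)
qed

lemma hol_dd:
  assumes "open U" "hol U f" shows "hol U (\<lambda>z. dd f z v)"
proof (rule hol_local)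
  fix z0 assume z0: "z0 \<in> U"
  obtain e \<tau> where e: "e > 0" "ball z0 (2*e) \<subseteq> U" and \<tau>: "\<And>n. \<tau> n > (0::real)"
    and in_U: "\<And>n z. z \<in> ball z0 e \<Longrightarrow> z + complex_of_real (\<tau> n) *s v \<in> U"
    and lim: "uniform_limit (ball z0 e) (\<lambda>n z. (f (z + complex_of_real (\<tau> n) *s v) - f z) / \<tau> n)
      (\<lambda>z. dd f z v) sequentially"
    by (rule hol_difference_quotient[OF assms z0, of v]) (rule that)
  have "hol (ball z0 e) (\<lambda>z. dd f z v)"
  proof (rule hol_uniform_limit[OF open_ball _ lim])
    show "hol (ball z0 e) (\<lambda>z. (f (z + complex_of_real (\<tau> n) *s v) - f z) / \<tau> n)" for n
      using \<tau>[of n] e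
      by (intro hol_divide hol_diff hol_const hol_shift[OF assms(2)] hol_subset[OF assms(2)] in_U) auto
  qed
  then show "\<exists>V. z0 \<in> V \<and> hol V (\<lambda>z. dd f z v)" using e by (intro exI[of _ "ball z0 e"]) auto
qed

lemma hol_dd_field:
  assumes "open U" "hol U f" "holomorphic_field U X"
  shows "hol U (\<lambda>z. dd f z (X z))"
proof (rule hol_cong[OF assms(1)])
  show "hol U (\<lambda>z. \<Sum>i\<in>UNIV. X z $ i * dd f z (axis i 1))"
    using assms by (intro hol_sum hol_mult hol_dd) (auto simp: holomorphic_field_iff)
  fix z assume z: "z \<in> U"
  show "(\<Sum>i\<in>UNIV. X z $ i * dd f z (axis i 1)) = dd f z (X z)"
    using hol_dd_sum[OF assms(2) z, of "\<lambda>i. X z $ i *s axis i 1" UNIV] z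
    by (simp add: basis_expansion hol_dd_smult[OF assms(2)])
qed

text \<open>Let q_n be the difference quotients of f in direction v. By uniform convergence their
  derivatives in direction w tend to the mixed derivative, first v and then w. The same numbers are
  the difference quotients in direction v of the derivative of f along w, which tend to the mixed
  derivative in the other order.\<close>

lemma hol_dd_commute:
  assumes "open U" "hol U f" "z0 \<in> U"
  shows "dd (\<lambda>z. dd f z v) z0 w = dd (\<lambda>z. dd f z w) z0 v"
proof -
  obtain e \<tau> where e: "e > 0" "ball z0 (2*e) \<subseteq> U" and \<tau>: "\<And>n. \<tau> n > (0::real)" "\<tau> \<longlonglongrightarrow> 0"
    and in_U: "\<And>n z. z \<in> ball z0 e \<Longrightarrow> z + complex_of_real (\<tau> n) *s v \<in> U"
    and lim: "uniform_limit (ball z0 e) (\<lambda>n z. (f (z + complex_of_real (\<tau> n) *s v) - f z) / \<tau> n)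
      (\<lambda>z. dd f z v) sequentially"
    by (rule hol_difference_quotient[OF assms, of v]) (rule that)
  let ?q = "\<lambda>n z. (f (z + complex_of_real (\<tau> n) *s v) - f z) / \<tau> n"
  have z0: "z0 \<in> ball z0 e" using e by simp
  have holq: "hol (ball z0 e) (?q n)" for n
    using \<tau>(1)[of n] e
    by (intro hol_divide hol_diff hol_const hol_shift[OF assms(2)] hol_subset[OF assms(2)] in_U) auto
  have q': "dd (?q n) z0 w = (dd f (z0 + complex_of_real (\<tau> n) *s v) w - dd f z0 w) / \<tau> n" for n
  proof -
    have "((\<lambda>z. inverse (complex_of_real (\<tau> n)) * (f (z + complex_of_real (\<tau> n) *s v) - f z)) has_derivative
        (\<lambda>w. inverse (complex_of_real (\<tau> n)) * (dd (\<lambda>z. f (z + complex_of_real (\<tau> n) *s v)) z0 w - dd f z0 w))) (at z0)"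
      by (intro has_derivative_mult_right has_derivative_diff hol_derivative[OF assms(2,3)]
          hol_derivative[OF hol_shift[OF assms(2), of "ball z0 e"] z0] in_U)
    then show ?thesis
      using dd_shift[OF assms(2) in_U[OF z0, of n]] by (simp add: dd_eqI divide_inverse mult.commute)
  qed
  define r where "r = e / (norm w + 1)"
  have r: "r > 0" using e by (auto simp: r_def intro!: divide_pos_pos add_nonneg_pos)
  have line: "z0 + \<zeta> *s w \<in> ball z0 e" if "\<zeta> \<in> ball 0 r" for \<zeta>
  proof -
    have "cmod \<zeta> * norm w \<le> cmod \<zeta> * (norm w + 1)" by (simp add: mult_left_mono)
    also have "\<dots> < e" using that by (simp add: r_def pos_less_divide_eq add_nonneg_pos)
    finally show ?thesis by (simp add: dist_norm norm_vec_smult)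
  qed
  have "uniform_limit (ball 0 r) (\<lambda>n \<zeta>. ?q n (z0 + \<zeta> *s w)) (\<lambda>\<zeta>. dd f (z0 + \<zeta> *s w) v) sequentially"
    by (rule uniform_limit_compose'[OF lim]) (use line in auto)
  then have "(\<lambda>n. (deriv ^^ 1) (\<lambda>\<zeta>. ?q n (z0 + \<zeta> *s w)) 0) \<longlonglongrightarrow> (deriv ^^ 1) (\<lambda>\<zeta>. dd f (z0 + \<zeta> *s w) v) 0"
    by (rule higher_deriv_complex_uniform_limit)
       (use r line in \<open>auto intro!: always_eventually hol_line[OF holq]\<close>)
  moreover have "deriv (\<lambda>\<zeta>. ?q n (z0 + \<zeta> *s w)) 0 = dd (?q n) z0 w" for n
    using hol_line_derivative[OF holq, of z0 0 w n] z0 by (auto intro!: DERIV_imp_deriv)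
  moreover have "deriv (\<lambda>\<zeta>. dd f (z0 + \<zeta> *s w) v) 0 = dd (\<lambda>z. dd f z v) z0 w"
    using hol_line_derivative[OF hol_dd[OF assms(1,2), of v], of z0 0 w] assms(3) by (auto intro!: DERIV_imp_deriv)
  ultimately have 1: "(\<lambda>n. dd (?q n) z0 w) \<longlonglongrightarrow> dd (\<lambda>z. dd f z v) z0 w" by simp
  have "((\<lambda>\<zeta>. (dd f (z0 + \<zeta> *s v) w - dd f z0 w) / \<zeta>) \<longlongrightarrow> dd (\<lambda>z. dd f z w) z0 v) (at 0)"
    using hol_line_derivative[OF hol_dd[OF assms(1,2), of w], of z0 0 v] assms(3)
    unfolding has_field_derivative_iff by simp
  moreover have "filterlim (\<lambda>n. complex_of_real (\<tau> n)) (at 0) sequentially"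
  proof -
    have "complex_of_real (\<tau> n) \<noteq> 0" for n using \<tau>(1)[of n] by simp
    then show ?thesis
      unfolding filterlim_at using tendsto_of_real[OF \<tau>(2), where 'a=complex]
      by (intro conjI always_eventually allI) auto
  qed
  ultimately have "(\<lambda>n. (dd f (z0 + complex_of_real (\<tau> n) *s v) w - dd f z0 w) / \<tau> n)
      \<longlonglongrightarrow> dd (\<lambda>z. dd f z w) z0 v"
    by (rule filterlim_compose)
  with 1 show ?thesis unfolding q' by (rule LIMSEQ_unique)
qed

section \<open>Identity theorem\<close>

text \<open>On the complex line through z1 and z the parameters that stay in U form a convex, hence
  connected, open set, and f vanishes on a disc around the parameter 0. One-variable continuation
  reaches the parameter 1.\<close>

lemma hol_zero_convex:
  assumes "open U" "convex U" "hol U f" "z1 \<in> U" "r > 0"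
    and zero: "\<And>z. z \<in> ball z1 r \<Longrightarrow> f z = 0" and z: "z \<in> U"
  shows "f z = 0"
proof -
  define S where "S = {\<zeta>. z1 + \<zeta> *s (z - z1) \<in> U}"
  have cont: "continuous_on UNIV (\<lambda>\<zeta>. z1 + \<zeta> *s (z - z1))"
    by (intro continuous_intros linear_continuous_on bounded_linear_vec_smult)
  have "open S" unfolding S_def using open_vimage[OF assms(1) cont] by (simp add: vimage_def)
  have "convex S"
  proof (rule convexI)
    fix a b :: complex and u v :: real
    assume ab: "a \<in> S" "b \<in> S" "0 \<le> u" "0 \<le> v" "u + v = 1"
    have v: "v = 1 - u" using ab by simp
    have "z1 + (u *\<^sub>R a + v *\<^sub>R b) *s (z - z1) = u *\<^sub>R (z1 + a *s (z - z1)) + v *\<^sub>R (z1 + b *s (z - z1))"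
      unfolding v by (simp add: vec_eq_iff scaleR_vec_smult scaleR_conv_of_real algebra_simps)
    then show "u *\<^sub>R a + v *\<^sub>R b \<in> S"
      using ab convexD[OF assms(2), of "z1 + a *s (z - z1)" "z1 + b *s (z - z1)" u v] by (simp add: S_def)
  qed
  define d where "d = r / (norm (z - z1) + 1)"
  have d: "d > 0" using assms(5) by (auto simp: d_def intro!: divide_pos_pos add_nonneg_pos)
  have small: "z1 + \<zeta> *s (z - z1) \<in> ball z1 r" if "\<zeta> \<in> ball 0 d" for \<zeta>
  proof -
    have "cmod \<zeta> * norm (z - z1) \<le> cmod \<zeta> * (norm (z - z1) + 1)" by (simp add: mult_left_mono)
    also have "\<dots> < r" using that by (simp add: d_def pos_less_divide_eq add_nonneg_pos)
    finally show ?thesis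
      using norm_vec_smult[of \<zeta> "z1 - z"] by (simp add: dist_norm norm_minus_commute)
  qed
  have "f (z1 + 1 *s (z - z1)) = 0"
  proof (rule analytic_continuation[where f="\<lambda>\<zeta>. f (z1 + \<zeta> *s (z - z1))" and S=S
        and U="S \<inter> ball 0 d" and \<xi>=0 and w=1])
    show "(\<lambda>\<zeta>. f (z1 + \<zeta> *s (z - z1))) holomorphic_on S"
      by (rule hol_line[OF assms(3)]) (simp add: S_def)
    show "0 islimpt S \<inter> ball 0 d"
      using \<open>open S\<close> d assms(4) interior_limit_point[of 0 "S \<inter> ball 0 d"]
      by (simp add: interior_open open_Int) (simp add: S_def)
  qed (use \<open>open S\<close> \<open>convex S\<close> assms(4) z zero small in \<open>auto simp: S_def convex_connected\<close>)
  then show ?thesis by simp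
qed

lemma cvec_nth [simp]: "cvec x $ i = complex_of_real (x $ i)"
  by (simp add: cvec_def)

lemma cvec_add: "cvec (x + y) = cvec x + cvec y"
  and cvec_diff: "cvec (x - y) = cvec x - cvec y"
  and cvec_scaleR: "cvec (t *\<^sub>R x) = complex_of_real t *s cvec x"
  by (auto simp: vec_eq_iff)

lemma norm_cvec [simp]: "norm (cvec x) = norm x"
  by (simp add: norm_vec_def)

lemma dist_cvec [simp]: "dist (cvec x) (cvec y) = dist x y"
  by (simp add: dist_norm flip: cvec_diff)

text \<open>The transfer principle of the whole proof: an identity at the real points of a ball
  holds throughout a convex complex domain. The point x + i y lies on the line \<zeta> \<mapsto> x +
  \<zeta> y at \<zeta> = i, and that line consists of real points for real \<zeta>, so the zeros
  accumulate at 0.\<close>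

lemma hol_zero_real:
  assumes "open U" "convex U" "hol U f" "cvec x1 \<in> U" "s > 0"
    and zero: "\<And>x. x \<in> ball x1 s \<Longrightarrow> f (cvec x) = 0" and z: "z \<in> U"
  shows "f z = 0"
proof -
  obtain e where e: "e > 0" "ball (cvec x1) e \<subseteq> U" using assms(1,4) open_contains_ball by blast
  \<comment> \<open>With x within d of x1, y shorter than d and |\<zeta>| \<le> 2, the line stays
    within 3 d of x1, which is less than both s and e.\<close>
  define d where "d = min s e / 6"
  have d: "d > 0" "3 * d < s" "3 * d < e" using e assms(5) by (auto simp: d_def)
  show ?thesis
  proof (rule hol_zero_convex[OF assms(1,2,3,4) d(1) _ z])
    fix w assume w: "w \<in> ball (cvec x1) d"
    define x y where "x = (\<chi> i. Re (w $ i))" and "y = (\<chi> i. Im (w $ i))"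
    have wxy: "w = cvec x + \<i> *s cvec y"
      by (simp add: vec_eq_iff x_def y_def complex_eq_iff)
    have nx: "norm (x - x1) \<le> norm (w - cvec x1)" and ny: "norm y \<le> norm (w - cvec x1)"
      unfolding norm_vec_def
      by (auto intro!: L2_set_mono simp: x_def y_def)
         (metis (no_types, opaque_lifting) Re_complex_of_real abs_Re_le_cmod minus_complex.simps(1),
          metis (no_types, opaque_lifting) Im_complex_of_real abs_Im_le_cmod minus_complex.simps(2) diff_zero)
    have nx: "norm (x - x1) < d" and ny: "norm y < d"
      using nx ny w by (auto simp: dist_norm norm_minus_commute)
    have dist: "norm (cvec x + \<zeta> *s cvec y - cvec x1) < 3 * d" if "cmod \<zeta> \<le> 2" for \<zeta>
    proof -
      have "norm (cvec x + \<zeta> *s cvec y - cvec x1) \<le> norm (cvec (x - x1)) + norm (\<zeta> *s cvec y)"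
        using norm_triangle_ineq[of "cvec (x - x1)" "\<zeta> *s cvec y"] by (simp add: cvec_diff algebra_simps)
      also have "norm (\<zeta> *s cvec y) \<le> 2 * norm y"
        using that by (simp add: norm_vec_smult mult_right_mono)
      finally show ?thesis using nx ny by simp
    qed
    have in_U: "cvec x + \<zeta> *s cvec y \<in> U" if "\<zeta> \<in> ball 0 2" for \<zeta>
      using dist[of \<zeta>] that e d by (intro subsetD[OF e(2)]) (simp add: dist_norm norm_minus_commute)
    have "f (cvec x + \<i> *s cvec y) = 0"
    proof (rule analytic_continuation[where f="\<lambda>\<zeta>. f (cvec x + \<zeta> *s cvec y)" and S="ball 0 2"
          and U="complex_of_real ` {-1<..<1}" and \<xi>=0 and w=\<i>])
      show "(\<lambda>\<zeta>. f (cvec x + \<zeta> *s cvec y)) holomorphic_on ball 0 2"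
        by (rule hol_line[OF assms(3) in_U])
      show "0 islimpt complex_of_real ` {-1<..<1}"
        unfolding islimpt_approachable
      proof (intro allI impI)
        fix \<epsilon> :: real assume "\<epsilon> > 0"
        then show "\<exists>x'\<in>complex_of_real ` {-1<..<1}. x' \<noteq> 0 \<and> dist x' 0 < \<epsilon>"
          by (intro bexI[of _ "complex_of_real (min \<epsilon> 1 / 2)"] imageI) auto
      qed
      fix \<zeta> assume "\<zeta> \<in> complex_of_real ` {-1<..<1}"
      then obtain t where t: "\<zeta> = complex_of_real t" "-1 < t" "t < 1" by auto
      have eq: "cvec x + \<zeta> *s cvec y = cvec (x + t *\<^sub>R y)" by (simp add: t cvec_add cvec_scaleR)
      have "norm (x + t *\<^sub>R y - x1) < 3 * d"
        using dist[of \<zeta>] t unfolding eq by (simp flip: cvec_diff)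
      then show "f (cvec x + \<zeta> *s cvec y) = 0"
        unfolding eq using d by (intro zero) (simp add: dist_norm norm_minus_commute)
    qed auto
    then show "f w = 0" using wxy by simp
  qed
qed

section \<open>Holomorphic vector fields\<close>

lemma holomorphic_field_const [intro]: "holomorphic_field U (\<lambda>z. w)"
  by (auto simp: holomorphic_field_iff)

lemma holomorphic_field_diff [intro]:
  "holomorphic_field U X \<Longrightarrow> holomorphic_field U Y \<Longrightarrow> holomorphic_field U (\<lambda>z. X z - Y z)"
  by (auto simp: holomorphic_field_iff)

lemma holomorphic_field_smult [intro]:
  "hol U f \<Longrightarrow> holomorphic_field U X \<Longrightarrow> holomorphic_field U (\<lambda>z. f z *s X z)"
  by (auto simp: holomorphic_field_iff)

lemma holomorphic_field_sum [intro]: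
  "(\<And>i. i \<in> I \<Longrightarrow> holomorphic_field U (X i)) \<Longrightarrow> holomorphic_field U (\<lambda>z. \<Sum>i\<in>I. X i z)"
  by (auto simp: holomorphic_field_iff)

lemma holomorphic_field_cong:
  assumes "open U" "\<And>z. z \<in> U \<Longrightarrow> X z = Y z" "holomorphic_field U X"
  shows "holomorphic_field U Y"
  unfolding holomorphic_field_iff
proof
  fix i
  show "hol U (\<lambda>z. Y z $ i)"
    by (rule hol_cong[OF assms(1), of "\<lambda>z. X z $ i"])
       (use assms in \<open>auto simp: holomorphic_field_iff\<close>)
qed

lemma holomorphic_field_dd:
  assumes "open U" "holomorphic_field U X" "holomorphic_field U Y"
  shows "holomorphic_field U (\<lambda>z. dd Y z (X z))"
proof -
  have "hol U (\<lambda>z. dd Y z (X z) $ i)" for i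
    by (rule hol_cong[OF assms(1) _ hol_dd_field[OF assms(1) _ assms(2), of "\<lambda>z. Y z $ i"]])
       (use assms(3) in \<open>auto simp: holomorphic_field_iff holomorphic_field_dd_nth[OF assms(3)]\<close>)
  then show ?thesis by (simp add: holomorphic_field_iff)
qed

lemma dd_expand:
  assumes "holomorphic_field U X" "z \<in> U"
  shows "dd X z v = (\<Sum>j\<in>UNIV. (v $ j) *s dd X z (axis j 1))"
proof -
  have "dd X z (\<Sum>j\<in>UNIV. (v $ j) *s axis j 1) = (\<Sum>j\<in>UNIV. dd X z ((v $ j) *s axis j 1))"
    using holomorphic_field_derivative[OF assms] has_derivative_linear linear_sum by blast
  then show ?thesis
    by (simp add: basis_expansion holomorphic_field_dd_smult[OF assms])
qed

lemma lie_bracket_hol: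
  assumes "holomorphic_field U X" "holomorphic_field U Y" "z \<in> U"
  shows "lie_bracket X Y z = dd Y z (X z) - dd X z (Y z)"
  unfolding lie_bracket_def sum_subtractf
  using dd_expand[OF assms(1,3)] dd_expand[OF assms(2,3)] by metis

lemma holomorphic_field_lie_bracket:
  assumes "open U" "holomorphic_field U X" "holomorphic_field U Y"
  shows "holomorphic_field U (lie_bracket X Y)"
  by (rule holomorphic_field_cong[OF assms(1) lie_bracket_hol[symmetric]])
     (use assms in \<open>auto intro!: holomorphic_field_diff holomorphic_field_dd\<close>)

text \<open>The Leibniz rule with the second-order part isolated: the first term keeps the vector Y
  z frozen, so it is a second derivative of f and symmetric by
  \<open>hol_dd_commute\<close>.\<close>

lemma dd_dd_field:
  assumes "open U" "hol U f" "holomorphic_field U Y" "z \<in> U"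
  shows "dd (\<lambda>z. dd f z (Y z)) z v = dd (\<lambda>x. dd f x (Y z)) z v + dd f z (dd Y z v)"
proof -
  have eq: "dd f x (Y x) = (\<Sum>i\<in>UNIV. Y x $ i * dd f x (axis i 1))" if "x \<in> U" for x
    using hol_dd_sum[OF assms(2) that, of "\<lambda>i. Y x $ i *s axis i 1" UNIV]
    by (simp add: basis_expansion hol_dd_smult[OF assms(2) that])
  have eq2: "dd f x w = (\<Sum>i\<in>UNIV. w $ i * dd f x (axis i 1))" if "x \<in> U" for x w
    using hol_dd_sum[OF assms(2) that, of "\<lambda>i. w $ i *s axis i 1" UNIV]
    by (simp add: basis_expansion hol_dd_smult[OF assms(2) that])
  have d: "((\<lambda>x. dd f x (axis i 1)) has_derivative dd (\<lambda>x. dd f x (axis i 1)) z) (at z)" for i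
    using hol_derivative[OF hol_dd[OF assms(1,2)] assms(4)] .
  have dY: "((\<lambda>x. Y x $ i) has_derivative (\<lambda>v. dd Y z v $ i)) (at z)" for i
    by (rule bounded_linear.has_derivative[OF bounded_linear_vec_nth]
        holomorphic_field_derivative[OF assms(3,4)])+
  have "((\<lambda>x. \<Sum>i\<in>UNIV. Y x $ i * dd f x (axis i 1)) has_derivative
      (\<lambda>v. \<Sum>i\<in>UNIV. Y z $ i * dd (\<lambda>x. dd f x (axis i 1)) z v + dd Y z v $ i * dd f z (axis i 1))) (at z)"
    by (intro has_derivative_sum has_derivative_mult d dY)
  then have "((\<lambda>x. dd f x (Y x)) has_derivative
      (\<lambda>v. \<Sum>i\<in>UNIV. Y z $ i * dd (\<lambda>x. dd f x (axis i 1)) z v + dd Y z v $ i * dd f z (axis i 1))) (at z)"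
    by (rule has_derivative_transform_within_open[OF _ assms(1,4)]) (simp add: eq)
  then have 1: "dd (\<lambda>z. dd f z (Y z)) z v =
      (\<Sum>i\<in>UNIV. Y z $ i * dd (\<lambda>x. dd f x (axis i 1)) z v + dd Y z v $ i * dd f z (axis i 1))"
    by (rule dd_eqI)
  have "((\<lambda>x. \<Sum>i\<in>UNIV. Y z $ i * dd f x (axis i 1)) has_derivative
      (\<lambda>v. \<Sum>i\<in>UNIV. Y z $ i * dd (\<lambda>x. dd f x (axis i 1)) z v)) (at z)"
    by (intro has_derivative_sum has_derivative_mult_right d)
  then have "((\<lambda>x. dd f x (Y z)) has_derivative
      (\<lambda>v. \<Sum>i\<in>UNIV. Y z $ i * dd (\<lambda>x. dd f x (axis i 1)) z v)) (at z)"
    by (rule has_derivative_transform_within_open[OF _ assms(1,4)]) (simp add: eq2[symmetric])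
  then have 2: "dd (\<lambda>x. dd f x (Y z)) z v = (\<Sum>i\<in>UNIV. Y z $ i * dd (\<lambda>x. dd f x (axis i 1)) z v)"
    by (rule dd_eqI)
  show ?thesis unfolding 1 2 eq2[OF assms(4), of "dd Y z v"] by (simp add: sum.distrib)
qed

lemma dd_lie_bracket_zero:
  assumes "open U" "hol U f" "holomorphic_field U X" "holomorphic_field U Y"
    and "\<And>z. z \<in> U \<Longrightarrow> dd f z (X z) = 0" "\<And>z. z \<in> U \<Longrightarrow> dd f z (Y z) = 0" "z \<in> U"
  shows "dd f z (lie_bracket X Y z) = 0"
proof -
  have zero: "dd (\<lambda>z. dd f z (W z)) z v = 0" if "\<And>z. z \<in> U \<Longrightarrow> dd f z (W z) = 0" for W v
    using dd_eqI[OF has_derivative_transform_within_open[OF has_derivative_const[of 0] assms(1,7)], of "\<lambda>z. dd f z (W z)"]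
      that by auto
  have "dd (\<lambda>x. dd f x (X z)) z (Y z) + dd f z (dd X z (Y z)) = 0"
    "dd (\<lambda>x. dd f x (Y z)) z (X z) + dd f z (dd Y z (X z)) = 0"
    using dd_dd_field[OF assms(1,2,3,7), of "Y z"] dd_dd_field[OF assms(1,2,4,7), of "X z"]
      zero[OF assms(5)] zero[OF assms(6)] by auto
  then show ?thesis
    using hol_dd_commute[OF assms(1,2,7), of "X z" "Y z"]
    by (simp add: lie_bracket_hol[OF assms(3,4,7)] hol_dd_diff[OF assms(2,7)] eq_diff_eq add_eq_0_iff2)
qed

lemma dd_lie_bracket:
  assumes "open U" "holomorphic_field U X" "holomorphic_field U Y" "z \<in> U"
  shows "dd (lie_bracket X Y) z v $ i =
     dd (\<lambda>x. dd (\<lambda>z. Y z $ i) x (X z)) z v + dd Y z (dd X z v) $ i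
   - dd (\<lambda>x. dd (\<lambda>z. X z $ i) x (Y z)) z v - dd X z (dd Y z v) $ i"
proof -
  have X: "hol U (\<lambda>z. X z $ i)" and Y: "hol U (\<lambda>z. Y z $ i)"
    using assms by (auto simp: holomorphic_field_iff)
  have br: "lie_bracket X Y x $ i = dd (\<lambda>z. Y z $ i) x (X x) - dd (\<lambda>z. X z $ i) x (Y x)" if "x \<in> U" for x
    using that by (simp add: lie_bracket_hol[OF assms(2,3)] holomorphic_field_dd_nth[OF assms(2)]
        holomorphic_field_dd_nth[OF assms(3)])
  have "((\<lambda>x. dd (\<lambda>z. Y z $ i) x (X x) - dd (\<lambda>z. X z $ i) x (Y x)) has_derivative
     (\<lambda>v. dd (\<lambda>x. dd (\<lambda>z. Y z $ i) x (X x)) z v - dd (\<lambda>x. dd (\<lambda>z. X z $ i) x (Y x)) z v)) (at z)"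
    by (intro has_derivative_diff hol_derivative[OF hol_dd_field[OF assms(1)] assms(4)] X Y assms(2,3))
  then have "((\<lambda>x. lie_bracket X Y x $ i) has_derivative
     (\<lambda>v. dd (\<lambda>x. dd (\<lambda>z. Y z $ i) x (X x)) z v - dd (\<lambda>x. dd (\<lambda>z. X z $ i) x (Y x)) z v)) (at z)"
    by (rule has_derivative_transform_within_open[OF _ assms(1,4)]) (simp add: br)
  then have "dd (\<lambda>x. lie_bracket X Y x $ i) z v =
      dd (\<lambda>x. dd (\<lambda>z. Y z $ i) x (X x)) z v - dd (\<lambda>x. dd (\<lambda>z. X z $ i) x (Y x)) z v"
    by (rule dd_eqI)
  then show ?thesis
    using holomorphic_field_dd_nth[OF holomorphic_field_lie_bracket[OF assms(1,2,3)] assms(4), of v i]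
      dd_dd_field[OF assms(1) Y assms(2,4), of v] dd_dd_field[OF assms(1) X assms(3,4), of v]
    by (simp add: holomorphic_field_dd_nth[OF assms(2,4)] holomorphic_field_dd_nth[OF assms(3,4)])
qed

text \<open>Written as the derivation rule of bracketing with X, the form in which it is used. After
  expansion the compositions of first derivatives cancel in pairs and the second derivatives match
  by symmetry.\<close>

lemma Jacobi:
  assumes "open U" "holomorphic_field U X" "holomorphic_field U Y" "holomorphic_field U Z" "z \<in> U"
  shows "lie_bracket X (lie_bracket Y Z) z =
    lie_bracket (lie_bracket X Y) Z z + lie_bracket Y (lie_bracket X Z) z"
proof -
  note fields = assms(2,3,4)
  note br = holomorphic_field_lie_bracket[OF assms(1)]
  have diff: "dd W z (a - b) = dd W z a - dd W z b" if "holomorphic_field U W" for W a b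
    using holomorphic_field_derivative[OF that assms(5)] has_derivative_linear linear_diff by blast
  have comm: "dd (\<lambda>x. dd (\<lambda>z. W z $ i) x a) z b = dd (\<lambda>x. dd (\<lambda>z. W z $ i) x b) z a"
    if "holomorphic_field U W" for W i a b
    by (rule hol_dd_commute[OF assms(1) _ assms(5)]) (use that in \<open>auto simp: holomorphic_field_iff\<close>)
  note L = lie_bracket_hol[OF _ _ assms(5)]
  have "lie_bracket X (lie_bracket Y Z) z $ i =
    (lie_bracket (lie_bracket X Y) Z z + lie_bracket Y (lie_bracket X Z) z) $ i" for i
    using fields br[OF fields(1,2)] br[OF fields(2,3)] br[OF fields(1,3)]
      comm[OF fields(1), of i "Y z" "Z z"] comm[OF fields(2), of i "X z" "Z z"]
      comm[OF fields(3), of i "X z" "Y z"]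
    by (simp add: L diff dd_lie_bracket[OF assms(1) _ _ assms(5)])
  then show ?thesis by (simp add: vec_eq_iff)
qed

section \<open>Annihilating row fields\<close>

text \<open>The complex bilinear pairing of a covector, stored as a vector, with a tangent vector.
  There is no conjugation, so it preserves holomorphy in both arguments.\<close>

definition dotp :: "complex^'m \<Rightarrow> complex^'m \<Rightarrow> complex" where
  "dotp q v = (\<Sum>i\<in>UNIV. q $ i * v $ i)"

lemma dotp_simps:
  "dotp (a + b) v = dotp a v + dotp b v" "dotp q (v + w) = dotp q v + dotp q w"
  "dotp (a - b) v = dotp a v - dotp b v" "dotp q (v - w) = dotp q v - dotp q w"
  "dotp (c *s q) v = c * dotp q v" "dotp q (c *s v) = c * dotp q v"
  "dotp 0 v = 0" "dotp q 0 = 0" "dotp (- q) v = - dotp q v" "dotp q (- v) = - dotp q v"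
  by (simp_all add: dotp_def algebra_simps sum.distrib sum_subtractf sum_distrib_left sum_negf)

lemma dotp_sum: "dotp q (\<Sum>i\<in>I. f i) = (\<Sum>i\<in>I. dotp q (f i))"
  by (induction I rule: infinite_finite_induct) (auto simp: dotp_simps)

lemma dotp_sum_left: "dotp (\<Sum>i\<in>I. f i) v = (\<Sum>i\<in>I. dotp (f i) v)"
  by (induction I rule: infinite_finite_induct) (auto simp: dotp_simps)

lemma hol_dotp [intro]:
  "holomorphic_field U q \<Longrightarrow> holomorphic_field U X \<Longrightarrow> hol U (\<lambda>z. dotp (q z) (X z))"
  by (auto simp: dotp_def holomorphic_field_iff intro!: hol_sum hol_mult)

lemma dd_dotp:
  assumes "holomorphic_field U q" "holomorphic_field U X" "z \<in> U"
  shows "dd (\<lambda>z. dotp (q z) (X z)) z v = dotp (dd q z v) (X z) + dotp (q z) (dd X z v)"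
proof -
  have n: "((\<lambda>x. Y x $ i) has_derivative (\<lambda>v. dd Y z v $ i)) (at z)" if "holomorphic_field U Y" for Y i
    by (rule bounded_linear.has_derivative[OF bounded_linear_vec_nth]
        holomorphic_field_derivative[OF that assms(3)])+
  have "((\<lambda>z. dotp (q z) (X z)) has_derivative
      (\<lambda>v. \<Sum>i\<in>UNIV. q z $ i * dd X z v $ i + dd q z v $ i * X z $ i)) (at z)"
    unfolding dotp_def by (intro has_derivative_sum has_derivative_mult n assms)
  then show ?thesis
    using dd_eqI by (fastforce simp: dotp_def sum.distrib)
qed

text \<open>Minus the exterior derivative of the 1-form q, evaluated on u and v.\<close>

definition curl :: "(complex^'m \<Rightarrow> complex^'m) \<Rightarrow> complex^'m \<Rightarrow> complex^'m \<Rightarrow> complex^'m \<Rightarrow> complex" where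
  "curl q z u v = dotp (dd q z v) u - dotp (dd q z u) v"

lemma curl_anti: "curl q z u v = - curl q z v u"
  by (simp add: curl_def)

lemma curl_bilinear:
  assumes "holomorphic_field U q" "z \<in> U"
  shows "curl q z (u + u') v = curl q z u v + curl q z u' v"
    "curl q z (c *s u) v = c * curl q z u v"
    "curl q z u (v + v') = curl q z u v + curl q z u v'"
    "curl q z u (c *s v) = c * curl q z u v"
proof -
  have "linear (dd q z)"
    using holomorphic_field_derivative[OF assms] has_derivative_linear by blast
  then show "curl q z (u + u') v = curl q z u v + curl q z u' v"
    "curl q z u (v + v') = curl q z u v + curl q z u v'"
    by (simp_all add: curl_def dotp_simps linear_add)
  show "curl q z (c *s u) v = c * curl q z u v" "curl q z u (c *s v) = c * curl q z u v"
    by (simp_all add: curl_def dotp_simps holomorphic_field_dd_smult[OF assms] algebra_simps)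
qed

lemma curl_0:
  assumes "holomorphic_field U q" "z \<in> U"
  shows "curl q z 0 v = 0" "curl q z u 0 = 0"
  using curl_bilinear(2)[OF assms, of 0 0 v] curl_bilinear(4)[OF assms, of u 0 0] by auto

lemma curl_sum_right:
  assumes "holomorphic_field U q" "z \<in> U"
  shows "curl q z u (\<Sum>i\<in>I. f i) = (\<Sum>i\<in>I. curl q z u (f i))"
  by (induction I rule: infinite_finite_induct)
     (auto simp: curl_0[OF assms] curl_bilinear[OF assms])

lemma hol_curl:
  assumes "open U" "holomorphic_field U q" "holomorphic_field U X" "holomorphic_field U Y"
  shows "hol U (\<lambda>z. curl q z (X z) (Y z))"
  unfolding curl_def by (intro hol_diff hol_dotp holomorphic_field_dd assms)

text \<open>Cartan's formula for a 1-form that annihilates both fields. The right side depends only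
  on the values X z and Y z, so brackets modulo a distribution become pointwise algebra.\<close>

lemma dotp_lie_bracket:
  assumes "open U" "holomorphic_field U q" "holomorphic_field U X" "holomorphic_field U Y"
    and "\<And>z. z \<in> U \<Longrightarrow> dotp (q z) (X z) = 0" "\<And>z. z \<in> U \<Longrightarrow> dotp (q z) (Y z) = 0" "z \<in> U"
  shows "dotp (q z) (lie_bracket X Y z) = curl q z (X z) (Y z)"
proof -
  have zero: "dd (\<lambda>z. dotp (q z) (W z)) z v = 0" if "\<And>z. z \<in> U \<Longrightarrow> dotp (q z) (W z) = 0" for W v
    using dd_eqI[OF has_derivative_transform_within_open[OF has_derivative_const[of 0] assms(1,7)], of "\<lambda>z. dotp (q z) (W z)"]
      that by auto
  have "dotp (dd q z (Y z)) (X z) + dotp (q z) (dd X z (Y z)) = 0"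
    "dotp (dd q z (X z)) (Y z) + dotp (q z) (dd Y z (X z)) = 0"
    using zero[OF assms(5), of "Y z"] zero[OF assms(6), of "X z"]
      dd_dotp[OF assms(2,3,7), of "Y z"] dd_dotp[OF assms(2,4,7), of "X z"] by auto
  then show ?thesis
    by (simp add: lie_bracket_hol[OF assms(3,4,7)] curl_def dotp_simps add_eq_0_iff2 add_eq_0_iff)
qed

section \<open>Conjugation\<close>

lemma cnjv_nth [simp]: "cnjv v $ i = cnj (v $ i)"
  by (simp add: cnjv_def)

lemma cnjv_simps [simp]:
  "cnjv (cnjv v) = v" "cnjv (u + v) = cnjv u + cnjv v" "cnjv (u - v) = cnjv u - cnjv v"
  "cnjv (c *s v) = cnj c *s cnjv v" "cnjv 0 = 0" "cnjv (cvec x) = cvec x" "norm (cnjv v) = norm v"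
  "cnjv (- v) = - cnjv v"
  by (auto simp: vec_eq_iff norm_vec_def)

lemma cnjv_sum: "cnjv (\<Sum>i\<in>I. f i) = (\<Sum>i\<in>I. cnjv (f i))"
  by (induction I rule: infinite_finite_induct) auto

lemma cnjv_axis [simp]: "cnjv (axis i 1) = axis i 1"
  by (simp add: vec_eq_iff axis_def)

lemma bounded_linear_cnjv: "bounded_linear cnjv"
  by (rule bounded_linear_intro[where K=1])
     (auto simp: scaleR_vec_smult)

lemma dist_cnjv [simp]: "dist (cnjv x) (cnjv y) = dist x y"
  unfolding dist_norm using cnjv_simps(7)[of "x - y"] by simp

lemma cnjv_image_ball: "cnjv ` ball (cvec p) r = ball (cvec p) r"
proof -
  have *: "cnjv z \<in> ball (cvec p) r \<longleftrightarrow> z \<in> ball (cvec p) r" for z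
    unfolding mem_ball by (metis dist_cnjv cnjv_simps(6))
  show ?thesis
  proof (intro equalityI subsetI)
    fix z assume "z \<in> ball (cvec p) r"
    then show "z \<in> cnjv ` ball (cvec p) r"
      using * by (intro image_eqI[of z cnjv "cnjv z"]) simp_all
  qed (use * in blast)
qed

text \<open>The push-forward of a field under the involution. Conjugation occurs twice, at the point
  and at the value, so the result is holomorphic again.\<close>

definition tau_field :: "(complex^'m \<Rightarrow> complex^'m) \<Rightarrow> complex^'m \<Rightarrow> complex^'m" where
  "tau_field X z = cnjv (X (cnjv z))"

lemma tau_field_cvec [simp]: "tau_field X (cvec x) = cnjv (X (cvec x))"
  by (simp add: tau_field_def)

lemma tau_field_derivative:
  assumes "holomorphic_field U X" "cnjv z \<in> U"
  shows "(tau_field X has_derivative (\<lambda>v. cnjv (dd X (cnjv z) (cnjv v)))) (at z)"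
proof -
  have "((\<lambda>z. X (cnjv z)) has_derivative (\<lambda>v. dd X (cnjv z) (cnjv v))) (at z)"
    by (rule has_derivative_compose[OF bounded_linear_imp_has_derivative[OF bounded_linear_cnjv]
          holomorphic_field_derivative[OF assms]])
  then show ?thesis
    unfolding tau_field_def[abs_def]
    by (rule bounded_linear.has_derivative[OF bounded_linear_cnjv])
qed

lemma holomorphic_field_tau_field:
  assumes "holomorphic_field U X" "cnjv ` V \<subseteq> U" shows "holomorphic_field V (tau_field X)"
  unfolding holomorphic_field_def
proof
  fix z assume z: "z \<in> V"
  have "cnjv z \<in> U" using assms z by auto
  then show "\<exists>D. (tau_field X has_derivative D) (at z) \<and> (\<forall>c v. D (c *s v) = c *s D v)"
    using tau_field_derivative[OF assms(1), of z]
    by (intro exI[of _ "\<lambda>v. cnjv (dd X (cnjv z) (cnjv v))"])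
       (simp add: holomorphic_field_dd_smult[OF assms(1)])
qed

lemma lie_bracket_tau_field:
  assumes "holomorphic_field U X" "holomorphic_field U Y" "cnjv z \<in> U"
  shows "lie_bracket (tau_field X) (tau_field Y) z = cnjv (lie_bracket X Y (cnjv z))"
proof -
  have "dd (tau_field W) z v = cnjv (dd W (cnjv z) (cnjv v))" if "holomorphic_field U W" for W v
    using dd_eqI[OF tau_field_derivative[OF that assms(3)]] .
  then show ?thesis
    using assms by (simp add: lie_bracket_def cnjv_sum) (simp add: tau_field_def)
qed

section \<open>Frames\<close>

text \<open>Independence of a finite sequence rather than of a set: a repeated member makes it
  dependent, so independence is the same as the span having dimension n.\<close>

definition indep :: "nat \<Rightarrow> (nat \<Rightarrow> complex^'m) \<Rightarrow> bool" where
  "indep n f \<longleftrightarrow> (\<forall>c. (\<Sum>j<n. c j *s f j) = 0 \<longrightarrow> (\<forall>j<n. c j = 0))"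

lemma span_lessThan:
  fixes f :: "nat \<Rightarrow> complex^'m"
  shows "v \<in> vec.span (f ` {..<n}) \<longleftrightarrow> (\<exists>c. v = (\<Sum>j<n. c j *s f j))"
proof (induction n arbitrary: v)
  case 0 then show ?case by auto
next
  case (Suc n)
  have "v \<in> vec.span (f ` {..<Suc n}) \<longleftrightarrow> (\<exists>k. v - k *s f n \<in> vec.span (f ` {..<n}))"
    by (simp add: lessThan_Suc vec.span_breakdown_eq)
  also have "\<dots> \<longleftrightarrow> (\<exists>k c. v - k *s f n = (\<Sum>j<n. c j *s f j))"
    by (simp add: Suc.IH)
  also have "\<dots> \<longleftrightarrow> (\<exists>c. v = (\<Sum>j<Suc n. c j *s f j))"
  proof
    assume "\<exists>k c. v - k *s f n = (\<Sum>j<n. c j *s f j)"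
    then obtain k c where kc: "v - k *s f n = (\<Sum>j<n. c j *s f j)" by blast
    have "v = (\<Sum>j<Suc n. (c(n := k)) j *s f j)"
      using kc by (simp add: algebra_simps)
    then show "\<exists>c. v = (\<Sum>j<Suc n. c j *s f j)" by blast
  next
    assume "\<exists>c. v = (\<Sum>j<Suc n. c j *s f j)"
    then obtain c where "v = (\<Sum>j<Suc n. c j *s f j)" by blast
    then have "v - c n *s f n = (\<Sum>j<n. c j *s f j)" by simp
    then show "\<exists>k c. v - k *s f n = (\<Sum>j<n. c j *s f j)" by blast
  qed
  finally show ?case .
qed

lemma indepD: "indep n f \<Longrightarrow> (\<Sum>j<n. c j *s f j) = 0 \<Longrightarrow> j < n \<Longrightarrow> c j = 0"
  unfolding indep_def by blast

lemma indep_inj_on: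
  assumes "indep n f" shows "inj_on f {..<n}"
proof (rule inj_onI)
  fix i j assume ij: "i \<in> {..<n}" "j \<in> {..<n}" "f i = f j"
  show "i = j"
  proof (rule ccontr)
    assume ne: "i \<noteq> j"
    let ?c = "\<lambda>k. if k = i then 1 else if k = j then -1 else 0 :: complex"
    have "(\<Sum>k<n. ?c k *s f k) = (\<Sum>k<n. (if k = i then f i else 0) - (if k = j then f j else 0))"
      using ne by (intro sum.cong) auto
    also have "\<dots> = 0" using ij by (simp add: sum_subtractf)
    finally show False using indepD[OF assms, of ?c i] ij by auto
  qed
qed

lemma indep_iff: "indep n f \<longleftrightarrow> inj_on f {..<n} \<and> vec.independent (f ` {..<n})"
proof
  assume ind: "indep n f"
  have "vec.independent (f ` {..<n})"
  proof (rule vec.independent_if_scalars_zero)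
    fix g x assume g: "(\<Sum>x\<in>f ` {..<n}. g x *s x) = 0" and x: "x \<in> f ` {..<n}"
    have "(\<Sum>j<n. g (f j) *s f j) = 0"
      using g by (simp add: sum.reindex[OF indep_inj_on[OF ind]])
    then show "g x = 0" using x indepD[OF ind, of "\<lambda>j. g (f j)"] by auto
  qed simp
  then show "inj_on f {..<n} \<and> vec.independent (f ` {..<n})" using indep_inj_on[OF ind] by blast
next
  assume a: "inj_on f {..<n} \<and> vec.independent (f ` {..<n})"
  show "indep n f" unfolding indep_def
  proof (intro allI impI)
    fix c j assume c: "(\<Sum>j<n. c j *s f j) = 0" and j: "j < n"
    let ?g = "\<lambda>x. c (the_inv_into {..<n} f x)"
    have "(\<Sum>x\<in>f ` {..<n}. ?g x *s x) = (\<Sum>j<n. c j *s f j)"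
      using a by (auto simp: sum.reindex the_inv_into_f_f intro!: sum.cong)
    then have "(\<Sum>x\<in>f ` {..<n}. ?g x *s x) = 0" using c by simp
    then have "?g (f j) = 0"
      using a j vec.independentD[of "f ` {..<n}" "f ` {..<n}" ?g "f j"] by auto
    then show "c j = 0" using a j by (simp add: the_inv_into_f_f)
  qed
qed

lemma indep_iff_dim: "indep n f \<longleftrightarrow> vec.dim (vec.span (f ` {..<n})) = n"
proof
  assume "indep n f"
  then have "inj_on f {..<n}" "vec.independent (f ` {..<n})" by (auto simp: indep_iff)
  then show "vec.dim (vec.span (f ` {..<n})) = n"
    by (simp add: vec.dim_eq_card_independent card_image)
next
  assume d: "vec.dim (vec.span (f ` {..<n})) = n"
  have "vec.dim (vec.span (f ` {..<n})) \<le> card (f ` {..<n})"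
    by (rule vec.dim_le_card) auto
  moreover have "card (f ` {..<n}) \<le> n" using card_image_le[of "{..<n}" f] by simp
  ultimately have c: "card (f ` {..<n}) = n" using d by simp
  then have inj: "inj_on f {..<n}" by (simp add: eq_card_imp_inj_on)
  have "vec.independent (f ` {..<n})"
    using vec.card_eq_dim[of "f ` {..<n}" "vec.span (f ` {..<n})"] c d by (auto simp: vec.span_superset)
  with inj show "indep n f" by (simp add: indep_iff)
qed

lemma indep_cong: "(\<And>j. j < n \<Longrightarrow> f j = g j) \<Longrightarrow> indep n f \<longleftrightarrow> indep n g"
proof -
  assume "\<And>j. j < n \<Longrightarrow> f j = g j"
  then have "(\<Sum>j<n. c j *s f j) = (\<Sum>j<n. c j *s g j)" for c by (intro sum.cong) auto
  then show ?thesis by (simp add: indep_def)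
qed

lemma indep_mono: "indep n f \<Longrightarrow> k \<le> n \<Longrightarrow> indep k f"
  unfolding indep_iff by (metis image_mono inj_on_subset lessThan_subset_iff vec.independent_mono)

lemma indep_complete:
  fixes f :: "nat \<Rightarrow> complex^'m"
  assumes "indep n f"
  obtains g where "\<And>j. j < n \<Longrightarrow> g j = f j" "indep CARD('m) g" "n \<le> CARD('m)"
proof -
  have f: "inj_on f {..<n}" "vec.independent (f ` {..<n})" using assms by (auto simp: indep_iff)
  obtain B where B: "f ` {..<n} \<subseteq> B" "vec.independent B" "UNIV \<subseteq> vec.span B"
    using vec.maximal_independent_subset_extend[OF subset_UNIV f(2)] by metis
  have finB: "finite B" using B vec.finiteI_independent by blast
  have cardB: "card B = CARD('m)"
    using vec.dim_eq_card[of B UNIV] B vec_dim_card[where 'a=complex and 'n='m]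
    by (simp add: top.extremum_unique)
  have n: "n \<le> CARD('m)"
    using card_mono[OF finB B(1)] cardB card_image[OF f(1)] by simp
  have "card (B - f ` {..<n}) = card {n..<CARD('m)}"
    using B(1) cardB card_image[OF f(1)] by (simp add: card_Diff_subset)
  then obtain h where h: "bij_betw h {n..<CARD('m)} (B - f ` {..<n})"
    using finite_same_card_bij finB by (metis finite_Diff finite_atLeastLessThan)
  define g where "g j = (if j < n then f j else h j)" for j
  have "bij_betw g ({..<n} \<union> {n..<CARD('m)}) (f ` {..<n} \<union> (B - f ` {..<n}))"
  proof (rule bij_betw_combine)
    show "bij_betw g {..<n} (f ` {..<n})"
      using f(1) by (auto simp: g_def bij_betw_def inj_on_def)
    show "bij_betw g {n..<CARD('m)} (B - f ` {..<n})"
      using h by (subst bij_betw_cong[of _ g h]) (auto simp: g_def)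
  qed auto
  moreover have "{..<n} \<union> {n..<CARD('m)} = {..<CARD('m)}" using n by auto
  moreover have "f ` {..<n} \<union> (B - f ` {..<n}) = B" using B by auto
  ultimately have "bij_betw g {..<CARD('m)} B" by simp
  then have "indep CARD('m) g" using B by (simp add: indep_iff bij_betw_def)
  then show thesis by (intro that[of g]) (auto simp: g_def n)
qed

lemma hol_det:
  assumes "\<And>i j. hol U (\<lambda>z. A z $ i $ j)" shows "hol U (\<lambda>z. det (A z))"
  unfolding det_def by (intro hol_sum hol_mult hol_prod hol_const assms)

text \<open>Cramer's rule writes the entries of the inverse as quotients of determinants, which are
  polynomials in the holomorphic entries of A.\<close>

lemma hol_matrix_inverse:
  fixes A :: "complex^'m \<Rightarrow> complex^'n^'n"
  assumes hol: "\<And>i j. hol U (\<lambda>z. A z $ i $ j)" and det: "\<And>z. z \<in> U \<Longrightarrow> det (A z) \<noteq> 0"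
  obtains B where "\<And>i j. hol U (\<lambda>z. B z $ i $ j)"
    "\<And>z. z \<in> U \<Longrightarrow> B z ** A z = mat 1" "\<And>z. z \<in> U \<Longrightarrow> A z ** B z = mat 1"
proof -
  define N where "N z k l = (\<chi> i j. if j = k then axis l 1 $ i else A z $ i $ j)" for z k l
  define B where "B z = (\<chi> k l. det (N z k l) / det (A z))" for z
  have hN: "hol U (\<lambda>z. N z k l $ i $ j)" for k l i j
    using hol by (cases "j = k") (auto simp: N_def)
  have AB: "A z ** B z = mat 1" if "z \<in> U" for z
  proof -
    have "A z *v column l (B z) = axis l 1" for l
      unfolding cramer[OF det[OF that]] by (simp add: column_def B_def N_def vec_eq_iff)
    then have "(A z ** B z) $ i $ l = axis l 1 $ i" for i l
      by (metis (no_types, lifting) column_def matrix_vector_mul_component matrix_matrix_mult_def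
          matrix_vector_mult_def sum.cong vec_lambda_beta)
    then show ?thesis by (simp add: vec_eq_iff mat_def axis_def eq_commute)
  qed
  show thesis
  proof (rule that[of B])
    show "hol U (\<lambda>z. B z $ i $ j)" for i j
      unfolding B_def using det by (simp, intro hol_divide hol_det hol hN) 
    show "A z ** B z = mat 1" if "z \<in> U" for z by (rule AB[OF that])
    show "B z ** A z = mat 1" if "z \<in> U" for z
      using AB[OF that] by (simp add: matrix_left_right_inverse)
  qed
qed

text \<open>The fields X are completed at p by constant vectors; the determinant stays nonzero
  nearby, and the rows of the inverse matrix form the dual coframe. That the completing fields are
  constant is part of the conclusion, because the projection used for Frobenius needs a complement
  that does not vary with the point.\<close>

lemma dual_frame:
  fixes X :: "nat \<Rightarrow> complex^'m \<Rightarrow> complex^'m"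
  assumes "open U" "p \<in> U" and hol: "\<And>j. j < d \<Longrightarrow> holomorphic_field U (X j)"
    and ind: "indep d (\<lambda>j. X j p)"
  obtains r Y q where "r > 0" "ball p r \<subseteq> U" "d \<le> CARD('m)" "\<And>j. j < d \<Longrightarrow> Y j = X j"
    "\<And>j z w. d \<le> j \<Longrightarrow> Y j z = Y j w"
    "\<And>j. j < CARD('m) \<Longrightarrow> holomorphic_field (ball p r) (Y j)"
    "\<And>j. j < CARD('m) \<Longrightarrow> holomorphic_field (ball p r) (q j)"
    "\<And>i j z. i < CARD('m) \<Longrightarrow> j < CARD('m) \<Longrightarrow> z \<in> ball p r \<Longrightarrow>
       dotp (q i z) (Y j z) = (if i = j then 1 else 0)"
    "\<And>z v. z \<in> ball p r \<Longrightarrow> v = (\<Sum>j<CARD('m). dotp (q j z) v *s Y j z)"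
proof -
  obtain g where g: "\<And>j. j < d \<Longrightarrow> g j = X j p" "indep CARD('m) g" and d: "d \<le> CARD('m)"
    using indep_complete[OF ind] by metis
  define Y where "Y j = (if j < d then X j else (\<lambda>z. g j))" for j
  \<comment> \<open>Frames are numbered by naturals, matrices by the index type of the space;
    \<sigma> and its inverse \<rho> translate between the two.\<close>
  obtain \<sigma> where \<sigma>: "bij_betw \<sigma> (UNIV::'m set) {..<CARD('m)}"
    using finite_same_card_bij[of "UNIV::'m set" "{..<CARD('m)}"] by auto
  define \<rho> where "\<rho> = the_inv_into UNIV \<sigma>"
  have \<sigma>\<rho>: "\<sigma> (\<rho> j) = j" if "j < CARD('m)" for j
    using f_the_inv_into_f_bij_betw[OF \<sigma>, of j] that by (simp add: \<rho>_def)
  have \<rho>\<sigma>: "\<rho> (\<sigma> i) = i" for i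
    using \<sigma> by (simp add: \<rho>_def bij_betw_def the_inv_into_f_f)
  have \<sigma>l: "\<sigma> i < CARD('m)" for i using \<sigma> by (auto simp: bij_betw_def)
  have holY: "holomorphic_field U (Y j)" for j
    by (cases "j < d") (auto simp: Y_def hol)
  define A where "A z = (\<chi> i k. Y (\<sigma> k) z $ i)" for z
  have holA: "hol U (\<lambda>z. A z $ i $ j)" for i j
    using holY by (auto simp: A_def holomorphic_field_iff)
  have Yp: "Y j p = g j" for j using g(1) by (simp add: Y_def)
  have "det (A p) \<noteq> 0"
  proof -
    have "\<forall>i. c i = 0" if "(\<Sum>i\<in>UNIV. c i *s column i (A p)) = 0" for c
    proof
      fix i
      have "(\<Sum>i\<in>UNIV. c i *s column i (A p)) = (\<Sum>i\<in>UNIV. c (\<rho> (\<sigma> i)) *s g (\<sigma> i))"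
        by (simp add: \<rho>\<sigma> column_def A_def Yp)
      also have "\<dots> = (\<Sum>j<CARD('m). c (\<rho> j) *s g j)"
        using sum.reindex_bij_betw[OF \<sigma>, of "\<lambda>j. c (\<rho> j) *s g j"] .
      finally have "(\<Sum>j<CARD('m). c (\<rho> j) *s g j) = 0" using that by simp
      then show "c i = 0" using indepD[OF g(2), of "\<lambda>j. c (\<rho> j)" "\<sigma> i"] \<sigma>l by (simp add: \<rho>\<sigma>)
    qed
    then have "\<exists>B. B ** A p = mat 1" using matrix_left_invertible_independent_columns by blast
    then show ?thesis using invertible_det_nz invertible_left_inverse by blast
  qed
  moreover have "continuous_on U (\<lambda>z. det (A z))" by (rule hol_continuous_on[OF hol_det[OF holA]])
  ultimately have "open (U \<inter> (\<lambda>z. det (A z)) -` (- {0}))"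
    using assms(1) continuous_open_preimage by blast
  moreover have "p \<in> U \<inter> (\<lambda>z. det (A z)) -` (- {0})" using assms(2) \<open>det (A p) \<noteq> 0\<close> by auto
  ultimately obtain r where r: "r > 0" "ball p r \<subseteq> U \<inter> (\<lambda>z. det (A z)) -` (- {0})"
    using open_contains_ball by metis
  obtain B where holB: "\<And>i j. hol (ball p r) (\<lambda>z. B z $ i $ j)"
    and BA: "\<And>z. z \<in> ball p r \<Longrightarrow> B z ** A z = mat 1" and AB: "\<And>z. z \<in> ball p r \<Longrightarrow> A z ** B z = mat 1"
  proof (rule hol_matrix_inverse[of "ball p r" A])
    show "hol (ball p r) (\<lambda>z. A z $ i $ j)" for i j
      using holA hol_subset r(2) by blast
    show "det (A z) \<noteq> 0" if "z \<in> ball p r" for z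
      using r(2) that by auto
  qed blast
  define q where "q j z = B z $ \<rho> j" for j z
  have dq: "dotp (q j z) v = (B z *v v) $ \<rho> j" for j z v
    by (simp add: q_def dotp_def matrix_vector_mult_def)
  show thesis
  proof (rule that[of r Y q])
    show "r > 0" "ball p r \<subseteq> U" "d \<le> CARD('m)" using r d by auto
    show "Y j = X j" if "j < d" for j using that by (simp add: Y_def)
    show "Y j z = Y j w" if "d \<le> j" for j z w using that by (simp add: Y_def)
    show "holomorphic_field (ball p r) (Y j)" for j
      using holomorphic_field_subset[OF holY] r by blast
    show "holomorphic_field (ball p r) (q j)" for j
      using holB by (simp add: holomorphic_field_iff q_def)
    show "dotp (q i z) (Y j z) = (if i = j then 1 else 0)"
      if "i < CARD('m)" "j < CARD('m)" "z \<in> ball p r" for i j z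
    proof -
      have "dotp (q i z) (Y j z) = (B z ** A z) $ \<rho> i $ \<rho> j"
        by (simp add: q_def dotp_def matrix_matrix_mult_def A_def \<sigma>\<rho> that)
      also have "\<dots> = (if \<rho> i = \<rho> j then 1 else 0)" using BA[OF that(3)] by (simp add: mat_def)
      finally show ?thesis using \<sigma>\<rho> that by metis
    qed
    show "v = (\<Sum>j<CARD('m). dotp (q j z) v *s Y j z)" if "z \<in> ball p r" for z v
    proof -
      have "v = A z *v (B z *v v)" using AB[OF that] by (simp add: matrix_vector_mul_assoc)
      also have "\<dots> = (\<Sum>k\<in>UNIV. (B z *v v) $ \<rho> (\<sigma> k) *s Y (\<sigma> k) z)"
        unfolding matrix_mult_sum[of "A z"] by (simp add: column_def A_def \<rho>\<sigma>)
      also have "\<dots> = (\<Sum>j<CARD('m). dotp (q j z) v *s Y j z)"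
        using sum.reindex_bij_betw[OF \<sigma>, of "\<lambda>j. (B z *v v) $ \<rho> j *s Y j z"] by (simp add: dq)
      finally show ?thesis .
    qed
  qed
qed

section \<open>Real-analytic functions and holomorphic extensions\<close>

lemma summable_on_comparison_norm:
  fixes f :: "'a \<Rightarrow> complex" and g :: "'a \<Rightarrow> real"
  assumes "g summable_on A" "\<And>x. x \<in> A \<Longrightarrow> cmod (f x) \<le> g x"
  shows "f summable_on A"
proof -
  have nonneg: "0 \<le> g x" if "x \<in> A" for x using assms(2)[OF that] norm_ge_zero order_trans by blast
  have "(\<lambda>x. norm (g x)) summable_on A"
    using assms(1) nonneg by (simp cong: summable_on_cong)
  then have "(\<lambda>x. norm (f x)) summable_on A"
    by (rule Infinite_Sum.abs_summable_on_comparison_test) (use assms(2) nonneg in \<open>auto intro: order_trans\<close>)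
  then show ?thesis by (rule abs_summable_summable)
qed

lemma eventually_finite_subsets_ex:
  "eventually P (finite_subsets_at_top A) \<Longrightarrow> \<exists>X. finite X \<and> P X"
  unfolding eventually_finite_subsets_at_top by blast

text \<open>Unordered convergence at one real point all of whose coordinates differ from those of p
  by t is absolute convergence. Its terms majorise the series on the complex ball of radius t, so
  the same coefficients define a holomorphic function there.\<close>

lemma real_analytic_extension:
  fixes f :: "real^'m \<Rightarrow> complex"
  assumes "real_analytic_on U f" "p \<in> U"
  obtains r F where "r > 0" "hol (ball (cvec p) r) F" "\<And>x. x \<in> ball p r \<Longrightarrow> F (cvec x) = f x"
proof -
  obtain c :: "('m \<Rightarrow> nat) \<Rightarrow> complex" and e where e: "e > 0"
    and sum: "\<And>x. x \<in> ball p e \<Longrightarrow>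
      ((\<lambda>\<alpha>. c \<alpha> * (\<Prod>i\<in>UNIV. complex_of_real (x $ i - p $ i) ^ \<alpha> i)) has_sum f x) UNIV"
    using assms unfolding real_analytic_on_def by blast
  define t where "t = e / (real CARD('m) + 1)"
  have t: "t > 0" "t * real CARD('m) < e" using e by (auto simp: t_def divide_simps algebra_simps)
  \<comment> \<open>Its norm distance from p is at most t CARD('m) < e, by the sum norm, so the
    given series converges at \<open>x0\<close>.\<close>
  define x0 where "x0 = (p + (\<chi> i. t) :: real^'m)"
  have "norm ((\<chi> i. t) :: real^'m) \<le> t * real CARD('m)"
    using norm_le_l1_cart[of "(\<chi> i. t) :: real^'m"] t by (simp add: mult.commute)
  then have "x0 \<in> ball p e" using t by (simp add: x0_def dist_norm)
  then have "(\<lambda>\<alpha>. c \<alpha> * (\<Prod>i\<in>UNIV. complex_of_real t ^ \<alpha> i)) summable_on UNIV"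
    using has_sum_imp_summable[OF sum[of x0]] by (simp add: x0_def)
  then have "(\<lambda>\<alpha>. norm (c \<alpha> * (\<Prod>i\<in>UNIV. complex_of_real t ^ \<alpha> i))) summable_on UNIV"
    by (simp only: summable_on_iff_abs_summable_on_complex[symmetric])
  then have summ: "(\<lambda>\<alpha>. cmod (c \<alpha>) * (\<Prod>i\<in>UNIV. t ^ \<alpha> i)) summable_on UNIV"
    using t by (simp add: norm_mult prod_norm[symmetric] norm_power)
  define F where "F z = (\<Sum>\<^sub>\<infinity>\<alpha>. c \<alpha> * (\<Prod>i\<in>UNIV. (z $ i - cvec p $ i) ^ \<alpha> i))" for z
  have UL: "uniform_limit (ball (cvec p) t) (\<lambda>A z. \<Sum>\<alpha>\<in>A. c \<alpha> * (\<Prod>i\<in>UNIV. (z $ i - cvec p $ i) ^ \<alpha> i))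
     F (finite_subsets_at_top UNIV)"
    unfolding F_def
  proof (rule Weierstrass_m_test_general[OF _ summ])
    fix \<alpha> :: "'m \<Rightarrow> nat" and z assume z: "z \<in> ball (cvec p) t"
    have "cmod (z $ i - cvec p $ i) \<le> t" for i
      using z Finite_Cartesian_Product.norm_nth_le[of "z - cvec p" i]
      by (simp add: dist_norm norm_minus_commute)
    then show "cmod (c \<alpha> * (\<Prod>i\<in>UNIV. (z $ i - cvec p $ i) ^ \<alpha> i)) \<le> cmod (c \<alpha>) * (\<Prod>i\<in>UNIV. t ^ \<alpha> i)"
      by (auto simp: norm_mult prod_norm[symmetric] norm_power intro!: mult_left_mono prod_mono power_mono)
  qed
  \<comment> \<open>The limit runs over finite sets of multi-indices. A sequence of such sets with
    error below 1 / (k + 1) is extracted to apply the theorem on uniform limits of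
    sequences.\<close>
  have "\<exists>A. finite A \<and> (\<forall>z\<in>ball (cvec p) t.
      dist (\<Sum>\<alpha>\<in>A. c \<alpha> * (\<Prod>i\<in>UNIV. (z $ i - cvec p $ i) ^ \<alpha> i)) (F z) < inverse (real (Suc k)))" for k
  proof -
    have "\<forall>\<^sub>F A in finite_subsets_at_top UNIV. \<forall>z\<in>ball (cvec p) t.
      dist (\<Sum>\<alpha>\<in>A. c \<alpha> * (\<Prod>i\<in>UNIV. (z $ i - cvec p $ i) ^ \<alpha> i)) (F z) < inverse (real (Suc k))"
      by (rule uniform_limitD[OF UL]) simp
    then show ?thesis by (rule eventually_finite_subsets_ex)
  qed
  then have "\<exists>A. \<forall>k. finite (A k) \<and> (\<forall>z\<in>ball (cvec p) t.
      dist (\<Sum>\<alpha>\<in>A k. c \<alpha> * (\<Prod>i\<in>UNIV. (z $ i - cvec p $ i) ^ \<alpha> i)) (F z) < inverse (real (Suc k)))"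
    by (intro choice allI)
  then obtain A where A: "\<And>k. finite (A k)" "\<And>k z. z \<in> ball (cvec p) t \<Longrightarrow>
      dist (\<Sum>\<alpha>\<in>A k. c \<alpha> * (\<Prod>i\<in>UNIV. (z $ i - cvec p $ i) ^ \<alpha> i)) (F z) < inverse (real (Suc k))"
    by blast
  have "uniform_limit (ball (cvec p) t)
      (\<lambda>k z. \<Sum>\<alpha>\<in>A k. c \<alpha> * (\<Prod>i\<in>UNIV. (z $ i - cvec p $ i) ^ \<alpha> i)) F sequentially"
  proof (rule uniform_limitI)
    fix \<epsilon> :: real assume "\<epsilon> > 0"
    then have "\<forall>\<^sub>F k in sequentially. inverse (real (Suc k)) < \<epsilon>"
      using order_tendstoD(2)[OF LIMSEQ_inverse_real_of_nat] by blast
    then show "\<forall>\<^sub>F k in sequentially. \<forall>z\<in>ball (cvec p) t.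
        dist (\<Sum>\<alpha>\<in>A k. c \<alpha> * (\<Prod>i\<in>UNIV. (z $ i - cvec p $ i) ^ \<alpha> i)) (F z) < \<epsilon>"
      by (rule eventually_mono) (blast intro: less_trans[OF A(2)])
  qed
  then have "hol (ball (cvec p) t) F"
    by (rule hol_uniform_limit[rotated 2])
       (auto intro!: hol_sum hol_mult hol_prod hol_power hol_diff)
  moreover have "F (cvec x) = f x" if "x \<in> ball p t" for x
  proof -
    have "t \<le> e" using t(2) e zero_less_card_finite[where 'a='m]
      by (simp add: t_def divide_simps)
    then have "x \<in> ball p e" using that by auto
    then show ?thesis using infsumI[OF sum] by (simp add: F_def)
  qed
  ultimately show thesis using that t(1) by blast
qed

text \<open>Multi-indices supported in S, so that a power series can be built one variable at a time
  by enlarging S.\<close>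

definition multiindices :: "'m set \<Rightarrow> ('m \<Rightarrow> nat) set" where
  "multiindices S = {\<alpha>. \<forall>i. i \<notin> S \<longrightarrow> \<alpha> i = 0}"

lemma bij_betw_multiindices_insert:
  assumes "j \<notin> S"
  shows "bij_betw (\<lambda>(\<beta>, k). \<beta>(j := k)) (multiindices S \<times> UNIV) (multiindices (insert j S))"
  by (rule bij_betw_byWitness[where f'="\<lambda>\<alpha>. (\<alpha>(j := 0), \<alpha> j)"])
     (use assms in \<open>auto simp: multiindices_def fun_eq_iff\<close>)

text \<open>The product of one geometric series per variable; the terms are nonnegative, so iterated
  summation decides summability.\<close>

lemma multi_geometric_summable:
  fixes x :: "'m \<Rightarrow> real"
  assumes "finite S" "\<And>i. i \<in> S \<Longrightarrow> 0 \<le> x i" "\<And>i. i \<in> S \<Longrightarrow> x i < 1"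
  shows "(\<lambda>\<alpha>. \<Prod>i\<in>S. x i ^ \<alpha> i) summable_on multiindices S"
  using assms
proof (induction S rule: finite_induct)
  case empty
  have "multiindices {} = {\<lambda>_::'m. 0::nat}" by (auto simp: multiindices_def)
  then show ?case by simp
next
  case (insert j S)
  have geo: "((\<lambda>k. x j ^ k) has_sum (1 / (1 - x j))) UNIV"
    using sums_nonneg_imp_has_sum[OF geometric_sums] insert.prems by auto
  have "(\<lambda>p. (\<Prod>i\<in>S. x i ^ fst p i) * x j ^ snd p) summable_on multiindices S \<times> UNIV"
  proof (rule summable_on_SigmaI)
    show "((\<lambda>y. (\<Prod>i\<in>S. x i ^ fst (\<beta>, y) i) * x j ^ snd (\<beta>, y)) has_sum
        (\<Prod>i\<in>S. x i ^ \<beta> i) * (1 / (1 - x j))) UNIV" for \<beta>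
      using has_sum_cmult_right[OF geo] by simp
    show "(\<lambda>\<beta>. (\<Prod>i\<in>S. x i ^ \<beta> i) * (1 / (1 - x j))) summable_on multiindices S"
      using insert by (intro summable_on_cmult_left) auto
    show "0 \<le> (\<Prod>i\<in>S. x i ^ fst (\<beta>, k) i) * x j ^ snd (\<beta>, k)" for \<beta> k
      using insert.prems by (auto intro!: mult_nonneg_nonneg prod_nonneg)
  qed
  moreover have "(\<Prod>i\<in>insert j S. x i ^ (case p of (\<beta>, k) \<Rightarrow> \<beta>(j := k)) i) = (\<Prod>i\<in>S. x i ^ fst p i) * x j ^ snd p" for p
  proof -
    have "(\<Prod>i\<in>S. x i ^ ((fst p)(j := snd p)) i) = (\<Prod>i\<in>S. x i ^ fst p i)"
      using insert.hyps by (intro prod.cong) auto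
    then show ?thesis using insert.hyps by (cases p) (simp add: mult.commute)
  qed
  ultimately have "(\<lambda>p. \<Prod>i\<in>insert j S. x i ^ (case p of (\<beta>, k) \<Rightarrow> \<beta>(j := k)) i) summable_on multiindices S \<times> UNIV"
    by simp
  then show ?case
    using summable_on_reindex_bij_betw[OF bij_betw_multiindices_insert[OF insert.hyps(2)]] by blast
qed

lemma higher_deriv_line:
  fixes g :: "complex^'m \<Rightarrow> complex"
  assumes "open U" "hol U g"
  shows "hol U (((\<lambda>h z. dd h z v) ^^ k) g) \<and> (\<forall>z \<zeta>. z + \<zeta> *s v \<in> U \<longrightarrow>
    (deriv ^^ k) (\<lambda>\<zeta>. g (z + \<zeta> *s v)) \<zeta> = ((\<lambda>h z. dd h z v) ^^ k) g (z + \<zeta> *s v))"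
proof (induction k)
  case 0 then show ?case using assms by simp
next
  case (Suc k)
  let ?D = "((\<lambda>h z. dd h z v) ^^ k) g"
  have hol: "hol U ?D" using Suc by blast
  have "deriv ((deriv ^^ k) (\<lambda>\<zeta>. g (z + \<zeta> *s v))) \<zeta> = dd ?D (z + \<zeta> *s v) v" if z: "z + \<zeta> *s v \<in> U" for z \<zeta>
  proof (rule DERIV_imp_deriv, rule has_field_derivative_transform_within_open[OF hol_line_derivative[OF hol z]])
    have "continuous_on UNIV (\<lambda>\<zeta>. z + \<zeta> *s v)"
      by (intro continuous_intros linear_continuous_on bounded_linear_vec_smult)
    then show "open {\<zeta>. z + \<zeta> *s v \<in> U}"
      using open_vimage[OF assms(1)] by (simp add: vimage_def)
  qed (use z Suc in auto)
  then show ?case using hol_dd[OF assms(1) hol, of v] by simp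
qed

text \<open>Variables are expanded one after another. At stage S the coefficients c \<alpha> are
  still holomorphic functions, evaluated with the coordinates in S frozen at p by
  \<open>rep\<close>. The bound B / \<rho>^|\<alpha>| is carried along by Cauchy estimates; it
  dominates the next stage by a product of geometric series and so justifies replacing iterated sums
  by one unordered sum.\<close>

lemma hol_multi_power_series:
  fixes f :: "complex^'m \<Rightarrow> complex"
  assumes "open \<Omega>" "hol \<Omega> f" "p \<in> \<Omega>"
  obtains c \<rho> where "\<rho> > 0"
    "\<And>z. (\<And>i. cmod (z $ i - p $ i) < \<rho>) \<Longrightarrow>
       ((\<lambda>\<alpha>. c \<alpha> * (\<Prod>i\<in>UNIV. (z $ i - p $ i) ^ \<alpha> i)) has_sum f z) UNIV"
proof -
  obtain e where e: "e > 0" "cball p e \<subseteq> \<Omega>" using assms open_contains_cball by blast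
  have "bounded (f ` cball p e)"
    using compact_imp_bounded[OF compact_continuous_image[OF
        continuous_on_subset[OF hol_continuous_on[OF assms(2)] e(2)]]] by simp
  then obtain B where B: "B > 0" "\<And>z. z \<in> cball p e \<Longrightarrow> cmod (f z) \<le> B"
    unfolding bounded_pos by auto
  \<comment> \<open>The polydisc P of radius R lies in the ball of radius e by the sum norm. Halving
    to \<rho> leaves room for the closed discs of the Cauchy estimates inside P.\<close>
  define R where "R = e / real CARD('m)"
  define \<rho> where "\<rho> = R / 2"
  have R: "R > 0" using e by (simp add: R_def)
  have \<rho>: "\<rho> > 0" "\<rho> < R" using R by (auto simp: \<rho>_def)
  define P where "P = {z. \<forall>i. cmod (z $ i - p $ i) < R}"
  have P_sub: "P \<subseteq> cball p e"
  proof
    fix z assume z: "z \<in> P"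
    have "norm (z - p) \<le> (\<Sum>i\<in>UNIV. cmod ((z - p) $ i))"
      unfolding norm_vec_def by (rule L2_set_le_sum) simp
    also have "\<dots> \<le> (\<Sum>i\<in>(UNIV::'m set). R)" using z by (intro sum_mono) (simp add: P_def less_imp_le)
    also have "\<dots> = e" by (simp add: R_def)
    finally show "z \<in> cball p e" by (simp add: dist_norm norm_minus_commute)
  qed
  have "open {z::complex^'m. cmod (z $ i - p $ i) < R}" for i
    by (intro open_Collect_less continuous_intros)
  then have openP: "open P"
    unfolding P_def by (simp add: Collect_all_eq open_INT)
  define rep where "rep S z = (\<chi> i. if i \<in> S then p $ i else z $ i)" for S and z :: "complex^'m"
  have repP: "rep S z \<in> P" if "z \<in> P" for S z using that R by (auto simp: P_def rep_def)
  have rep_field: "holomorphic_field P (rep S)" for S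
    unfolding holomorphic_field_iff
  proof
    fix i show "hol P (\<lambda>z. rep S z $ i)" by (cases "i \<in> S") (auto simp: rep_def)
  qed
  have main: "\<exists>c. (\<forall>\<alpha>. hol P (c \<alpha>)) \<and> (\<forall>\<alpha>. \<forall>z\<in>P. cmod (c \<alpha> z) \<le> B / \<rho> ^ (\<Sum>i\<in>S. \<alpha> i)) \<and>
      (\<forall>z. (\<forall>i. cmod (z $ i - p $ i) < \<rho>) \<longrightarrow>
        ((\<lambda>\<alpha>. c \<alpha> (rep S z) * (\<Prod>i\<in>S. (z $ i - p $ i) ^ \<alpha> i)) has_sum f z) (multiindices S))"
    if "finite S" for S
    using that
  proof (induction S rule: finite_induct)
    case empty
    have m: "multiindices {} = {\<lambda>_::'m. 0::nat}" by (auto simp: multiindices_def)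
    have "rep {} z = z" for z by (simp add: rep_def vec_eq_iff)
    moreover have "hol P f" using hol_subset[OF assms(2)] P_sub e by blast
    ultimately show ?case
      using B P_sub by (intro exI[of _ "\<lambda>\<alpha>. f"]) (auto simp: m has_sum_finite_iff)
  next
    case (insert j S)
    obtain c where holc: "\<And>\<alpha>. hol P (c \<alpha>)"
      and bound: "\<And>\<alpha> z. z \<in> P \<Longrightarrow> cmod (c \<alpha> z) \<le> B / \<rho> ^ (\<Sum>i\<in>S. \<alpha> i)"
      and sum: "\<And>z. (\<And>i. cmod (z $ i - p $ i) < \<rho>) \<Longrightarrow>
        ((\<lambda>\<alpha>. c \<alpha> (rep S z) * (\<Prod>i\<in>S. (z $ i - p $ i) ^ \<alpha> i)) has_sum f z) (multiindices S)"
      using insert.IH by blast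
    let ?v = "axis j (1::complex)"
    define D where "D k g = ((\<lambda>h z. dd h z ?v) ^^ k) g" for k and g :: "complex^'m \<Rightarrow> complex"
    \<comment> \<open>The Taylor coefficient of order \<alpha> j in the variable j, taken at the
      j-th coordinate of p, of the coefficient function whose index is \<alpha> without its j-th
      entry.\<close>
    define c' where "c' \<alpha> z = D (\<alpha> j) (c (\<alpha>(j := 0))) (rep {j} z) / fact (\<alpha> j)" for \<alpha> z
    have holD: "hol P (D k (c \<alpha>))" for k \<alpha>
      using higher_deriv_line[OF openP holc] by (simp add: D_def)
    have holc': "hol P (c' \<alpha>)" for \<alpha>
      unfolding c'_def using repP by (intro hol_divide hol_const hol_compose[OF holD rep_field]) auto
    have line: "w + \<zeta> *s ?v \<in> P" if "w \<in> P" "w $ j = p $ j" "\<zeta> \<in> ball 0 R" for w \<zeta>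
      using that by (auto simp: P_def axis_def)
    have deriv_D: "(deriv ^^ k) (\<lambda>\<zeta>. c \<alpha> (w + \<zeta> *s ?v)) 0 = D k (c \<alpha>) w" if "w \<in> P" for k \<alpha> w
    proof -
      have "w + 0 *s ?v \<in> P" using that by simp
      then show ?thesis
        using higher_deriv_line[OF openP holc, where v="?v" and k=k] unfolding D_def by fastforce
    qed
    have line_hol: "(\<lambda>\<zeta>. c \<alpha> (w + \<zeta> *s ?v)) holomorphic_on ball 0 R" if "w \<in> P" "w $ j = p $ j" for \<alpha> w
      by (rule hol_line[OF holc line[OF that]])
    have D_bound: "cmod (D k (c \<alpha>) w / fact k) \<le> B / \<rho> ^ (\<Sum>i\<in>S. \<alpha> i) / \<rho> ^ k"
      if w: "w \<in> P" "w $ j = p $ j" for k \<alpha> w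
    proof -
      have "cmod ((deriv ^^ k) (\<lambda>\<zeta>. c \<alpha> (w + \<zeta> *s ?v)) 0) \<le> fact k * (B / \<rho> ^ (\<Sum>i\<in>S. \<alpha> i)) / \<rho> ^ k"
      proof (rule Cauchy_inequality)
        show "(\<lambda>\<zeta>. c \<alpha> (w + \<zeta> *s ?v)) holomorphic_on ball 0 \<rho>"
          by (rule holomorphic_on_subset[OF line_hol[OF w]]) (use \<rho> in auto)
        show "continuous_on (cball 0 \<rho>) (\<lambda>\<zeta>. c \<alpha> (w + \<zeta> *s ?v))"
          by (rule continuous_on_subset[OF holomorphic_on_imp_continuous_on[OF line_hol[OF w]]]) (use \<rho> in auto)
        show "cmod (c \<alpha> (w + x *s ?v)) \<le> B / \<rho> ^ (\<Sum>i\<in>S. \<alpha> i)" if "cmod (0 - x) = \<rho>" for x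
          by (rule bound[OF line[OF w]]) (use that \<rho> in auto)
      qed (use \<rho> in auto)
      then have "cmod (D k (c \<alpha>) w) \<le> B / \<rho> ^ (\<Sum>i\<in>S. \<alpha> i) / \<rho> ^ k * fact k"
        unfolding deriv_D[OF w(1)] by (simp add: mult.commute)
      then show ?thesis by (simp only: norm_divide norm_fact pos_divide_le_eq[OF fact_gt_zero])
    qed
    have bound': "cmod (c' \<alpha> z) \<le> B / \<rho> ^ (\<Sum>i\<in>insert j S. \<alpha> i)" if "z \<in> P" for \<alpha> z
    proof -
      have "(\<Sum>i\<in>S. (\<alpha>(j := 0)) i) = (\<Sum>i\<in>S. \<alpha> i)" using insert.hyps by (intro sum.cong) auto
      then have "cmod (c' \<alpha> z) \<le> B / \<rho> ^ (\<Sum>i\<in>S. \<alpha> i) / \<rho> ^ \<alpha> j"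
        using D_bound[OF repP[OF that, of "{j}"], of "\<alpha> j" "\<alpha>(j := 0)"] by (simp add: c'_def rep_def)
      then show ?thesis using insert.hyps by (simp add: power_add mult.commute)
    qed
    have sum': "((\<lambda>\<alpha>. c' \<alpha> (rep (insert j S) z) * (\<Prod>i\<in>insert j S. (z $ i - p $ i) ^ \<alpha> i)) has_sum f z)
        (multiindices (insert j S))" if z: "\<And>i. cmod (z $ i - p $ i) < \<rho>" for z
    proof -
      define y where "y = rep S z"
      define w where "w = rep (insert j S) z"
      have zP: "z \<in> P" using z \<rho> by (auto simp: P_def intro: less_trans)
      have wP: "w \<in> P" using repP[OF zP] by (auto simp: y_def w_def)
      have wj: "w $ j = p $ j" by (simp add: w_def rep_def)
      have yw: "y = w + (z $ j - p $ j) *s ?v"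
        using insert.hyps by (auto simp: y_def w_def rep_def vec_eq_iff axis_def)
      have rw: "rep {j} w = w" by (auto simp: w_def rep_def vec_eq_iff)
      define x where "x i = cmod (z $ i - p $ i) / \<rho>" for i
      have x: "0 \<le> x i" "x i < 1" for i using z[of i] \<rho> by (auto simp: x_def divide_simps)
      define T where "T \<alpha> = c' \<alpha> w * (\<Prod>i\<in>insert j S. (z $ i - p $ i) ^ \<alpha> i)" for \<alpha>
      \<comment> \<open>The powers of \<rho> in the coefficient bound are distributed over the
        variables, which leaves ratios x i < 1.\<close>
      have T_bound: "cmod (T \<alpha>) \<le> B * (\<Prod>i\<in>insert j S. x i ^ \<alpha> i)" for \<alpha>
      proof -
        have "cmod (T \<alpha>) = cmod (c' \<alpha> w) * (\<Prod>i\<in>insert j S. cmod (z $ i - p $ i) ^ \<alpha> i)"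
          by (simp add: T_def norm_mult prod_norm[symmetric] norm_power del: prod.insert)
        also have "\<dots> \<le> B / \<rho> ^ (\<Sum>i\<in>insert j S. \<alpha> i) * (\<Prod>i\<in>insert j S. cmod (z $ i - p $ i) ^ \<alpha> i)"
          by (intro mult_right_mono bound'[OF wP] prod_nonneg) auto
        also have "\<dots> = B * (\<Prod>i\<in>insert j S. x i ^ \<alpha> i)"
          by (simp add: x_def power_divide prod_dividef power_sum del: prod.insert sum.insert)
        finally show ?thesis .
      qed
      have "T summable_on multiindices (insert j S)"
        by (rule summable_on_comparison_norm[OF summable_on_cmult_right[OF multi_geometric_summable] T_bound])
           (use insert.hyps x in auto)
      then have "(\<lambda>q. T (case q of (\<beta>, k) \<Rightarrow> \<beta>(j := k))) summable_on multiindices S \<times> UNIV"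
        by (simp add: summable_on_reindex_bij_betw[OF bij_betw_multiindices_insert[OF insert.hyps(2)]])
      moreover have "((\<lambda>k. T (case (\<beta>, k) of (\<beta>, k) \<Rightarrow> \<beta>(j := k))) has_sum
          c \<beta> y * (\<Prod>i\<in>S. (z $ i - p $ i) ^ \<beta> i)) UNIV" if \<beta>: "\<beta> \<in> multiindices S" for \<beta>
      proof -
        have \<beta>j: "\<beta>(j := 0) = \<beta>" using \<beta> insert.hyps by (auto simp: multiindices_def fun_eq_iff)
        have Tk: "T (\<beta>(j := k)) = (deriv ^^ k) (\<lambda>\<zeta>. c \<beta> (w + \<zeta> *s ?v)) 0 / fact k * (z $ j - p $ j - 0) ^ k *
           (\<Prod>i\<in>S. (z $ i - p $ i) ^ \<beta> i)" for k
        proof -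
          have "(\<Prod>i\<in>S. (z $ i - p $ i) ^ (\<beta>(j := k)) i) = (\<Prod>i\<in>S. (z $ i - p $ i) ^ \<beta> i)"
            using insert.hyps by (intro prod.cong) auto
          then show ?thesis
            using insert.hyps by (simp add: T_def c'_def deriv_D[OF wP] rw \<beta>j mult_ac)
        qed
        have "(\<lambda>k. (deriv ^^ k) (\<lambda>\<zeta>. c \<beta> (w + \<zeta> *s ?v)) 0 / fact k * (z $ j - p $ j - 0) ^ k) sums c \<beta> (w + (z $ j - p $ j) *s ?v)"
          by (rule holomorphic_power_series[OF line_hol[OF wP wj]]) (use z[of j] \<rho> in auto)
        moreover have "summable (\<lambda>k. cmod ((deriv ^^ k) (\<lambda>\<zeta>. c \<beta> (w + \<zeta> *s ?v)) 0 / fact k * (z $ j - p $ j - 0) ^ k))"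
        proof (rule summable_comparison_test')
          show "summable (\<lambda>k. B / \<rho> ^ (\<Sum>i\<in>S. \<beta> i) * x j ^ k)"
            using x[of j] by (intro summable_mult summable_geometric) auto
          show "norm (cmod ((deriv ^^ k) (\<lambda>\<zeta>. c \<beta> (w + \<zeta> *s ?v)) 0 / fact k * (z $ j - p $ j - 0) ^ k))
             \<le> B / \<rho> ^ (\<Sum>i\<in>S. \<beta> i) * x j ^ k" for k
          proof -
            have "cmod (D k (c \<beta>) w / fact k) * cmod (z $ j - p $ j) ^ k
               \<le> B / \<rho> ^ (\<Sum>i\<in>S. \<beta> i) / \<rho> ^ k * cmod (z $ j - p $ j) ^ k"
              by (intro mult_right_mono D_bound[OF wP wj]) auto
            then show ?thesis
              by (simp add: deriv_D[OF wP] norm_mult norm_power norm_divide x_def power_divide)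
          qed
        qed
        ultimately have "((\<lambda>k. (deriv ^^ k) (\<lambda>\<zeta>. c \<beta> (w + \<zeta> *s ?v)) 0 / fact k * (z $ j - p $ j - 0) ^ k) has_sum c \<beta> y) UNIV"
          unfolding yw by (intro norm_summable_imp_has_sum)
        from has_sum_cmult_left[OF this, of "\<Prod>i\<in>S. (z $ i - p $ i) ^ \<beta> i"]
        show ?thesis by (simp only: prod.case Tk)
      qed
      moreover have "((\<lambda>\<beta>. c \<beta> y * (\<Prod>i\<in>S. (z $ i - p $ i) ^ \<beta> i)) has_sum f z) (multiindices S)"
        unfolding y_def by (rule sum[OF z])
      ultimately have "((\<lambda>q. T (case q of (\<beta>, k) \<Rightarrow> \<beta>(j := k))) has_sum f z) (multiindices S \<times> UNIV)"
        by (intro has_sum_SigmaI)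
      then show ?thesis
        unfolding has_sum_reindex_bij_betw[OF bij_betw_multiindices_insert[OF insert.hyps(2)], of T "f z"]
        unfolding T_def[abs_def] w_def .
    qed
    show ?case
      by (rule exI[of _ c']) (use holc' bound' sum' in auto)
  qed
  obtain c where c: "\<And>z. (\<And>i. cmod (z $ i - p $ i) < \<rho>) \<Longrightarrow>
        ((\<lambda>\<alpha>. c \<alpha> (rep UNIV z) * (\<Prod>i\<in>UNIV. (z $ i - p $ i) ^ \<alpha> i)) has_sum f z) (multiindices UNIV)"
    using main[OF finite[of UNIV]] by blast
  have "rep UNIV z = p" for z by (simp add: rep_def vec_eq_iff)
  moreover have "multiindices (UNIV::'m set) = UNIV" by (auto simp: multiindices_def)
  ultimately show thesis using that[of \<rho> "\<lambda>\<alpha>. c \<alpha> p"] c \<rho> by simp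
qed

text \<open>The converse of \<open>real_analytic_extension\<close>. It is what makes restrictions of
  holomorphic frames admissible as analytic sections over M.\<close>

lemma hol_real_analytic:
  fixes F :: "complex^'m \<Rightarrow> complex"
  assumes "open \<Omega>" "hol \<Omega> F" "\<And>x. x \<in> U \<Longrightarrow> cvec x \<in> \<Omega>"
  shows "real_analytic_on U (\<lambda>x. F (cvec x))"
  unfolding real_analytic_on_def
proof
  fix p assume "p \<in> U"
  then obtain c \<rho> where \<rho>: "\<rho> > 0" and c: "\<And>z. (\<And>i. cmod (z $ i - cvec p $ i) < \<rho>) \<Longrightarrow>
       ((\<lambda>\<alpha>. c \<alpha> * (\<Prod>i\<in>UNIV. (z $ i - cvec p $ i) ^ \<alpha> i)) has_sum F z) UNIV"
    by (rule hol_multi_power_series[OF assms(1,2,3)]) blast+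
  have "((\<lambda>\<alpha>. c \<alpha> * (\<Prod>i\<in>UNIV. complex_of_real (x $ i - p $ i) ^ \<alpha> i)) has_sum F (cvec x)) UNIV"
    if "x \<in> ball p \<rho>" for x
  proof -
    have "cmod (cvec x $ i - cvec p $ i) < \<rho>" for i
      using Finite_Cartesian_Product.norm_nth_le[of "cvec (x - p)" i] that
      by (simp only: norm_cvec) (simp add: dist_norm norm_minus_commute)
    from c[OF this] show ?thesis by simp
  qed
  then show "\<exists>c. \<exists>e>0. \<forall>x\<in>ball p e.
      ((\<lambda>\<alpha>. c \<alpha> * (\<Prod>i\<in>UNIV. complex_of_real (x $ i - p $ i) ^ \<alpha> i)) has_sum F (cvec x)) UNIV"
    using \<rho> by blast
qed

section \<open>Flows of time-dependent holomorphic vector fields\<close>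

text \<open>Joint continuity, as needed to differentiate under an integral. The change in s is
  controlled by the Cauchy inequality for the difference of the functions at s and s0; the change in
  \<zeta> is continuity of the derivative at fixed s0.\<close>

lemma continuous_deriv_param:
  fixes g :: "complex \<Rightarrow> real \<Rightarrow> complex"
  assumes cont: "continuous_on (ball 0 r \<times> {a..b}) (\<lambda>(\<zeta>, s). g \<zeta> s)"
    and hol: "\<And>s. s \<in> {a..b} \<Longrightarrow> (\<lambda>\<zeta>. g \<zeta> s) holomorphic_on ball 0 r"
  shows "continuous_on (ball 0 r \<times> {a..b}) (\<lambda>(\<zeta>, s). deriv (\<lambda>\<zeta>. g \<zeta> s) \<zeta>)"
  unfolding continuous_on_iff
proof (intro ballI allI impI)
  fix q0 :: "complex \<times> real" and \<epsilon> :: real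
  assume q0: "q0 \<in> ball 0 r \<times> {a..b}" and \<epsilon>: "\<epsilon> > 0"
  obtain \<zeta>0 s0 where q0_eq: "q0 = (\<zeta>0, s0)" by (cases q0)
  then have \<zeta>0: "\<zeta>0 \<in> ball 0 r" and s0: "s0 \<in> {a..b}" using q0 by auto
  obtain d0 where d0: "d0 > 0" "cball \<zeta>0 d0 \<subseteq> ball 0 r"
    using \<zeta>0 open_contains_cball by blast
  define d where "d = d0 / 2"
  have d: "d > 0" using d0 by (simp add: d_def)
  have sub: "cball \<zeta> d \<subseteq> cball \<zeta>0 d0" if "dist \<zeta> \<zeta>0 < d" for \<zeta>
  proof
    fix w assume "w \<in> cball \<zeta> d"
    then show "w \<in> cball \<zeta>0 d0"
      using that dist_triangle[of \<zeta>0 w \<zeta>] by (simp add: d_def dist_commute)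
  qed
  have "uniformly_continuous_on (cball \<zeta>0 d0 \<times> {a..b}) (\<lambda>(\<zeta>, s). g \<zeta> s)"
    by (rule compact_uniformly_continuous[OF continuous_on_subset[OF cont]])
       (use d0 in \<open>auto intro!: compact_Times\<close>)
  then obtain \<delta>1 where \<delta>1: "\<delta>1 > 0"
    "\<And>q q'. q \<in> cball \<zeta>0 d0 \<times> {a..b} \<Longrightarrow> q' \<in> cball \<zeta>0 d0 \<times> {a..b} \<Longrightarrow> dist q' q < \<delta>1 \<Longrightarrow>
       dist (case q' of (\<zeta>, s) \<Rightarrow> g \<zeta> s) (case q of (\<zeta>, s) \<Rightarrow> g \<zeta> s) < \<epsilon> * d / 4"
    using uniformly_continuous_onE[of _ _ "\<epsilon> * d / 4"] \<epsilon> d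
    by (metis (no_types, lifting) divide_pos_pos mult_pos_pos zero_less_numeral)
  have "isCont (deriv (\<lambda>\<zeta>. g \<zeta> s0)) \<zeta>0"
    using holomorphic_on_imp_continuous_on[OF holomorphic_deriv[OF hol[OF s0] open_ball]] \<zeta>0
      continuous_on_eq_continuous_at[OF open_ball] by blast
  then obtain \<delta>2 where \<delta>2: "\<delta>2 > 0"
    "\<And>\<zeta>. dist \<zeta> \<zeta>0 < \<delta>2 \<Longrightarrow> dist (deriv (\<lambda>\<zeta>. g \<zeta> s0) \<zeta>) (deriv (\<lambda>\<zeta>. g \<zeta> s0) \<zeta>0) < \<epsilon>/2"
    unfolding continuous_at_eps_delta using \<epsilon> by (meson half_gt_zero)
  show "\<exists>\<delta>>0. \<forall>q\<in>ball 0 r \<times> {a..b}. dist q q0 < \<delta> \<longrightarrow>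
      dist (case q of (\<zeta>, s) \<Rightarrow> deriv (\<lambda>\<zeta>. g \<zeta> s) \<zeta>) (case q0 of (\<zeta>, s) \<Rightarrow> deriv (\<lambda>\<zeta>. g \<zeta> s) \<zeta>) < \<epsilon>"
  proof (intro exI[of _ "min d (min \<delta>1 \<delta>2)"] conjI ballI impI)
    show "0 < min d (min \<delta>1 \<delta>2)" using d \<delta>1 \<delta>2 by simp
    fix q assume q: "q \<in> ball 0 r \<times> {a..b}" and dist_q: "dist q q0 < min d (min \<delta>1 \<delta>2)"
    obtain \<zeta> s where q_eq: "q = (\<zeta>, s)" by (cases q)
    have \<zeta>: "\<zeta> \<in> ball 0 r" and s: "s \<in> {a..b}" using q q_eq by auto
    have dist: "dist (\<zeta>, s) (\<zeta>0, s0) < min d (min \<delta>1 \<delta>2)" using dist_q by (simp add: q_eq q0_eq)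
    have dz: "dist \<zeta> \<zeta>0 < min d (min \<delta>1 \<delta>2)" and ds: "dist s s0 < min d (min \<delta>1 \<delta>2)"
      using dist dist_fst_le[of "(\<zeta>, s)" "(\<zeta>0, s0)"] dist_snd_le[of "(\<zeta>, s)" "(\<zeta>0, s0)"] by auto
    have subz: "cball \<zeta> d \<subseteq> ball 0 r" using sub dz d0 by auto
    have diff: "(\<lambda>\<zeta>. g \<zeta> s - g \<zeta> s0) holomorphic_on ball 0 r"
      by (intro holomorphic_on_diff hol s s0)
    have "cmod ((deriv ^^ 1) (\<lambda>\<zeta>. g \<zeta> s - g \<zeta> s0) \<zeta>) \<le> fact 1 * (\<epsilon> * d / 4) / d ^ 1"
    proof (rule Cauchy_inequality)
      show "(\<lambda>\<zeta>. g \<zeta> s - g \<zeta> s0) holomorphic_on ball \<zeta> d"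
        by (rule holomorphic_on_subset[OF diff]) (use subz ball_subset_cball in blast)
      show "continuous_on (cball \<zeta> d) (\<lambda>\<zeta>. g \<zeta> s - g \<zeta> s0)"
        by (rule continuous_on_subset[OF holomorphic_on_imp_continuous_on[OF diff] subz])
      fix w assume "cmod (\<zeta> - w) = d"
      then have "w \<in> cball \<zeta>0 d0" using sub[of \<zeta>] dz by (auto simp: dist_norm subset_iff)
      then show "cmod (g w s - g w s0) \<le> \<epsilon> * d / 4"
        using \<delta>1(2)[of "(w, s0)" "(w, s)"] s s0 ds by (simp add: dist_Pair_Pair dist_norm)
    qed (rule d)
    moreover have "deriv (\<lambda>\<zeta>. g \<zeta> s - g \<zeta> s0) \<zeta> = deriv (\<lambda>\<zeta>. g \<zeta> s) \<zeta> - deriv (\<lambda>\<zeta>. g \<zeta> s0) \<zeta>"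
      using hol[OF s] hol[OF s0] \<zeta> by (intro deriv_diff) (auto intro: holomorphic_on_imp_differentiable_at)
    ultimately have "cmod (deriv (\<lambda>\<zeta>. g \<zeta> s) \<zeta> - deriv (\<lambda>\<zeta>. g \<zeta> s0) \<zeta>) \<le> \<epsilon> / 4"
      using d by simp
    then show "dist (case q of (\<zeta>, s) \<Rightarrow> deriv (\<lambda>\<zeta>. g \<zeta> s) \<zeta>) (case q0 of (\<zeta>, s) \<Rightarrow> deriv (\<lambda>\<zeta>. g \<zeta> s) \<zeta>) < \<epsilon>"
      using \<delta>2(2)[of \<zeta>] dz \<epsilon> dist_triangle[of "deriv (\<lambda>\<zeta>. g \<zeta> s) \<zeta>" "deriv (\<lambda>\<zeta>. g \<zeta> s0) \<zeta>0" "deriv (\<lambda>\<zeta>. g \<zeta> s0) \<zeta>"]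
      by (simp add: dist_norm q_eq q0_eq)
  qed
qed

text \<open>On each complex line this is the one-variable Leibniz rule; \<open>Osgood_lines\<close>
  combines the lines.\<close>

lemma hol_integral:
  fixes f :: "real \<Rightarrow> complex^'m \<Rightarrow> complex"
  assumes U: "open U" and cont: "continuous_on (U \<times> {a..b}) (\<lambda>(z, s). f s z)"
    and hol: "\<And>s. s \<in> {a..b} \<Longrightarrow> hol U (f s)"
  shows "hol U (\<lambda>z. integral {a..b} (\<lambda>s. f s z))"
proof (rule Osgood_lines[OF U])
  show "continuous_on U (\<lambda>z. integral {a..b} (\<lambda>s. f s z))"
    using integral_continuous_on_param[of U a b "\<lambda>z s. f s z"] cont by simp
  fix z v :: "complex^'m" and r :: real
  assume r: "r > 0" and sub: "\<And>\<zeta>. \<zeta> \<in> ball 0 r \<Longrightarrow> z + \<zeta> *s v \<in> U"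
  let ?g = "\<lambda>\<zeta> s. f s (z + \<zeta> *s v)"
  have gcont: "continuous_on (ball 0 r \<times> {a..b}) (\<lambda>(\<zeta>, s). ?g \<zeta> s)"
  proof -
    have "continuous_on (ball 0 r \<times> {a..b}) (\<lambda>q. (z + fst q *s v, snd q))"
      by (intro continuous_intros bounded_linear.continuous_on[OF bounded_linear_vec_smult])
    then have "continuous_on (ball 0 r \<times> {a..b}) (\<lambda>q. (\<lambda>(z, s). f s z) (z + fst q *s v, snd q))"
      by (rule continuous_on_compose2[OF cont]) (use sub in auto)
    then show ?thesis by (simp add: case_prod_beta)
  qed
  have ghol: "(\<lambda>\<zeta>. ?g \<zeta> s) holomorphic_on ball 0 r" if "s \<in> {a..b}" for s
    by (rule hol_line[OF hol[OF that] sub])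
  have "(\<lambda>\<zeta>. integral (cbox a b) (?g \<zeta>)) holomorphic_on ball 0 r"
  proof (rule leibniz_rule_holomorphic[where fx="\<lambda>\<zeta> s. deriv (\<lambda>\<zeta>. ?g \<zeta> s) \<zeta>"])
    show "((\<lambda>\<zeta>. ?g \<zeta> s) has_field_derivative deriv (\<lambda>\<zeta>. ?g \<zeta> s) \<zeta>) (at \<zeta> within ball 0 r)"
      if "\<zeta> \<in> ball 0 r" "s \<in> cbox a b" for \<zeta> s
      using holomorphic_derivI[OF ghol open_ball that(1)] that(2) has_field_derivative_at_within by auto
    show "?g \<zeta> integrable_on cbox a b" if "\<zeta> \<in> ball 0 r" for \<zeta>
    proof (rule integrable_continuous)
      show "continuous_on (cbox a b) (?g \<zeta>)"
      proof -
        have "continuous_on (cbox a b) (\<lambda>s. (\<lambda>(\<zeta>, s). ?g \<zeta> s) (\<zeta>, s))"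
          by (rule continuous_on_compose2[OF gcont]) (use that in \<open>auto intro!: continuous_intros\<close>)
        then show ?thesis by simp
      qed
    qed
    show "continuous_on (ball 0 r \<times> cbox a b) (\<lambda>(\<zeta>, s). deriv (\<lambda>\<zeta>. ?g \<zeta> s) \<zeta>)"
      using continuous_deriv_param[OF gcont ghol] by simp
  qed simp
  then show "(\<lambda>\<zeta>. integral {a..b} (\<lambda>s. f s (z + \<zeta> *s v))) holomorphic_on ball 0 r" by simp
qed

text \<open>The substitution s = t \<sigma> makes the interval of integration fixed and moves t into
  the integrand.\<close>

lemma continuous_on_integral_upper:
  fixes F :: "'a::topological_space \<Rightarrow> real \<Rightarrow> 'b::euclidean_space"
  assumes "continuous_on (Z \<times> {0..1}) (\<lambda>(z, s). F z s)"
  shows "continuous_on (Z \<times> {0..1}) (\<lambda>(z, t). integral {0..t} (F z))"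
proof -
  have "continuous_on ((Z \<times> {0..1}) \<times> {0..1}) (\<lambda>q. (\<lambda>(z, s). F z s) (fst (fst q), snd (fst q) * snd q))"
    by (rule continuous_on_compose2[OF assms]) (auto intro!: continuous_intros mult_le_one)
  then have "continuous_on ((Z \<times> {0..1}) \<times> cbox 0 1) (\<lambda>(q, \<sigma>). F (fst q) (snd q * \<sigma>))"
    by (simp add: case_prod_beta)
  then have "continuous_on (Z \<times> {0..1}) (\<lambda>q. snd q *\<^sub>R integral (cbox 0 1) (\<lambda>\<sigma>. F (fst q) (snd q * \<sigma>)))"
    by (intro continuous_intros integral_continuous_on_param) auto
  moreover have "snd q *\<^sub>R integral (cbox 0 1) (\<lambda>\<sigma>. F (fst q) (snd q * \<sigma>)) = (\<lambda>(z, t). integral {0..t} (F z)) q"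
    if q: "q \<in> Z \<times> {0..1}" for q
  proof -
    obtain z t where zt: "q = (z, t)" "z \<in> Z" "0 \<le> t" "t \<le> 1" using q by auto
    show ?thesis
    proof (cases "t = 0")
      case True then show ?thesis using zt by simp
    next
      case False
      then have t: "t > 0" using zt by simp
      have "continuous_on {0..t} (\<lambda>s. (\<lambda>(z, s). F z s) (z, s))"
        by (rule continuous_on_compose2[OF assms]) (use zt in \<open>auto intro!: continuous_intros\<close>)
      then have "(F z has_integral integral {0..t} (F z)) {0..t}"
        using integrable_continuous_interval integrable_integral by fastforce
      from has_integral_stretch_real[OF this, of t]
      have "((\<lambda>x. F z (t * x)) has_integral (1 / t) *\<^sub>R integral {0..t} (F z)) ((\<lambda>x. x / t) ` {0..t})"
        using t by simp
      moreover have "(\<lambda>x. x / t) ` {0..t} = {0..1}"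
        using t by simp
      ultimately have "((\<lambda>x. F z (t * x)) has_integral (1 / t) *\<^sub>R integral {0..t} (F z)) {0..1}" by simp
      then have "integral {0..1} (\<lambda>x. F z (t * x)) = (1 / t) *\<^sub>R integral {0..t} (F z)"
        by (rule integral_unique)
      then show ?thesis using t zt by simp
    qed
  qed
  ultimately show ?thesis by (simp cong: continuous_on_cong)
qed

lemma integral_vec_nth:
  fixes F :: "real \<Rightarrow> complex^'m"
  assumes "continuous_on {a..b} F"
  shows "integral {a..b} F $ i = integral {a..b} (\<lambda>s. F s $ i)"
  using integral_linear[OF integrable_continuous_interval[OF assms] bounded_linear_vec_nth[of i]]
  by (simp add: o_def)

lemma holomorphic_field_Lipschitz:
  assumes "open U" "holomorphic_field U X" "cball p R \<subseteq> U"
  obtains B where "B > 0" "\<And>w. w \<in> cball p R \<Longrightarrow> norm (X w) \<le> B"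
    "\<And>w w'. w \<in> cball p R \<Longrightarrow> w' \<in> cball p R \<Longrightarrow> norm (X w - X w') \<le> B * norm (w - w')"
proof -
  have bounded: "\<exists>C>0. \<forall>w\<in>cball p R. norm (Y w) \<le> C" if "holomorphic_field U Y" for Y :: "complex^'a \<Rightarrow> complex^'a"
    using compact_imp_bounded[OF compact_continuous_image[OF
        continuous_on_subset[OF holomorphic_field_continuous_on[OF that] assms(3)]]]
    unfolding bounded_pos by auto
  obtain C where C: "C > 0" "\<And>w. w \<in> cball p R \<Longrightarrow> norm (X w) \<le> C" using bounded[OF assms(2)] by blast
  have "\<exists>K. \<forall>j. K j > 0 \<and> (\<forall>w\<in>cball p R. norm (dd X w (axis j 1)) \<le> K j)"
    using bounded[OF holomorphic_field_dd[OF assms(1) holomorphic_field_const assms(2)]]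
    by (intro choice allI) blast
  then obtain K where K: "\<And>j. K j > 0" "\<And>j w. w \<in> cball p R \<Longrightarrow> norm (dd X w (axis j 1)) \<le> K j" by blast
  define L where "L = (\<Sum>j\<in>UNIV. K j)"
  have Ddd: "norm (dd X w v) \<le> L * norm v" if w: "w \<in> cball p R" for w v
  proof -
    have wU: "w \<in> U" using w assms by blast
    have "norm (dd X w v) \<le> (\<Sum>j\<in>UNIV. norm ((v $ j) *s dd X w (axis j 1)))"
      unfolding dd_expand[OF assms(2) wU, of v] by (rule norm_sum)
    also have "\<dots> \<le> (\<Sum>j\<in>UNIV. norm v * K j)"
      by (intro sum_mono) (auto simp: norm_vec_smult K(2)[OF w] intro!: mult_mono Finite_Cartesian_Product.norm_nth_le)
    finally show ?thesis by (simp add: L_def sum_distrib_left mult.commute)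
  qed
  have lip: "norm (X w - X w') \<le> L * norm (w - w')" if "w \<in> cball p R" "w' \<in> cball p R" for w w'
  proof (rule differentiable_bound[OF convex_cball _ _ that])
    show "(X has_derivative dd X x) (at x within cball p R)" if "x \<in> cball p R" for x
      using holomorphic_field_derivative[OF assms(2)] that assms(3) has_derivative_at_withinI by blast
    show "onorm (dd X x) \<le> L" if "x \<in> cball p R" for x
      by (rule onorm_le) (rule Ddd[OF that])
  qed
  show thesis
  proof (rule that[of "max C L"])
    show "max C L > 0" using C by simp
    show "norm (X w) \<le> max C L" if "w \<in> cball p R" for w using C(2)[OF that] by simp
    show "norm (X w - X w') \<le> max C L * norm (w - w')" if "w \<in> cball p R" "w' \<in> cball p R" for w w'
      using lip[OF that] by (meson max.cobounded2 mult_right_mono norm_ge_zero order_trans)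
  qed
qed

lemma continuous_on_vec_smult:
  "continuous_on S f \<Longrightarrow> continuous_on S g \<Longrightarrow> continuous_on S (\<lambda>x. f x *s (g x :: complex^'m))"
  unfolding vector_scalar_mult_def by (intro continuous_intros)

lemma linear_family_expand:
  fixes a :: "complex^'m \<Rightarrow> complex^'n"
  assumes "\<And>u v. a (u + v) = a u + a v" "\<And>c v. a (c *s v) = c *s a v"
  shows "a v = (\<Sum>j\<in>UNIV. v $ j *s a (axis j 1))"
proof -
  have a0: "a 0 = 0" using assms(2)[of 0 0] by simp
  have "a (\<Sum>j\<in>S. v $ j *s axis j 1) = (\<Sum>j\<in>S. v $ j *s a (axis j 1))" for S
    by (induction S rule: infinite_finite_induct) (auto simp: assms a0)
  then show ?thesis by (metis basis_expansion)
qed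

text \<open>Picard iteration for c' = - A(c)(z - p), with z - p frozen at the starting point. The
  right side is of size |z - p|, so the ball of starting points is shrunk instead of the time
  interval, and every curve lives on [0, 1]. All iterates are holomorphic in z and converge
  uniformly. Uniqueness is included because the later identities of the flow are derived from
  it.\<close>

lemma flow_exists:
  fixes A :: "complex^'m \<Rightarrow> complex^'m \<Rightarrow> complex^'m"
  assumes U: "open U" "R > 0" "cball p R \<subseteq> U"
    and hol: "\<And>v. holomorphic_field U (\<lambda>w. A w v)"
    and lin: "\<And>w u v. w \<in> U \<Longrightarrow> A w (u + v) = A w u + A w v" "\<And>w c v. w \<in> U \<Longrightarrow> A w (c *s v) = c *s A w v"
  shows "\<exists>\<delta> M c. \<delta> > 0 \<and> M > 0 \<and> (\<forall>t\<in>{0..1}. holomorphic_field (ball p \<delta>) (c t)) \<and>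
    (\<forall>z\<in>ball p \<delta>. c 0 z = z \<and>
      (\<forall>t\<in>{0..1::real}. ((\<lambda>t. c t z) has_vector_derivative - A (c t z) (z - p)) (at t within {0..1}) \<and>
        norm (c t z - z) \<le> M * norm (z - p) \<and> c t z \<in> cball p R) \<and>
      (\<forall>b. b 0 = z \<longrightarrow> (\<forall>t\<in>{0..1}. b t \<in> cball p R \<and>
          (b has_vector_derivative - A (b t) (z - p)) (at t within {0..1})) \<longrightarrow>
        (\<forall>t\<in>{0..1}. b t = c t z)))"
proof -
  have expand: "A w v = (\<Sum>j\<in>UNIV. v $ j *s A w (axis j 1))" if "w \<in> U" for w v
    using linear_family_expand[of "A w" v] lin[OF that] by blast
  have "\<exists>B. \<forall>j. B j > 0 \<and> (\<forall>w\<in>cball p R. norm (A w (axis j 1)) \<le> B j) \<and>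
     (\<forall>w\<in>cball p R. \<forall>w'\<in>cball p R. norm (A w (axis j 1) - A w' (axis j 1)) \<le> B j * norm (w - w'))"
  proof (intro choice allI)
    fix j
    obtain B where "B > 0" "\<And>w. w \<in> cball p R \<Longrightarrow> norm (A w (axis j 1)) \<le> B"
      "\<And>w w'. w \<in> cball p R \<Longrightarrow> w' \<in> cball p R \<Longrightarrow> norm (A w (axis j 1) - A w' (axis j 1)) \<le> B * norm (w - w')"
      using holomorphic_field_Lipschitz[OF U(1) hol[of "axis j 1"] U(3)] by blast
    then show "\<exists>B>0. (\<forall>w\<in>cball p R. norm (A w (axis j 1)) \<le> B) \<and>
     (\<forall>w\<in>cball p R. \<forall>w'\<in>cball p R. norm (A w (axis j 1) - A w' (axis j 1)) \<le> B * norm (w - w'))" by blast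
  qed
  then obtain B where B: "\<And>j. B j > 0" "\<And>j w. w \<in> cball p R \<Longrightarrow> norm (A w (axis j 1)) \<le> B j"
    "\<And>j w w'. w \<in> cball p R \<Longrightarrow> w' \<in> cball p R \<Longrightarrow> norm (A w (axis j 1) - A w' (axis j 1)) \<le> B j * norm (w - w')"
    by blast
  define M where "M = (\<Sum>j\<in>(UNIV::'m set). B j)"
  have M: "M > 0" unfolding M_def using B(1) by (intro sum_pos) auto
  have A_bound: "norm (A w v) \<le> M * norm v" if w: "w \<in> cball p R" for w v
  proof -
    have "norm (A w v) \<le> (\<Sum>j\<in>UNIV. norm (v $ j *s A w (axis j 1)))"
      unfolding expand[OF subsetD[OF U(3) w], of v] by (rule norm_sum)
    also have "\<dots> \<le> (\<Sum>j\<in>UNIV. norm v * B j)"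
      by (intro sum_mono) (auto simp: norm_vec_smult B(2)[OF w] intro!: mult_mono Finite_Cartesian_Product.norm_nth_le)
    finally show ?thesis by (simp add: M_def sum_distrib_left mult.commute)
  qed
  have A_lip: "norm (A w v - A w' v) \<le> M * norm (w - w') * norm v"
    if w: "w \<in> cball p R" "w' \<in> cball p R" for w w' v
  proof -
    have "A w v - A w' v = (\<Sum>j\<in>UNIV. v $ j *s (A w (axis j 1) - A w' (axis j 1)))"
      unfolding expand[OF subsetD[OF U(3) w(1)], of v] expand[OF subsetD[OF U(3) w(2)], of v]
      by (simp add: sum_subtractf)
    then have "norm (A w v - A w' v) \<le> (\<Sum>j\<in>UNIV. norm (v $ j *s (A w (axis j 1) - A w' (axis j 1))))"
      by (simp only: norm_sum)
    also have "\<dots> \<le> (\<Sum>j\<in>UNIV. norm v * (B j * norm (w - w')))"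
      unfolding norm_vec_smult
      by (intro sum_mono mult_mono B(3)[OF w] Finite_Cartesian_Product.norm_nth_le) auto
    also have "\<dots> = M * norm (w - w') * norm v"
      by (simp add: M_def sum_distrib_left sum_distrib_right mult_ac)
    finally show ?thesis .
  qed
  \<comment> \<open>The three bounds in turn: z is within R/2 of p, a curve moves by at most R/2 and
    thus stays in the ball where A is controlled, and the integral operator contracts by
    1/2.\<close>
  define \<delta> where "\<delta> = min (R/2) (min (R / (2 * M)) (1 / (2 * M)))"
  have \<delta>: "\<delta> > 0" "\<delta> \<le> R / 2" using U(2) M by (auto simp: \<delta>_def)
  have M\<delta>: "M * \<delta> \<le> R / 2" "M * \<delta> \<le> 1 / 2"
  proof -
    have "\<delta> \<le> R / (2 * M)" "\<delta> \<le> 1 / (2 * M)" by (auto simp: \<delta>_def)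
    then show "M * \<delta> \<le> R / 2" "M * \<delta> \<le> 1 / 2" using M by (auto simp: field_simps)
  qed
  let ?Z = "ball p \<delta>" and ?I = "{0..1::real}"
  have Z\<delta>: "norm (z - p) \<le> \<delta>" if "z \<in> ?Z" for z using that by (simp add: dist_norm norm_minus_commute)
  have MZ: "M * norm (z - p) \<le> R / 2" "M * norm (z - p) \<le> 1 / 2" if "z \<in> ?Z" for z
    using mult_left_mono[OF Z\<delta>[OF that], of M] M M\<delta> by linarith+
  have ZR: "w \<in> cball p R" if "z \<in> ?Z" "norm (w - z) \<le> M * norm (z - p)" for z w
    using that MZ(1)[OF that(1)] \<delta>(2) dist_triangle[of p w z] by (simp add: dist_norm norm_minus_commute)
  define it where "it = rec_nat (\<lambda>(t::real) z. z) (\<lambda>k f t z. z - integral {0..t} (\<lambda>s. A (f s z) (z - p)))"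
  have it0: "it 0 t z = z" and itS: "it (Suc k) t z = z - integral {0..t} (\<lambda>s. A (it k s z) (z - p))" for k t z
    by (simp_all add: it_def)
  have F_cont: "continuous_on (?Z \<times> ?I) (\<lambda>(z, s). A (f s z) (z - p))"
    if f: "continuous_on (?Z \<times> ?I) (\<lambda>(z, s). f s z)" and fR: "\<And>z s. z \<in> ?Z \<Longrightarrow> s \<in> ?I \<Longrightarrow> f s z \<in> cball p R"
    for f :: "real \<Rightarrow> complex^'m \<Rightarrow> complex^'m"
  proof -
    have "continuous_on (?Z \<times> ?I) (\<lambda>q. \<Sum>j\<in>UNIV. (fst q - p) $ j *s A ((\<lambda>(z, s). f s z) q) (axis j 1))"
      using fR U(3)
      by (intro continuous_on_sum continuous_on_vec_smult continuous_intros
          continuous_on_compose2[OF holomorphic_field_continuous_on[OF hol] f]) fastforce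
    then show ?thesis
      by (rule continuous_on_eq) (use fR U(3) in \<open>auto simp: expand[of _ "_ - p"] subset_iff\<close>)
  qed
  have F_cont1: "continuous_on {0..t} (\<lambda>s. A (f s z) (z - p))"
    if "continuous_on (?Z \<times> ?I) (\<lambda>(z, s). f s z)" "\<And>z s. z \<in> ?Z \<Longrightarrow> s \<in> ?I \<Longrightarrow> f s z \<in> cball p R"
      "z \<in> ?Z" "t \<in> ?I" for f :: "real \<Rightarrow> complex^'m \<Rightarrow> complex^'m" and z t
  proof -
    have "continuous_on {0..t} (\<lambda>s. (\<lambda>(z, s). A (f s z) (z - p)) (z, s))"
      by (rule continuous_on_compose2[OF F_cont[OF that(1,2)]]) (use that in \<open>auto intro!: continuous_intros\<close>)
    then show ?thesis by simp
  qed
  have int_bound: "norm (integral {0..t} (\<lambda>s. A (f s z) (z - p))) \<le> M * norm (z - p)"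
    if "continuous_on (?Z \<times> ?I) (\<lambda>(z, s). f s z)" "\<And>z s. z \<in> ?Z \<Longrightarrow> s \<in> ?I \<Longrightarrow> f s z \<in> cball p R"
      "z \<in> ?Z" "t \<in> ?I" for f :: "real \<Rightarrow> complex^'m \<Rightarrow> complex^'m" and z t
  proof -
    have "norm (integral {0..t} (\<lambda>s. A (f s z) (z - p))) \<le> M * norm (z - p) * (t - 0)"
      using that by (intro integral_bound F_cont1 A_bound) auto
    also have "\<dots> \<le> M * norm (z - p)" using that M by (simp add: mult_left_le)
    finally show ?thesis .
  qed
  have int_diff: "norm (integral {0..t} (\<lambda>s. A (f s z) (z - p)) - integral {0..t} (\<lambda>s. A (g s z) (z - p))) \<le> e / 2"
    if f: "continuous_on (?Z \<times> ?I) (\<lambda>(z, s). f s z)" "\<And>z s. z \<in> ?Z \<Longrightarrow> s \<in> ?I \<Longrightarrow> f s z \<in> cball p R"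
      and g: "continuous_on (?Z \<times> ?I) (\<lambda>(z, s). g s z)" "\<And>z s. z \<in> ?Z \<Longrightarrow> s \<in> ?I \<Longrightarrow> g s z \<in> cball p R"
      and z: "z \<in> ?Z" "t \<in> ?I" and e: "\<And>s. s \<in> ?I \<Longrightarrow> norm (f s z - g s z) \<le> e"
    for f g :: "real \<Rightarrow> complex^'m \<Rightarrow> complex^'m" and z t e
  proof -
    have e0: "0 \<le> e" using e[of 0] norm_ge_zero[of "f 0 z - g 0 z"] by (simp del: norm_ge_zero)
    have "integral {0..t} (\<lambda>s. A (f s z) (z - p)) - integral {0..t} (\<lambda>s. A (g s z) (z - p)) =
      integral {0..t} (\<lambda>s. A (f s z) (z - p) - A (g s z) (z - p))"
      by (intro Henstock_Kurzweil_Integration.integral_diff[symmetric] integrable_continuous_interval F_cont1 f g z)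
    also have "norm \<dots> \<le> e / 2 * (t - 0)"
    proof (rule integral_bound)
      show "continuous_on {0..t} (\<lambda>s. A (f s z) (z - p) - A (g s z) (z - p))"
        by (intro continuous_on_diff F_cont1 f g z)
      show "norm (A (f s z) (z - p) - A (g s z) (z - p)) \<le> e / 2" if "s \<in> {0..t}" for s
      proof -
        have s: "s \<in> ?I" using that z by auto
        have "norm (A (f s z) (z - p) - A (g s z) (z - p)) \<le> M * norm (f s z - g s z) * norm (z - p)"
          by (rule A_lip[OF f(2)[OF z(1) s] g(2)[OF z(1) s]])
        also have "\<dots> = M * norm (z - p) * norm (f s z - g s z)" by (simp only: mult_ac)
        also have "\<dots> \<le> 1 / 2 * e" using MZ(2)[OF z(1)] e[OF s] by (intro mult_mono) auto
        finally show ?thesis by simp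
      qed
    qed (use z in auto)
    also have "\<dots> \<le> e / 2" using z e0 by (simp add: mult_left_le)
    finally show ?thesis .
  qed
  have it_props: "continuous_on (?Z \<times> ?I) (\<lambda>(z, s). it k s z) \<and> (\<forall>z\<in>?Z. \<forall>s\<in>?I. it k s z \<in> cball p R)
     \<and> (\<forall>t\<in>?I. holomorphic_field ?Z (it k t))" for k
  proof (induction k)
    case 0
    have "continuous_on (?Z \<times> ?I) fst" by (intro continuous_intros)
    moreover have "holomorphic_field ?Z (\<lambda>z. z)" by (auto simp: holomorphic_field_iff)
    ultimately show ?case using \<delta> U(2) by (auto simp: it0[abs_def] case_prod_beta' dist_norm)
  next
    case (Suc k)
    then have IH: "continuous_on (?Z \<times> ?I) (\<lambda>(z, s). it k s z)" "\<And>z s. z \<in> ?Z \<Longrightarrow> s \<in> ?I \<Longrightarrow> it k s z \<in> cball p R"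
      "\<And>t. t \<in> ?I \<Longrightarrow> holomorphic_field ?Z (it k t)" by blast+
    let ?F = "\<lambda>z s. A (it k s z) (z - p)"
    have Fc: "continuous_on (?Z \<times> ?I) (\<lambda>(z, s). ?F z s)" by (rule F_cont[OF IH(1,2)])
    have "continuous_on (?Z \<times> ?I) (\<lambda>q. fst q - (\<lambda>(z, t). integral {0..t} (?F z)) q)"
      by (intro continuous_intros continuous_on_integral_upper[OF Fc])
    then have "continuous_on (?Z \<times> ?I) (\<lambda>(z, s). it (Suc k) s z)"
      by (simp add: itS case_prod_beta')
    moreover have "it (Suc k) s z \<in> cball p R" if "z \<in> ?Z" "s \<in> ?I" for z s
      by (rule ZR[OF that(1)]) (use int_bound[OF IH(1,2) that] in \<open>simp add: itS\<close>)
    moreover have "holomorphic_field ?Z (it (Suc k) t)" if t: "t \<in> ?I" for t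
      unfolding holomorphic_field_iff
    proof
      fix i
      have "hol ?Z (\<lambda>z. integral {0..t} (\<lambda>s. ?F z s $ i))"
      proof (rule hol_integral[OF open_ball])
        have "continuous_on (?Z \<times> {0..t}) (\<lambda>q. (\<lambda>(z, s). ?F z s) q $ i)"
          by (intro continuous_intros continuous_on_subset[OF Fc]) (use t in auto)
        then show "continuous_on (?Z \<times> {0..t}) (\<lambda>(z, s). ?F z s $ i)" by (simp add: case_prod_beta')
        fix s assume "s \<in> {0..t}"
        then have s: "s \<in> ?I" using t by auto
        have "hol ?Z (\<lambda>z. \<Sum>j\<in>UNIV. (z $ j - p $ j) * A (it k s z) (axis j 1) $ i)"
        proof (intro hol_sum hol_mult hol_diff hol_nth hol_const)
          fix j
          show "hol ?Z (\<lambda>z. A (it k s z) (axis j 1) $ i)"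
            by (rule hol_compose[where f="\<lambda>w. A w (axis j 1) $ i" and V=U, OF _ IH(3)[OF s]])
               (use hol[of "axis j 1"] IH(2) s U(3) in \<open>auto simp: holomorphic_field_iff\<close>)
        qed
        then show "hol ?Z (\<lambda>z. ?F z s $ i)"
        proof (rule hol_cong[OF open_ball, rotated])
          fix z assume "z \<in> ?Z"
          then have "it k s z \<in> U" using IH(2) s U(3) by blast
          from expand[OF this, of "z - p"]
          show "(\<Sum>j\<in>UNIV. (z $ j - p $ j) * A (it k s z) (axis j 1) $ i) = ?F z s $ i" by (simp add: left_diff_distrib)
        qed
      qed
      then have "hol ?Z (\<lambda>z. z $ i - integral {0..t} (\<lambda>s. ?F z s $ i))" by (intro hol_diff hol_nth)
      then show "hol ?Z (\<lambda>z. it (Suc k) t z $ i)"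
      proof (rule hol_cong[OF open_ball, rotated])
        fix z assume z: "z \<in> ?Z"
        show "z $ i - integral {0..t} (\<lambda>s. ?F z s $ i) = it (Suc k) t z $ i"
          using integral_vec_nth[OF F_cont1[of "it k", OF IH(1,2) z t], of i] by (simp add: itS)
      qed
    qed
    ultimately show ?case by blast
  qed
  have it_cont: "continuous_on (?Z \<times> ?I) (\<lambda>(z, s). it k s z)"
    and it_R: "\<And>z s. z \<in> ?Z \<Longrightarrow> s \<in> ?I \<Longrightarrow> it k s z \<in> cball p R"
    and it_hol: "\<And>t. t \<in> ?I \<Longrightarrow> holomorphic_field ?Z (it k t)" for k
    using it_props by blast+
  have it_diff: "norm (it (Suc k) t z - it k t z) \<le> R * (1/2)^k" if "z \<in> ?Z" "t \<in> ?I" for k t z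
    using that
  proof (induction k arbitrary: t)
    case 0
    have "norm (it (Suc 0) t z - it 0 t z) \<le> M * norm (z - p)"
      using int_bound[OF it_cont it_R 0, of 0] by (simp only: itS[of 0] it0) simp
    then show ?case using MZ(1)[OF 0(1)] U(2) by simp
  next
    case (Suc k)
    have "norm (it (Suc (Suc k)) t z - it (Suc k) t z) =
       norm (integral {0..t} (\<lambda>s. A (it k s z) (z - p)) - integral {0..t} (\<lambda>s. A (it (Suc k) s z) (z - p)))"
      by (simp only: itS[of "Suc k" t z] itS[of k t z]) simp
    also have "\<dots> \<le> R * (1/2)^k / 2"
      by (rule int_diff[OF it_cont it_R it_cont it_R Suc.prems])
         (use Suc.IH[OF Suc.prems(1)] in \<open>simp_all add: norm_minus_commute\<close>)
    finally show ?case by simp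
  qed
  define c where "c t z = z + (\<Sum>k. it (Suc k) t z - it k t z)" for t z
  have "uniform_limit (?Z \<times> ?I) (\<lambda>n q. \<Sum>k<n. it (Suc k) (snd q) (fst q) - it k (snd q) (fst q))
     (\<lambda>q. \<Sum>k. it (Suc k) (snd q) (fst q) - it k (snd q) (fst q)) sequentially"
  proof (rule Weierstrass_m_test)
    show "norm (it (Suc k) (snd q) (fst q) - it k (snd q) (fst q)) \<le> R * (1/2)^k" if "q \<in> ?Z \<times> ?I" for k q
      using it_diff[of "fst q" "snd q"] that by auto
    show "summable (\<lambda>k. R * (1/2::real)^k)" by (intro summable_mult summable_geometric) simp
  qed
  then have "uniform_limit (?Z \<times> ?I) (\<lambda>n q. fst q + (\<Sum>k<n. it (Suc k) (snd q) (fst q) - it k (snd q) (fst q)))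
     (\<lambda>q. fst q + (\<Sum>k. it (Suc k) (snd q) (fst q) - it k (snd q) (fst q))) sequentially"
    by (intro uniform_limit_add uniform_limit_const)
  moreover have "(\<Sum>k<n. it (Suc k) t z - it k t z) = it n t z - z" for n t z
    using sum_lessThan_telescope[of "\<lambda>k. it k t z" n] by (simp add: it0)
  ultimately have UL: "uniform_limit (?Z \<times> ?I) (\<lambda>n (z, t). it n t z) (\<lambda>(z, t). c t z) sequentially"
    by (simp add: c_def case_prod_beta')
  have ULt: "\<forall>\<^sub>F n in sequentially. \<forall>z\<in>?Z. \<forall>t\<in>?I. dist (it n t z) (c t z) < e" if "e > 0" for e
    using uniform_limitD[OF UL that] by (rule eventually_mono) auto
  have c_cont: "continuous_on (?Z \<times> ?I) (\<lambda>(z, t). c t z)"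
    by (rule uniform_limit_theorem[OF _ UL]) (auto intro!: always_eventually it_cont)
  have lim: "(\<lambda>n. it n t z) \<longlonglongrightarrow> c t z" if "z \<in> ?Z" "t \<in> ?I" for z t
    using tendsto_uniform_limitI[OF UL, of "(z, t)"] that by simp
  have c_R: "c t z \<in> cball p R" if "z \<in> ?Z" "t \<in> ?I" for z t
    by (rule closed_sequentially[OF closed_cball _ lim[OF that]]) (use it_R that in blast)
  have c_hol: "holomorphic_field ?Z (c t)" if t: "t \<in> ?I" for t
    unfolding holomorphic_field_iff
  proof
    fix i
    show "hol ?Z (\<lambda>z. c t z $ i)"
    proof (rule hol_uniform_limit[OF open_ball])
      show "hol ?Z (\<lambda>z. it k t z $ i)" for k using it_hol[OF t] by (simp add: holomorphic_field_iff)
      show "uniform_limit ?Z (\<lambda>k z. it k t z $ i) (\<lambda>z. c t z $ i) sequentially"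
      proof (rule uniform_limitI)
        fix e :: real assume "e > 0"
        from ULt[OF this]
        show "\<forall>\<^sub>F n in sequentially. \<forall>z\<in>?Z. dist (it n t z $ i) (c t z $ i) < e"
          by (rule eventually_mono) (use t dist_vec_nth_le le_less_trans in blast)
      qed
    qed
  qed
  have c_eq: "c t z = z - integral {0..t} (\<lambda>s. A (c s z) (z - p))" if z: "z \<in> ?Z" "t \<in> ?I" for z t
  proof (rule LIMSEQ_unique[OF LIMSEQ_Suc[OF lim[OF z]]])
    show "(\<lambda>n. it (Suc n) t z) \<longlonglongrightarrow> z - integral {0..t} (\<lambda>s. A (c s z) (z - p))"
      unfolding tendsto_iff
    proof (intro allI impI)
      fix e :: real assume e: "e > 0"
      from ULt[OF e]
      show "\<forall>\<^sub>F n in sequentially. dist (it (Suc n) t z) (z - integral {0..t} (\<lambda>s. A (c s z) (z - p))) < e"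
      proof (rule eventually_mono)
        fix n assume n: "\<forall>z\<in>?Z. \<forall>t\<in>?I. dist (it n t z) (c t z) < e"
        have "norm (integral {0..t} (\<lambda>s. A (it n s z) (z - p)) - integral {0..t} (\<lambda>s. A (c s z) (z - p))) \<le> e / 2"
          by (rule int_diff[OF it_cont it_R c_cont c_R z]) (use n z in \<open>auto simp: dist_norm less_imp_le\<close>)
        then show "dist (it (Suc n) t z) (z - integral {0..t} (\<lambda>s. A (c s z) (z - p))) < e"
          using e by (simp add: itS dist_norm norm_minus_commute)
      qed
    qed
  qed
  have c_der: "((\<lambda>t. c t z) has_vector_derivative - A (c t z) (z - p)) (at t within ?I)"
    if z: "z \<in> ?Z" "t \<in> ?I" for z t
  proof -
    have "((\<lambda>t. z - integral {0..t} (\<lambda>s. A (c s z) (z - p))) has_vector_derivative 0 - A (c t z) (z - p)) (at t within ?I)"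
      by (intro has_vector_derivative_diff has_vector_derivative_const integral_has_vector_derivative
          F_cont1[OF c_cont c_R z(1)] z) auto
    then have "((\<lambda>t. z - integral {0..t} (\<lambda>s. A (c s z) (z - p))) has_vector_derivative - A (c t z) (z - p)) (at t within ?I)"
      by simp
    then show ?thesis
      by (rule has_vector_derivative_transform[OF z(2), rotated]) (use c_eq z in simp)
  qed
  \<comment> \<open>At the time where |b - c| is largest, the mean value inequality bounds it by
    half of itself.\<close>
  have uniq: "b t = c t z" if z: "z \<in> ?Z" and b: "b 0 = z" "\<And>t. t \<in> ?I \<Longrightarrow> b t \<in> cball p R"
      "\<And>t. t \<in> ?I \<Longrightarrow> (b has_vector_derivative - A (b t) (z - p)) (at t within ?I)" and t: "t \<in> ?I" for z b t
  proof -
    define e where "e t = b t - c t z" for t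
    have e': "(e has_vector_derivative (- A (b t) (z - p) - (- A (c t z) (z - p)))) (at t within ?I)" if "t \<in> ?I" for t
      unfolding e_def[abs_def] by (intro has_vector_derivative_diff b c_der z that)
    have "continuous_on ?I e"
      using e' by (meson continuous_on_eq_continuous_within has_vector_derivative_continuous)
    then have "continuous_on ?I (\<lambda>t. norm (e t))" by (intro continuous_intros)
    then obtain t0 where t0: "t0 \<in> ?I" "\<And>t. t \<in> ?I \<Longrightarrow> norm (e t) \<le> norm (e t0)"
      using continuous_attains_sup[of ?I "\<lambda>t. norm (e t)"] by auto
    have h1: "norm (e t0 - e 0) \<le> (norm (e t0) / 2) * norm (t0 - 0)"
    proof (rule differentiable_bound[of ?I e "\<lambda>t h. h *\<^sub>R (- A (b t) (z - p) - (- A (c t z) (z - p)))"])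
      show "(e has_derivative (\<lambda>h. h *\<^sub>R (- A (b t) (z - p) - (- A (c t z) (z - p))))) (at t within ?I)" if "t \<in> ?I" for t
        using e'[OF that] by (simp only: has_vector_derivative_def)
      show "onorm (\<lambda>h. h *\<^sub>R (- A (b t) (z - p) - (- A (c t z) (z - p)))) \<le> norm (e t0) / 2" if t: "t \<in> ?I" for t
      proof (rule onorm_le)
        fix h :: real
        have "norm (- A (b t) (z - p) - (- A (c t z) (z - p))) \<le> M * norm (c t z - b t) * norm (z - p)"
          using A_lip[OF c_R[OF z t] b(2)[OF t], of "z - p"] by simp
        also have "\<dots> = M * norm (z - p) * norm (e t)" by (simp add: e_def norm_minus_commute)
        also have "\<dots> \<le> 1 / 2 * norm (e t0)" using MZ(2)[OF z] t0(2)[OF t] by (intro mult_mono) auto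
        finally have "norm h * norm (- A (b t) (z - p) - (- A (c t z) (z - p))) \<le> norm h * (norm (e t0) / 2)"
          by (intro mult_left_mono) auto
        then show "norm (h *\<^sub>R (- A (b t) (z - p) - (- A (c t z) (z - p)))) \<le> norm (e t0) / 2 * norm h"
          by (simp only: norm_scaleR real_norm_def mult.commute)
      qed
    qed (use t0 in auto)
    have e0: "e 0 = 0" using b(1) c_eq[OF z, of 0] by (simp add: e_def)
    have h2: "norm (e t0) / 2 * norm (t0 - 0) \<le> norm (e t0) / 2 * 1" using t0(1) by (intro mult_left_mono) auto
    have "norm (e t0) \<le> norm (e t0) / 2 * 1" using order_trans[OF h1 h2] by (simp only: e0 diff_zero)
    then have "norm (e t0) = 0" using norm_ge_zero[of "e t0"] by linarith
    then show ?thesis using t0(2)[OF t] by (simp add: e_def)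
  qed
  have c0: "c 0 z = z" if "z \<in> ?Z" for z using c_eq[OF that, of 0] by simp
  have c_near: "norm (c t z - z) \<le> M * norm (z - p)" if "z \<in> ?Z" "t \<in> ?I" for z t
  proof -
    have "c t z - z = - integral {0..t} (\<lambda>s. A (c s z) (z - p))" using c_eq[OF that] by simp
    then show ?thesis using int_bound[OF c_cont c_R that] by simp
  qed
  have uniq': "\<forall>b. b 0 = z \<longrightarrow> (\<forall>t\<in>?I. b t \<in> cball p R \<and>
      (b has_vector_derivative - A (b t) (z - p)) (at t within ?I)) \<longrightarrow> (\<forall>t\<in>?I. b t = c t z)"
    if "z \<in> ?Z" for z
  proof (intro allI impI ballI)
    fix b t assume b: "b 0 = z" "\<forall>t\<in>?I. b t \<in> cball p R \<and>
      (b has_vector_derivative - A (b t) (z - p)) (at t within ?I)" "t \<in> ?I"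
    show "b t = c t z" by (rule uniq[of z b t, OF that b(1) _ _ b(3)]) (use b(2) in blast)+
  qed
  show ?thesis
    by (rule exI[of _ \<delta>], rule exI[of _ M], rule exI[of _ c], intro conjI ballI)
       (use \<delta>(1) M c_hol c_der c0 c_near c_R uniq' in simp_all)
qed

section \<open>First integrals of involutive distributions\<close>

lemma zero_vector_derivative_const:
  fixes f :: "real \<Rightarrow> 'b::real_normed_vector"
  assumes "\<And>t. t \<in> {0..1} \<Longrightarrow> (f has_vector_derivative 0) (at t within {0..1})" "t \<in> {0..1}"
  shows "f t = f 0"
proof -
  have "\<exists>c. \<forall>x\<in>{0..1}. f x = c"
    by (rule has_derivative_zero_constant)
       (use assms(1) in \<open>auto simp: has_vector_derivative_def\<close>)
  then show ?thesis using assms(2) by auto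
qed

lemma hol_curve_derivative:
  assumes "hol U u" "\<gamma> t \<in> U" "(\<gamma> has_vector_derivative v) (at t within I)"
  shows "((\<lambda>t. u (\<gamma> t)) has_vector_derivative dd u (\<gamma> t) v) (at t within I)"
proof -
  have "((\<lambda>t. u (\<gamma> t)) has_derivative (\<lambda>h. dd u (\<gamma> t) (h *\<^sub>R v))) (at t within I)"
    by (rule has_derivative_compose[OF assms(3)[unfolded has_vector_derivative_def] hol_derivative[OF assms(1,2)]])
  then show ?thesis
    unfolding has_vector_derivative_def
    by (rule has_derivative_eq_rhs)
       (use hol_dd_linear[OF assms(1,2)] in \<open>simp add: linear_scale fun_eq_iff\<close>)
qed

lemma bounded_bilinear_vec_smult: "bounded_bilinear (\<lambda>c (v::complex^'m). c *s v)"
  by (rule bounded_bilinear.intro)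
     (auto simp: vec_eq_iff algebra_simps norm_vec_smult intro!: exI[of _ 1])

lemma dd_linear_family:
  assumes lin: "\<And>w. w \<in> U \<Longrightarrow> A w v = (\<Sum>j\<in>UNIV. v $ j *s A w (axis j 1))"
    and "open U" "z \<in> U" and hol: "\<And>v. holomorphic_field U (\<lambda>w. A w v)"
  shows "dd (\<lambda>x. A x v) z w = (\<Sum>j\<in>UNIV. v $ j *s dd (\<lambda>x. A x (axis j 1)) z w)"
proof -
  have "((\<lambda>x. \<Sum>j\<in>UNIV. v $ j *s A x (axis j 1)) has_derivative
     (\<lambda>w. \<Sum>j\<in>UNIV. v $ j *s dd (\<lambda>x. A x (axis j 1)) z w)) (at z)"
    by (intro has_derivative_sum bounded_linear.has_derivative[OF bounded_linear_vec_smult_right]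
        holomorphic_field_derivative[OF hol assms(3)])
  then have "((\<lambda>x. A x v) has_derivative (\<lambda>w. \<Sum>j\<in>UNIV. v $ j *s dd (\<lambda>x. A x (axis j 1)) z w)) (at z)"
    by (rule has_derivative_transform_within_open[OF _ assms(2,3)]) (simp add: lin)
  then show ?thesis by (rule dd_eqI)
qed

text \<open>The first term of the derivative keeps z - p frozen; the second comes from
  differentiating x - p.\<close>

lemma dd_radial_family:
  assumes lin: "\<And>w v. w \<in> U \<Longrightarrow> A w v = (\<Sum>j\<in>UNIV. v $ j *s A w (axis j 1))"
    and "open U" "z \<in> U" and hol: "\<And>v. holomorphic_field U (\<lambda>w. A w v)"
  shows "holomorphic_field U (\<lambda>x. A x (x - p))"
    "dd (\<lambda>x. A x (x - p)) z w = dd (\<lambda>x. A x (z - p)) z w + A z w"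
proof -
  have "holomorphic_field U (\<lambda>x. \<Sum>j\<in>UNIV. (x $ j - p $ j) *s A x (axis j 1))"
    by (intro holomorphic_field_sum holomorphic_field_smult hol_diff hol_nth hol_const hol)
  then show "holomorphic_field U (\<lambda>x. A x (x - p))"
    by (rule holomorphic_field_cong[OF assms(2), rotated]) (use lin[of _ "_ - p"] in simp)
  have "((\<lambda>x. \<Sum>j\<in>UNIV. (x - p) $ j *s A x (axis j 1)) has_derivative
     (\<lambda>w. \<Sum>j\<in>UNIV. (z - p) $ j *s dd (\<lambda>x. A x (axis j 1)) z w + (w - 0) $ j *s A z (axis j 1))) (at z)"
    by (intro has_derivative_sum bounded_bilinear.FDERIV[OF bounded_bilinear_vec_smult]
        holomorphic_field_derivative[OF hol assms(3)]
        bounded_linear.has_derivative[OF bounded_linear_vec_nth] has_derivative_diff has_derivative_ident has_derivative_const)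
  then have "((\<lambda>x. A x (x - p)) has_derivative
     (\<lambda>w. \<Sum>j\<in>UNIV. (z - p) $ j *s dd (\<lambda>x. A x (axis j 1)) z w + (w - 0) $ j *s A z (axis j 1))) (at z)"
    by (rule has_derivative_transform_within_open[OF _ assms(2,3)]) (simp add: lin[of _ "_ - p"])
  then have "dd (\<lambda>x. A x (x - p)) z w =
      (\<Sum>j\<in>UNIV. (z - p) $ j *s dd (\<lambda>x. A x (axis j 1)) z w + (w - 0) $ j *s A z (axis j 1))"
    by (rule dd_eqI)
  then show "dd (\<lambda>x. A x (x - p)) z w = dd (\<lambda>x. A x (z - p)) z w + A z w"
    using dd_linear_family[OF lin assms(2,3) hol, of "z - p" w] lin[OF assms(3), of w]
    by (simp add: sum.distrib)
qed

text \<open>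
  With \<open>A z\<close> the projection onto the distribution along a fixed complement, integrate the radial
  field \<open>E z = A z (z - p)\<close>: the flow is constant along \<open>E\<close>, and \<open>[E, A v] = - A v\<close> forces its
  limit map to be constant along the whole distribution.\<close>

lemma Frobenius_first_integral:
  fixes A :: "complex^'m \<Rightarrow> complex^'m \<Rightarrow> complex^'m"
  assumes r: "r > 0" and hol: "\<And>v. holomorphic_field (ball p r) (\<lambda>w. A w v)"
    and lin: "\<And>w u v. w \<in> ball p r \<Longrightarrow> A w (u + v) = A w u + A w v"
      "\<And>w c v. w \<in> ball p r \<Longrightarrow> A w (c *s v) = c *s A w v"
    and proj: "\<And>z w v. z \<in> ball p r \<Longrightarrow> w \<in> ball p r \<Longrightarrow> A z (A w v) = A z v"
    and integ: "\<And>z u v. z \<in> ball p r \<Longrightarrow> dd (\<lambda>x. A x v) z (A z u) = dd (\<lambda>x. A x u) z (A z v)"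
    and a: "\<And>v. dotp a (A p v) = 0"
  obtains \<delta> u where "\<delta> > 0" "hol (ball p \<delta>) u"
    "\<And>z v. z \<in> ball p \<delta> \<Longrightarrow> dd u z (A z v) = 0" "\<And>w. dd u p w = dotp a w"
proof -
  let ?U = "ball p r" and ?I = "{0..1::real}"
  have expand: "A w v = (\<Sum>j\<in>UNIV. v $ j *s A w (axis j 1))" if "w \<in> ?U" for w v
    using linear_family_expand[of "A w" v] lin[OF that] by blast
  have R: "r / 2 > 0" "cball p (r / 2) \<subseteq> ?U" using r by auto
  obtain \<delta> M c where flow_c: "\<delta> > 0 \<and> M > 0 \<and> (\<forall>t\<in>{0..1}. holomorphic_field (ball p \<delta>) (c t)) \<and>
    (\<forall>z\<in>ball p \<delta>. c 0 z = z \<and>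
      (\<forall>t\<in>{0..1::real}. ((\<lambda>t. c t z) has_vector_derivative - A (c t z) (z - p)) (at t within {0..1}) \<and>
        norm (c t z - z) \<le> M * norm (z - p) \<and> c t z \<in> cball p (r / 2)) \<and>
      (\<forall>b. b 0 = z \<longrightarrow> (\<forall>t\<in>{0..1}. b t \<in> cball p (r / 2) \<and>
          (b has_vector_derivative - A (b t) (z - p)) (at t within {0..1})) \<longrightarrow>
        (\<forall>t\<in>{0..1}. b t = c t z)))"
    by (rule exE[OF flow_exists[OF open_ball R hol lin]], assumption, assumption, elim exE, rule that)
  have \<delta>: "\<delta> > 0" and M: "M > 0" using flow_c by blast+
  have c_hol: "holomorphic_field (ball p \<delta>) (c t)" if "t \<in> ?I" for t using flow_c that by blast
  have c0: "c 0 z = z" if "z \<in> ball p \<delta>" for z using flow_c that by blast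
  have c_der: "((\<lambda>t. c t z) has_vector_derivative - A (c t z) (z - p)) (at t within ?I)"
    and c_near: "norm (c t z - z) \<le> M * norm (z - p)" and c_R: "c t z \<in> cball p (r/2)"
    if "z \<in> ball p \<delta>" "t \<in> ?I" for z t using flow_c that by blast+
  have uniq: "b t = c t z" if "z \<in> ball p \<delta>" "b 0 = z" "\<And>t. t \<in> ?I \<Longrightarrow> b t \<in> cball p (r/2)"
    "\<And>t. t \<in> ?I \<Longrightarrow> (b has_vector_derivative - A (b t) (z - p)) (at t within ?I)" "t \<in> ?I" for z b t
  proof -
    have H: "\<forall>t\<in>{0..1}. b t \<in> cball p (r / 2) \<and>
          (b has_vector_derivative - A (b t) (z - p)) (at t within {0..1})"
      by (intro ballI conjI that(3,4))
    have main: "\<forall>b. b 0 = z \<longrightarrow> (\<forall>t\<in>{0..1}. b t \<in> cball p (r / 2) \<and>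
          (b has_vector_derivative - A (b t) (z - p)) (at t within {0..1})) \<longrightarrow>
        (\<forall>t\<in>{0..1}. b t = c t z)"
      by (rule flow_c[THEN conjunct2, THEN conjunct2, THEN conjunct2, THEN bspec, OF that(1), THEN conjunct2, THEN conjunct2])
    show ?thesis
      by (rule bspec[OF main[THEN spec[of _ b], THEN mp, OF that(2), THEN mp, OF H] that(5)])
  qed
  have c_U: "c t z \<in> ?U" if "z \<in> ball p \<delta>" "t \<in> ?I" for z t using c_R[OF that] R by blast
  \<comment> \<open>The distance from p grows by at most the factor 1 + M along the flow. Two radii
    are prepared because the flow is composed with itself and then combined with identities valid
    only on the smaller ball.\<close>
  define \<delta>2 where "\<delta>2 = \<delta> / (1 + M)"
  define \<delta>3 where "\<delta>3 = \<delta>2 / (1 + M)"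
  have \<delta>2: "\<delta>2 > 0" "\<delta>2 \<le> \<delta>" and \<delta>3: "\<delta>3 > 0" "\<delta>3 \<le> \<delta>2"
    using \<delta> M by (auto simp: \<delta>2_def \<delta>3_def divide_simps)
  have stay: "c t z \<in> ball p e" if z: "z \<in> ball p (e / (1 + M))" and e: "e > 0" "e \<le> \<delta>" and t: "t \<in> ?I" for z t e
  proof -
    have "e / (1 + M) \<le> e" using e M by (simp add: pos_divide_le_eq distrib_left)
    then have "e / (1 + M) \<le> \<delta>" using e by linarith
    then have "norm (c t z - z) \<le> M * norm (z - p)" using z t by (intro c_near) auto
    then have "norm (c t z - p) \<le> (1 + M) * norm (z - p)"
      using norm_triangle_ineq[of "c t z - z" "z - p"] by (simp add: algebra_simps)
    also have "\<dots> < e" using z M by (simp add: dist_norm norm_minus_commute pos_less_divide_eq mult.commute)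
    finally show ?thesis by (simp add: dist_norm norm_minus_commute)
  qed
  have stay2: "c t z \<in> ball p \<delta>" if "z \<in> ball p \<delta>2" "t \<in> ?I" for z t
    using stay[of z \<delta> t] that \<delta> by (simp add: \<delta>2_def)
  have stay3: "c t z \<in> ball p \<delta>2" if "z \<in> ball p \<delta>3" "t \<in> ?I" for z t
    using stay[of z \<delta>2 t] that \<delta>2 by (simp add: \<delta>3_def)
  have in\<delta>: "z \<in> ball p \<delta>" if "z \<in> ball p \<delta>2" for z using that \<delta>2 by auto
  have in\<delta>2: "z \<in> ball p \<delta>2" if "z \<in> ball p \<delta>3" for z using that \<delta>3 by auto
  have inU: "z \<in> ?U" if "z \<in> ball p \<delta>" for z using c_U[OF that, of 0] c0[OF that] by simp
  have blin: "bounded_linear (A w)" if "w \<in> ?U" for w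
  proof -
    have "linear (A w)" by (rule linearI) (use lin[OF that] in \<open>auto simp: scaleR_vec_smult\<close>)
    then show ?thesis by (simp add: linear_conv_bounded_linear)
  qed
  have radial: "A w (c t z - p) = (1 - complex_of_real t) *s A w (z - p)"
    if z: "z \<in> ball p \<delta>" and t: "t \<in> ?I" and w: "w \<in> ?U" for z t w
  proof -
    have D: "((\<lambda>t. A w (c t z - p) + t *\<^sub>R A w (z - p)) has_vector_derivative 0) (at t within ?I)"
      if t: "t \<in> ?I" for t
    proof -
      have "((\<lambda>t. A w (c t z - p) + t *\<^sub>R A w (z - p)) has_vector_derivative
          A w (- A (c t z) (z - p) - 0) + (t *\<^sub>R 0 + 1 *\<^sub>R A w (z - p))) (at t within ?I)"
        by (intro has_vector_derivative_add bounded_linear.has_vector_derivative[OF blin[OF w]]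
            has_vector_derivative_diff c_der z t has_vector_derivative_const has_vector_derivative_scaleR)
           (auto intro!: derivative_eq_intros)
      moreover have "A w (- A (c t z) (z - p) - 0) + (t *\<^sub>R 0 + 1 *\<^sub>R A w (z - p)) = 0"
        using proj[OF w c_U[OF z t], of "z - p"] bounded_linear.linear[OF blin[OF w]] by (simp add: linear_neg)
      ultimately show ?thesis by (simp only:)
    qed
    have "A w (c t z - p) + t *\<^sub>R A w (z - p) = A w (c 0 z - p) + 0 *\<^sub>R A w (z - p)"
      by (rule zero_vector_derivative_const[OF D t])
    then show ?thesis using c0[OF z] by (simp add: scaleR_vec_smult vec_eq_iff algebra_simps)
  qed
  \<comment> \<open>By \<open>radial\<close>, the rest of the trajectory, rescaled to [0, 1], solves
    the equation started at c s z; uniqueness identifies the end points.\<close>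
  have flow: "c 1 (c s z) = c 1 z" if z: "z \<in> ball p \<delta>2" and s: "s \<in> ?I" for z s
  proof -
    let ?b = "\<lambda>\<tau>. c (s + (1 - s) * \<tau>) z"
    have I: "s + (1 - s) * \<tau> \<in> ?I" if "\<tau> \<in> ?I" for \<tau>
    proof -
      have "(1 - s) * \<tau> \<le> (1 - s) * 1" using s that by (intro mult_left_mono) auto
      then show ?thesis using s that by simp
    qed
    have "?b 1 = c 1 (c s z)"
    proof (rule uniq[of "c s z" ?b 1])
      show "c s z \<in> ball p \<delta>" by (rule stay2[OF z s])
      show "?b \<tau> \<in> cball p (r/2)" if "\<tau> \<in> ?I" for \<tau> by (rule c_R[OF in\<delta>[OF z] I[OF that]])
      show "(?b has_vector_derivative - A (?b \<tau>) (c s z - p)) (at \<tau> within ?I)" if \<tau>: "\<tau> \<in> ?I" for \<tau>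
      proof -
        have "((\<lambda>t. c t z) has_vector_derivative - A (?b \<tau>) (z - p)) (at (s + (1 - s) * \<tau>) within (\<lambda>\<tau>. s + (1 - s) * \<tau>) ` ?I)"
          by (rule has_vector_derivative_within_subset[OF c_der[OF in\<delta>[OF z] I[OF \<tau>]]]) (use I in blast)
        moreover have "((\<lambda>\<tau>. s + (1 - s) * \<tau>) has_vector_derivative (1 - s)) (at \<tau> within ?I)"
          by (auto intro!: derivative_eq_intros)
        ultimately have "(((\<lambda>t. c t z) \<circ> (\<lambda>\<tau>. s + (1 - s) * \<tau>)) has_vector_derivative (1 - s) *\<^sub>R (- A (?b \<tau>) (z - p))) (at \<tau> within ?I)"
          by (intro vector_diff_chain_within)
        then show ?thesis
          unfolding radial[OF in\<delta>[OF z] s c_U[OF in\<delta>[OF z] I[OF \<tau>]]]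
          by (simp add: o_def scaleR_vec_smult vec_eq_iff)
      qed
    qed auto
    then show ?thesis by simp
  qed
  \<comment> \<open>The covector a pulled back by the end-point map, which carries z along its
    trajectory into the slice p + ker (A p).\<close>
  define u where "u z = dotp a (c 1 z)" for z
  have u_hol: "hol (ball p \<delta>) u"
    unfolding u_def by (intro hol_dotp c_hol holomorphic_field_const) simp
  have u_hol2: "hol (ball p \<delta>2) u" by (rule hol_subset[OF u_hol]) (use \<delta>2 in auto)
  let ?E = "\<lambda>x. A x (x - p)"
  have E_hol: "holomorphic_field ?U ?E"
    by (rule dd_radial_family(1)[OF expand open_ball centre_in_ball[THEN iffD2, OF r] hol])
  have E_hol2: "holomorphic_field (ball p \<delta>2) ?E"
    by (rule holomorphic_field_subset[OF E_hol]) (use inU in\<delta> in blast)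
  have A_hol2: "holomorphic_field (ball p \<delta>2) (\<lambda>x. A x v)" for v
    by (rule holomorphic_field_subset[OF hol]) (use inU in\<delta> in blast)
  have uE: "dd u z (?E z) = 0" if z: "z \<in> ball p \<delta>2" for z
  proof -
    have 0: "(0::real) \<in> ?I" by simp
    have "((\<lambda>t. u (c t z)) has_vector_derivative dd u (c 0 z) (- A (c 0 z) (z - p))) (at 0 within ?I)"
      by (rule hol_curve_derivative[OF u_hol stay2[OF z 0] c_der[OF in\<delta>[OF z] 0]])
    moreover have "((\<lambda>t. u (c t z)) has_vector_derivative 0) (at 0 within ?I)"
      by (rule has_vector_derivative_transform[OF 0 _ has_vector_derivative_const[of "u z"]])
         (simp add: u_def flow[OF z])
    ultimately have "dd u (c 0 z) (- A (c 0 z) (z - p)) = 0"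
      using vector_derivative_unique_within_closed_interval[of 0 1 0 "\<lambda>t. u (c t z)"] by simp
    then show ?thesis
      using linear_neg[OF hol_dd_linear[OF u_hol in\<delta>[OF z]], of "?E z"] c0[OF in\<delta>[OF z]] by simp
  qed
  define G where "G v z = dd u z (A z v)" for v z
  have G_hol: "hol (ball p \<delta>2) (G v)" for v
    unfolding G_def by (rule hol_dd_field[OF open_ball u_hol2 A_hol2])
  have GE: "dd (G v) z (?E z) = - G v z" if z: "z \<in> ball p \<delta>2" for v z
  proof -
    have zU: "z \<in> ?U" by (rule inU[OF in\<delta>[OF z]])
    have "dd (\<lambda>z. dd u z (?E z)) z (A z v) = 0"
      by (rule dd_eqI[where D="\<lambda>_. 0"]) (rule has_derivative_transform_within_open[OF has_derivative_const[of 0] open_ball z], simp add: uE)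
    then have e1: "dd (\<lambda>x. dd u x (?E z)) z (A z v) + dd u z (dd ?E z (A z v)) = 0"
      using dd_dd_field[OF open_ball u_hol2 E_hol2 z, of "A z v"] by simp
    \<comment> \<open>\<open>integ\<close> with the vector z - p exchanges the two derivatives of A;
      \<open>proj\<close> reduces the remaining term A z (A z v) to A z v.\<close>
    have e2: "dd ?E z (A z v) = dd (\<lambda>x. A x v) z (?E z) + A z v"
      using dd_radial_family(2)[OF expand open_ball zU hol, of p "A z v"] integ[OF zU, of "z - p" v] proj[OF zU zU, of v]
      by simp
    have e3: "dd (G v) z (?E z) = dd (\<lambda>x. dd u x (A z v)) z (?E z) + dd u z (dd (\<lambda>x. A x v) z (?E z))"
      unfolding G_def[abs_def] by (rule dd_dd_field[OF open_ball u_hol2 A_hol2 z])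
    have e4: "dd (\<lambda>x. dd u x (A z v)) z (?E z) = dd (\<lambda>x. dd u x (?E z)) z (A z v)"
      by (rule hol_dd_commute[OF open_ball u_hol2 z])
    have e5: "dd u z (dd ?E z (A z v)) = dd u z (dd (\<lambda>x. A x v) z (?E z)) + dd u z (A z v)"
      unfolding e2 by (rule hol_dd_add[OF u_hol2 z])
    have "dd (G v) z (?E z) + dd u z (A z v) = 0"
      using e1 unfolding e3 e4 e5 by (simp only: add.assoc)
    then show ?thesis by (simp only: G_def eq_neg_iff_add_eq_0)
  qed
  \<comment> \<open>By \<open>GE\<close> and \<open>radial\<close> the function (1 - t) G v (c t z)
    has derivative zero in t, and it vanishes at t = 1.\<close>
  have G0: "G v z = 0" if z: "z \<in> ball p \<delta>3" for v z
  proof -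
    let ?m = "\<lambda>t. (1 - complex_of_real t) * G v (c t z)"
    have z2: "z \<in> ball p \<delta>2" by (rule in\<delta>2[OF z])
    have "(?m has_vector_derivative 0) (at t within ?I)" if t: "t \<in> ?I" for t
    proof -
      have "((\<lambda>t. G v (c t z)) has_vector_derivative dd (G v) (c t z) (- A (c t z) (z - p))) (at t within ?I)"
        by (rule hol_curve_derivative[OF G_hol stay3[OF z t] c_der[OF in\<delta>[OF z2] t]])
      then have "(?m has_vector_derivative (1 - complex_of_real t) * dd (G v) (c t z) (- A (c t z) (z - p)) + (- 1) * G v (c t z)) (at t within ?I)"
        by (intro has_vector_derivative_mult) (auto intro!: derivative_eq_intros)
      moreover have "(1 - complex_of_real t) * dd (G v) (c t z) (- A (c t z) (z - p)) = G v (c t z)"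
      proof -
        have "dd (G v) (c t z) ((1 - complex_of_real t) *s A (c t z) (z - p)) = - G v (c t z)"
          using GE[OF stay3[OF z t], of v] unfolding radial[OF in\<delta>[OF z2] t c_U[OF in\<delta>[OF z2] t]] .
        then have "(1 - complex_of_real t) * dd (G v) (c t z) (A (c t z) (z - p)) = - G v (c t z)"
          unfolding hol_dd_smult[OF G_hol stay3[OF z t]] .
        then show ?thesis
          unfolding linear_neg[OF hol_dd_linear[OF G_hol stay3[OF z t]], of v "A (c t z) (z - p)"]
          by simp
      qed
      ultimately show ?thesis by simp
    qed
    then have "?m 1 = ?m 0" by (rule zero_vector_derivative_const) auto
    then show ?thesis using c0[OF in\<delta>[OF z2]] by simp
  qed
  have p: "p \<in> ball p \<delta>" "p \<in> ball p \<delta>3" "p \<in> ?U" using \<delta> \<delta>3 r by auto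
  \<comment> \<open>The flow is stationary on p + ker (A p), so there u is the covector a itself.
    Together with \<open>G0\<close> at p and with a vanishing on the distribution this determines du
    at p.\<close>
  have ker: "dd u p w = dotp a w" if w: "A p w = 0" for w
  proof -
    have Aw: "A z w = 0" if "z \<in> ?U" for z
      using proj[OF that p(3), of w] w lin(2)[OF that, of 0 0] by simp
    define d where "d = \<delta> / (norm w + 1)"
    have d: "d > 0" using \<delta> by (auto simp: d_def intro!: divide_pos_pos add_nonneg_pos)
    have u_line: "dotp a p + \<zeta> * dotp a w = u (p + \<zeta> *s w)" if "\<zeta> \<in> ball 0 d" for \<zeta>
    proof -
      have "cmod \<zeta> * norm w \<le> cmod \<zeta> * (norm w + 1)" by (simp add: mult_left_mono)
      also have "\<dots> < \<delta>" using that by (simp add: d_def pos_less_divide_eq add_nonneg_pos)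
      finally have z: "p + \<zeta> *s w \<in> ball p \<delta>" by (simp add: dist_norm norm_vec_smult)
      have "p + \<zeta> *s w = c 1 (p + \<zeta> *s w)"
      proof (rule uniq[OF z, of "\<lambda>t. p + \<zeta> *s w"])
        show "p + \<zeta> *s w \<in> cball p (r/2)" using c_R[OF z, of 0] c0[OF z] by simp
        have "A (p + \<zeta> *s w) (\<zeta> *s w) = 0" using lin(2)[OF inU[OF z], of \<zeta> w] Aw[OF inU[OF z]] by simp
        then show "((\<lambda>t. p + \<zeta> *s w) has_vector_derivative - A (p + \<zeta> *s w) (p + \<zeta> *s w - p)) (at t within ?I)" for t
          by simp
      qed auto
      then have "u (p + \<zeta> *s w) = dotp a (p + \<zeta> *s w)" by (simp add: u_def)
      then show ?thesis by (simp add: dotp_simps)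
    qed
    have "((\<lambda>\<zeta>. dotp a p + \<zeta> * dotp a w) has_field_derivative dotp a w) (at 0)"
      by (auto intro!: derivative_eq_intros)
    then have "((\<lambda>\<zeta>. u (p + \<zeta> *s w)) has_field_derivative dotp a w) (at 0)"
      by (rule has_field_derivative_transform_within_open[OF _ open_ball[of 0 d]]) (use d u_line in auto)
    then show ?thesis
      using hol_line_derivative[OF u_hol, of p 0 w] p(1) DERIV_unique by fastforce
  qed
  show thesis
  proof (rule that[of \<delta>3 u])
    show "hol (ball p \<delta>3) u" by (rule hol_subset[OF u_hol2]) (use \<delta>3 in auto)
    show "dd u z (A z v) = 0" if "z \<in> ball p \<delta>3" for z v using G0[OF that, of v] by (simp add: G_def)
    show "dd u p w = dotp a w" for w
    proof -
      have Apw: "A p (w - A p w) = 0"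
        using bounded_linear.linear[OF blin[OF p(3)]] proj[OF p(3) p(3), of w] by (simp add: linear_diff)
      have "dd u p w = dd u p (A p w) + dd u p (w - A p w)"
        using hol_dd_add[OF u_hol p(1), of "A p w" "w - A p w"] by simp
      also have "\<dots> = dotp a (w - A p w)" using G0[OF p(2), of w] ker[OF Apw] by (simp add: G_def)
      finally show ?thesis by (simp add: dotp_simps a)
    qed
  qed (rule \<delta>3(1))
qed

section \<open>Real-analytic sections\<close>

lemma holomorphic_field_analytic:
  assumes "open \<Omega>" "holomorphic_field \<Omega> X" "\<And>x. x \<in> U \<Longrightarrow> cvec x \<in> \<Omega>"
  shows "analytic_field U (\<lambda>x. X (cvec x))"
  unfolding analytic_field_def
proof
  fix i
  have "hol \<Omega> (\<lambda>z. X z $ i)" using assms(2) by (simp add: holomorphic_field_iff)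
  from hol_real_analytic[OF assms(1) this assms(3)]
  show "real_analytic_on U (\<lambda>x. X (cvec x) $ i)" .
qed

lemma analytic_field_extension:
  fixes X :: "real^'m \<Rightarrow> complex^'m"
  assumes "analytic_field U X" "p \<in> U"
  obtains r Xc where "r > 0" "holomorphic_field (ball (cvec p) r) Xc"
    "\<And>x. x \<in> ball p r \<Longrightarrow> Xc (cvec x) = X x"
proof -
  have "\<forall>i. \<exists>rF. fst rF > 0 \<and> hol (ball (cvec p) (fst rF)) (snd rF) \<and>
      (\<forall>x\<in>ball p (fst rF). snd rF (cvec x) = X x $ i)"
  proof
    fix i
    have "real_analytic_on U (\<lambda>x. X x $ i)" using assms(1) by (simp add: analytic_field_def)
    then obtain r F where "r > 0" "hol (ball (cvec p) r) F" "\<And>x. x \<in> ball p r \<Longrightarrow> F (cvec x) = X x $ i"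
      using real_analytic_extension[OF _ assms(2)] by blast
    then show "\<exists>rF. fst rF > 0 \<and> hol (ball (cvec p) (fst rF)) (snd rF) \<and>
      (\<forall>x\<in>ball p (fst rF). snd rF (cvec x) = X x $ i)"
      by (intro exI[of _ "(r, F)"]) auto
  qed
  then obtain rF where rF: "\<And>i. fst (rF i) > 0" "\<And>i. hol (ball (cvec p) (fst (rF i))) (snd (rF i))"
    "\<And>i x. x \<in> ball p (fst (rF i)) \<Longrightarrow> snd (rF i) (cvec x) = X x $ i" by metis
  define r where "r = Min (range (\<lambda>i. fst (rF i)))"
  have r: "r > 0" "\<And>i. r \<le> fst (rF i)" using rF(1) by (auto simp: r_def)
  show thesis
  proof (rule that[of r "\<lambda>z. \<chi> i. snd (rF i) z"])
    show "holomorphic_field (ball (cvec p) r) (\<lambda>z. \<chi> i. snd (rF i) z)"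
      using hol_subset[OF rF(2) subset_ball[OF r(2)]] by (simp add: holomorphic_field_iff)
    show "(\<chi> i. snd (rF i) (cvec x)) = X x" if "x \<in> ball p r" for x
      using rF(3)[OF subsetD[OF subset_ball[OF r(2)] that]] by (simp add: vec_eq_iff)
  qed (rule r(1))
qed

lemma bounded_linear_cvec: "bounded_linear cvec"
  by (rule bounded_linear_intro[where K=1]) (auto simp: cvec_add cvec_scaleR scaleR_vec_smult)

lemma cvec_axis [simp]: "cvec (axis i 1) = axis i 1"
  by (simp add: vec_eq_iff axis_def)

lemma lie_bracket_cvec:
  fixes X Y :: "real^'m \<Rightarrow> complex^'m"
  assumes "r > 0" "holomorphic_field (ball (cvec p) r) Xc" "holomorphic_field (ball (cvec p) r) Yc"
    and "\<And>x. x \<in> ball p r \<Longrightarrow> X x = Xc (cvec x)" "\<And>x. x \<in> ball p r \<Longrightarrow> Y x = Yc (cvec x)"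
  shows "lie_bracket X Y p = lie_bracket Xc Yc (cvec p)"
proof -
  have p: "cvec p \<in> ball (cvec p) r" "p \<in> ball p r" using assms(1) by auto
  have "frechet_derivative W (at p) (axis j 1) = dd Wc (cvec p) (axis j 1)"
    if "holomorphic_field (ball (cvec p) r) Wc" "\<And>x. x \<in> ball p r \<Longrightarrow> W x = Wc (cvec x)"
    for W :: "real^'m \<Rightarrow> complex^'m" and Wc j
  proof -
    have "((\<lambda>x. Wc (cvec x)) has_derivative (\<lambda>v. dd Wc (cvec p) (cvec v))) (at p)"
      by (rule has_derivative_compose[OF bounded_linear_imp_has_derivative[OF bounded_linear_cvec]
            holomorphic_field_derivative[OF that(1) p(1)]])
    then have "(W has_derivative (\<lambda>v. dd Wc (cvec p) (cvec v))) (at p)"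
      by (rule has_derivative_transform_within_open[OF _ open_ball p(2)]) (simp add: that(2))
    then show ?thesis using dd_eqI[of W "\<lambda>v. dd Wc (cvec p) (cvec v)" p "axis j 1"] by simp
  qed
  then show ?thesis using assms p by (simp add: lie_bracket_def)
qed

text \<open>Sections over M are only real analytic and satisfy the annihilation at real points. Both
  are extended, the annihilation is extended by the identity theorem, and Cartan's formula is
  applied to the extensions.\<close>

lemma real_bracket_curl:
  fixes X Y :: "real^'m \<Rightarrow> complex^'m"
  assumes "open U" "p \<in> U" "analytic_field U X" "analytic_field U Y"
    and "s > 0" "holomorphic_field (ball (cvec p) s) q"
    and zero: "\<And>x. x \<in> U \<Longrightarrow> x \<in> ball p s \<Longrightarrow> dotp (q (cvec x)) (X x) = 0"
      "\<And>x. x \<in> U \<Longrightarrow> x \<in> ball p s \<Longrightarrow> dotp (q (cvec x)) (Y x) = 0"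
  shows "dotp (q (cvec p)) (lie_bracket X Y p) = curl q (cvec p) (X p) (Y p)"
proof -
  obtain r1 Xc where X: "r1 > 0" "holomorphic_field (ball (cvec p) r1) Xc" "\<And>x. x \<in> ball p r1 \<Longrightarrow> Xc (cvec x) = X x"
    using analytic_field_extension[OF assms(3,2)] by blast
  obtain r2 Yc where Y: "r2 > 0" "holomorphic_field (ball (cvec p) r2) Yc" "\<And>x. x \<in> ball p r2 \<Longrightarrow> Yc (cvec x) = Y x"
    using analytic_field_extension[OF assms(4,2)] by blast
  obtain r3 where r3: "r3 > 0" "ball p r3 \<subseteq> U" using assms(1,2) open_contains_ball by blast
  define r where "r = min (min r1 r2) (min r3 s)"
  have r: "r > 0" using X Y r3 assms(5) by (simp add: r_def)
  have le: "r \<le> r1" "r \<le> r2" "r \<le> r3" "r \<le> s" by (auto simp: r_def)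
  note sub = le[THEN subset_ball]
  let ?V = "ball (cvec p) r"
  note Xc = holomorphic_field_subset[OF X(2) sub(1)]
  note Yc = holomorphic_field_subset[OF Y(2) sub(2)]
  note q = holomorphic_field_subset[OF assms(6) sub(4)]
  have p: "cvec p \<in> ?V" "p \<in> ball p r" using r by auto
  have zero_c: "dotp (q z) (Wc z) = 0"
    if "holomorphic_field ?V Wc" "\<And>x. x \<in> ball p r \<Longrightarrow> dotp (q (cvec x)) (Wc (cvec x)) = 0" "z \<in> ?V" for Wc z
    by (rule hol_zero_real[OF open_ball convex_ball hol_dotp[OF q that(1)] p(1) r that(2,3)])
  have 1: "dotp (q z) (Xc z) = 0" if "z \<in> ?V" for z
    by (rule zero_c[OF Xc _ that]) (use X(3) zero(1) le r3 in \<open>auto simp: subset_iff\<close>)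
  have 2: "dotp (q z) (Yc z) = 0" if "z \<in> ?V" for z
    by (rule zero_c[OF Yc _ that]) (use Y(3) zero(2) le r3 in \<open>auto simp: subset_iff\<close>)
  have "lie_bracket X Y p = lie_bracket Xc Yc (cvec p)"
    by (rule lie_bracket_cvec[OF r Xc Yc]) (use X(3) Y(3) le in auto)
  then show ?thesis
    using dotp_lie_bracket[OF open_ball q Xc Yc 1 2 p(1)] X(3)[of p] Y(3)[of p] X(1) Y(1) by simp
qed

lemma analytic_field_cnjv:
  fixes X :: "real^'m \<Rightarrow> complex^'m"
  assumes "analytic_field U X" "open U"
  shows "analytic_field U (\<lambda>x. cnjv (X x))"
  unfolding analytic_field_def real_analytic_on_def
proof (intro allI ballI)
  fix i p assume p: "p \<in> U"
  obtain c :: "('m \<Rightarrow> nat) \<Rightarrow> complex" and e where e: "e > 0" "\<And>x. x \<in> ball p e \<Longrightarrow>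
      ((\<lambda>\<alpha>. c \<alpha> * (\<Prod>i\<in>UNIV. complex_of_real (x $ i - p $ i) ^ \<alpha> i)) has_sum X x $ i) UNIV"
    using assms(1) p unfolding analytic_field_def real_analytic_on_def by blast
  have "((\<lambda>\<alpha>. cnj (c \<alpha>) * (\<Prod>i\<in>UNIV. complex_of_real (x $ i - p $ i) ^ \<alpha> i)) has_sum cnjv (X x) $ i) UNIV"
    if "x \<in> ball p e" for x
  proof -
    have "((\<lambda>\<alpha>. cnj (c \<alpha> * (\<Prod>i\<in>UNIV. complex_of_real (x $ i - p $ i) ^ \<alpha> i))) has_sum cnj (X x $ i)) UNIV"
      by (rule has_sum_cnj_iff[THEN iffD2, OF e(2)[OF that]])
    moreover have "cnj (c \<alpha> * (\<Prod>i\<in>UNIV. complex_of_real (x $ i - p $ i) ^ \<alpha> i)) =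
        cnj (c \<alpha>) * (\<Prod>i\<in>UNIV. complex_of_real (x $ i - p $ i) ^ \<alpha> i)" for \<alpha>
      by (simp only: complex_cnj_mult cnj_prod complex_cnj_power complex_cnj_complex_of_real)
    ultimately show ?thesis by (simp only: cnjv_nth)
  qed
  then show "\<exists>c. \<exists>e>0. \<forall>x\<in>ball p e.
      ((\<lambda>\<alpha>. c \<alpha> * (\<Prod>i\<in>UNIV. complex_of_real (x $ i - p $ i) ^ \<alpha> i)) has_sum cnjv (X x) $ i) UNIV"
    using e(1) by (intro exI[of _ "\<lambda>\<alpha>. cnj (c \<alpha>)"] exI[of _ e] conjI ballI)
qed

lemma lie_bracket_cnjv:
  fixes X Y :: "real^'m \<Rightarrow> complex^'m"
  assumes "analytic_field U X" "analytic_field U Y" "p \<in> U"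
  shows "lie_bracket (\<lambda>x. cnjv (X x)) (\<lambda>x. cnjv (Y x)) p = cnjv (lie_bracket X Y p)"
proof -
  obtain r1 Xc where X: "r1 > 0" "holomorphic_field (ball (cvec p) r1) Xc" "\<And>x. x \<in> ball p r1 \<Longrightarrow> Xc (cvec x) = X x"
    using analytic_field_extension[OF assms(1,3)] by blast
  obtain r2 Yc where Y: "r2 > 0" "holomorphic_field (ball (cvec p) r2) Yc" "\<And>x. x \<in> ball p r2 \<Longrightarrow> Yc (cvec x) = Y x"
    using analytic_field_extension[OF assms(2,3)] by blast
  define r where "r = min r1 r2"
  have r: "r > 0" using X Y by (simp add: r_def)
  have le: "r \<le> r1" "r \<le> r2" by (auto simp: r_def)
  note sub = le[THEN subset_ball]
  note Xc = holomorphic_field_subset[OF X(2) sub(1)]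
  note Yc = holomorphic_field_subset[OF Y(2) sub(2)]
  note tau = holomorphic_field_tau_field[of _ _ "ball (cvec p) r", unfolded cnjv_image_ball, OF _ order_refl]
  have "lie_bracket X Y p = lie_bracket Xc Yc (cvec p)"
    by (rule lie_bracket_cvec[OF r Xc Yc]) (use X(3) Y(3) le in auto)
  moreover have "lie_bracket (\<lambda>x. cnjv (X x)) (\<lambda>x. cnjv (Y x)) p = lie_bracket (tau_field Xc) (tau_field Yc) (cvec p)"
    by (rule lie_bracket_cvec[OF r tau[OF Xc] tau[OF Yc]]) (use X(3) Y(3) le in auto)
  ultimately show ?thesis using lie_bracket_tau_field[OF Xc Yc, of "cvec p"] r by simp
qed

section \<open>Frames and dual frames at a point\<close>

lemma cnjv_span: "cnjv ` vec.span (f ` {..<n}) = vec.span ((\<lambda>j. cnjv (f j)) ` {..<n::nat})"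
proof (intro equalityI subsetI)
  fix v assume "v \<in> cnjv ` vec.span (f ` {..<n})"
  then obtain c where "v = cnjv (\<Sum>j<n. c j *s f j)" by (auto simp: span_lessThan)
  then have "v = (\<Sum>j<n. cnj (c j) *s cnjv (f j))" by (simp add: cnjv_sum)
  then show "v \<in> vec.span ((\<lambda>j. cnjv (f j)) ` {..<n})"
    unfolding span_lessThan by (intro exI[of _ "\<lambda>j. cnj (c j)"])
next
  fix v assume "v \<in> vec.span ((\<lambda>j. cnjv (f j)) ` {..<n})"
  then obtain c where "v = (\<Sum>j<n. c j *s cnjv (f j))" by (auto simp: span_lessThan)
  then have "v = cnjv (\<Sum>j<n. cnj (c j) *s f j)" by (simp add: cnjv_sum)
  then show "v \<in> cnjv ` vec.span (f ` {..<n})"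
    by (intro image_eqI[of v]) (auto simp: span_lessThan)
qed

text \<open>The coordinates of v in the frame are its pairings with the coframe, so a span of frame
  members is cut out by the other coordinates. The selection s is general because the conjugate of H
  occupies the places n to 2 n - 1.\<close>

lemma dual_span:
  fixes f q :: "nat \<Rightarrow> complex^'m" and s :: "nat \<Rightarrow> nat"
  assumes dual: "\<And>i j. i < N \<Longrightarrow> j < N \<Longrightarrow> dotp (q i) (f j) = (if i = j then 1 else 0)"
    and expand: "\<And>v. v = (\<Sum>j<N. dotp (q j) v *s f j)"
    and s: "inj_on s {..<d}" "s ` {..<d} \<subseteq> {..<N}"
  shows "v \<in> vec.span ((\<lambda>j. f (s j)) ` {..<d}) \<longleftrightarrow> (\<forall>j<N. j \<notin> s ` {..<d} \<longrightarrow> dotp (q j) v = 0)"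
proof
  assume "v \<in> vec.span ((\<lambda>j. f (s j)) ` {..<d})"
  then obtain c where v: "v = (\<Sum>j<d. c j *s f (s j))" unfolding span_lessThan by blast
  show "\<forall>j<N. j \<notin> s ` {..<d} \<longrightarrow> dotp (q j) v = 0"
  proof (intro allI impI)
    fix i assume i: "i < N" "i \<notin> s ` {..<d}"
    have "dotp (q i) (f (s j)) = 0" if "j < d" for j
    proof -
      have "s j < N" "i \<noteq> s j" using s(2) i(2) that by (auto simp: image_subset_iff)
      then show ?thesis using dual[OF i(1)] by simp
    qed
    then show "dotp (q i) v = 0" by (simp add: v dotp_sum dotp_simps)
  qed
next
  assume z: "\<forall>j<N. j \<notin> s ` {..<d} \<longrightarrow> dotp (q j) v = 0"
  have "v = (\<Sum>j<N. dotp (q j) v *s f j)" by (rule expand)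
  also have "\<dots> = (\<Sum>j\<in>s ` {..<d}. dotp (q j) v *s f j)"
    by (rule sum.mono_neutral_right) (use s z in auto)
  also have "\<dots> = (\<Sum>j<d. dotp (q (s j)) v *s f (s j))"
    using sum.reindex[OF s(1), of "\<lambda>j. dotp (q j) v *s f j"] by (simp add: o_def)
  finally show "v \<in> vec.span ((\<lambda>j. f (s j)) ` {..<d})"
    unfolding span_lessThan by (intro exI[of _ "\<lambda>j. dotp (q (s j)) v"])
qed

lemma dual_span_lessThan:
  fixes f q :: "nat \<Rightarrow> complex^'m"
  assumes "\<And>i j. i < N \<Longrightarrow> j < N \<Longrightarrow> dotp (q i) (f j) = (if i = j then 1 else 0)"
    and "\<And>v. v = (\<Sum>j<N. dotp (q j) v *s f j)" and "d \<le> N"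
  shows "v \<in> vec.span (f ` {..<d}) \<longleftrightarrow> (\<forall>j\<in>{d..<N}. dotp (q j) v = 0)"
proof -
  have "v \<in> vec.span (f ` {..<d}) \<longleftrightarrow> (\<forall>j<N. j \<notin> (\<lambda>j. j) ` {..<d} \<longrightarrow> dotp (q j) v = 0)"
    using dual_span[OF assms(1,2), of "\<lambda>j. j" d v] assms(3) by auto
  then show ?thesis by auto
qed

lemma dual_indep:
  fixes f q :: "nat \<Rightarrow> complex^'m"
  assumes "\<And>i j. i < N \<Longrightarrow> j < N \<Longrightarrow> dotp (q i) (f j) = (if i = j then 1 else 0)"
  shows "indep N f"
  unfolding indep_def
proof (intro allI impI)
  fix c i assume c: "(\<Sum>j<N. c j *s f j) = 0" and i: "i < N"
  have "0 = dotp (q i) (\<Sum>j<N. c j *s f j)" by (simp add: c dotp_simps)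
  also have "\<dots> = (\<Sum>j<N. if i = j then c j else 0)"
    unfolding dotp_sum dotp_simps by (intro sum.cong) (use assms i in auto)
  finally show "c i = 0" using i by simp
qed

lemma vec_span_singleton: "v \<in> vec.span {w :: complex^'m} \<longleftrightarrow> (\<exists>c. v = c *s w)"
  by (auto simp: vec.span_singleton)

text \<open>For square matrices, independent rows and a trivial null space both mean
  invertibility.\<close>

lemma indep_iff_kernel:
  fixes X :: "nat \<Rightarrow> complex^'m"
  shows "indep CARD('m) X \<longleftrightarrow> (\<forall>v. (\<forall>i<CARD('m). dotp (X i) v = 0) \<longrightarrow> v = 0)"
proof -
  obtain \<sigma> where \<sigma>: "bij_betw \<sigma> (UNIV::'m set) {..<CARD('m)}"
    using finite_same_card_bij[of "UNIV::'m set" "{..<CARD('m)}"] by auto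
  have \<sigma>_ex: "\<exists>k. i = \<sigma> k" if "i < CARD('m)" for i using \<sigma> that by (auto simp: bij_betw_def)
  have \<sigma>l: "\<sigma> k < CARD('m)" for k using \<sigma> by (auto simp: bij_betw_def)
  define \<rho> where "\<rho> = the_inv_into UNIV \<sigma>"
  have \<rho>: "\<rho> (\<sigma> k) = k" for k using \<sigma> by (simp add: \<rho>_def bij_betw_def the_inv_into_f_f)
  define A where "A = (\<chi> k. X (\<sigma> k))"
  have "(\<forall>v. (\<forall>i<CARD('m). dotp (X i) v = 0) \<longrightarrow> v = 0) \<longleftrightarrow> (\<forall>v. A *v v = 0 \<longrightarrow> v = 0)"
  proof -
    have "A *v v = 0 \<longleftrightarrow> (\<forall>i<CARD('m). dotp (X i) v = 0)" for v
      using \<sigma>_ex \<sigma>l by (fastforce simp: vec_eq_iff matrix_vector_mult_def A_def dotp_def)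
    then show ?thesis by simp
  qed
  also have "\<dots> \<longleftrightarrow> (\<exists>B. B ** A = mat 1)" by (simp add: matrix_left_invertible_ker)
  also have "\<dots> \<longleftrightarrow> (\<exists>B. A ** B = mat 1)" by (simp add: matrix_left_right_inverse)
  also have "\<dots> \<longleftrightarrow> (\<forall>c. (\<Sum>k\<in>UNIV. c k *s X (\<sigma> k)) = 0 \<longrightarrow> (\<forall>k. c k = 0))"
    unfolding matrix_right_invertible_independent_rows by (simp add: row_def A_def)
  also have "\<dots> \<longleftrightarrow> indep CARD('m) X"
  proof
    assume L: "\<forall>c. (\<Sum>k\<in>UNIV. c k *s X (\<sigma> k)) = 0 \<longrightarrow> (\<forall>k. c k = 0)"
    show "indep CARD('m) X" unfolding indep_def
    proof (intro allI impI)
      fix c i assume c: "(\<Sum>j<CARD('m). c j *s X j) = 0" and i: "i < CARD('m)"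
      then have "(\<Sum>k\<in>UNIV. c (\<sigma> k) *s X (\<sigma> k)) = 0"
        using sum.reindex_bij_betw[OF \<sigma>, of "\<lambda>j. c j *s X j"] by simp
      then show "c i = 0" using L[rule_format, of "\<lambda>k. c (\<sigma> k)"] \<sigma>_ex[OF i] by auto
    qed
  next
    assume R: "indep CARD('m) X"
    show "\<forall>c. (\<Sum>k\<in>UNIV. c k *s X (\<sigma> k)) = 0 \<longrightarrow> (\<forall>k. c k = 0)"
    proof (intro allI impI)
      fix c k assume "(\<Sum>k\<in>UNIV. c k *s X (\<sigma> k)) = 0"
      then have "(\<Sum>j<CARD('m). c (\<rho> j) *s X j) = 0"
        using sum.reindex_bij_betw[OF \<sigma>, of "\<lambda>j. c (\<rho> j) *s X j"] by (simp add: \<rho>)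
      then show "c k = 0" using indepD[OF R, of "\<lambda>j. c (\<rho> j)" "\<sigma> k"] \<sigma>l by (simp add: \<rho>)
    qed
  qed
  finally show ?thesis by blast
qed

section \<open>Adapted frames of a CR structure\<close>

lemma sum_lessThan_add: "(\<Sum>j<n + k. g j) = (\<Sum>j<n. g j) + (\<Sum>j<k::nat. g (n + j) :: 'b::comm_monoid_add)"
  by (induction k) (auto simp: add.assoc)

lemma set_plus_iff: "v \<in> A + B \<longleftrightarrow> (\<exists>a\<in>A. \<exists>b\<in>B. v = a + b)"
  by (simp add: set_plus_def)

lemma analytic_field_subset: "analytic_field U X \<Longrightarrow> V \<subseteq> U \<Longrightarrow> analytic_field V X"
  unfolding analytic_field_def real_analytic_on_def by blast

text \<open>A holomorphic frame F adapted to the CR structure: a frame E of H, its image under the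
  involution, and one transversal field at the last place. Q is the dual coframe. The frame of H is
  tied to the structure at real points only.\<close>

locale levi_frame =
  fixes M :: "(real^'m) set" and H :: "real^'m \<Rightarrow> (complex^'m) set" and n :: nat and p0 :: "real^'m"
    and r :: real and E F Q :: "nat \<Rightarrow> complex^'m \<Rightarrow> complex^'m"
  assumes cr: "cr_structure n M H" and r: "r > 0" and ball_M: "ball p0 r \<subseteq> M"
    and holF: "\<And>j. j < 2 * n + 1 \<Longrightarrow> holomorphic_field (ball (cvec p0) r) (F j)"
    and holQ: "\<And>j. j < 2 * n + 1 \<Longrightarrow> holomorphic_field (ball (cvec p0) r) (Q j)"
    and F_E: "\<And>j. j < n \<Longrightarrow> F j = E j" and F_tau: "\<And>j. j < n \<Longrightarrow> F (n + j) = tau_field (E j)"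
    and dual: "\<And>i j z. i < 2 * n + 1 \<Longrightarrow> j < 2 * n + 1 \<Longrightarrow> z \<in> ball (cvec p0) r \<Longrightarrow>
      dotp (Q i z) (F j z) = (if i = j then 1 else 0)"
    and expand: "\<And>z v. z \<in> ball (cvec p0) r \<Longrightarrow> v = (\<Sum>j<2 * n + 1. dotp (Q j z) v *s F j z)"
    and H_span: "\<And>x. x \<in> ball p0 r \<Longrightarrow> H x = vec.span ((\<lambda>j. E j (cvec x)) ` {..<n})"
begin

abbreviation \<Omega> where "\<Omega> \<equiv> ball (cvec p0) r"
abbreviation B where "B \<equiv> ball p0 r"

definition Hs where "Hs z = vec.span ((\<lambda>j. E j z) ` {..<n})"
definition Hb where "Hb z = vec.span ((\<lambda>j. tau_field (E j) z) ` {..<n})"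

text \<open>The form annihilating H + bar H; its exterior derivative represents the Levi form. It is
  not normalised to be real, so conjugation symmetry is recovered through its kernel at real
  points.\<close>

abbreviation \<theta> where "\<theta> \<equiv> Q (2 * n)"

lemma hol\<theta>: "holomorphic_field \<Omega> \<theta>" by (rule holQ) simp

lemma holE: "j < n \<Longrightarrow> holomorphic_field \<Omega> (E j)"
  using holF[of j] F_E[of j] by simp

lemma hol_tauE: "j < n \<Longrightarrow> holomorphic_field \<Omega> (tau_field (E j))"
  using holF[of "n + j"] F_tau[of j] by simp

lemma mem_Hs: "z \<in> \<Omega> \<Longrightarrow> v \<in> Hs z \<longleftrightarrow> (\<forall>j\<in>{n..<2 * n + 1}. dotp (Q j z) v = 0)"
proof -
  assume z: "z \<in> \<Omega>"
  have "Hs z = vec.span ((\<lambda>j. F j z) ` {..<n})"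
    unfolding Hs_def by (rule arg_cong[where f=vec.span], rule image_cong) (auto simp: F_E)
  then show ?thesis
    using dual_span_lessThan[of "2 * n + 1" "\<lambda>j. Q j z" "\<lambda>j. F j z" n v] dual[OF _ _ z] expand[OF z] by auto
qed

lemma mem_Hb: "z \<in> \<Omega> \<Longrightarrow> v \<in> Hb z \<longleftrightarrow> (\<forall>j<n. dotp (Q j z) v = 0) \<and> dotp (\<theta> z) v = 0"
proof -
  assume z: "z \<in> \<Omega>"
  have "Hb z = vec.span ((\<lambda>j. F (n + j) z) ` {..<n})"
    unfolding Hb_def by (rule arg_cong[where f=vec.span], rule image_cong) (auto simp: F_tau)
  moreover have "v \<in> vec.span ((\<lambda>j. F (n + j) z) ` {..<n}) \<longleftrightarrow>
      (\<forall>j<2 * n + 1. j \<notin> (\<lambda>j. n + j) ` {..<n} \<longrightarrow> dotp (Q j z) v = 0)"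
    by (rule dual_span[where f="\<lambda>j. F j z"]) (use dual[OF _ _ z] expand[OF z] in auto)
  moreover have "j \<notin> (\<lambda>j. n + j) ` {..<n} \<longleftrightarrow> j < n \<or> j = 2 * n" if "j < 2 * n + 1" for j
  proof -
    have "j \<in> (\<lambda>j. n + j) ` {..<n} \<longleftrightarrow> n \<le> j \<and> j < 2 * n"
      by (auto simp: image_iff intro!: bexI[of _ "j - n"])
    then show ?thesis using that by auto
  qed
  ultimately show ?thesis by auto
qed

lemma Hs_Hb: "z \<in> \<Omega> \<Longrightarrow> v \<in> Hs z \<Longrightarrow> v \<in> Hb z \<Longrightarrow> v = 0"
proof -
  assume z: "z \<in> \<Omega>" and v: "v \<in> Hs z" "v \<in> Hb z"
  have "dotp (Q j z) v = 0" if "j < 2 * n + 1" for j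
    using v that by (cases "j < n") (auto simp: mem_Hs[OF z] mem_Hb[OF z])
  then show "v = 0" using expand[OF z, of v] by simp
qed

lemma subspace_Hs: "vec.subspace (Hs z)" and subspace_Hb: "vec.subspace (Hb z)"
  by (auto simp: Hs_def Hb_def)

lemma theta_iff:
  assumes z: "z \<in> \<Omega>" shows "dotp (\<theta> z) v = 0 \<longleftrightarrow> (\<exists>a\<in>Hs z. \<exists>b\<in>Hb z. v = a + b)"
proof
  assume v: "dotp (\<theta> z) v = 0"
  define a where "a = (\<Sum>j<n. dotp (Q j z) v *s F j z)"
  have "a = (\<Sum>j<n. dotp (Q j z) v *s E j z)" by (simp add: a_def F_E)
  then have aH: "a \<in> Hs z" unfolding Hs_def span_lessThan by (intro exI[of _ "\<lambda>j. dotp (Q j z) v"])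
  have "dotp (Q i z) a = dotp (Q i z) v" if "i < n" for i
  proof -
    have "dotp (Q i z) a = (\<Sum>j<n. if i = j then dotp (Q j z) v else 0)"
      unfolding a_def dotp_sum dotp_simps by (intro sum.cong) (use dual[OF _ _ z] that in auto)
    then show ?thesis using that by simp
  qed
  moreover have "dotp (\<theta> z) a = 0" using aH mem_Hs[OF z] by auto
  ultimately have "v - a \<in> Hb z" using v by (simp add: mem_Hb[OF z] dotp_simps)
  then show "\<exists>a\<in>Hs z. \<exists>b\<in>Hb z. v = a + b" using aH by (intro bexI[of _ a] bexI[of _ "v - a"]) auto
next
  assume "\<exists>a\<in>Hs z. \<exists>b\<in>Hb z. v = a + b"
  then show "dotp (\<theta> z) v = 0" using mem_Hs[OF z] mem_Hb[OF z] by (auto simp: dotp_simps)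
qed

lemma theta_Hs: "z \<in> \<Omega> \<Longrightarrow> v \<in> Hs z \<Longrightarrow> dotp (\<theta> z) v = 0"
  and theta_Hb: "z \<in> \<Omega> \<Longrightarrow> v \<in> Hb z \<Longrightarrow> dotp (\<theta> z) v = 0"
  using mem_Hs mem_Hb by auto

lemma H_Hs: "x \<in> B \<Longrightarrow> H x = Hs (cvec x)"
  by (simp add: H_span Hs_def)

lemma cnjv_Hs: "cnjv ` Hs (cvec x) = Hb (cvec x)"
  unfolding Hs_def Hb_def cnjv_span by simp

lemma cnjv_mem: "cnjv v \<in> Hb (cvec x) \<longleftrightarrow> v \<in> Hs (cvec x)" "cnjv v \<in> Hs (cvec x) \<longleftrightarrow> v \<in> Hb (cvec x)"
proof -
  show "cnjv v \<in> Hb (cvec x) \<longleftrightarrow> v \<in> Hs (cvec x)" for v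
    unfolding cnjv_Hs[symmetric] by (metis cnjv_simps(1) image_iff)
  from this[of "cnjv v"] show "cnjv v \<in> Hs (cvec x) \<longleftrightarrow> v \<in> Hb (cvec x)" by simp
qed

lemma bar_H: "x \<in> B \<Longrightarrow> bar H x = Hb (cvec x)"
  by (simp add: bar_def H_Hs cnjv_Hs)

lemma H_plus_bar: "x \<in> B \<Longrightarrow> v \<in> H x + bar H x \<longleftrightarrow> dotp (\<theta> (cvec x)) v = 0"
  by (simp add: set_plus_iff H_Hs bar_H theta_iff)

lemma cnj_theta:
  assumes x: "x \<in> B" shows "dotp (\<theta> (cvec x)) (cnjv v) = 0 \<longleftrightarrow> dotp (\<theta> (cvec x)) v = 0"
proof -
  have *: "dotp (\<theta> (cvec x)) (cnjv v) = 0" if "dotp (\<theta> (cvec x)) v = 0" for v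
  proof -
    have z: "cvec x \<in> \<Omega>" using x by simp
    from that obtain a b where ab: "a \<in> Hs (cvec x)" "b \<in> Hb (cvec x)" "v = a + b"
      using theta_iff[OF z] by blast
    have "cnjv b \<in> Hs (cvec x)" "cnjv a \<in> Hb (cvec x)" "cnjv v = cnjv b + cnjv a"
      using ab by (auto simp: cnjv_mem)
    then show ?thesis using theta_iff[OF z] by blast
  qed
  show ?thesis using *[of v] *[of "cnjv v"] by auto
qed

lemma row_bracket:
  assumes q: "holomorphic_field \<Omega> q" and x: "x \<in> B" and U: "open U" "x \<in> U"
    and X: "analytic_field U X" "\<And>y. y \<in> U \<Longrightarrow> y \<in> B \<Longrightarrow> dotp (q (cvec y)) (X y) = 0"
    and Y: "analytic_field U Y" "\<And>y. y \<in> U \<Longrightarrow> y \<in> B \<Longrightarrow> dotp (q (cvec y)) (Y y) = 0"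
  shows "dotp (q (cvec x)) (lie_bracket X Y x) = curl q (cvec x) (X x) (Y x)"
proof -
  define s where "s = r - dist p0 x"
  have s: "s > 0" using x by (simp add: s_def)
  have "ball (cvec x) s \<subseteq> \<Omega>" by (rule ball_subset_ball_iff[THEN iffD2]) (auto simp: s_def dist_commute)
  note q' = holomorphic_field_subset[OF q this]
  have "ball x s \<subseteq> B" by (rule ball_subset_ball_iff[THEN iffD2]) (auto simp: s_def dist_commute)
  then show ?thesis by (intro real_bracket_curl[OF U X(1) Y(1) s q']) (use X(2) Y(2) in auto)
qed

lemma local_section_real:
  assumes "holomorphic_field \<Omega> X" "\<And>y. y \<in> B \<Longrightarrow> X (cvec y) \<in> D y" "x \<in> B"
  shows "(\<lambda>y. X (cvec y)) \<in> local_sections analytic_field M D x"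
  unfolding local_sections_def
  using assms ball_M holomorphic_field_analytic[OF open_ball assms(1), of B]
  by (intro CollectI exI[of _ B]) auto

lemma section_Hs:
  assumes "z \<in> \<Omega>" "v \<in> Hs z"
  obtains X where "holomorphic_field \<Omega> X" "X z = v" "\<And>w. X w \<in> Hs w"
proof -
  obtain c where "v = (\<Sum>j<n. c j *s E j z)" using assms(2) unfolding Hs_def span_lessThan by blast
  moreover have "(\<Sum>j<n. c j *s E j w) \<in> Hs w" for w unfolding Hs_def span_lessThan by blast
  moreover have "holomorphic_field \<Omega> (\<lambda>w. \<Sum>j<n. c j *s E j w)"
    by (intro holomorphic_field_sum holomorphic_field_smult hol_const holE) simp
  ultimately show thesis by (intro that[of "\<lambda>w. \<Sum>j<n. c j *s E j w"]) auto
qed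

lemma local_sectionsD:
  assumes "X \<in> local_sections analytic_field M D x" "Y \<in> local_sections analytic_field M D' x" "x \<in> B"
  obtains U where "open U" "x \<in> U" "U \<subseteq> B" "analytic_field U X" "analytic_field U Y"
    "\<And>y. y \<in> U \<Longrightarrow> X y \<in> D y" "\<And>y. y \<in> U \<Longrightarrow> Y y \<in> D' y"
proof -
  obtain U1 where U1: "open U1" "x \<in> U1" "analytic_field U1 X" "\<forall>y\<in>U1. X y \<in> D y"
    using assms(1) unfolding local_sections_def by blast
  obtain U2 where U2: "open U2" "x \<in> U2" "analytic_field U2 Y" "\<forall>y\<in>U2. Y y \<in> D' y"
    using assms(2) unfolding local_sections_def by blast
  show thesis
    by (rule that[of "U1 \<inter> U2 \<inter> B"])
       (use U1 U2 assms(3) in \<open>auto intro: analytic_field_subset\<close>)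
qed

text \<open>By Cartan's formula the class of the bracket depends only on the values at x, so all
  pairs of sections in the definition yield the same coset, namely a level set of \<theta>.\<close>

lemma levi_form_eq:
  assumes x: "x \<in> B" and v: "v \<in> H x" and w: "w \<in> H x"
  shows "levi_form M H x v w = {u. dotp (\<theta> (cvec x)) u = \<i> / 2 * curl \<theta> (cvec x) v (cnjv w)}"
proof -
  have br: "dotp (\<theta> (cvec x)) (lie_bracket X (\<lambda>y. cnjv (Y y)) x) = curl \<theta> (cvec x) (X x) (cnjv (Y x))"
    if XY: "X \<in> local_sections analytic_field M H x" "Y \<in> local_sections analytic_field M H x" for X Y
  proof -
    obtain U where U: "open U" "x \<in> U" "U \<subseteq> B" "analytic_field U X" "analytic_field U Y"
      "\<And>y. y \<in> U \<Longrightarrow> X y \<in> H y" "\<And>y. y \<in> U \<Longrightarrow> Y y \<in> H y"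
      using local_sectionsD[OF XY x] by metis
    have "dotp (\<theta> (cvec y)) (X y) = 0" "dotp (\<theta> (cvec y)) (cnjv (Y y)) = 0" if "y \<in> U" for y
      using U(3,6,7) that theta_Hs[of "cvec y"] by (auto simp: H_Hs cnj_theta subset_iff)
    then show ?thesis
      by (intro row_bracket[OF hol\<theta> x U(1,2,4) _ analytic_field_cnjv[OF U(5,1)]]) auto
  qed
  obtain X where X: "holomorphic_field \<Omega> X" "X (cvec x) = v" "\<And>z. X z \<in> Hs z"
    using section_Hs[of "cvec x" v] x v by (auto simp: H_Hs)
  obtain Y where Y: "holomorphic_field \<Omega> Y" "Y (cvec x) = w" "\<And>z. Y z \<in> Hs z"
    using section_Hs[of "cvec x" w] x w by (auto simp: H_Hs)
  have S: "(\<lambda>y. X (cvec y)) \<in> local_sections analytic_field M H x" "(\<lambda>y. Y (cvec y)) \<in> local_sections analytic_field M H x"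
    using local_section_real[OF X(1) _ x, of H] local_section_real[OF Y(1) _ x, of H] X(3) Y(3) by (auto simp: H_Hs)
  show ?thesis
  proof (intro set_eqI iffI)
    fix u assume "u \<in> levi_form M H x v w"
    then obtain X Y where XY: "X \<in> local_sections analytic_field M H x" "Y \<in> local_sections analytic_field M H x"
      "X x = v" "Y x = w" "u - (\<i> / 2) *s lie_bracket X (\<lambda>x. cnjv (Y x)) x \<in> H x + bar H x"
      unfolding levi_form_def by blast
    then show "u \<in> {u. dotp (\<theta> (cvec x)) u = \<i> / 2 * curl \<theta> (cvec x) v (cnjv w)}"
      using br[OF XY(1,2)] by (simp add: H_plus_bar[OF x] dotp_simps)
  next
    fix u assume "u \<in> {u. dotp (\<theta> (cvec x)) u = \<i> / 2 * curl \<theta> (cvec x) v (cnjv w)}"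
    then have "u - (\<i> / 2) *s lie_bracket (\<lambda>y. X (cvec y)) (\<lambda>y. cnjv (Y (cvec y))) x \<in> H x + bar H x"
      using br[OF S] X(2) Y(2) by (simp add: H_plus_bar[OF x] dotp_simps)
    then show "u \<in> levi_form M H x v w"
      unfolding levi_form_def using X(2) Y(2)
      by (intro CollectI bexI[OF _ S(1)] bexI[OF _ S(2)] conjI) simp_all
  qed
qed

lemma levi_kernel_iff:
  assumes x: "x \<in> B"
  shows "v \<in> levi_kernel M H x \<longleftrightarrow> v \<in> H x \<and> (\<forall>w\<in>H x. curl \<theta> (cvec x) v (cnjv w) = 0)"
proof -
  have sum: "H x + bar H x = {u. dotp (\<theta> (cvec x)) u = 0}" using H_plus_bar[OF x] by blast
  have "levi_form M H x v w = H x + bar H x \<longleftrightarrow> curl \<theta> (cvec x) v (cnjv w) = 0"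
    if "v \<in> H x" "w \<in> H x" for w
  proof
    assume "levi_form M H x v w = H x + bar H x"
    then have "0 \<in> {u. dotp (\<theta> (cvec x)) u = \<i> / 2 * curl \<theta> (cvec x) v (cnjv w)}"
      unfolding levi_form_eq[OF x that] sum by (simp add: dotp_simps)
    then show "curl \<theta> (cvec x) v (cnjv w) = 0" by (simp add: dotp_simps)
  qed (simp add: levi_form_eq[OF x that] sum)
  then show ?thesis unfolding levi_kernel_def by blast
qed

lemma curl_zero_real:
  assumes "holomorphic_field \<Omega> q" "holomorphic_field \<Omega> X" "holomorphic_field \<Omega> Y"
    and "\<And>x. x \<in> B \<Longrightarrow> curl q (cvec x) (X (cvec x)) (Y (cvec x)) = 0" "z \<in> \<Omega>"
  shows "curl q z (X z) (Y z) = 0"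
  by (rule hol_zero_real[OF open_ball convex_ball hol_curl[OF open_ball assms(1,2,3)] _ r assms(4,5)])
     (use r in auto)

lemma curl_sum_left:
  assumes "holomorphic_field \<Omega> q" "z \<in> \<Omega>"
  shows "curl q z (\<Sum>i\<in>I. f i) v = (\<Sum>i\<in>I. curl q z (f i) v)"
  using curl_sum_right[OF assms, of v f I] by (simp add: curl_anti[of q z _ v] sum_negf)

lemma curl_span_right:
  assumes "holomorphic_field \<Omega> q" "z \<in> \<Omega>" "\<And>j. j < k \<Longrightarrow> curl q z u (f j) = 0" "v \<in> vec.span (f ` {..<k::nat})"
  shows "curl q z u v = 0"
proof -
  obtain c where "v = (\<Sum>j<k. c j *s f j)" using assms(4) unfolding span_lessThan by blast
  then show ?thesis
    using assms(3) by (simp add: curl_sum_right[OF assms(1,2)] curl_bilinear[OF assms(1,2)])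
qed

lemma curl_span_left:
  assumes "holomorphic_field \<Omega> q" "z \<in> \<Omega>" "\<And>j. j < k \<Longrightarrow> curl q z (f j) u = 0" "v \<in> vec.span (f ` {..<k::nat})"
  shows "curl q z v u = 0"
  using curl_span_right[OF assms(1,2) _ assms(4), of u] assms(3) curl_anti[of q z _ u] by simp

text \<open>Involutivity of H is given at real points. It yields the vanishing for pairs of frame
  fields there; the identity theorem extends it to the complex ball, and bilinearity to all
  vectors.\<close>

lemma curl_Hs_Hs:
  assumes j: "j \<in> {n..<2 * n + 1}" and z: "z \<in> \<Omega>" and uv: "u \<in> Hs z" "v \<in> Hs z"
  shows "curl (Q j) z u v = 0"
proof -
  have hq: "holomorphic_field \<Omega> (Q j)" using holQ j by simp
  have EE: "curl (Q j) z (E a z) (E b z) = 0" if ab: "a < n" "b < n" for a b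
  proof (rule curl_zero_real[OF hq holE[OF ab(1)] holE[OF ab(2)] _ z])
    fix x assume x: "x \<in> B"
    have EH: "E c (cvec y) \<in> H y" if "c < n" "y \<in> B" for c y
      using that by (auto simp: H_span intro!: vec.span_base)
    have S: "(\<lambda>y. E c (cvec y)) \<in> local_sections analytic_field M H x" if "c < n" for c
      by (rule local_section_real[OF holE[OF that] EH[OF that] x])
    have zero: "dotp (Q j (cvec y)) (E c (cvec y)) = 0" if "c < n" "y \<in> B" for c y
      using EH[OF that] that(2) j mem_Hs[of "cvec y"] by (simp add: H_Hs)
    have "lie_bracket (\<lambda>y. E a (cvec y)) (\<lambda>y. E b (cvec y)) x \<in> H x"
      using cr S ab x ball_M unfolding cr_structure_def involutive_def by blast
    then have "dotp (Q j (cvec x)) (lie_bracket (\<lambda>y. E a (cvec y)) (\<lambda>y. E b (cvec y)) x) = 0"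
      using x j mem_Hs[of "cvec x"] by (simp add: H_Hs)
    then show "curl (Q j) (cvec x) (E a (cvec x)) (E b (cvec x)) = 0"
      using row_bracket[OF hq x open_ball x holomorphic_field_analytic[OF open_ball holE[OF ab(1)]] zero[OF ab(1)]
          holomorphic_field_analytic[OF open_ball holE[OF ab(2)]] zero[OF ab(2)]] by simp
  qed
  show ?thesis
    by (rule curl_span_left[OF hq z curl_span_right[OF hq z EE] uv(1)[unfolded Hs_def]])
       (use uv(2) in \<open>simp_all add: Hs_def\<close>)
qed

lemma bracket_Hs:
  assumes "open V" "V \<subseteq> \<Omega>" "holomorphic_field V X" "holomorphic_field V Y"
    and "\<And>z. z \<in> V \<Longrightarrow> X z \<in> Hs z" "\<And>z. z \<in> V \<Longrightarrow> Y z \<in> Hs z" "z \<in> V"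
  shows "lie_bracket X Y z \<in> Hs z"
proof -
  have z: "z \<in> \<Omega>" using assms by blast
  have "dotp (Q j z) (lie_bracket X Y z) = 0" if j: "j \<in> {n..<2 * n + 1}" for j
  proof -
    have hq: "holomorphic_field V (Q j)" using holomorphic_field_subset[OF holQ assms(2)] j by simp
    have "dotp (Q j z) (lie_bracket X Y z) = curl (Q j) z (X z) (Y z)"
      by (rule dotp_lie_bracket[OF assms(1) hq assms(3,4) _ _ assms(7)])
         (use assms(2,5,6) j mem_Hs in blast)+
    then show ?thesis using curl_Hs_Hs[OF j z assms(5,6)[OF assms(7)]] by simp
  qed
  then show ?thesis using mem_Hs[OF z] by blast
qed

lemma section_theta:
  assumes "z \<in> \<Omega>" "dotp (\<theta> z) v = 0"
  obtains X where "holomorphic_field \<Omega> X" "X z = v" "\<And>w. w \<in> \<Omega> \<Longrightarrow> dotp (\<theta> w) (X w) = 0"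
proof (rule that[of "\<lambda>w. \<Sum>j<2 * n. dotp (Q j z) v *s F j w"])
  show "holomorphic_field \<Omega> (\<lambda>w. \<Sum>j<2 * n. dotp (Q j z) v *s F j w)"
    by (intro holomorphic_field_sum holomorphic_field_smult hol_const holF) auto
  show "(\<Sum>j<2 * n. dotp (Q j z) v *s F j z) = v"
    using expand[OF assms(1), of v] assms(2) by simp
  show "dotp (\<theta> w) (\<Sum>j<2 * n. dotp (Q j z) v *s F j w) = 0" if "w \<in> \<Omega>" for w
    using dual[OF _ _ that, of "2 * n"] by (simp add: dotp_sum dotp_simps)
qed

text \<open>As \<theta> is not real, the symmetry is read off from brackets: the bracket of
  conjugate sections is the conjugate bracket, and the kernel of \<theta> at a real point is
  invariant under conjugation.\<close>

lemma curl_cnj: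
  assumes x: "x \<in> B" and uv: "dotp (\<theta> (cvec x)) u = 0" "dotp (\<theta> (cvec x)) v = 0"
    and zero: "curl \<theta> (cvec x) u v = 0"
  shows "curl \<theta> (cvec x) (cnjv u) (cnjv v) = 0"
proof -
  have z: "cvec x \<in> \<Omega>" using x by simp
  obtain X where X: "holomorphic_field \<Omega> X" "X (cvec x) = u" "\<And>w. w \<in> \<Omega> \<Longrightarrow> dotp (\<theta> w) (X w) = 0"
    using section_theta[OF z uv(1)] by blast
  obtain Y where Y: "holomorphic_field \<Omega> Y" "Y (cvec x) = v" "\<And>w. w \<in> \<Omega> \<Longrightarrow> dotp (\<theta> w) (Y w) = 0"
    using section_theta[OF z uv(2)] by blast
  have aX: "analytic_field B (\<lambda>y. X (cvec y))" and aY: "analytic_field B (\<lambda>y. Y (cvec y))"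
    using holomorphic_field_analytic[OF open_ball X(1), of B] holomorphic_field_analytic[OF open_ball Y(1), of B] by auto
  have zX: "dotp (\<theta> (cvec y)) (X (cvec y)) = 0" and zY: "dotp (\<theta> (cvec y)) (Y (cvec y)) = 0" if "y \<in> B" for y
    using X(3) Y(3) that by auto
  have "dotp (\<theta> (cvec x)) (lie_bracket (\<lambda>y. X (cvec y)) (\<lambda>y. Y (cvec y)) x) = curl \<theta> (cvec x) (X (cvec x)) (Y (cvec x))"
    by (rule row_bracket[OF hol\<theta> x open_ball x aX zX aY zY])
  then have "dotp (\<theta> (cvec x)) (cnjv (lie_bracket (\<lambda>y. X (cvec y)) (\<lambda>y. Y (cvec y)) x)) = 0"
    using zero X(2) Y(2) cnj_theta[OF x] by simp
  moreover have "dotp (\<theta> (cvec x)) (lie_bracket (\<lambda>y. cnjv (X (cvec y))) (\<lambda>y. cnjv (Y (cvec y))) x) =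
      curl \<theta> (cvec x) (cnjv (X (cvec x))) (cnjv (Y (cvec x)))"
    by (rule row_bracket[OF hol\<theta> x open_ball x analytic_field_cnjv[OF aX open_ball] _ analytic_field_cnjv[OF aY open_ball]])
       (use zX zY cnj_theta in auto)
  ultimately show ?thesis using lie_bracket_cnjv[OF aX aY x] X(2) Y(2) by simp
qed

end

text \<open>The frame of H and its conjugate are jointly independent at p0: a relation between them
  gives a vector in H and bar H, hence zero, and each half is independent by itself.\<close>

lemma levi_frame_exists:
  fixes E :: "nat \<Rightarrow> complex^'m \<Rightarrow> complex^'m"
  assumes cr: "cr_structure n M H" and p0: "p0 \<in> M" and R: "R > 0"
    and holE: "\<And>j. j < n \<Longrightarrow> holomorphic_field (ball (cvec p0) R) (E j)"
    and HE: "\<And>x. x \<in> ball p0 R \<Longrightarrow> H x = vec.span ((\<lambda>j. E j (cvec x)) ` {..<n})"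
  obtains r F Q where "r \<le> R" "levi_frame M H n p0 r E F Q"
proof -
  have card: "CARD('m) = 2 * n + 1" and "open M" and cap: "H p0 \<inter> bar H p0 = {0}"
    using cr p0 by (auto simp: cr_structure_def)
  have "vec.dim (H p0) = n"
    using cr p0 unfolding cr_structure_def subbundle_def by blast
  then have indE: "indep n (\<lambda>j. E j (cvec p0))" using HE[of p0] R by (simp add: indep_iff_dim)
  obtain R' where R': "R' > 0" "ball p0 R' \<subseteq> M" using \<open>open M\<close> p0 open_contains_ball by blast
  define X where "X j = (if j < n then E j else tau_field (E (j - n)))" for j
  define R1 where "R1 = min R R'"
  have R1: "R1 > 0" "R1 \<le> R" "R1 \<le> R'" using R R' by (auto simp: R1_def)
  have holX: "holomorphic_field (ball (cvec p0) R1) (X j)" if "j < 2 * n" for j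
  proof (cases "j < n")
    case True
    then show ?thesis using holomorphic_field_subset[OF holE subset_ball[OF R1(2)]] by (simp add: X_def)
  next
    case False
    then have "j - n < n" using that by simp
    from holomorphic_field_tau_field[OF holE[OF this], of "ball (cvec p0) R1"]
    show ?thesis using False subset_ball[OF R1(2), of "cvec p0"] by (simp add: X_def cnjv_image_ball)
  qed
  have "indep (n + n) (\<lambda>j. X j (cvec p0))" unfolding indep_def
  proof (rule allI, rule impI)
    fix c assume "(\<Sum>j<n + n. c j *s X j (cvec p0)) = 0"
    then have s: "(\<Sum>j<n. c j *s E j (cvec p0)) + (\<Sum>j<n. c (n + j) *s cnjv (E j (cvec p0))) = 0"
      unfolding sum_lessThan_add by (simp add: X_def)
    define h where "h = (\<Sum>j<n. c j *s E j (cvec p0))"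
    define g where "g = (\<Sum>j<n. c (n + j) *s cnjv (E j (cvec p0)))"
    have H0: "H p0 = vec.span ((\<lambda>j. E j (cvec p0)) ` {..<n})" using HE R by simp
    have hH: "h \<in> H p0" unfolding H0 h_def span_lessThan by blast
    have "g \<in> bar H p0" unfolding bar_def H0 cnjv_span g_def span_lessThan
      by (intro exI[of _ "\<lambda>j. c (n + j)"]) simp
    moreover have hg: "h = - g" using s by (simp add: h_def g_def eq_neg_iff_add_eq_0)
    moreover have "vec.subspace (bar H p0)" unfolding bar_def H0 cnjv_span by simp
    ultimately have "h \<in> bar H p0" by (simp add: vec.subspace_neg)
    then have h0: "h = 0" using hH cap by blast
    then have g0: "g = 0" using hg by simp
    have c1: "c j = 0" if "j < n" for j using indepD[OF indE _ that, of c] h0 by (simp add: h_def)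
    have "(\<Sum>j<n. cnj (c (n + j)) *s E j (cvec p0)) = cnjv g" by (simp add: g_def cnjv_sum)
    then have c2: "c (n + j) = 0" if "j < n" for j
      using indepD[OF indE _ that, of "\<lambda>j. cnj (c (n + j))"] g0 by simp
    show "\<forall>j<n + n. c j = 0"
    proof (intro allI impI)
      fix j assume "j < n + n"
      then show "c j = 0" using c1[of j] c2[of "j - n"] by (cases "j < n") auto
    qed
  qed
  then have ind: "indep (2 * n) (\<lambda>j. X j (cvec p0))" by (simp add: mult_2)
  have p0R: "cvec p0 \<in> ball (cvec p0) R1" using R1 by simp
  obtain r F Q where r: "r > 0" "ball (cvec p0) r \<subseteq> ball (cvec p0) R1" and FX: "\<And>j. j < 2 * n \<Longrightarrow> F j = X j"
    and F: "\<And>j. j < CARD('m) \<Longrightarrow> holomorphic_field (ball (cvec p0) r) (F j)"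
    and Q: "\<And>j. j < CARD('m) \<Longrightarrow> holomorphic_field (ball (cvec p0) r) (Q j)"
    and dual: "\<And>i j z. i < CARD('m) \<Longrightarrow> j < CARD('m) \<Longrightarrow> z \<in> ball (cvec p0) r \<Longrightarrow>
       dotp (Q i z) (F j z) = (if i = j then 1 else 0)"
    and expand: "\<And>z v. z \<in> ball (cvec p0) r \<Longrightarrow> v = (\<Sum>j<CARD('m). dotp (Q j z) v *s F j z)"
    by (rule dual_frame[OF open_ball p0R holX ind]) (assumption, rule that)
  have rR1: "r \<le> R1" using r R1 by (simp add: ball_subset_ball_iff)
  show thesis
  proof (rule that[of r F Q])
    show "r \<le> R" using rR1 R1 by simp
    show "levi_frame M H n p0 r E F Q"
    proof
      show "ball p0 r \<subseteq> M" using rR1 R1(3) R'(2) subset_ball[of r R' p0] by auto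
      show "F j = E j" if "j < n" for j using FX[of j] that by (simp add: X_def)
      show "F (n + j) = tau_field (E j)" if "j < n" for j using FX[of "n + j"] that by (simp add: X_def)
      show "H x = vec.span ((\<lambda>j. E j (cvec x)) ` {..<n})" if "x \<in> ball p0 r" for x
        using HE rR1 R1(2) that by auto
      show "v = (\<Sum>j<2 * n + 1. dotp (Q j z) v *s F j z)" if "z \<in> ball (cvec p0) r" for z v
        using expand[OF that, of v] unfolding card .
    qed (use cr r F Q dual in \<open>simp_all add: card\<close>)
  qed
qed

section \<open>The Levi kernel and the operators ad\<close>

declare tau_field_cvec [simp del]

text \<open>A second frame G, adapted to H + bar K: the frame E of H, then
  \<open>tau_field k\<close> at place n, then a complement; P is its dual coframe. The field k spans
  the Levi kernel at real points, while on the complex ball it is known to be nonzero and in the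
  span of E.\<close>

locale levi_kernel_frame = levi_frame +
  fixes k :: "complex^'a \<Rightarrow> complex^'a" and G P :: "nat \<Rightarrow> complex^'a \<Rightarrow> complex^'a"
  assumes holk: "holomorphic_field (ball (cvec p0) r) k"
    and K_span: "\<And>x. x \<in> ball p0 r \<Longrightarrow> levi_kernel M H x = vec.span {k (cvec x)}"
    and k_nz: "\<And>z. z \<in> ball (cvec p0) r \<Longrightarrow> k z \<noteq> 0"
    and k_span: "\<And>z. z \<in> ball (cvec p0) r \<Longrightarrow> k z \<in> vec.span ((\<lambda>j. E j z) ` {..<n})"
    and holP: "\<And>j. j < 2 * n + 1 \<Longrightarrow> holomorphic_field (ball (cvec p0) r) (P j)"
    and G_E: "\<And>j. j < n \<Longrightarrow> G j = E j" and G_e: "G n = tau_field k"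
    and dualP: "\<And>i j z. i < 2 * n + 1 \<Longrightarrow> j < 2 * n + 1 \<Longrightarrow> z \<in> ball (cvec p0) r \<Longrightarrow>
      dotp (P i z) (G j z) = (if i = j then 1 else 0)"
    and expandP: "\<And>z v. z \<in> ball (cvec p0) r \<Longrightarrow> v = (\<Sum>j<2 * n + 1. dotp (P j z) v *s G j z)"
begin

abbreviation e where "e \<equiv> tau_field k"
abbreviation R where "R \<equiv> {Suc n..<2 * n + 1}"
abbreviation ad_row where "ad_row l z h \<equiv> curl (P l) z (e z) h"

lemma k_Hs: "z \<in> \<Omega> \<Longrightarrow> k z \<in> Hs z"
  using k_span by (simp add: Hs_def)

lemma n_pos: "n > 0"
proof (rule ccontr)
  assume "\<not> n > 0"
  then have "k (cvec p0) = 0" using k_span[of "cvec p0"] r by simp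
  then show False using k_nz[of "cvec p0"] r by simp
qed

lemma cnjv_\<Omega>: "z \<in> \<Omega> \<Longrightarrow> cnjv z \<in> \<Omega>"
  using cnjv_image_ball[of p0 r] by blast

lemma hole: "holomorphic_field \<Omega> e"
  by (rule holomorphic_field_tau_field[OF holk]) (simp add: cnjv_image_ball)

lemma e_nz: "z \<in> \<Omega> \<Longrightarrow> e z \<noteq> 0"
  using k_nz[OF cnjv_\<Omega>] unfolding tau_field_def by (metis cnjv_simps(1,5))

lemma e_Hb: assumes "z \<in> \<Omega>" shows "e z \<in> Hb z"
proof -
  obtain c where "k (cnjv z) = (\<Sum>j<n. c j *s E j (cnjv z))"
    using k_Hs[OF cnjv_\<Omega>[OF assms]] unfolding Hs_def span_lessThan by blast
  then have "e z = (\<Sum>j<n. cnj (c j) *s tau_field (E j) z)" by (simp add: tau_field_def cnjv_sum)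
  then show ?thesis unfolding Hb_def span_lessThan by (intro exI[of _ "\<lambda>j. cnj (c j)"])
qed

definition Ds where "Ds z = vec.span ((\<lambda>j. G j z) ` {..<Suc n})"

lemma subspace_Ds: "vec.subspace (Ds z)"
  by (simp add: Ds_def)

lemma mem_Ds: "z \<in> \<Omega> \<Longrightarrow> v \<in> Ds z \<longleftrightarrow> (\<forall>l\<in>R. dotp (P l z) v = 0)"
  unfolding Ds_def
  by (rule dual_span_lessThan) (use dualP expandP n_pos in auto)

lemma Ds_iff: "v \<in> Ds z \<longleftrightarrow> (\<exists>h\<in>Hs z. \<exists>c. v = h + c *s e z)"
proof
  assume "v \<in> Ds z"
  then obtain c where "v = (\<Sum>j<Suc n. c j *s G j z)" unfolding Ds_def span_lessThan by blast
  then have "v = (\<Sum>j<n. c j *s E j z) + c n *s e z" by (simp add: G_E G_e)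
  moreover have "(\<Sum>j<n. c j *s E j z) \<in> Hs z" unfolding Hs_def span_lessThan by blast
  ultimately show "\<exists>h\<in>Hs z. \<exists>c. v = h + c *s e z" by blast
next
  assume "\<exists>h\<in>Hs z. \<exists>c. v = h + c *s e z"
  then obtain h b where h: "h \<in> Hs z" "v = h + b *s e z" by blast
  then obtain c where "h = (\<Sum>j<n. c j *s E j z)" unfolding Hs_def span_lessThan by blast
  then have "v = (\<Sum>j<Suc n. (c(n := b)) j *s G j z)" using h(2) by (simp add: G_E G_e)
  then show "v \<in> Ds z" unfolding Ds_def span_lessThan by (intro exI[of _ "c(n := b)"])
qed

lemma Hs_Ds: "h \<in> Hs z \<Longrightarrow> h \<in> Ds z"
  unfolding Ds_iff by (intro bexI[of _ h] exI[of _ 0]) auto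

lemma e_Ds: "e z \<in> Ds z"
  unfolding Ds_iff using subspace_Hs[of z] by (intro bexI[of _ 0] exI[of _ 1]) (auto simp: vec.subspace_0)

lemma Hs_e: "z \<in> \<Omega> \<Longrightarrow> h \<in> Hs z \<Longrightarrow> h = c *s e z \<Longrightarrow> h = 0 \<and> c = 0"
  using Hs_Hb[of z h] e_Hb[of z] subspace_Hb[of z] e_nz[of z] by (auto simp: vec.subspace_scale)

lemma Ds_Hb: assumes z: "z \<in> \<Omega>" and v: "v \<in> Ds z" "v \<in> Hb z" shows "\<exists>c. v = c *s e z"
proof -
  obtain h c where h: "h \<in> Hs z" "v = h + c *s e z" using v(1) unfolding Ds_iff by blast
  have "h = v - c *s e z" using h by simp
  then have "h \<in> Hb z" using v(2) e_Hb[OF z] subspace_Hb[of z] by (simp add: vec.subspace_scale vec.subspace_diff)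
  then show ?thesis using Hs_Hb[OF z h(1)] h(2) by auto
qed

lemma levi_kernel_mem: "x \<in> B \<Longrightarrow> v \<in> levi_kernel M H x \<longleftrightarrow> (\<exists>c. v = c *s k (cvec x))"
  by (simp add: K_span vec_span_singleton)

lemma bar_kernel_mem: assumes "x \<in> B" shows "v \<in> bar (levi_kernel M H) x \<longleftrightarrow> (\<exists>c. v = c *s e (cvec x))"
proof
  assume "v \<in> bar (levi_kernel M H) x"
  then obtain u where u: "u \<in> levi_kernel M H x" "v = cnjv u" by (auto simp: bar_def)
  then obtain c where "u = c *s k (cvec x)" using levi_kernel_mem[OF assms] by blast
  then have "v = cnj c *s e (cvec x)" by (simp add: u(2) tau_field_cvec)
  then show "\<exists>c. v = c *s e (cvec x)" by blast
next
  assume "\<exists>c. v = c *s e (cvec x)"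
  then obtain c where "v = cnjv (cnj c *s k (cvec x))" by (auto simp: tau_field_cvec)
  then show "v \<in> bar (levi_kernel M H) x" unfolding bar_def using levi_kernel_mem[OF assms] by blast
qed

lemma curl_\<theta>_k: assumes z: "z \<in> \<Omega>" and v: "v \<in> Hb z" shows "curl \<theta> z (k z) v = 0"
proof (rule curl_span_right[OF hol\<theta> z _ v[unfolded Hb_def]])
  fix j assume j: "j < n"
  show "curl \<theta> z (k z) (tau_field (E j) z) = 0"
  proof (rule curl_zero_real[OF hol\<theta> holk hol_tauE[OF j] _ z])
    fix x assume x: "x \<in> B"
    have "k (cvec x) \<in> levi_kernel M H x" unfolding levi_kernel_mem[OF x] by (intro exI[of _ 1]) simp
    moreover have "E j (cvec x) \<in> H x" using j by (auto simp: H_span[OF x] intro!: vec.span_base)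
    ultimately show "curl \<theta> (cvec x) (k (cvec x)) (tau_field (E j) (cvec x)) = 0"
      using levi_kernel_iff[OF x, of "k (cvec x)"] by (simp add: tau_field_cvec)
  qed
qed

text \<open>The conjugate of \<open>curl_\<theta>_k\<close>. Conjugation is available only at real
  points, so the identity theorem is applied once more.\<close>

lemma curl_\<theta>_e: assumes z: "z \<in> \<Omega>" and v: "v \<in> Hs z" shows "curl \<theta> z (e z) v = 0"
proof (rule curl_span_right[OF hol\<theta> z _ v[unfolded Hs_def]])
  fix j assume j: "j < n"
  show "curl \<theta> z (e z) (E j z) = 0"
  proof (rule curl_zero_real[OF hol\<theta> hole holE[OF j] _ z])
    fix x assume x: "x \<in> B"
    then have zx: "cvec x \<in> \<Omega>" by simp
    have t: "tau_field (E j) (cvec x) \<in> Hb (cvec x)" using j by (auto simp: Hb_def intro!: vec.span_base)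
    have "curl \<theta> (cvec x) (cnjv (k (cvec x))) (cnjv (tau_field (E j) (cvec x))) = 0"
      by (rule curl_cnj[OF x theta_Hs[OF zx k_Hs[OF zx]] theta_Hb[OF zx t] curl_\<theta>_k[OF zx t]])
    then show "curl \<theta> (cvec x) (e (cvec x)) (E j (cvec x)) = 0" by (simp add: tau_field_cvec)
  qed
qed

lemma curl_P_Hs:
  assumes l: "l \<in> R" and z: "z \<in> \<Omega>" and uv: "u \<in> Hs z" "v \<in> Hs z" shows "curl (P l) z u v = 0"
proof -
  have hP: "holomorphic_field \<Omega> (P l)" using holP l by simp
  obtain X where X: "holomorphic_field \<Omega> X" "X z = u" "\<And>w. X w \<in> Hs w" using section_Hs[OF z uv(1)] by blast
  obtain Y where Y: "holomorphic_field \<Omega> Y" "Y z = v" "\<And>w. Y w \<in> Hs w" using section_Hs[OF z uv(2)] by blast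
  have "lie_bracket X Y z \<in> Hs z" by (rule bracket_Hs[OF open_ball order_refl X(1) Y(1) X(3) Y(3) z])
  then have "dotp (P l z) (lie_bracket X Y z) = 0" using mem_Ds[OF z] Hs_Ds l by blast
  moreover have "dotp (P l z) (lie_bracket X Y z) = curl (P l) z (X z) (Y z)"
    by (rule dotp_lie_bracket[OF open_ball hP X(1) Y(1) _ _ z]) (use mem_Ds Hs_Ds l X(3) Y(3) in blast)+
  ultimately show ?thesis by (simp add: X(2) Y(2))
qed

lemma curl_self: "curl q z u u = 0"
  by (simp add: curl_def)

text \<open>The source of the relation between the \<nu> and ad_e: the term in H and H vanishes by
  involutivity, the term in e and e by antisymmetry, and only the mixed terms remain.\<close>

lemma curl_P_Ds:
  assumes l: "l \<in> R" and z: "z \<in> \<Omega>" and h: "h1 \<in> Hs z" "h2 \<in> Hs z"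
  shows "curl (P l) z (h1 + c1 *s e z) (h2 + c2 *s e z) = c1 * ad_row l z h2 - c2 * ad_row l z h1"
proof -
  have hP: "holomorphic_field \<Omega> (P l)" using holP l by simp
  show ?thesis
    using curl_P_Hs[OF l z h] curl_anti[of "P l" z h1 "e z"]
    by (simp add: curl_bilinear[OF hP z] curl_self)
qed

text \<open>\<open>[K, K\<^sup>-] \<subseteq> H + K\<^sup>-\<close>, by the Jacobi identity.\<close>

lemma ad_row_k: assumes l: "l \<in> R" and z: "z \<in> \<Omega>" shows "ad_row l z (k z) = 0"
proof -
  have hP: "holomorphic_field \<Omega> (P l)" using holP l by simp
  define W where "W = lie_bracket k e"
  have holW: "holomorphic_field \<Omega> W" unfolding W_def by (rule holomorphic_field_lie_bracket[OF open_ball holk hole])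
  have \<theta>k: "dotp (\<theta> z) (k z) = 0" and \<theta>e: "dotp (\<theta> z) (e z) = 0" if "z \<in> \<Omega>" for z
    using theta_Hs[OF that k_Hs[OF that]] theta_Hb[OF that e_Hb[OF that]] by auto
  have \<theta>W: "dotp (\<theta> z) (W z) = 0" if "z \<in> \<Omega>" for z
  proof -
    have "dotp (\<theta> z) (lie_bracket k e z) = curl \<theta> z (k z) (e z)"
      by (rule dotp_lie_bracket[OF open_ball hol\<theta> holk hole \<theta>k \<theta>e that])
    then show ?thesis using curl_\<theta>_k[OF that e_Hb[OF that]] by (simp add: W_def)
  qed
  \<comment> \<open>By Jacobi, [W, E j] = [k, S] - [e, T] with S = [e, E j] and T = [k, E j]. Here S
    is killed by \<theta> and T lies in H, so \<theta> kills both brackets by the Levi degeneracy of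
    k and e.\<close>
  have WE: "curl \<theta> z (W z) (E j z) = 0" if j: "j < n" and z: "z \<in> \<Omega>" for j z
  proof -
    have E_Hs: "E j z \<in> Hs z" for z using j by (auto simp: Hs_def intro!: vec.span_base)
    have \<theta>E: "dotp (\<theta> z) (E j z) = 0" if "z \<in> \<Omega>" for z by (rule theta_Hs[OF that E_Hs])
    define S where "S = lie_bracket e (E j)"
    define T where "T = lie_bracket k (E j)"
    have holS: "holomorphic_field \<Omega> S" and holT: "holomorphic_field \<Omega> T"
      unfolding S_def T_def by (intro holomorphic_field_lie_bracket[OF open_ball] hole holk holE[OF j])+
    have \<theta>S: "dotp (\<theta> z) (S z) = 0" if "z \<in> \<Omega>" for z
    proof -
      have "dotp (\<theta> z) (lie_bracket e (E j) z) = curl \<theta> z (e z) (E j z)"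
        by (rule dotp_lie_bracket[OF open_ball hol\<theta> hole holE[OF j] \<theta>e \<theta>E that])
      then show ?thesis using curl_\<theta>_e[OF that E_Hs] by (simp add: S_def)
    qed
    have T_Hs: "T z \<in> Hs z" if "z \<in> \<Omega>" for z
      unfolding T_def by (rule bracket_Hs[OF open_ball order_refl holk holE[OF j] k_Hs E_Hs that])
    have "dotp (\<theta> z) (lie_bracket k S z) = curl \<theta> z (k z) (S z)"
      by (rule dotp_lie_bracket[OF open_ball hol\<theta> holk holS \<theta>k \<theta>S z])
    moreover have "curl \<theta> z (k z) (S z) = 0"
    proof -
      obtain a b where "a \<in> Hs z" "b \<in> Hb z" "S z = a + b" using \<theta>S[OF z] theta_iff[OF z] by blast
      then show ?thesis
        using curl_Hs_Hs[OF _ z k_Hs[OF z], of "2 * n"] curl_\<theta>_k[OF z] n_pos by (simp add: curl_bilinear[OF hol\<theta> z])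
    qed
    moreover have "dotp (\<theta> z) (lie_bracket e T z) = curl \<theta> z (e z) (T z)"
      by (rule dotp_lie_bracket[OF open_ball hol\<theta> hole holT \<theta>e theta_Hs[OF _ T_Hs] z])
    moreover have "curl \<theta> z (e z) (T z) = 0" by (rule curl_\<theta>_e[OF z T_Hs[OF z]])
    moreover have "lie_bracket k S z = lie_bracket W (E j) z + lie_bracket e T z"
      unfolding S_def T_def W_def by (rule Jacobi[OF open_ball holk hole holE[OF j] z])
    ultimately have "dotp (\<theta> z) (lie_bracket W (E j) z) = 0" by (simp add: dotp_simps)
    then show ?thesis using dotp_lie_bracket[OF open_ball hol\<theta> holW holE[OF j] \<theta>W \<theta>E z] by simp
  qed
  have "curl (P l) z (k z) (e z) = 0"
  proof (rule curl_zero_real[OF hP holk hole _ z])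
    fix x assume x: "x \<in> B"
    then have zx: "cvec x \<in> \<Omega>" by simp
    obtain a b where ab: "a \<in> Hs (cvec x)" "b \<in> Hb (cvec x)" "W (cvec x) = a + b"
      using \<theta>W[OF zx] theta_iff[OF zx] by blast
    \<comment> \<open>By \<open>WE\<close> the bar H part b of [k, e] is Levi-orthogonal to H, so
      its conjugate is in the Levi kernel. This is argued at real points, where the Levi kernel
      lives; then b is a multiple of e and W lies in H + bar K.\<close>
    have "cnjv b \<in> levi_kernel M H x"
      unfolding levi_kernel_iff[OF x]
    proof
      show "cnjv b \<in> H x" using ab(2) by (simp add: H_Hs[OF x] cnjv_mem)
      show "\<forall>w\<in>H x. curl \<theta> (cvec x) (cnjv b) (cnjv w) = 0"
      proof
        fix w assume "w \<in> H x"
        then have w: "w \<in> Hs (cvec x)" by (simp add: H_Hs[OF x])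
        have "curl \<theta> (cvec x) (W (cvec x)) w = 0"
          by (rule curl_span_right[OF hol\<theta> zx WE[OF _ zx]]) (use w in \<open>simp_all add: Hs_def\<close>)
        then have "curl \<theta> (cvec x) b w = 0"
          using curl_Hs_Hs[OF _ zx ab(1) w, of "2 * n"] n_pos by (simp add: ab(3) curl_bilinear[OF hol\<theta> zx])
        then show "curl \<theta> (cvec x) (cnjv b) (cnjv w) = 0"
          by (rule curl_cnj[OF x theta_Hb[OF zx ab(2)] theta_Hs[OF zx w]])
      qed
    qed
    then obtain c where "cnjv b = c *s k (cvec x)" using levi_kernel_mem[OF x] by blast
    then have "b = cnj c *s e (cvec x)" by (metis cnjv_simps(1,4) tau_field_cvec)
    then have "W (cvec x) \<in> Ds (cvec x)" unfolding Ds_iff ab(3) using ab(1) by blast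
    then have "dotp (P l (cvec x)) (W (cvec x)) = 0" using mem_Ds[OF zx] l by blast
    moreover have "dotp (P l (cvec x)) (W (cvec x)) = curl (P l) (cvec x) (k (cvec x)) (e (cvec x))"
      unfolding W_def
      by (rule dotp_lie_bracket[OF open_ball hP holk hole _ _ zx]) (use mem_Ds Hs_Ds k_Hs e_Ds l in blast)+
    ultimately show "curl (P l) (cvec x) (k (cvec x)) (e (cvec x)) = 0" by simp
  qed
  then show ?thesis using curl_anti[of "P l" z "e z" "k z"] by simp
qed

lemma e_section: "x \<in> B \<Longrightarrow> (\<lambda>y. c *s e (cvec y)) \<in> local_sections analytic_field M (bar (levi_kernel M H)) x"
  by (rule local_section_real[of "\<lambda>z. c *s e z", OF holomorphic_field_smult[OF hol_const hole]])
     (use bar_kernel_mem in blast)+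

lemma H_section:
  assumes "x \<in> B" "h \<in> H x"
  obtains Y where "Y \<in> local_sections analytic_field M H x" "Y x = h"
proof -
  obtain X where "holomorphic_field \<Omega> X" "X (cvec x) = h" "\<And>w. X w \<in> Hs w"
    using section_Hs[of "cvec x" h] assms by (auto simp: H_Hs)
  then show thesis
    using that[OF local_section_real[of X H x]] assms(1) by (auto simp: H_Hs)
qed

lemma P_bracket:
  assumes x: "x \<in> B" and l: "l \<in> R" and V: "V \<in> local_sections analytic_field M (bar (levi_kernel M H)) x"
    and Y: "Y \<in> local_sections analytic_field M H x"
  shows "dotp (P l (cvec x)) (lie_bracket V Y x) = curl (P l) (cvec x) (V x) (Y x)"
proof -
  obtain U where U: "open U" "x \<in> U" "U \<subseteq> B" "analytic_field U V" "analytic_field U Y"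
      "\<And>y. y \<in> U \<Longrightarrow> V y \<in> bar (levi_kernel M H) y" "\<And>y. y \<in> U \<Longrightarrow> Y y \<in> H y"
    using local_sectionsD[OF V Y x] by metis
  have hP: "holomorphic_field \<Omega> (P l)" using holP l by simp
  have "dotp (P l (cvec y)) (V y) = 0" "dotp (P l (cvec y)) (Y y) = 0" if "y \<in> U" for y
  proof -
    have y: "y \<in> B" "cvec y \<in> \<Omega>" using that U(3) by auto
    have "V y \<in> Ds (cvec y)"
      using U(6)[OF that] bar_kernel_mem[OF y(1)] e_Ds[of "cvec y"] subspace_Ds[of "cvec y"]
      by (auto simp: vec.subspace_scale)
    moreover have "Y y \<in> Ds (cvec y)" using U(7)[OF that] by (simp add: H_Hs[OF y(1)] Hs_Ds)
    ultimately show "dotp (P l (cvec y)) (V y) = 0" "dotp (P l (cvec y)) (Y y) = 0"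
      using mem_Ds[OF y(2)] l by auto
  qed
  then show ?thesis by (intro row_bracket[OF hP x U(1,2,4) _ U(5)]) auto
qed

lemma bar_kernel_plus_H: "x \<in> B \<Longrightarrow> v \<in> bar (levi_kernel M H) x + H x \<longleftrightarrow> v \<in> Ds (cvec x)"
  unfolding set_plus_iff Ds_iff using bar_kernel_mem[of x] H_Hs[of x] by (metis add.commute)

lemma quot_sub: "x \<in> B \<Longrightarrow> C \<in> quot (H x) (levi_kernel M H x) \<Longrightarrow> C \<subseteq> H x"
proof
  fix h assume x: "x \<in> B" and C: "C \<in> quot (H x) (levi_kernel M H x)" "h \<in> C"
  then obtain a v where "a \<in> H x" "v \<in> levi_kernel M H x" "h = a + v" by (auto simp: quot_def set_plus_iff)
  then show "h \<in> H x" using levi_kernel_iff[OF x, of v] subspace_Hs[of "cvec x"] by (simp add: H_Hs[OF x] vec.subspace_add)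
qed

lemma quot_coset: "x \<in> B \<Longrightarrow> h \<in> H x \<Longrightarrow> {h} + levi_kernel M H x \<in> quot (H x) (levi_kernel M H x) \<and> h \<in> {h} + levi_kernel M H x"
  using levi_kernel_mem[of x 0] by (auto simp: quot_def set_plus_iff intro!: exI[of _ "0::complex"] bexI[of _ 0])

text \<open>Membership in bar K + H is tested by the rows P l, and \<open>P_bracket\<close>
  evaluates them on the bracket of sections. The quantification over sections thereby becomes a
  system of linear equations for w.\<close>

lemma ad_conj_apply:
  assumes x: "x \<in> B" and v: "v \<in> bar (levi_kernel M H) x" and C: "C \<in> quot (H x) (levi_kernel M H x)"
  shows "ad_conj M H x v C =
    {w \<in> Hb (cvec x). \<exists>h\<in>C. \<forall>l\<in>R. dotp (P l (cvec x)) w = curl (P l) (cvec x) v h}"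
proof -
  have zx: "cvec x \<in> \<Omega>" using x by simp
  have br: "w - lie_bracket V Y x \<in> bar (levi_kernel M H) x + H x \<longleftrightarrow>
      (\<forall>l\<in>R. dotp (P l (cvec x)) w = curl (P l) (cvec x) (V x) (Y x))"
    if "V \<in> local_sections analytic_field M (bar (levi_kernel M H)) x" "Y \<in> local_sections analytic_field M H x" for V Y w
    unfolding bar_kernel_plus_H[OF x] mem_Ds[OF zx] using P_bracket[OF x _ that] by (simp add: dotp_simps)
  have "ad_conj M H x v C = {w \<in> bar H x. \<exists>V\<in>local_sections analytic_field M (bar (levi_kernel M H)) x.
      \<exists>Y\<in>local_sections analytic_field M H x. V x = v \<and> Y x \<in> C \<and> w - lie_bracket V Y x \<in> bar (levi_kernel M H) x + H x}"
    using C by (simp add: ad_conj_def ad_op_def)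
  also have "\<dots> = {w \<in> Hb (cvec x). \<exists>h\<in>C. \<forall>l\<in>R. dotp (P l (cvec x)) w = curl (P l) (cvec x) v h}"
  proof (intro set_eqI iffI)
    fix w assume "w \<in> {w \<in> bar H x. \<exists>V\<in>local_sections analytic_field M (bar (levi_kernel M H)) x.
      \<exists>Y\<in>local_sections analytic_field M H x. V x = v \<and> Y x \<in> C \<and> w - lie_bracket V Y x \<in> bar (levi_kernel M H) x + H x}"
    then obtain V Y where w: "w \<in> bar H x" and VY: "V \<in> local_sections analytic_field M (bar (levi_kernel M H)) x"
      "Y \<in> local_sections analytic_field M H x" "V x = v" "Y x \<in> C" "w - lie_bracket V Y x \<in> bar (levi_kernel M H) x + H x"
      by blast
    then show "w \<in> {w \<in> Hb (cvec x). \<exists>h\<in>C. \<forall>l\<in>R. dotp (P l (cvec x)) w = curl (P l) (cvec x) v h}"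
      using br[OF VY(1,2)] bar_H[OF x] by auto
  next
    fix w assume "w \<in> {w \<in> Hb (cvec x). \<exists>h\<in>C. \<forall>l\<in>R. dotp (P l (cvec x)) w = curl (P l) (cvec x) v h}"
    then obtain h where w: "w \<in> bar H x" "h \<in> C" "\<forall>l\<in>R. dotp (P l (cvec x)) w = curl (P l) (cvec x) v h"
      using bar_H[OF x] by auto
    obtain c where c: "v = c *s e (cvec x)" using v bar_kernel_mem[OF x] by blast
    obtain Y where Y: "Y \<in> local_sections analytic_field M H x" "Y x = h"
      using H_section[OF x] quot_sub[OF x C] w(2) by blast
    have "w - lie_bracket (\<lambda>y. c *s e (cvec y)) Y x \<in> bar (levi_kernel M H) x + H x"
      using br[OF e_section[OF x] Y(1)] w(3) c Y(2) by simp
    then show "w \<in> {w \<in> bar H x. \<exists>V\<in>local_sections analytic_field M (bar (levi_kernel M H)) x.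
      \<exists>Y\<in>local_sections analytic_field M H x. V x = v \<and> Y x \<in> C \<and> w - lie_bracket V Y x \<in> bar (levi_kernel M H) x + H x}"
      using w(1,2) c Y(2) by (intro CollectI conjI bexI[OF _ e_section[OF x]] bexI[OF _ Y(1)]) auto
  qed
  finally show ?thesis .
qed

text \<open>The bracket of e with a section of H is killed by \<theta>, so it splits into parts in H
  and bar H, and the rows P l do not see the part in H.\<close>

lemma ad_row_lift:
  assumes z: "z \<in> \<Omega>" and h: "h \<in> Hs z"
  obtains w where "w \<in> Hb z" "\<And>l. l \<in> R \<Longrightarrow> dotp (P l z) w = ad_row l z h"
proof -
  obtain X where X: "holomorphic_field \<Omega> X" "X z = h" "\<And>w. X w \<in> Hs w" using section_Hs[OF z h] by blast
  have "dotp (\<theta> z) (lie_bracket e X z) = curl \<theta> z (e z) (X z)"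
    by (rule dotp_lie_bracket[OF open_ball hol\<theta> hole X(1) _ _ z]) (use theta_Hb e_Hb theta_Hs X(3) in auto)
  also have "\<dots> = 0" by (rule curl_\<theta>_e[OF z X(3)])
  finally obtain a b where ab: "a \<in> Hs z" "b \<in> Hb z" "lie_bracket e X z = a + b" using theta_iff[OF z] by blast
  show thesis
  proof (rule that[OF ab(2)])
    fix l assume l: "l \<in> R"
    have hP: "holomorphic_field \<Omega> (P l)" using holP l by simp
    have "dotp (P l z) (lie_bracket e X z) = ad_row l z (X z)"
      by (rule dotp_lie_bracket[OF open_ball hP hole X(1) _ _ z]) (use mem_Ds Hs_Ds e_Ds X(3) l in blast)+
    moreover have "dotp (P l z) a = 0" using mem_Ds[OF z] Hs_Ds[OF ab(1)] l by blast
    ultimately show "dotp (P l z) b = ad_row l z h" by (simp add: ab(3) X(2) dotp_simps)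
  qed
qed

lemma bar_kernel_dim: "x \<in> B \<Longrightarrow> vec.dim (bar (levi_kernel M H) x) = 1"
proof -
  assume x: "x \<in> B"
  have "bar (levi_kernel M H) x = vec.span {e (cvec x)}"
    using bar_kernel_mem[OF x] by (auto simp: vec_span_singleton)
  moreover have "vec.independent {e (cvec x)}" using e_nz[of "cvec x"] x by (simp add: vec.dependent_single)
  ultimately show ?thesis by (simp add: vec.dim_eq_card_independent)
qed

text \<open>If all values of ad_e were multiples of one tuple a, the preimage of the image in bar H
  would be spanned by e and one further vector. Its dimension is then at most 2, and the rank, after
  subtracting that of bar K, at most 1.\<close>

lemma rank_op_gt_one_imp:
  assumes x: "x \<in> B" and T: "T \<in> ad_Kbar M H x" "rank_op M H x T > 1"
  shows "\<not> (\<forall>h\<in>Hs (cvec x). \<exists>c. \<forall>l\<in>R. ad_row l (cvec x) h = c * a l)"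
proof
  assume mult: "\<forall>h\<in>Hs (cvec x). \<exists>c. \<forall>l\<in>R. ad_row l (cvec x) h = c * a l"
  have zx: "cvec x \<in> \<Omega>" using x by simp
  obtain \<mu> where Tv: "T = ad_conj M H x (\<mu> *s e (cvec x))" and v: "\<mu> *s e (cvec x) \<in> bar (levi_kernel M H) x"
  proof -
    obtain v where v: "T = ad_conj M H x v" "v \<in> bar (levi_kernel M H) x" using T(1) unfolding ad_Kbar_def by blast
    then obtain \<mu> where "v = \<mu> *s e (cvec x)" using bar_kernel_mem[OF x] by blast
    then show thesis using that v by blast
  qed
  define S where "S = {w \<in> Hb (cvec x). \<exists>c. \<forall>l\<in>R. dotp (P l (cvec x)) w = c * a l}"
  have sub: "\<Union> (T ` quot (H x) (levi_kernel M H x)) \<subseteq> S"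
  proof
    fix w assume "w \<in> \<Union> (T ` quot (H x) (levi_kernel M H x))"
    then obtain C where C: "C \<in> quot (H x) (levi_kernel M H x)" "w \<in> T C" by blast
    then obtain h where h: "w \<in> Hb (cvec x)" "h \<in> C" "\<forall>l\<in>R. dotp (P l (cvec x)) w = curl (P l) (cvec x) (\<mu> *s e (cvec x)) h"
      unfolding Tv ad_conj_apply[OF x v C(1)] by blast
    have "h \<in> Hs (cvec x)" using quot_sub[OF x C(1)] h(2) by (auto simp: H_Hs[OF x])
    then obtain c where c: "\<forall>l\<in>R. ad_row l (cvec x) h = c * a l" using mult by blast
    have "dotp (P l (cvec x)) w = (\<mu> * c) * a l" if "l \<in> R" for l
    proof -
      have "holomorphic_field \<Omega> (P l)" using holP that by simp
      then show ?thesis using h(3) c that by (simp add: curl_bilinear[OF _ zx])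
    qed
    then show "w \<in> S" unfolding S_def using h(1) by blast
  qed
  \<comment> \<open>A vector of bar H killed by all rows is a multiple of e. So any w0 in S with a
    nonzero row generates S together with e; if there is none, w0 = 0 serves.\<close>
  have "\<exists>w0. S \<subseteq> vec.span {e (cvec x), w0}"
  proof (cases "\<exists>w0\<in>S. w0 \<notin> Ds (cvec x)")
    case True
    then obtain w0 where w0: "w0 \<in> S" "w0 \<notin> Ds (cvec x)" by blast
    then obtain c0 where c0: "w0 \<in> Hb (cvec x)" "\<forall>l\<in>R. dotp (P l (cvec x)) w0 = c0 * a l" unfolding S_def by blast
    have "c0 \<noteq> 0" using w0(2) c0(2) mem_Ds[OF zx] by auto
    have "w \<in> vec.span {e (cvec x), w0}" if "w \<in> S" for w
    proof -
      obtain c where c: "w \<in> Hb (cvec x)" "\<forall>l\<in>R. dotp (P l (cvec x)) w = c * a l" using \<open>w \<in> S\<close> unfolding S_def by blast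
      have "w - (c / c0) *s w0 \<in> Ds (cvec x)"
        unfolding mem_Ds[OF zx] using c(2) c0(2) \<open>c0 \<noteq> 0\<close> by (simp add: dotp_simps)
      moreover have "w - (c / c0) *s w0 \<in> Hb (cvec x)"
        using c(1) c0(1) subspace_Hb by (simp add: vec.subspace_diff vec.subspace_scale)
      ultimately obtain d where "w - (c / c0) *s w0 = d *s e (cvec x)" using Ds_Hb[OF zx] by blast
      then have "w = d *s e (cvec x) + (c / c0) *s w0" by (simp add: algebra_simps)
      moreover have "d *s e (cvec x) + (c / c0) *s w0 \<in> vec.span {e (cvec x), w0}"
        by (intro vec.span_add vec.span_scale vec.span_base) auto
      ultimately show ?thesis by simp
    qed
    then show ?thesis by blast
  next
    case False
    have "w \<in> vec.span {e (cvec x), 0}" if "w \<in> S" for w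
    proof -
      have "w \<in> Ds (cvec x)" "w \<in> Hb (cvec x)" using False that S_def by auto
      then obtain d where "w = d *s e (cvec x)" using Ds_Hb[OF zx] by blast
      moreover have "d *s e (cvec x) \<in> vec.span {e (cvec x), 0}"
        by (intro vec.span_scale vec.span_base) auto
      ultimately show ?thesis by simp
    qed
    then show ?thesis by blast
  qed
  then obtain w0 where "\<Union> (T ` quot (H x) (levi_kernel M H x)) \<subseteq> vec.span {e (cvec x), w0}" using sub by blast
  then have "vec.dim (\<Union> (T ` quot (H x) (levi_kernel M H x))) \<le> card {e (cvec x), w0}"
    by (rule vec.dim_le_card) simp
  also have "\<dots> \<le> 2" by (simp add: card_insert_le_m1)
  finally show False using T(2) bar_kernel_dim[OF x] unfolding rank_op_def by linarith
qed

text \<open>Two solutions of the linear system for the same h differ by a multiple of e. For c = 0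
  the left side is all of bar K, which is where the summand bar K in \<open>scale_op\<close>
  enters.\<close>

lemma ad_conj_scale:
  assumes x: "x \<in> B"
  shows "ad_conj M H x (c *s e (cvec x)) = scale_op M H x c (ad_conj M H x (e (cvec x)))"
proof
  fix C
  have zx: "cvec x \<in> \<Omega>" using x by simp
  have ce: "c *s e (cvec x) \<in> bar (levi_kernel M H) x" for c using bar_kernel_mem[OF x] by blast
  have e1: "e (cvec x) \<in> bar (levi_kernel M H) x" using ce[of 1] by simp
  show "ad_conj M H x (c *s e (cvec x)) C = scale_op M H x c (ad_conj M H x (e (cvec x))) C"
  proof (cases "C \<in> quot (H x) (levi_kernel M H x)")
    case False
    then show ?thesis by (simp add: ad_conj_def ad_op_def scale_op_def)
  next
    case C: True
    define T where "T = ad_conj M H x (e (cvec x)) C"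
    have T: "T = {w \<in> Hb (cvec x). \<exists>h\<in>C. \<forall>l\<in>R. dotp (P l (cvec x)) w = ad_row l (cvec x) h}"
      unfolding T_def by (rule ad_conj_apply[OF x e1 C])
    have cT: "ad_conj M H x (c *s e (cvec x)) C =
        {w \<in> Hb (cvec x). \<exists>h\<in>C. \<forall>l\<in>R. dotp (P l (cvec x)) w = c * ad_row l (cvec x) h}"
    proof -
      have "curl (P l) (cvec x) (c *s e (cvec x)) h = c * ad_row l (cvec x) h" if "l \<in> R" for l h
        by (rule curl_bilinear(2)[OF holP zx]) (use that in auto)
      then show ?thesis unfolding ad_conj_apply[OF x ce C] by auto
    qed
    have "scale_op M H x c (ad_conj M H x (e (cvec x))) C = (*s) c ` T + bar (levi_kernel M H) x"
      using C by (simp add: scale_op_def T_def)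
    moreover have "{w \<in> Hb (cvec x). \<exists>h\<in>C. \<forall>l\<in>R. dotp (P l (cvec x)) w = c * ad_row l (cvec x) h}
       = (*s) c ` T + bar (levi_kernel M H) x"
    proof (intro set_eqI iffI)
      fix w assume "w \<in> {w \<in> Hb (cvec x). \<exists>h\<in>C. \<forall>l\<in>R. dotp (P l (cvec x)) w = c * ad_row l (cvec x) h}"
      then obtain h where w: "w \<in> Hb (cvec x)" "h \<in> C" "\<forall>l\<in>R. dotp (P l (cvec x)) w = c * ad_row l (cvec x) h" by blast
      have "h \<in> Hs (cvec x)" using quot_sub[OF x C] w(2) by (auto simp: H_Hs[OF x])
      \<comment> \<open>A lift of the values at h replaces the quotient of w by c and so covers c =
        0 as well; w - c w' is killed by all rows.\<close>
      then obtain w' where w': "w' \<in> Hb (cvec x)" "\<And>l. l \<in> R \<Longrightarrow> dotp (P l (cvec x)) w' = ad_row l (cvec x) h"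
        using ad_row_lift[OF zx] by blast
      have "w' \<in> T" unfolding T using w' w(2) by blast
      have "w - c *s w' \<in> Ds (cvec x)" unfolding mem_Ds[OF zx] using w(3) w'(2) by (simp add: dotp_simps)
      moreover have "w - c *s w' \<in> Hb (cvec x)"
        using w(1) w'(1) subspace_Hb by (simp add: vec.subspace_diff vec.subspace_scale)
      ultimately obtain d where "w - c *s w' = d *s e (cvec x)" using Ds_Hb[OF zx] by blast
      then have "w = c *s w' + d *s e (cvec x)" by (simp add: algebra_simps)
      then show "w \<in> (*s) c ` T + bar (levi_kernel M H) x"
        unfolding set_plus_iff using \<open>w' \<in> T\<close> ce by blast
    next
      fix w assume "w \<in> (*s) c ` T + bar (levi_kernel M H) x"
      then obtain w' d where w: "w' \<in> T" "w = c *s w' + d *s e (cvec x)"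
      proof -
        obtain w' b where w': "w' \<in> T" "b \<in> bar (levi_kernel M H) x" "w = c *s w' + b"
          using \<open>w \<in> (*s) c ` T + bar (levi_kernel M H) x\<close> unfolding set_plus_iff by blast
        then obtain d where "b = d *s e (cvec x)" using bar_kernel_mem[OF x] by blast
        then show thesis using that w' by blast
      qed
      then obtain h where h: "w' \<in> Hb (cvec x)" "h \<in> C" "\<forall>l\<in>R. dotp (P l (cvec x)) w' = ad_row l (cvec x) h"
        unfolding T by blast
      have "w \<in> Hb (cvec x)" using h(1) e_Hb[OF zx] subspace_Hb w(2) by (simp add: vec.subspace_add vec.subspace_scale)
      moreover have "dotp (P l (cvec x)) (e (cvec x)) = 0" if "l \<in> R" for l
        using e_Ds mem_Ds[OF zx] that by blast
      then have "\<forall>l\<in>R. dotp (P l (cvec x)) w = c * ad_row l (cvec x) h" using h(3) by (simp add: w(2) dotp_simps)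
      ultimately show "w \<in> {w \<in> Hb (cvec x). \<exists>h\<in>C. \<forall>l\<in>R. dotp (P l (cvec x)) w = c * ad_row l (cvec x) h}"
        using h(2) by blast
    qed
    ultimately show ?thesis using cT by simp
  qed
qed

text \<open>A nonzero minor makes e and lifts of the values at two frame vectors independent modulo
  nothing but zero: three independent vectors in the preimage of the image, so rank at least 2 after
  subtracting dim bar K = 1. One generator suffices because bar K is a line.\<close>

lemma rank_condition:
  assumes x: "x \<in> B" and ij: "i < n" "j < n" and l: "l \<in> R" "l' \<in> R"
    and minor: "ad_row l (cvec x) (E i (cvec x)) * ad_row l' (cvec x) (E j (cvec x))
      - ad_row l' (cvec x) (E i (cvec x)) * ad_row l (cvec x) (E j (cvec x)) \<noteq> 0"
  shows "\<exists>T\<in>ad_Kbar M H x. ad_Kbar M H x = range (\<lambda>c. scale_op M H x c T) \<and> rank_op M H x T > 1"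
proof -
  have zx: "cvec x \<in> \<Omega>" using x by simp
  let ?T = "ad_conj M H x (e (cvec x))"
  have e1: "e (cvec x) \<in> bar (levi_kernel M H) x" unfolding bar_kernel_mem[OF x] by (intro exI[of _ 1]) simp
  have "ad_Kbar M H x = range (\<lambda>c. ad_conj M H x (c *s e (cvec x)))"
    unfolding ad_Kbar_def using bar_kernel_mem[OF x] by (auto simp: image_iff)
  then have rng: "ad_Kbar M H x = range (\<lambda>c. scale_op M H x c ?T)" by (simp add: ad_conj_scale[OF x])
  define S where "S = \<Union> (?T ` quot (H x) (levi_kernel M H x))"
  have in_S: "w \<in> S" if "w \<in> Hb (cvec x)" "h \<in> Hs (cvec x)" "\<And>l. l \<in> R \<Longrightarrow> dotp (P l (cvec x)) w = ad_row l (cvec x) h" for w h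
  proof -
    have h: "h \<in> H x" using that(2) by (simp add: H_Hs[OF x])
    note C = quot_coset[OF x h]
    have "w \<in> ?T ({h} + levi_kernel M H x)"
      unfolding ad_conj_apply[OF x e1 C[THEN conjunct1]] using that C by blast
    then show ?thesis unfolding S_def using C by blast
  qed
  have E_Hs: "E i (cvec x) \<in> Hs (cvec x)" if "i < n" for i using that by (auto simp: Hs_def intro!: vec.span_base)
  obtain wi where wi: "wi \<in> Hb (cvec x)" "\<And>l. l \<in> R \<Longrightarrow> dotp (P l (cvec x)) wi = ad_row l (cvec x) (E i (cvec x))"
    using ad_row_lift[OF zx E_Hs[OF ij(1)]] by blast
  obtain wj where wj: "wj \<in> Hb (cvec x)" "\<And>l. l \<in> R \<Longrightarrow> dotp (P l (cvec x)) wj = ad_row l (cvec x) (E j (cvec x))"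
    using ad_row_lift[OF zx E_Hs[OF ij(2)]] by blast
  have Pe: "dotp (P l (cvec x)) (e (cvec x)) = 0" if "l \<in> R" for l
    using e_Ds mem_Ds[OF zx] that by blast
  have eS: "e (cvec x) \<in> S"
    by (rule in_S[OF e_Hb[OF zx], of 0]) (use Pe subspace_Hs curl_0(2)[OF holP zx] in \<open>auto simp: vec.subspace_0\<close>)
  define f where "f a = (if a = 0 then e (cvec x) else if a = 1 then wi else wj)" for a :: nat
  have fS: "f ` {..<3} \<subseteq> S" using eS in_S[OF wi(1) E_Hs[OF ij(1)] wi(2)] in_S[OF wj(1) E_Hs[OF ij(2)] wj(2)]
    by (auto simp: f_def)
  have "indep 3 f" unfolding indep_def
  proof (rule allI, rule impI)
    fix c assume "(\<Sum>a<3. c a *s f a) = 0"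
    then have s: "c 0 *s e (cvec x) + c 1 *s wi + c 2 *s wj = 0"
      by (simp add: f_def eval_nat_numeral lessThan_Suc add_ac)
    have eq: "c 1 * ad_row l (cvec x) (E i (cvec x)) + c 2 * ad_row l (cvec x) (E j (cvec x)) = 0" if "l \<in> R" for l
      using arg_cong[OF s, of "dotp (P l (cvec x))"] wi(2)[OF that] wj(2)[OF that] Pe[OF that] by (simp add: dotp_simps)
    define A where "A = ad_row l (cvec x) (E i (cvec x))"
    define A' where "A' = ad_row l' (cvec x) (E i (cvec x))"
    define D where "D = ad_row l (cvec x) (E j (cvec x))"
    define D' where "D' = ad_row l' (cvec x) (E j (cvec x))"
    have q: "c 1 * A + c 2 * D = 0" "c 1 * A' + c 2 * D' = 0" using eq[OF l(1)] eq[OF l(2)] by (auto simp: A_def A'_def D_def D'_def)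
    have m: "A * D' - A' * D \<noteq> 0" using minor by (simp add: A_def A'_def D_def D'_def)
    have "c 1 * (A * D' - A' * D) = (c 1 * A + c 2 * D) * D' - (c 1 * A' + c 2 * D') * D" by (simp add: algebra_simps)
    then have c1: "c 1 = 0" using q m by simp
    have "c 2 * (A * D' - A' * D) = (c 1 * A' + c 2 * D') * A - (c 1 * A + c 2 * D) * A'" by (simp add: algebra_simps)
    then have c2: "c 2 = 0" using q m by simp
    then have "c 0 = 0" using s c1 e_nz[OF zx] by simp
    then show "\<forall>a<3. c a = 0" using c1 c2 by (auto simp: eval_nat_numeral less_Suc_eq)
  qed
  then have "card (f ` {..<3}) = 3" "vec.independent (f ` {..<3})" by (auto simp: indep_iff card_image)
  then have "3 \<le> vec.dim S" using vec.independent_card_le_dim[OF fS] by simp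
  then have "rank_op M H x ?T > 1" unfolding rank_op_def S_def[symmetric] bar_kernel_dim[OF x] by simp
  moreover have "?T \<in> ad_Kbar M H x" unfolding ad_Kbar_def using e1 by blast
  ultimately show ?thesis using rng by blast
qed

text \<open>2-nondegeneracy speaks of ad_v for v in K, the rows of ad_e for e in bar K. If all rows
  vanished at x, conjugating brackets would show that ad_k sends every coset to the zero coset
  K.\<close>

lemma ad_row_nonzero:
  assumes nd: "two_nondegenerate M H" and x: "x \<in> B"
  shows "\<exists>l\<in>R. \<exists>i<n. ad_row l (cvec x) (E i (cvec x)) \<noteq> 0"
proof (rule ccontr)
  assume "\<not> (\<exists>l\<in>R. \<exists>i<n. ad_row l (cvec x) (E i (cvec x)) \<noteq> 0)"
  then have zero: "ad_row l (cvec x) (E i (cvec x)) = 0" if "l \<in> R" "i < n" for l i using that by blast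
  have zx: "cvec x \<in> \<Omega>" using x by simp
  have adH: "ad_row l (cvec x) h = 0" if "l \<in> R" "h \<in> Hs (cvec x)" for l h
    by (rule curl_span_right[OF holP zx zero[OF that(1)]]) (use that in \<open>auto simp: Hs_def\<close>)
  have kK: "k (cvec x) \<in> levi_kernel M H x" unfolding levi_kernel_mem[OF x] by (intro exI[of _ 1]) simp
  have "\<not> (\<forall>C\<in>quot (bar H x) (bar (levi_kernel M H) x). ad M H x (k (cvec x)) C = levi_kernel M H x)"
    using nd x ball_M kK k_nz[OF zx] unfolding two_nondegenerate_def by blast
  then obtain C where C: "C \<in> quot (bar H x) (bar (levi_kernel M H) x)" "ad M H x (k (cvec x)) C \<noteq> levi_kernel M H x" by blast
  have KH: "levi_kernel M H x \<subseteq> H x" using levi_kernel_iff[OF x] by blast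
  \<comment> \<open>The conjugates of V and Y are sections of bar K and H, whose bracket lies in bar
    K + H because the rows vanish. Hence [V, Y] lies in K + bar H and drops out of the
    condition.\<close>
  have br: "w - lie_bracket V Y x \<in> levi_kernel M H x + bar H x \<longleftrightarrow> w \<in> levi_kernel M H x + bar H x"
    if V: "V \<in> local_sections analytic_field M (levi_kernel M H) x" "V x = k (cvec x)"
      and Y: "Y \<in> local_sections analytic_field M (bar H) x" for V Y w
  proof -
    obtain U where U: "open U" "x \<in> U" "U \<subseteq> B" "analytic_field U V" "analytic_field U Y"
      "\<And>y. y \<in> U \<Longrightarrow> V y \<in> levi_kernel M H y" "\<And>y. y \<in> U \<Longrightarrow> Y y \<in> bar H y"
      using local_sectionsD[OF V(1) Y x] by metis
    have UM: "U \<subseteq> M" using U(3) ball_M by blast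
    have V': "(\<lambda>y. cnjv (V y)) \<in> local_sections analytic_field M (bar (levi_kernel M H)) x"
      unfolding local_sections_def bar_def using U(1,2,6) UM analytic_field_cnjv[OF U(4,1)] by blast
    have "cnjv (Y y) \<in> H y" if "y \<in> U" for y using U(7)[OF that] by (auto simp: bar_def)
    then have Y': "(\<lambda>y. cnjv (Y y)) \<in> local_sections analytic_field M H x"
      unfolding local_sections_def using U(1,2) UM analytic_field_cnjv[OF U(5,1)] by blast
    have "cnjv (Y x) \<in> Hs (cvec x)" using \<open>\<And>y. y \<in> U \<Longrightarrow> cnjv (Y y) \<in> H y\<close>[OF U(2)] by (simp add: H_Hs[OF x])
    then have "dotp (P l (cvec x)) (lie_bracket (\<lambda>y. cnjv (V y)) (\<lambda>y. cnjv (Y y)) x) = 0" if "l \<in> R" for l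
      using P_bracket[OF x that V' Y'] adH[OF that] V(2) by (simp add: tau_field_cvec)
    then have "cnjv (lie_bracket V Y x) \<in> bar (levi_kernel M H) x + H x"
      unfolding bar_kernel_plus_H[OF x] mem_Ds[OF zx] using lie_bracket_cnjv[OF U(4,5,2)] by simp
    then obtain a b where ab: "a \<in> bar (levi_kernel M H) x" "b \<in> H x" "cnjv (lie_bracket V Y x) = a + b"
      unfolding set_plus_iff by blast
    then have "lie_bracket V Y x = cnjv a + cnjv b" by (metis cnjv_simps(1,2))
    moreover have ca: "cnjv a \<in> levi_kernel M H x" and cb: "cnjv b \<in> bar H x" using ab by (auto simp: bar_def)
    moreover have sK: "vec.subspace (levi_kernel M H x)" and sH: "vec.subspace (bar H x)"
      by (simp_all add: K_span[OF x] bar_H[OF x] subspace_Hb)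
    ultimately show ?thesis
      unfolding set_plus_iff
    proof (safe, goal_cases)
      case (1 u v)
      show ?case using 1 sK sH ca cb
        by (intro bexI[of _ "u + cnjv a"] bexI[of _ "v + cnjv b"]) (auto simp: algebra_simps vec.subspace_add)
    next
      case (2 u v)
      show ?case using 2 sK sH ca cb
        by (intro bexI[of _ "u - cnjv a"] bexI[of _ "v - cnjv b"]) (auto simp: algebra_simps vec.subspace_diff)
    qed
  qed
  have "ad M H x (k (cvec x)) C = {w \<in> H x. \<exists>V\<in>local_sections analytic_field M (levi_kernel M H) x.
      \<exists>Y\<in>local_sections analytic_field M (bar H) x. V x = k (cvec x) \<and> Y x \<in> C \<and>
        w - lie_bracket V Y x \<in> levi_kernel M H x + bar H x}"
    using C(1) by (simp add: ad_def ad_op_def)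
  also have "\<dots> = {w \<in> H x. w \<in> levi_kernel M H x + bar H x}"
  proof -
    have Vs: "(\<lambda>y. k (cvec y)) \<in> local_sections analytic_field M (levi_kernel M H) x"
      by (rule local_section_real[OF holk _ x]) (use levi_kernel_mem in \<open>metis vec.scale_one\<close>)
    obtain b where b: "b \<in> bar H x" "b \<in> C"
    proof -
      obtain b where b: "b \<in> bar H x" "C = {b} + bar (levi_kernel M H) x" using C(1) by (auto simp: quot_def)
      have "0 \<in> bar (levi_kernel M H) x" unfolding bar_kernel_mem[OF x] by (intro exI[of _ 0]) simp
      then have "b \<in> C" unfolding b(2) set_plus_iff by auto
      then show thesis using that b(1) by blast
    qed
    obtain Y where Y: "Y \<in> local_sections analytic_field M (bar H) x" "Y x = b"
    proof -
      have "cnjv b \<in> H x" using b(1) by (auto simp: bar_def)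
      then obtain Y where Y: "Y \<in> local_sections analytic_field M H x" "Y x = cnjv b" using H_section[OF x] by blast
      then obtain U where "open U" "x \<in> U" "U \<subseteq> M" "analytic_field U Y" "\<forall>y\<in>U. Y y \<in> H y"
        unfolding local_sections_def by blast
      then have "(\<lambda>y. cnjv (Y y)) \<in> local_sections analytic_field M (bar H) x"
        unfolding local_sections_def bar_def using analytic_field_cnjv by blast
      then show thesis using that Y(2) by simp
    qed
    show ?thesis
    proof (intro set_eqI iffI)
      fix w assume "w \<in> {w \<in> H x. \<exists>V\<in>local_sections analytic_field M (levi_kernel M H) x.
        \<exists>Y\<in>local_sections analytic_field M (bar H) x. V x = k (cvec x) \<and> Y x \<in> C \<and>
          w - lie_bracket V Y x \<in> levi_kernel M H x + bar H x}"
      then obtain V Y where "w \<in> H x" "V \<in> local_sections analytic_field M (levi_kernel M H) x"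
        "Y \<in> local_sections analytic_field M (bar H) x" "V x = k (cvec x)"
        "w - lie_bracket V Y x \<in> levi_kernel M H x + bar H x" by blast
      then show "w \<in> {w \<in> H x. w \<in> levi_kernel M H x + bar H x}" using br[of V Y w] by simp
    next
      fix w assume w: "w \<in> {w \<in> H x. w \<in> levi_kernel M H x + bar H x}"
      then have "w - lie_bracket (\<lambda>y. k (cvec y)) Y x \<in> levi_kernel M H x + bar H x"
        using br[OF Vs refl Y(1)] by simp
      then show "w \<in> {w \<in> H x. \<exists>V\<in>local_sections analytic_field M (levi_kernel M H) x.
        \<exists>Y\<in>local_sections analytic_field M (bar H) x. V x = k (cvec x) \<and> Y x \<in> C \<and>
          w - lie_bracket V Y x \<in> levi_kernel M H x + bar H x}"
        using w b Y(2) by (intro CollectI conjI bexI[OF _ Vs] bexI[OF _ Y(1)]) auto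
    qed
  qed
  also have "\<dots> = levi_kernel M H x"
  proof (intro set_eqI iffI)
    fix w assume "w \<in> {w \<in> H x. w \<in> levi_kernel M H x + bar H x}"
    then obtain u v where w: "w \<in> H x" "u \<in> levi_kernel M H x" "v \<in> bar H x" "w = u + v" unfolding set_plus_iff by blast
    have "w \<in> Hs (cvec x)" "u \<in> Hs (cvec x)" using w(1,2) KH by (auto simp: H_Hs[OF x])
    then have "w - u \<in> Hs (cvec x)" by (rule vec.subspace_diff[OF subspace_Hs])
    then have "v \<in> Hs (cvec x)" using w(4) by simp
    then have "v = 0" using Hs_Hb[OF zx] w(3) by (simp add: bar_H[OF x])
    then show "w \<in> levi_kernel M H x" using w by simp
  next
    fix w assume w: "w \<in> levi_kernel M H x"
    have "0 \<in> bar H x" using subspace_Hb by (simp add: bar_H[OF x] vec.subspace_0)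
    then show "w \<in> {w \<in> H x. w \<in> levi_kernel M H x + bar H x}" using w KH unfolding set_plus_iff by force
  qed
  finally show False using C(2) by simp
qed

end

section \<open>Reconstructions\<close>

lemma local_sections_holD:
  assumes "X \<in> local_sections holomorphic_field U D z" "Y \<in> local_sections holomorphic_field U D' z"
  obtains V where "open V" "z \<in> V" "V \<subseteq> U" "holomorphic_field V X" "holomorphic_field V Y"
    "\<And>w. w \<in> V \<Longrightarrow> X w \<in> D w" "\<And>w. w \<in> V \<Longrightarrow> Y w \<in> D' w"
proof -
  obtain U1 where U1: "open U1" "z \<in> U1" "U1 \<subseteq> U" "holomorphic_field U1 X" "\<forall>w\<in>U1. X w \<in> D w"
    using assms(1) unfolding local_sections_def by blast
  obtain U2 where U2: "open U2" "z \<in> U2" "holomorphic_field U2 Y" "\<forall>w\<in>U2. Y w \<in> D' w"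
    using assms(2) unfolding local_sections_def by blast
  show thesis
    by (rule that[of "U1 \<inter> U2"])
       (use U1 U2 in \<open>auto intro: holomorphic_field_subset[OF U1(4)] holomorphic_field_subset[OF U2(3)]\<close>)
qed

lemma hol_nonzero_ball:
  assumes "open U" "hol U f" "p \<in> U" "f p \<noteq> 0"
  obtains s where "s > 0" "ball p s \<subseteq> U" "\<And>z. z \<in> ball p s \<Longrightarrow> f z \<noteq> 0"
proof -
  have "open (U \<inter> f -` (- {0}))"
    by (rule continuous_open_preimage[OF hol_continuous_on[OF assms(2)] assms(1)]) auto
  moreover have "p \<in> U \<inter> f -` (- {0})" using assms by auto
  ultimately obtain s where "s > 0" "ball p s \<subseteq> U \<inter> f -` (- {0})" using open_contains_ball by metis
  then show thesis by (intro that[of s]) auto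
qed

context levi_kernel_frame
begin

lemma indep_E: "z \<in> \<Omega> \<Longrightarrow> indep n (\<lambda>j. E j z)"
proof -
  assume z: "z \<in> \<Omega>"
  have "indep (2 * n + 1) (\<lambda>j. F j z)" by (rule dual_indep[of _ "\<lambda>j. Q j z"]) (use dual z in auto)
  then have "indep n (\<lambda>j. F j z)" by (rule indep_mono) simp
  then show ?thesis by (subst indep_cong[of n _ "\<lambda>j. F j z"]) (auto simp: F_E)
qed

lemma indep_G: "z \<in> \<Omega> \<Longrightarrow> indep (Suc n) (\<lambda>j. G j z)"
proof -
  assume z: "z \<in> \<Omega>"
  have "indep (2 * n + 1) (\<lambda>j. G j z)" by (rule dual_indep[of _ "\<lambda>j. P j z"]) (use dualP z in auto)
  then show ?thesis by (rule indep_mono) (use n_pos in simp)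
qed

lemma dim_Hs: "z \<in> \<Omega> \<Longrightarrow> vec.dim (Hs z) = n"
  using indep_E unfolding Hs_def indep_iff_dim .

lemma tau_push_K:
  assumes Kc: "\<forall>z\<in>\<Omega>. Kc z = vec.span {k z}" and z: "z \<in> \<Omega>"
  shows "v \<in> tau_push Kc z \<longleftrightarrow> (\<exists>c. v = c *s e z)"
proof -
  have "v \<in> tau_push Kc z \<longleftrightarrow> (\<exists>c. v = cnjv (c *s k (cnjv z)))"
    unfolding tau_push_def Kc[rule_format, OF cnjv_\<Omega>[OF z]] by (simp only: image_iff Bex_def vec_span_singleton) blast
  also have "\<dots> \<longleftrightarrow> (\<exists>c. v = cnj c *s e z)" by (simp add: tau_field_def)
  also have "\<dots> \<longleftrightarrow> (\<exists>c. v = c *s e z)" by (metis complex_cnj_cnj)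
  finally show ?thesis .
qed

lemma sum_plus_Ds:
  assumes Hc: "\<forall>z\<in>\<Omega>. Hc z = Hs z" and Kc: "\<forall>z\<in>\<Omega>. Kc z = vec.span {k z}" and z: "z \<in> \<Omega>"
  shows "Hc z + tau_push Kc z = Ds z"
proof (intro set_eqI)
  fix v show "v \<in> Hc z + tau_push Kc z \<longleftrightarrow> v \<in> Ds z"
    unfolding set_plus_iff Ds_iff Hc[rule_format, OF z] Bex_def tau_push_K[OF Kc z] by blast
qed

lemma reconstruction_Hs:
  assumes Hc: "\<forall>z\<in>\<Omega>. Hc z = Hs z" and Kc: "\<forall>z\<in>\<Omega>. Kc z = vec.span {k z}"
  shows "reconstruction n \<Omega> Hc Kc Hc"
  unfolding reconstruction_def
proof (intro conjI ballI)
  show "subbundle holomorphic_field n \<Omega> Hc"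
    unfolding subbundle_def
    by (intro ballI exI[of _ \<Omega>] exI[of _ E]) (use holE Hc dim_Hs in \<open>auto simp: Hs_def\<close>)
  show "involutive holomorphic_field \<Omega> Hc"
    unfolding involutive_def
  proof (intro ballI)
    fix z X Y assume z: "z \<in> \<Omega>" and X: "X \<in> local_sections holomorphic_field \<Omega> Hc z"
      and Y: "Y \<in> local_sections holomorphic_field \<Omega> Hc z"
    obtain V where V: "open V" "z \<in> V" "V \<subseteq> \<Omega>" "holomorphic_field V X" "holomorphic_field V Y"
      "\<And>w. w \<in> V \<Longrightarrow> X w \<in> Hc w" "\<And>w. w \<in> V \<Longrightarrow> Y w \<in> Hc w"
      using local_sections_holD[OF X Y] by metis
    have "lie_bracket X Y z \<in> Hs z"
      by (rule bracket_Hs[OF V(1,3,4,5) _ _ V(2)]) (use V(3,6,7) Hc in blast)+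
    then show "lie_bracket X Y z \<in> Hc z" using Hc[rule_format, OF z] by simp
  qed
  fix z assume z: "z \<in> \<Omega>"
  show "Kc z \<subseteq> Hc z"
    unfolding Hc[rule_format, OF z] Kc[rule_format, OF z] by (rule vec.span_minimal) (use k_Hs[OF z] subspace_Hs in auto)
  show "Hc z \<subseteq> Hc z + tau_push Kc z"
  proof -
    have "Hc z \<subseteq> Ds z" unfolding Hc[rule_format, OF z] using Hs_Ds by blast
    then show ?thesis by (simp only: sum_plus_Ds[OF Hc Kc z])
  qed
  show "Hc z \<inter> tau_push Kc z = {0}"
    unfolding Hc[rule_format, OF z]
  proof (intro equalityI subsetI)
    fix v assume v: "v \<in> Hs z \<inter> tau_push Kc z"
    then obtain c where "v = c *s e z" using tau_push_K[OF Kc z] by blast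
    then show "v \<in> {0}" using v Hs_e[OF z] by blast
  next
    fix v :: "complex^'a" assume v: "v \<in> {0}"
    then have "v = 0 *s e z" by simp
    then have "v \<in> tau_push Kc z" using tau_push_K[OF Kc z] by blast
    then show "v \<in> Hs z \<inter> tau_push Kc z" using v subspace_Hs by (auto simp: vec.subspace_0)
  qed
qed

text \<open>Near p one row l0 is nonzero on one frame vector E i0. With all minors zero, every other
  row is a multiple of row l0 there, so a single scalar equation describes the kernel of ad_e in H
  and yields an explicit frame of it.\<close>

lemma second_reconstruction:
  assumes nd: "two_nondegenerate M H"
    and Hc: "\<forall>z\<in>\<Omega>. Hc z = Hs z" and Kc: "\<forall>z\<in>\<Omega>. Kc z = vec.span {k z}"
    and minors: "\<And>z i j l l'. z \<in> \<Omega> \<Longrightarrow> i < n \<Longrightarrow> j < n \<Longrightarrow> l \<in> R \<Longrightarrow> l' \<in> R \<Longrightarrow>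
      ad_row l z (E i z) * ad_row l' z (E j z) - ad_row l' z (E i z) * ad_row l z (E j z) = 0"
  obtains U H' where "open U" "cvec p0 \<in> U" "U \<subseteq> \<Omega>" "reconstruction n U Hc Kc H'"
    "H' (cvec p0) \<noteq> Hc (cvec p0)"
proof -
  define p where "p = cvec p0"
  have p\<Omega>: "p \<in> \<Omega>" using r by (simp add: p_def)

  \<comment> \<open>A frame of the kernel of ad_e in H\<close>
  obtain l0 i0 where l0: "l0 \<in> R" and i0: "i0 < n" and ad0: "ad_row l0 p (E i0 p) \<noteq> 0"
    using ad_row_nonzero[OF nd, of p0] r by (auto simp: p_def)
  have holPl: "holomorphic_field \<Omega> (P l)" if "l \<in> R" for l using holP that by simp
  have E_Hs: "E j z \<in> Hs z" if "j < n" for j z using that by (auto simp: Hs_def intro!: vec.span_base)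
  define a0 where "a0 z = ad_row l0 z (E i0 z)" for z
  have hol_ad: "hol \<Omega> (\<lambda>z. ad_row l z (E j z))" if "l \<in> R" "j < n" for l j
    by (rule hol_curl[OF open_ball holPl[OF that(1)] hole holE[OF that(2)]])
  obtain r1 where r1: "r1 > 0" "ball p r1 \<subseteq> \<Omega>" "\<And>z. z \<in> ball p r1 \<Longrightarrow> a0 z \<noteq> 0"
    using hol_nonzero_ball[OF open_ball hol_ad[OF l0 i0] p\<Omega> ad0] unfolding a0_def by blast
  \<comment> \<open>Chosen so that row l0 vanishes on L j for j \<noteq> i0. The value 0 at i0
    leaves E i0 unchanged, which keeps the formula for X at p uniform in j.\<close>
  define m where "m j z = (if j = i0 then 0 else ad_row l0 z (E j z) / a0 z)" for j z
  define L where "L j z = E j z - m j z *s E i0 z" for j z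
  have holm: "hol (ball p r1) (m j)" if "j < n" for j
  proof (cases "j = i0")
    case True then show ?thesis by (simp add: m_def[abs_def] hol_const)
  next
    case False
    then show ?thesis unfolding m_def[abs_def] a0_def
      using hol_divide[OF hol_subset[OF hol_ad[OF l0 that] r1(2)] hol_subset[OF hol_ad[OF l0 i0] r1(2)]] r1(3)
      by (simp add: a0_def)
  qed
  have holL: "holomorphic_field (ball p r1) (L j)" if "j < n" for j
    unfolding L_def[abs_def]
    by (intro holomorphic_field_diff holomorphic_field_smult holm that holomorphic_field_subset[OF holE r1(2)] i0)
  \<comment> \<open>The fields completing the frame L are frozen at p: E i0 and e enter as
    constants, as do the later members of the dual frame, so the complement of the kernel is
    constant.\<close>
  define X where "X j = (if j < n then (if j = i0 then (\<lambda>z. E i0 p) else L j) else (\<lambda>z. e p))" for j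
  have holX: "holomorphic_field (ball p r1) (X j)" if "j < Suc n" for j
    using holL by (auto simp: X_def)
  have Xp: "X j p = E j p - m j p *s E i0 p" if "j < n" for j
    using that by (auto simp: X_def L_def m_def)
  have indX: "indep (Suc n) (\<lambda>j. X j p)" unfolding indep_def
  proof (rule allI, rule impI)
    fix c assume c: "(\<Sum>j<Suc n. c j *s X j p) = 0"
    define s where "s = (\<Sum>j<n. c j * m j p)"
    define c' where "c' j = (if j = n then c n else c j - (if j = i0 then s else 0))" for j
    have "(\<Sum>j<n. c j *s X j p) = (\<Sum>j<n. c j *s E j p - (c j * m j p) *s E i0 p)"
      by (intro sum.cong) (auto simp: Xp algebra_simps)
    also have "\<dots> = (\<Sum>j<n. c j *s E j p) - s *s E i0 p"
      by (simp add: sum_subtractf s_def vec.scale_sum_left)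
    also have "\<dots> = (\<Sum>j<n. c j *s E j p) - (\<Sum>j<n. if j = i0 then s *s E j p else 0)"
      using i0 by simp
    also have "\<dots> = (\<Sum>j<n. c' j *s E j p)"
      unfolding sum_subtractf[symmetric] by (intro sum.cong) (auto simp: c'_def algebra_simps)
    finally have "(\<Sum>j<Suc n. c' j *s G j p) = 0"
      using c by (simp add: G_E G_e X_def c'_def)
    then have c'0: "c' j = 0" if "j < Suc n" for j using indepD[OF indep_G[OF p\<Omega>] _ that, of c'] by simp
    have cj: "c j = 0" if "j < n" "j \<noteq> i0" for j using c'0[of j] that by (simp add: c'_def)
    have "s = 0" unfolding s_def by (intro sum.neutral) (use cj m_def in auto)
    then have "c i0 = 0" using c'0[of i0] i0 by (simp add: c'_def)
    moreover have "c n = 0" using c'0[of n] by (simp add: c'_def)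
    ultimately show "\<forall>j<Suc n. c j = 0" using cj by (metis less_antisym)
  qed
  have p1: "p \<in> ball p r1" using r1 by simp
  obtain r2 Y q where r2: "r2 > 0" "ball p r2 \<subseteq> ball p r1" "Suc n \<le> CARD('a)" and YX: "\<And>j. j < Suc n \<Longrightarrow> Y j = X j"
    and Yc: "\<And>j z w. Suc n \<le> j \<Longrightarrow> Y j z = Y j w"
    and holq: "\<And>j. j < CARD('a) \<Longrightarrow> holomorphic_field (ball p r2) (q j)"
    and dualq: "\<And>i j z. i < CARD('a) \<Longrightarrow> j < CARD('a) \<Longrightarrow> z \<in> ball p r2 \<Longrightarrow>
       dotp (q i z) (Y j z) = (if i = j then 1 else 0)"
    and expandq: "\<And>z v. z \<in> ball p r2 \<Longrightarrow> v = (\<Sum>j<CARD('a). dotp (q j z) v *s Y j z)"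
    by (rule dual_frame[OF open_ball p1 holX indX]) (assumption, rule that)
  let ?V = "ball p r2"
  have V\<Omega>: "?V \<subseteq> \<Omega>" using r1 r2 by blast
  have p2: "p \<in> ?V" using r2 by simp
  have a0V: "a0 z \<noteq> 0" if "z \<in> ?V" for z using r1(3) r2(2) that by blast
  define J where "J = {..<n} - {i0}"
  have J: "finite J" "\<And>j. j \<in> J \<Longrightarrow> j < n" "\<And>j. j \<in> J \<Longrightarrow> j < CARD('a)" "\<And>j. j \<in> J \<Longrightarrow> Y j = L j"
    using r2(3) YX by (auto simp: J_def X_def)
  have notJ: "Y j z = Y j w" if "j \<notin> J" for j z w
  proof (cases "j < Suc n")
    case True
    then show ?thesis using that YX[OF True] by (auto simp: J_def X_def)
  next
    case False then show ?thesis using Yc[of j z w] by simp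
  qed
  have holLV: "holomorphic_field ?V (L j)" if "j < n" for j
    using holomorphic_field_subset[OF holL[OF that] r2(2)] .

  \<comment> \<open>The projection onto the kernel along a constant complement\<close>
  define A where "A z v = (\<Sum>j\<in>J. dotp (q j z) v *s L j z)" for z v
  have A_add: "A z (v + w) = A z v + A z w" and A_smult: "A z (c *s v) = c *s A z v" for z v w c
    by (simp_all add: A_def dotp_simps vec.scale_left_distrib sum.distrib vec.scale_sum_right)
  have A0: "A z 0 = 0" for z by (simp add: A_def dotp_simps)
  have A_sum: "A z (\<Sum>i\<in>I. f i) = (\<Sum>i\<in>I. A z (f i))" for z I f
    by (induction I rule: infinite_finite_induct) (auto simp: A_add A0)
  have holA: "holomorphic_field ?V (\<lambda>z. A z v)" for v
    unfolding A_def using J by (intro holomorphic_field_sum holomorphic_field_smult hol_dotp holq holLV) auto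
  have A_L: "A z (L j z) = L j z" if "j \<in> J" "z \<in> ?V" for j z
  proof -
    have "A z (L j z) = (\<Sum>i\<in>J. if i = j then L j z else 0)"
      unfolding A_def by (intro sum.cong) (use dualq[OF J(3) J(3) that(2)] J(4) that(1) in auto)
    then show ?thesis using J(1) that(1) by simp
  qed
  have A_Y: "A z (Y j z) = 0" if "j \<notin> J" "j < CARD('a)" "z \<in> ?V" for j z
    unfolding A_def by (intro sum.neutral) (use dualq[OF J(3) that(2,3)] that(1) in auto)
  \<comment> \<open>v - A w v lies in the constant complement, which is annihilated by A z at every
    point z.\<close>
  have proj: "A z (A w v) = A z v" if "z \<in> ?V" "w \<in> ?V" for z w v
  proof -
    have "A z v = (\<Sum>j<CARD('a). dotp (q j w) v *s A z (Y j w))"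
      using expandq[OF that(2), of v] by (metis (mono_tags, lifting) A_sum A_smult sum.cong)
    also have "\<dots> = (\<Sum>j\<in>J. dotp (q j w) v *s A z (Y j w))"
    proof (rule sum.mono_neutral_right)
      show "\<forall>j\<in>{..<CARD('a)} - J. dotp (q j w) v *s A z (Y j w) = 0"
        using A_Y[OF _ _ that(1)] notJ by (metis DiffD1 DiffD2 lessThan_iff vec.scale_zero_right)
    qed (use J in auto)
    also have "\<dots> = A z (A w v)" by (simp add: A_def[of w] A_sum A_smult J(4))
    finally show ?thesis by simp
  qed
  define Lz where "Lz z = {h \<in> Hs z. ad_row l0 z h = 0}" for z
  have ad_lin: "ad_row l z (u + v) = ad_row l z u + ad_row l z v" "ad_row l z (c *s u) = c * ad_row l z u"
    "ad_row l z (\<Sum>i\<in>I. f i) = (\<Sum>i\<in>I. ad_row l z (f i))" if "l \<in> R" "z \<in> \<Omega>"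
    for l z u v c I and f :: "nat \<Rightarrow> complex^'a"
    using curl_bilinear[OF holPl[OF that(1)] that(2)] curl_sum_right[OF holPl[OF that(1)] that(2)] by auto
  \<comment> \<open>Multiplied by a0 this is the minor of rows l0, l and columns i0, j.\<close>
  have ad_L: "ad_row l z (L j z) = 0" if l: "l \<in> R" and j: "j \<in> J" and z: "z \<in> ?V" for l j z
  proof -
    have z\<Omega>: "z \<in> \<Omega>" using z V\<Omega> by blast
    have jn: "j < n" "j \<noteq> i0" using j by (auto simp: J_def)
    have "ad_row l z (L j z) = ad_row l z (E j z) - m j z * ad_row l z (E i0 z)"
      using ad_lin(1)[OF l z\<Omega>, of "E j z" "(- m j z) *s E i0 z"] ad_lin(2)[OF l z\<Omega>, of "- m j z" "E i0 z"]
      by (simp add: L_def)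
    then show ?thesis
      using minors[OF z\<Omega> i0 jn(1) l0 l] a0V[OF z] jn(2) by (simp add: m_def a0_def field_simps)
  qed
  have L_Hs: "L j z \<in> Hs z" if "j < n" for j z
    unfolding L_def using E_Hs[OF that] E_Hs[OF i0] subspace_Hs by (simp add: vec.subspace_diff vec.subspace_scale)
  have A_Hs: "A z v \<in> Hs z" for z v
    unfolding A_def using subspace_Hs L_Hs J(2) by (auto intro!: vec.subspace_sum vec.subspace_scale)
  have ad_A: "ad_row l z (A z v) = 0" if "l \<in> R" "z \<in> ?V" for l z v
    using that V\<Omega> ad_L[OF that(1) _ that(2)] unfolding A_def
    by (subst ad_lin(3)) (auto simp: ad_lin(2) subset_iff)
  \<comment> \<open>The equation of row l0 determines the coefficient of E i0 from the others, so h
    is a combination of the L j, which A z fixes.\<close>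
  have A_Lz: "A z h = h" if h: "h \<in> Lz z" and z: "z \<in> ?V" for h z
  proof -
    have z\<Omega>: "z \<in> \<Omega>" using z V\<Omega> by blast
    obtain c where c: "h = (\<Sum>j<n. c j *s E j z)" using h unfolding Lz_def Hs_def span_lessThan by blast
    have hE: "h = c i0 *s E i0 z + (\<Sum>j\<in>J. c j *s E j z)" unfolding c by (rule sum.remove[of "{..<n}" i0, folded J_def]) (use i0 in auto)
    have "ad_row l0 z h = c i0 * a0 z + (\<Sum>j\<in>J. c j * ad_row l0 z (E j z))"
      unfolding hE ad_lin[OF l0 z\<Omega>] a0_def ..
    then have "c i0 * a0 z = - (\<Sum>j\<in>J. c j * ad_row l0 z (E j z))"
      using h by (simp add: Lz_def eq_neg_iff_add_eq_0)
    then have ci0: "c i0 = - (\<Sum>j\<in>J. c j * m j z)"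
    proof -
      have "(\<Sum>j\<in>J. c j * m j z) = (\<Sum>j\<in>J. c j * ad_row l0 z (E j z)) / a0 z"
        unfolding sum_divide_distrib by (intro sum.cong) (auto simp: m_def J_def)
      then show ?thesis
        using nonzero_mult_div_cancel_right[OF a0V[OF z], of "c i0"]
        unfolding \<open>c i0 * a0 z = - (\<Sum>j\<in>J. c j * ad_row l0 z (E j z))\<close> by simp
    qed
    have "h = (\<Sum>j\<in>J. c j *s L j z)"
      unfolding hE ci0 L_def
      by (simp add: vec.scale_right_diff_distrib sum_subtractf vec.scale_sum_left)
    then show ?thesis using A_L[OF _ z] by (simp add: A_sum A_smult)
  qed

  \<comment> \<open>Involutivity of the kernel: the projected constant fields commute\<close>
  have integ: "dd (\<lambda>x. A x v) z (A z u) = dd (\<lambda>x. A x u) z (A z v)" if z: "z \<in> ?V" for z u v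
  proof -
    have z\<Omega>: "z \<in> \<Omega>" using z V\<Omega> by blast
    define X Y where "X = (\<lambda>x. A x u)" and "Y = (\<lambda>x. A x v)"
    have hX: "holomorphic_field ?V X" and hY: "holomorphic_field ?V Y" using holA by (auto simp: X_def Y_def)
    have he: "holomorphic_field ?V e" by (rule holomorphic_field_subset[OF hole V\<Omega>])
    have hP: "holomorphic_field ?V (P l)" if "l \<in> R" for l by (rule holomorphic_field_subset[OF holPl[OF that] V\<Omega>])
    have XH: "X w \<in> Hs w" and YH: "Y w \<in> Hs w" for w using A_Hs by (auto simp: X_def Y_def)
    have PX: "dotp (P l w) (X w) = 0" and PY: "dotp (P l w) (Y w) = 0" and Pe: "dotp (P l w) (e w) = 0"
      if "l \<in> R" "w \<in> ?V" for l w
      using mem_Ds[of w] Hs_Ds[OF XH] Hs_Ds[OF YH] e_Ds that V\<Omega> by blast+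
    \<comment> \<open>By Jacobi [e, Z] = [[e, X], Y] + [X, [e, Y]]. The inner brackets lie in H +
      bar K, and row l0 vanishes on X and Y, so it kills both summands; hence Z lies in the kernel
      again.\<close>
    define Z where "Z = lie_bracket X Y"
    have hZ: "holomorphic_field ?V Z" unfolding Z_def by (rule holomorphic_field_lie_bracket[OF open_ball hX hY])
    have ZH: "Z w \<in> Hs w" if "w \<in> ?V" for w
      unfolding Z_def by (rule bracket_Hs[OF open_ball V\<Omega> hX hY XH YH that])
    have eW: "lie_bracket e W w \<in> Ds w" if W: "holomorphic_field ?V W" "\<And>w. W w \<in> Hs w" "\<And>l w. l \<in> R \<Longrightarrow> w \<in> ?V \<Longrightarrow> ad_row l w (W w) = 0"
      and w: "w \<in> ?V" for W w
    proof -
      have "dotp (P l w) (lie_bracket e W w) = 0" if l: "l \<in> R" for l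
      proof -
        have "dotp (P l w) (lie_bracket e W w) = ad_row l w (W w)"
          by (rule dotp_lie_bracket[OF open_ball hP[OF l] he W(1) Pe[OF l] _ w])
             (use mem_Ds Hs_Ds[OF W(2)] l V\<Omega> in blast)+
        then show ?thesis using W(3)[OF l w] by simp
      qed
      then show ?thesis using mem_Ds w V\<Omega> by blast
    qed
    have eX: "lie_bracket e X w \<in> Ds w" and eY: "lie_bracket e Y w \<in> Ds w" if "w \<in> ?V" for w
      using eW[OF hX XH _ that] eW[OF hY YH _ that] ad_A by (auto simp: X_def Y_def)
    have heX: "holomorphic_field ?V (lie_bracket e X)" and heY: "holomorphic_field ?V (lie_bracket e Y)"
      by (intro holomorphic_field_lie_bracket[OF open_ball] he hX hY)+
    have PeX: "dotp (P l0 w) (lie_bracket e X w) = 0" and PeY: "dotp (P l0 w) (lie_bracket e Y w) = 0"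
      if "w \<in> ?V" for w using mem_Ds eX[OF that] eY[OF that] l0 that V\<Omega> by blast+
    have "dotp (P l0 z) (lie_bracket (lie_bracket e X) Y z) = curl (P l0) z (lie_bracket e X z) (Y z)"
      by (rule dotp_lie_bracket[OF open_ball hP[OF l0] heX hY PeX PY[OF l0] z])
    moreover have "curl (P l0) z (lie_bracket e X z) (Y z) = 0"
    proof -
      obtain h c where h: "h \<in> Hs z" "lie_bracket e X z = h + c *s e z" using eX[OF z] unfolding Ds_iff by blast
      show ?thesis using curl_P_Ds[OF l0 z\<Omega> h(1) YH, of c 0] ad_A[OF l0 z, of v] by (simp add: h(2) Y_def)
    qed
    moreover have "dotp (P l0 z) (lie_bracket X (lie_bracket e Y) z) = curl (P l0) z (X z) (lie_bracket e Y z)"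
      by (rule dotp_lie_bracket[OF open_ball hP[OF l0] hX heY PX[OF l0] PeY z])
    moreover have "curl (P l0) z (X z) (lie_bracket e Y z) = 0"
    proof -
      obtain h c where h: "h \<in> Hs z" "lie_bracket e Y z = h + c *s e z" using eY[OF z] unfolding Ds_iff by blast
      show ?thesis using curl_P_Ds[OF l0 z\<Omega> XH h(1), of 0 c] ad_A[OF l0 z, of u] by (simp add: h(2) X_def)
    qed
    moreover have "lie_bracket e Z z = lie_bracket (lie_bracket e X) Y z + lie_bracket X (lie_bracket e Y) z"
      unfolding Z_def by (rule Jacobi[OF open_ball he hX hY z])
    moreover have "dotp (P l0 z) (lie_bracket e Z z) = ad_row l0 z (Z z)"
      by (rule dotp_lie_bracket[OF open_ball hP[OF l0] he hZ Pe[OF l0] _ z])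
         (use mem_Ds Hs_Ds ZH l0 V\<Omega> in blast)+
    ultimately have "ad_row l0 z (Z z) = 0" by (simp add: dotp_simps)
    then have AZ: "A z (Z z) = Z z" using A_Lz[OF _ z] ZH[OF z] by (simp add: Lz_def)
    have Zeq: "Z z = dd Y z (X z) - dd X z (Y z)" unfolding Z_def by (rule lie_bracket_hol[OF hX hY z])
    have lin: "linear (A p)" by (rule linearI) (simp_all add: A_add A_smult scaleR_vec_smult)
    then have blin: "bounded_linear (A p)" by (simp add: linear_conv_bounded_linear)
    \<comment> \<open>A p (A x w) = A p w is independent of x, so derivatives of the projected
      fields lie in the complement. The bracket Z is thus in the complement and in the kernel, that
      is, zero.\<close>
    have Ap0: "A p (dd (\<lambda>x. A x w) z w') = 0" for w w'
    proof -
      have "((\<lambda>x. A p (A x w)) has_derivative (\<lambda>w'. A p (dd (\<lambda>x. A x w) z w'))) (at z)"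
        by (rule bounded_linear.has_derivative[OF blin holomorphic_field_derivative[OF holA z]])
      moreover have "((\<lambda>x. A p (A x w)) has_derivative (\<lambda>w'. 0)) (at z)"
        by (rule has_derivative_transform_within_open[OF has_derivative_const[of "A p w"] open_ball z]) (simp add: proj[OF p2])
      ultimately show ?thesis using has_derivative_unique by metis
    qed
    have "A p (Z z) = 0" using Ap0 linear_diff[OF lin] by (simp add: Zeq X_def Y_def)
    then have "Z z = 0" using proj[OF z p2, of "Z z"] AZ A0 by simp
    then show ?thesis by (simp add: Zeq X_def Y_def)
  qed

  \<comment> \<open>A first integral that sees both E i0 and e\<close>
  have nc: "n < CARD('a)" "i0 < CARD('a)" using r2(3) i0 by auto
  \<comment> \<open>The sum of the two dual covectors takes the value 1 on E i0 and on e at p and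
    vanishes on the kernel of ad_e. Nonvanishing on e gives transversality to bar K, nonvanishing on
    E i0 separates the new distribution from H.\<close>
  define a where "a = q i0 p + q n p"
  have aY: "dotp a (Y j p) = (if j = i0 \<or> j = n then 1 else 0)" if "j < CARD('a)" for j
    using dualq[OF nc(1) that p2] dualq[OF nc(2) that p2] i0 by (auto simp: a_def dotp_simps)
  have "dotp a (L j p) = 0" if "j \<in> J" for j
    using aY[OF J(3)[OF that]] J(4)[OF that] that by (auto simp: J_def)
  then have aA: "dotp a (A p v) = 0" for v by (simp add: A_def dotp_sum dotp_simps)
  obtain \<delta> u where \<delta>: "\<delta> > 0" and holu: "hol (ball p \<delta>) u"
    and uA: "\<And>z v. z \<in> ball p \<delta> \<Longrightarrow> dd u z (A z v) = 0" and up: "\<And>w. dd u p w = dotp a w"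
    using Frobenius_first_integral[OF r2(1) holA A_add A_smult proj integ aA] by metis
  have uE: "dd u p (E i0 p) = 1" using aY[OF nc(2)] YX[of i0] i0 by (simp add: up X_def)
  have ue: "dd u p (e p) = 1" using aY[OF nc(1)] YX[of n] by (simp add: up X_def)
  define r3 where "r3 = min \<delta> r2"
  have r3: "r3 > 0" "ball p r3 \<subseteq> ball p \<delta>" "ball p r3 \<subseteq> ?V" using \<delta> r2 by (auto simp: r3_def)
  have p3: "p \<in> ball p r3" using r3 by simp
  have holu3: "hol (ball p r3) u" by (rule hol_subset[OF holu r3(2)])
  have sub3: "ball p r3 \<subseteq> \<Omega>" using r3(3) V\<Omega> by blast
  have holue: "hol (ball p r3) (\<lambda>z. dd u z (e z))"
    by (rule hol_dd_field[OF open_ball holu3 holomorphic_field_subset[OF hole sub3]])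
  obtain r4 where r4: "r4 > 0" "ball p r4 \<subseteq> ball p r3" "\<And>z. z \<in> ball p r4 \<Longrightarrow> dd u z (e z) \<noteq> 0"
    using hol_nonzero_ball[OF open_ball holue p3] ue by auto
  let ?W = "ball p r4"
  have W\<Omega>: "?W \<subseteq> \<Omega>" and WV: "?W \<subseteq> ?V" using r4 r3 V\<Omega> by blast+
  have holuW: "hol ?W u" by (rule hol_subset[OF holu3 r4(2)])
  have duL: "dd u z h = 0" if "h \<in> Lz z" "z \<in> ?W" for h z
    using uA[of z h] A_Lz[OF that(1)] that(2) r4(2) r3(2) WV by (metis subsetD)

  \<comment> \<open>The second distribution and its properties\<close>
  define Z where "Z j z = E j z - (dd u z (E j z) / dd u z (e z)) *s e z" for j z
  define H' where "H' z = vec.span ((\<lambda>j. Z j z) ` {..<n})" for z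
  have holZ: "holomorphic_field ?W (Z j)" if "j < n" for j
    unfolding Z_def[abs_def]
    by (intro holomorphic_field_diff holomorphic_field_smult hol_divide hol_dd_field[OF open_ball holuW]
        holomorphic_field_subset[OF holE[OF that] W\<Omega>] holomorphic_field_subset[OF hole W\<Omega>] r4(3))
  have ZDs: "Z j z \<in> Ds z" if "j < n" for j z
    unfolding Z_def using Hs_Ds[OF E_Hs[OF that]] e_Ds subspace_Ds by (simp add: vec.subspace_diff vec.subspace_scale)
  have duZ: "dd u z (Z j z) = 0" if "z \<in> ?W" for j z
    unfolding Z_def hol_dd_diff[OF holuW that] hol_dd_smult[OF holuW that] using r4(3)[OF that] by simp
  have Zsum: "(\<Sum>j<n. c j *s Z j z) = (\<Sum>j<n. c j *s E j z) - (dd u z (\<Sum>j<n. c j *s E j z) / dd u z (e z)) *s e z"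
    if "z \<in> ?W" for c z
    unfolding Z_def hol_dd_sum[OF holuW that] hol_dd_smult[OF holuW that]
    by (simp add: vec.scale_right_diff_distrib sum_subtractf vec.scale_sum_left sum_divide_distrib)
  have H'_iff: "v \<in> H' z \<longleftrightarrow> v \<in> Ds z \<and> dd u z v = 0" if z: "z \<in> ?W" for v z
  proof
    assume "v \<in> H' z"
    then obtain c where c: "v = (\<Sum>j<n. c j *s Z j z)" unfolding H'_def span_lessThan by blast
    have "v \<in> Ds z" unfolding c using ZDs subspace_Ds by (auto intro!: vec.subspace_sum vec.subspace_scale)
    moreover have "dd u z v = 0" unfolding c hol_dd_sum[OF holuW z] hol_dd_smult[OF holuW z] by (simp add: duZ[OF z])
    ultimately show "v \<in> Ds z \<and> dd u z v = 0" ..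
  next
    assume v: "v \<in> Ds z \<and> dd u z v = 0"
    then obtain h b where h: "h \<in> Hs z" "v = h + b *s e z" unfolding Ds_iff by blast
    then obtain c where c: "h = (\<Sum>j<n. c j *s E j z)" unfolding Hs_def span_lessThan by blast
    have "dd u z h + b * dd u z (e z) = 0"
      using v unfolding h(2) hol_dd_add[OF holuW z] hol_dd_smult[OF holuW z] by simp
    then have "b = - (dd u z h / dd u z (e z))" using r4(3)[OF z] by (simp add: field_simps eq_neg_iff_add_eq_0)
    then have "v = (\<Sum>j<n. c j *s Z j z)" using Zsum[OF z, of c] by (simp add: h(2) c[symmetric])
    then show "v \<in> H' z" unfolding H'_def span_lessThan by blast
  qed
  \<comment> \<open>Subtracting a multiple of E i0 brings h into the kernel of ad_e, where du and
    all rows vanish. So on H they are multiples of one and the same functional, row l0 divided by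
    a0.\<close>
  have propE: "dd u z h = (ad_row l0 z h / a0 z) * dd u z (E i0 z)"
    "l \<in> R \<Longrightarrow> ad_row l z h = (ad_row l0 z h / a0 z) * ad_row l z (E i0 z)"
    if h: "h \<in> Hs z" and z: "z \<in> ?W" for h z l
  proof -
    have z\<Omega>: "z \<in> \<Omega>" and zV: "z \<in> ?V" using z W\<Omega> WV by auto
    define \<mu> where "\<mu> = ad_row l0 z h / a0 z"
    define g where "g = h + (- \<mu>) *s E i0 z"
    have "g \<in> Hs z" unfolding g_def using h E_Hs[OF i0] subspace_Hs by (intro vec.subspace_add vec.subspace_scale) auto
    moreover have "ad_row l0 z g = 0"
      unfolding g_def ad_lin(1,2)[OF l0 z\<Omega>] using a0V[OF zV] by (simp add: \<mu>_def a0_def)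
    ultimately have gL: "g \<in> Lz z" by (simp add: Lz_def)
    have hg: "h = g + \<mu> *s E i0 z" by (simp add: g_def)
    have "dd u z h = \<mu> * dd u z (E i0 z)"
      unfolding hg hol_dd_add[OF holuW z] hol_dd_smult[OF holuW z] using duL[OF gL z] by simp
    then show "dd u z h = (ad_row l0 z h / a0 z) * dd u z (E i0 z)" by (simp add: \<mu>_def)
    assume l: "l \<in> R"
    have "ad_row l z h = \<mu> * ad_row l z (E i0 z)"
      unfolding hg ad_lin(1,2)[OF l z\<Omega>] using ad_A[OF l zV, of g] A_Lz[OF gL zV] by simp
    then show "ad_row l z h = (ad_row l0 z h / a0 z) * ad_row l z (E i0 z)" by (simp add: \<mu>_def)
  qed
  have rec: "reconstruction n ?W Hc Kc H'"
    unfolding reconstruction_def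
  proof (intro conjI ballI)
    have dim: "vec.dim (H' z) = n" if z: "z \<in> ?W" for z
    proof -
      have z\<Omega>: "z \<in> \<Omega>" using z W\<Omega> by blast
      have "indep n (\<lambda>j. Z j z)" unfolding indep_def
      proof (rule allI, rule impI)
        fix c assume "(\<Sum>j<n. c j *s Z j z) = 0"
        then have "(\<Sum>j<n. c j *s E j z) = (dd u z (\<Sum>j<n. c j *s E j z) / dd u z (e z)) *s e z"
          using Zsum[OF z, of c] by simp
        moreover have "(\<Sum>j<n. c j *s E j z) \<in> Hs z" unfolding Hs_def span_lessThan by blast
        ultimately have "(\<Sum>j<n. c j *s E j z) = 0" using Hs_e[OF z\<Omega>] by blast
        then show "\<forall>j<n. c j = 0" using indepD[OF indep_E[OF z\<Omega>]] by blast
      qed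
      then show ?thesis unfolding H'_def indep_iff_dim .
    qed
    show "subbundle holomorphic_field n ?W H'"
      unfolding subbundle_def
      by (intro ballI exI[of _ ?W] exI[of _ Z]) (use holZ dim in \<open>auto simp: H'_def\<close>)
    show "involutive holomorphic_field ?W H'"
      unfolding involutive_def
    proof (intro ballI)
      fix z X Y assume z: "z \<in> ?W" and X: "X \<in> local_sections holomorphic_field ?W H' z"
        and Y: "Y \<in> local_sections holomorphic_field ?W H' z"
      obtain V where V: "open V" "z \<in> V" "V \<subseteq> ?W" "holomorphic_field V X" "holomorphic_field V Y"
        "\<And>w. w \<in> V \<Longrightarrow> X w \<in> H' w" "\<And>w. w \<in> V \<Longrightarrow> Y w \<in> H' w"
        using local_sections_holD[OF X Y] by metis
      have z\<Omega>: "z \<in> \<Omega>" using z W\<Omega> by blast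
      have XD: "X w \<in> Ds w" "dd u w (X w) = 0" and YD: "Y w \<in> Ds w" "dd u w (Y w) = 0" if "w \<in> V" for w
        using V(3,6,7) that H'_iff[of w] by blast+
      have "dd u z (lie_bracket X Y z) = 0"
        by (rule dd_lie_bracket_zero[OF V(1) hol_subset[OF holuW V(3)] V(4,5) XD(2) YD(2) V(2)])
      moreover have "lie_bracket X Y z \<in> Ds z"
        unfolding mem_Ds[OF z\<Omega>]
      proof
        fix l assume l: "l \<in> R"
        have hP: "holomorphic_field V (P l)" by (rule holomorphic_field_subset[OF holPl[OF l]]) (use V(3) W\<Omega> in blast)
        have "dotp (P l z) (lie_bracket X Y z) = curl (P l) z (X z) (Y z)"
          by (rule dotp_lie_bracket[OF V(1) hP V(4,5) _ _ V(2)]) (use mem_Ds XD(1) YD(1) V(3) W\<Omega> l in blast)+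
        also have "\<dots> = 0"
        proof -
          obtain h1 c1 where h1: "h1 \<in> Hs z" "X z = h1 + c1 *s e z" using XD(1)[OF V(2)] unfolding Ds_iff by blast
          obtain h2 c2 where h2: "h2 \<in> Hs z" "Y z = h2 + c2 *s e z" using YD(1)[OF V(2)] unfolding Ds_iff by blast
          have ne: "dd u z (e z) \<noteq> 0" by (rule r4(3)[OF z])
          have e1: "dd u z h1 + c1 * dd u z (e z) = 0" using XD(2)[OF V(2)]
            unfolding h1(2) hol_dd_add[OF holuW z] hol_dd_smult[OF holuW z] .
          have e2: "dd u z h2 + c2 * dd u z (e z) = 0" using YD(2)[OF V(2)]
            unfolding h2(2) hol_dd_add[OF holuW z] hol_dd_smult[OF holuW z] .
          have "c * dd u z (e z) = - a" if "a + c * dd u z (e z) = 0" for a c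
            using that by (simp add: eq_neg_iff_add_eq_0 add.commute)
          then have c1: "c1 = - dd u z h1 / dd u z (e z)" and c2: "c2 = - dd u z h2 / dd u z (e z)"
            using e1 e2 by (metis nonzero_mult_div_cancel_right[OF ne])+
          \<comment> \<open>The factors of the common functional are symmetric in h1 and h2. With c
            = - du(h) / du(e) for each field, this is the vanishing of the right side of
            \<open>curl_P_Ds\<close>.\<close>
          have "dd u z h1 * ad_row l z h2 = dd u z h2 * ad_row l z h1"
            unfolding propE(1)[OF h1(1) z] propE(1)[OF h2(1) z] propE(2)[OF h1(1) z l] propE(2)[OF h2(1) z l] by (simp only: mult_ac)
          then show ?thesis
            unfolding h1(2) h2(2) curl_P_Ds[OF l z\<Omega> h1(1) h2(1)] c1 c2 by (simp add: diff_divide_distrib[symmetric])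
        qed
        finally show "dotp (P l z) (lie_bracket X Y z) = 0" .
      qed
      ultimately show "lie_bracket X Y z \<in> H' z" using H'_iff[OF z] by blast
    qed
    fix z assume z: "z \<in> ?W"
    have z\<Omega>: "z \<in> \<Omega>" using z W\<Omega> by blast
    \<comment> \<open>Here [K, bar K] \<subseteq> H + bar K is used: it places k in the kernel of
      ad_e, on which du vanishes.\<close>
    have "k z \<in> Lz z" unfolding Lz_def using k_Hs[OF z\<Omega>] ad_row_k[OF l0 z\<Omega>] by blast
    then have "k z \<in> H' z" using H'_iff[OF z] duL[OF _ z] Hs_Ds[OF k_Hs[OF z\<Omega>]] by blast
    then show "Kc z \<subseteq> H' z"
      unfolding Kc[rule_format, OF z\<Omega>] H'_def by (intro vec.span_minimal) auto
    show "H' z \<subseteq> Hc z + tau_push Kc z" unfolding sum_plus_Ds[OF Hc Kc z\<Omega>] using H'_iff[OF z] by blast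
    show "H' z \<inter> tau_push Kc z = {0}"
    proof (intro equalityI subsetI)
      fix v assume v: "v \<in> H' z \<inter> tau_push Kc z"
      then obtain c where c: "v = c *s e z" using tau_push_K[OF Kc z\<Omega>] by blast
      then have "c * dd u z (e z) = 0" using v H'_iff[OF z] hol_dd_smult[OF holuW z] by auto
      then show "v \<in> {0}" using r4(3)[OF z] c by simp
    next
      fix v :: "complex^'a" assume v: "v \<in> {0}"
      then have "v = 0 *s e z" by simp
      then have "v \<in> tau_push Kc z" using tau_push_K[OF Kc z\<Omega>] by blast
      then show "v \<in> H' z \<inter> tau_push Kc z" using v by (auto simp: H'_def vec.span_zero)
    qed
  qed
  have pW: "p \<in> ?W" using r4 by simp
  have "E i0 p \<in> Hc p" "E i0 p \<notin> H' p"
    using E_Hs[OF i0] Hc[rule_format, OF p\<Omega>] H'_iff[OF pW] uE by auto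
  then have "H' p \<noteq> Hc p" by blast
  then show thesis using that[OF open_ball _ W\<Omega> rec] pW by (simp add: p_def)
qed

end

context levi_kernel_frame
begin

lemma P_n: "z \<in> \<Omega> \<Longrightarrow> h \<in> Hs z \<Longrightarrow> dotp (P n z) (h + c *s e z) = c"
proof -
  assume z: "z \<in> \<Omega>" and h: "h \<in> Hs z"
  obtain b where "h = (\<Sum>j<n. b j *s G j z)" using h unfolding Hs_def span_lessThan by (auto simp: G_E)
  then have "dotp (P n z) h = 0" using dualP[OF _ _ z, of n] by (simp add: dotp_sum dotp_simps)
  moreover have "dotp (P n z) (e z) = 1" using dualP[OF _ _ z, of n n] by (simp add: G_e)
  ultimately show ?thesis by (simp add: dotp_simps)
qed

text \<open>The row P n reads off the bar K component \<nu> i of a section Z i, and h i is what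
  remains in H. The rank hypothesis is applied at points of the dense set; continuity and then the
  identity theorem remove \<nu> on the whole complex ball.\<close>

lemma unique_reconstruction:
  assumes Hc: "\<forall>z\<in>\<Omega>. Hc z = Hs z" and Kc: "\<forall>z\<in>\<Omega>. Kc z = vec.span {k z}"
    and U0: "open U0" "p0 \<in> U0" "U0 \<subseteq> closure G0"
    and rank: "\<And>x. x \<in> G0 \<Longrightarrow> \<exists>T\<in>ad_Kbar M H x. rank_op M H x T > 1"
    and U: "open U" "cvec p0 \<in> U" "U \<subseteq> \<Omega>" and rec: "reconstruction n U Hc Kc H'"
  shows "\<exists>W. open W \<and> cvec p0 \<in> W \<and> W \<subseteq> U \<and> (\<forall>z\<in>W. H' z = Hc z)"
proof -
  have sub: "subbundle holomorphic_field n U H'" and inv: "involutive holomorphic_field U H'"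
    and H'D: "\<And>z. z \<in> U \<Longrightarrow> H' z \<subseteq> Hc z + tau_push Kc z" "\<And>z. z \<in> U \<Longrightarrow> H' z \<inter> tau_push Kc z = {0}"
    using rec unfolding reconstruction_def by auto
  obtain U1 Z where U1: "open U1" "cvec p0 \<in> U1" "U1 \<subseteq> U" "\<And>i. i < n \<Longrightarrow> holomorphic_field U1 (Z i)"
    "\<And>z. z \<in> U1 \<Longrightarrow> vec.dim (H' z) = n" "\<And>z. z \<in> U1 \<Longrightarrow> H' z = vec.span ((\<lambda>i. Z i z) ` {..<n})"
    using sub U(2) unfolding subbundle_def by metis
  obtain s1 where s1: "s1 > 0" "ball (cvec p0) s1 \<subseteq> U1" using U1(1,2) open_contains_ball by blast
  obtain s2 where s2: "s2 > 0" "ball p0 s2 \<subseteq> U0" using U0(1,2) open_contains_ball by blast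
  define s where "s = min s1 s2"
  have s: "s > 0" "ball (cvec p0) s \<subseteq> U1" "ball p0 s \<subseteq> U0" using s1 s2 by (auto simp: s_def)
  let ?W = "ball (cvec p0) s"
  have WU: "?W \<subseteq> U" and W\<Omega>: "?W \<subseteq> \<Omega>" using s(2) U1(3) U(3) by auto
  have pW: "cvec p0 \<in> ?W" using s by simp
  have holZ: "holomorphic_field ?W (Z i)" if "i < n" for i by (rule holomorphic_field_subset[OF U1(4)[OF that] s(2)])
  have Z_mem: "Z i z \<in> H' z" if "i < n" "z \<in> ?W" for i z
  proof -
    have "H' z = vec.span ((\<lambda>i. Z i z) ` {..<n})" using that(2) s(2) by (intro U1(6)) blast
    then show ?thesis using that(1) by (simp add: vec.span_base)
  qed
  have H'Ds: "H' z \<subseteq> Ds z" if "z \<in> ?W" for z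
    using H'D(1)[of z] sum_plus_Ds[OF Hc Kc, of z] that WU W\<Omega> by (metis subsetD)
  define \<nu> where "\<nu> i z = dotp (P n z) (Z i z)" for i z
  have hol\<nu>: "hol ?W (\<nu> i)" if "i < n" for i
    unfolding \<nu>_def by (intro hol_dotp holZ that holomorphic_field_subset[OF holP W\<Omega>]) simp
  define h where "h i z = Z i z - \<nu> i z *s e z" for i z
  have h_Hs: "h i z \<in> Hs z" if "i < n" "z \<in> ?W" for i z
  proof -
    have "Z i z \<in> Ds z" using Z_mem[OF that] H'Ds[OF that(2)] by blast
    then obtain g c where g: "g \<in> Hs z" "Z i z = g + c *s e z" unfolding Ds_iff by blast
    have "\<nu> i z = c" unfolding \<nu>_def g(2) by (rule P_n) (use g that W\<Omega> in auto)
    then show ?thesis using g by (simp add: h_def)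
  qed
  have real_zero: "\<nu> i (cvec x) = 0" if x: "x \<in> G0" "x \<in> ball p0 s" and i: "i < n" for i x
  proof (rule ccontr)
    assume nz: "\<nu> i (cvec x) \<noteq> 0"
    define z where "z = cvec x"
    have z: "z \<in> ?W" using x by (simp add: z_def)
    have z\<Omega>: "z \<in> \<Omega>" using z W\<Omega> by blast
    have xB: "x \<in> B" using z\<Omega> by (simp add: z_def)
    have rel: "\<nu> i z * ad_row l z (h j z) = \<nu> j z * ad_row l z (h i z)" if l: "l \<in> R" and j: "j < n" for l j
    proof -
      have hP: "holomorphic_field ?W (P l)" by (rule holomorphic_field_subset[OF holP W\<Omega>]) (use l in simp)
      have S: "Z a \<in> local_sections holomorphic_field U H' z" if "a < n" for a
        unfolding local_sections_def
        by (intro CollectI exI[of _ ?W] conjI open_ball z WU holZ ballI Z_mem that)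
      have PZ: "dotp (P l w) (Z a w) = 0" if "a < n" "w \<in> ?W" for a w
        using Z_mem[OF that] H'Ds[OF that(2)] mem_Ds[of w] that(2) W\<Omega> l by blast
      have "lie_bracket (Z i) (Z j) z \<in> H' z"
        using inv S[OF i] S[OF j] z WU unfolding involutive_def by blast
      then have "dotp (P l z) (lie_bracket (Z i) (Z j) z) = 0" using H'Ds[OF z] mem_Ds[OF z\<Omega>] l by blast
      moreover have "dotp (P l z) (lie_bracket (Z i) (Z j) z) = curl (P l) z (Z i z) (Z j z)"
        by (rule dotp_lie_bracket[OF open_ball hP holZ[OF i] holZ[OF j] PZ[OF i] PZ[OF j] z])
      moreover have "Z a z = h a z + \<nu> a z *s e z" for a by (simp add: h_def)
      ultimately show ?thesis using curl_P_Ds[OF l z\<Omega> h_Hs[OF i z] h_Hs[OF j z]] by simp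
    qed
    \<comment> \<open>A relation between the h j would put a combination of the Z j into bar K,
      which meets H' only in zero.\<close>
    have ind_h: "indep n (\<lambda>j. h j z)" unfolding indep_def
    proof (rule allI, rule impI)
      fix c assume "(\<Sum>j<n. c j *s h j z) = 0"
      then have "(\<Sum>j<n. c j *s Z j z) = (\<Sum>j<n. c j * \<nu> j z) *s e z"
        by (simp add: h_def vec.scale_right_diff_distrib sum_subtractf vec.scale_sum_left)
      then have "(\<Sum>j<n. c j *s Z j z) \<in> tau_push Kc z" using tau_push_K[OF Kc z\<Omega>] by blast
      moreover have "(\<Sum>j<n. c j *s Z j z) \<in> H' z"
        using U1(6)[of z] z s(2) unfolding span_lessThan[symmetric] by (metis span_lessThan subsetD)
      ultimately have "(\<Sum>j<n. c j *s Z j z) = 0" using H'D(2)[of z] z WU by blast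
      moreover have "indep n (\<lambda>j. Z j z)" using U1(5,6)[of z] z s(2) by (simp add: indep_iff_dim subset_iff)
      ultimately show "\<forall>j<n. c j = 0" unfolding indep_def by blast
    qed
    have span_h: "Hs z \<subseteq> vec.span ((\<lambda>j. h j z) ` {..<n})"
    proof -
      have "(\<lambda>j. h j z) ` {..<n} \<subseteq> Hs z" using h_Hs z by blast
      moreover have "card ((\<lambda>j. h j z) ` {..<n}) = vec.dim (Hs z)"
        using ind_h dim_Hs[OF z\<Omega>] by (simp add: indep_iff card_image)
      ultimately show ?thesis using ind_h vec.card_eq_dim[of "(\<lambda>j. h j z) ` {..<n}" "Hs z"] by (simp add: indep_iff)
    qed
    have "\<exists>c. \<forall>l\<in>R. ad_row l z g = c * ad_row l z (h i z)" if "g \<in> Hs z" for g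
    proof -
      have "g \<in> vec.span ((\<lambda>j. h j z) ` {..<n})" using that span_h by blast
      then obtain b where b: "g = (\<Sum>j<n. b j *s h j z)" unfolding span_lessThan by blast
      \<comment> \<open>Dividing \<open>rel\<close> by \<nu> i makes every value of ad_e a multiple
        of its value at h i, contradicting rank greater than one.\<close>
      have "ad_row l z g = (\<Sum>j<n. b j * (\<nu> j z / \<nu> i z)) * ad_row l z (h i z)" if l: "l \<in> R" for l
      proof -
        have hP: "holomorphic_field \<Omega> (P l)" using holP l by simp
        have "ad_row l z (h j z) = \<nu> j z / \<nu> i z * ad_row l z (h i z)" if "j < n" for j
          using rel[OF l that] nz by (simp add: z_def field_simps)
        then show ?thesis
          unfolding b by (simp add: curl_sum_right[OF hP z\<Omega>] curl_bilinear[OF hP z\<Omega>] sum_distrib_right mult.assoc)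
      qed
      then show ?thesis by blast
    qed
    then show False
      using rank[OF x(1)] rank_op_gt_one_imp[OF xB, of _ "\<lambda>l. ad_row l z (h i z)"] unfolding z_def by blast
  qed
  have zero: "\<nu> i z = 0" if i: "i < n" and z: "z \<in> ?W" for i z
  proof (rule hol_zero_real[OF open_ball convex_ball hol\<nu>[OF i] pW s(1) _ z])
    fix x assume x: "x \<in> ball p0 s"
    show "\<nu> i (cvec x) = 0"
    proof (rule ccontr)
      assume nz: "\<nu> i (cvec x) \<noteq> 0"
      have "continuous_on (ball p0 s) (\<lambda>x. \<nu> i (cvec x))"
        by (rule continuous_on_compose2[OF hol_continuous_on[OF hol\<nu>[OF i]]])
           (auto intro: linear_continuous_on bounded_linear_cvec)
      then have "open (ball p0 s \<inter> (\<lambda>x. \<nu> i (cvec x)) -` (- {0}))"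
        by (rule continuous_open_preimage) auto
      moreover have "x \<in> ball p0 s \<inter> (\<lambda>x. \<nu> i (cvec x)) -` (- {0})" using x nz by simp
      \<comment> \<open>A nonzero value of \<nu> i would persist on a neighbourhood of x, which
        contains a point of the dense set.\<close>
      moreover have "x \<in> closure G0" using x s(3) U0(3) by blast
      ultimately obtain y where "y \<in> G0" "y \<in> ball p0 s" "\<nu> i (cvec y) \<noteq> 0"
        unfolding closure_iff_nhds_not_empty by blast
      then show False using real_zero i by blast
    qed
  qed
  have "H' z = Hc z" if z: "z \<in> ?W" for z
  proof -
    have z\<Omega>: "z \<in> \<Omega>" using z W\<Omega> by blast
    have "Z i z \<in> Hs z" if "i < n" for i using h_Hs[OF that z] zero[OF that z] by (simp add: h_def)
    then have "vec.span ((\<lambda>i. Z i z) ` {..<n}) \<subseteq> Hs z" by (intro vec.span_minimal subspace_Hs) auto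
    then have "H' z \<subseteq> Hs z" using U1(6)[of z] z s(2) by blast
    moreover have "vec.subspace (H' z)" using U1(6)[of z] z s(2) by auto
    moreover have "vec.dim (H' z) = n" using U1(5)[of z] z s(2) by auto
    ultimately have "H' z = Hs z" using vec.subspace_dim_equal[of "H' z" "Hs z"] subspace_Hs dim_Hs[OF z\<Omega>] by simp
    then show ?thesis using Hc z\<Omega> by simp
  qed
  then show ?thesis using WU pW by (intro exI[of _ ?W]) auto
qed

end

section \<open>Existence of adapted frames\<close>

lemma analytic_family_extension:
  fixes X :: "nat \<Rightarrow> real^'m \<Rightarrow> complex^'m"
  assumes "open U" "p \<in> U" "\<And>i. i < n \<Longrightarrow> analytic_field U (X i)"
  obtains s E where "s > 0" "ball p s \<subseteq> U" "\<And>i. i < n \<Longrightarrow> holomorphic_field (ball (cvec p) s) (E i)"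
    "\<And>i x. i < n \<Longrightarrow> x \<in> ball p s \<Longrightarrow> E i (cvec x) = X i x"
proof -
  obtain s0 where s0: "s0 > 0" "ball p s0 \<subseteq> U" using assms(1,2) open_contains_ball by blast
  have "\<forall>i. \<exists>sF. i < n \<longrightarrow> fst sF > 0 \<and> holomorphic_field (ball (cvec p) (fst sF)) (snd sF) \<and>
      (\<forall>x\<in>ball p (fst sF). snd sF (cvec x) = X i x)"
  proof (intro allI)
    fix i
    show "\<exists>sF. i < n \<longrightarrow> fst sF > 0 \<and> holomorphic_field (ball (cvec p) (fst sF)) (snd sF) \<and>
      (\<forall>x\<in>ball p (fst sF). snd sF (cvec x) = X i x)"
    proof (cases "i < n")
      case True
      obtain s F where "s > 0" "holomorphic_field (ball (cvec p) s) F" "\<And>x. x \<in> ball p s \<Longrightarrow> F (cvec x) = X i x"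
        using analytic_field_extension[OF assms(3)[OF True] assms(2)] by blast
      then show ?thesis by (intro exI[of _ "(s, F)"]) auto
    qed auto
  qed
  then obtain sF where sF: "\<And>i. i < n \<Longrightarrow> fst (sF i) > 0"
    "\<And>i. i < n \<Longrightarrow> holomorphic_field (ball (cvec p) (fst (sF i))) (snd (sF i))"
    "\<And>i x. i < n \<Longrightarrow> x \<in> ball p (fst (sF i)) \<Longrightarrow> snd (sF i) (cvec x) = X i x" by metis
  define s where "s = Min (insert s0 ((\<lambda>i. fst (sF i)) ` {..<n}))"
  have s: "s > 0" "s \<le> s0" "\<And>i. i < n \<Longrightarrow> s \<le> fst (sF i)" using s0 sF(1) by (auto simp: s_def)
  show thesis
  proof (rule that[of s "\<lambda>i. snd (sF i)"])
    show "ball p s \<subseteq> U" using subset_ball[OF s(2)] s0(2) by blast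
    show "holomorphic_field (ball (cvec p) s) (snd (sF i))" if "i < n" for i
      by (rule holomorphic_field_subset[OF sF(2)[OF that] subset_ball[OF s(3)[OF that]]])
    show "snd (sF i) (cvec x) = X i x" if "i < n" "x \<in> ball p s" for i x
      using sF(3)[OF that(1)] subset_ball[OF s(3)[OF that(1)]] that(2) by blast
  qed (rule s(1))
qed

lemma dotp_commute: "dotp a b = dotp b a"
  by (simp add: dotp_def mult.commute)

lemma dotp_axis: "dotp (axis i c) v = c * v $ i"
proof -
  have "dotp (axis i c) v = (\<Sum>j\<in>UNIV. if j = i then c * v $ i else 0)"
    unfolding dotp_def by (intro sum.cong) (auto simp: axis_def)
  then show ?thesis by simp
qed

lemma dim_one_span:
  fixes V :: "(complex^'m) set"
  assumes "vec.subspace V" "vec.dim V = 1"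
  obtains v where "v \<noteq> 0" "V = vec.span {v}"
proof -
  obtain Bs where Bs: "Bs \<subseteq> V" "vec.independent Bs" "V \<subseteq> vec.span Bs" "card Bs = vec.dim V"
    using vec.basis_exists by blast
  then obtain v where v: "Bs = {v}" using assms(2) card_1_singletonE by metis
  then have "v \<noteq> 0" using Bs(2) by (simp add: vec.dependent_single)
  moreover have "V = vec.span {v}" using Bs(1,3) v vec.span_minimal[OF _ assms(1)] by blast
  ultimately show thesis using that by blast
qed

lemma levi_frame_shrink:
  assumes "levi_frame M H n p0 r E F Q" "0 < s" "s \<le> r"
  shows "levi_frame M H n p0 s E F Q"
proof -
  interpret levi_frame M H n p0 r E F Q by (rule assms(1))
  have sub: "ball (cvec p0) s \<subseteq> ball (cvec p0) r" and sub': "ball p0 s \<subseteq> ball p0 r"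
    using subset_ball[OF assms(3)] by blast+
  show ?thesis
  proof
    show "cr_structure n M H" by (rule cr)
    show "ball p0 s \<subseteq> M" using sub' ball_M by blast
    show "v = (\<Sum>j<2 * n + 1. dotp (Q j z) v *s F j z)" if "z \<in> ball (cvec p0) s" for z v
      using expand[of z v] that sub by blast
  qed (use assms(2) sub sub' F_E F_tau in \<open>auto intro: holomorphic_field_subset[OF holF] holomorphic_field_subset[OF holQ] simp: dual H_span subset_iff\<close>)
qed

context levi_frame
begin

lemma curl_row:
  assumes "holomorphic_field \<Omega> q" "z \<in> \<Omega>"
  shows "dotp (\<chi> i. curl q z (axis i 1) w) v = curl q z v w"
proof -
  have "curl q z (\<Sum>i\<in>UNIV. v $ i *s axis i 1) w = (\<Sum>i\<in>UNIV. v $ i * curl q z (axis i 1) w)"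
    by (simp add: curl_sum_left[OF assms] curl_bilinear[OF assms])
  then show ?thesis by (simp add: dotp_def basis_expansion mult.commute)
qed

text \<open>
  The Levi kernel is the null space of \<open>2 n + 1\<close> row fields whose rank drops by one on the real
  points.  After one dependent row is replaced by a constant one, the dual frame of the rows
  contains a section of the kernel.\<close>

lemma kernel_section:
  assumes dim: "\<And>x. x \<in> M \<Longrightarrow> vec.dim (levi_kernel M H x) = 1"
  obtains s k where "0 < s" "s \<le> r" "holomorphic_field (ball (cvec p0) s) k"
    "\<And>x. x \<in> ball p0 s \<Longrightarrow> levi_kernel M H x = vec.span {k (cvec x)}"
    "\<And>z. z \<in> ball (cvec p0) s \<Longrightarrow> k z \<noteq> 0" "\<And>z. z \<in> ball (cvec p0) s \<Longrightarrow> k z \<in> Hs z"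
proof -
  define m where "m = 2 * n + 1"
  have card: "CARD('m) = m" using cr by (simp add: cr_structure_def m_def)
  define p where "p = cvec p0"
  have p\<Omega>: "p \<in> \<Omega>" and p0B: "p0 \<in> B" using r by (auto simp: p_def)
  \<comment> \<open>The first n rows pair a vector with bar H under the Levi form, the other n + 1
    rows cut out H. At real points their common null space is the Levi kernel.\<close>
  define row where "row j z = (if j < n then (\<chi> i. curl \<theta> z (axis i 1) (tau_field (E j) z)) else Q j z)" for j z
  have hol_row: "holomorphic_field \<Omega> (row j)" if j: "j < m" for j
  proof (cases "j < n")
    case True
    then show ?thesis
      unfolding holomorphic_field_iff row_def
      by (auto intro!: hol_curl[OF open_ball hol\<theta> holomorphic_field_const hol_tauE[OF True]])
  next
    case False
    then show ?thesis using holQ[of j] j by (simp add: row_def[abs_def] m_def)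
  qed
  have kernel_iff: "v \<in> levi_kernel M H x \<longleftrightarrow> (\<forall>j<m. dotp (row j (cvec x)) v = 0)" if x: "x \<in> B" for x v
  proof -
    have zx: "cvec x \<in> \<Omega>" using x by simp
    have 1: "v \<in> H x \<longleftrightarrow> (\<forall>j<m. \<not> j < n \<longrightarrow> dotp (row j (cvec x)) v = 0)"
      unfolding H_Hs[OF x] mem_Hs[OF zx] by (auto simp: row_def m_def)
    have 2: "(\<forall>w\<in>H x. curl \<theta> (cvec x) v (cnjv w) = 0) \<longleftrightarrow> (\<forall>j<n. dotp (row j (cvec x)) v = 0)"
    proof
      assume L: "\<forall>w\<in>H x. curl \<theta> (cvec x) v (cnjv w) = 0"
      show "\<forall>j<n. dotp (row j (cvec x)) v = 0"
      proof (intro allI impI)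
        fix j assume j: "j < n"
        have "E j (cvec x) \<in> H x" using j by (auto simp: H_span[OF x] intro!: vec.span_base)
        then show "dotp (row j (cvec x)) v = 0" using L j by (simp add: row_def curl_row[OF hol\<theta> zx] tau_field_cvec)
      qed
    next
      assume R: "\<forall>j<n. dotp (row j (cvec x)) v = 0"
      show "\<forall>w\<in>H x. curl \<theta> (cvec x) v (cnjv w) = 0"
      proof
        fix w assume "w \<in> H x"
        then have "cnjv w \<in> Hb (cvec x)" by (simp add: H_Hs[OF x] cnjv_mem)
        then show "curl \<theta> (cvec x) v (cnjv w) = 0"
          unfolding Hb_def
          by (rule curl_span_right[OF hol\<theta> zx, rotated]) (use R in \<open>simp add: row_def curl_row[OF hol\<theta> zx]\<close>)
      qed
    qed
    have "(\<forall>j<m. dotp (row j (cvec x)) v = 0) \<longleftrightarrow>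
        (\<forall>j<m. \<not> j < n \<longrightarrow> dotp (row j (cvec x)) v = 0) \<and> (\<forall>j<n. dotp (row j (cvec x)) v = 0)"
      by (auto simp: m_def)
    then show ?thesis unfolding levi_kernel_iff[OF x] 1 2 by blast
  qed
  have kernel_span: "\<exists>v. v \<noteq> 0 \<and> levi_kernel M H x = vec.span {v}" if x: "x \<in> B" for x
  proof -
    have "vec.subspace (levi_kernel M H x)"
      unfolding vec.subspace_def using kernel_iff[OF x] by (simp add: dotp_simps)
    then show ?thesis using dim_one_span[OF _ dim] x ball_M by blast
  qed
  obtain k0 where k0: "k0 \<noteq> 0" "levi_kernel M H p0 = vec.span {k0}" using kernel_span[OF p0B] by blast
  have "\<forall>j<m. dotp (row j p) k0 = 0"
    using kernel_iff[OF p0B, of k0] k0(2) by (simp add: p_def vec.span_base)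
  then have "\<not> indep m (\<lambda>j. row j p)" using indep_iff_kernel[of "\<lambda>j. row j p"] k0(1) unfolding card by blast
  then obtain c j1 where c: "(\<Sum>j<m. c j *s row j p) = 0" and j1: "j1 < m" "c j1 \<noteq> 0" unfolding indep_def by blast
  obtain i where i: "k0 $ i \<noteq> 0" using k0(1) by (auto simp: vec_eq_iff)
  \<comment> \<open>A constant covector with value 1 on k0. It takes the place of row j1, which is a
    combination of the other rows at p, and makes the system invertible.\<close>
  define a where "a = axis i (1 / k0 $ i)"
  have ak0: "dotp a k0 = 1" using i by (simp add: a_def dotp_axis)
  define X where "X j = (if j = j1 then (\<lambda>z. a) else row j)" for j
  have holX: "holomorphic_field \<Omega> (X j)" if "j < m" for j using hol_row[OF that] by (auto simp: X_def)
  have "indep CARD('m) (\<lambda>j. X j p)"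
    unfolding indep_iff_kernel
  proof (intro allI impI)
    fix v assume v: "\<forall>j<CARD('m). dotp (X j p) v = 0"
    then have others: "dotp (row j p) v = 0" if "j < m" "j \<noteq> j1" for j using that by (auto simp: X_def card)
    have "0 = dotp (\<Sum>j<m. c j *s row j p) v" by (simp add: c dotp_simps)
    also have "\<dots> = (\<Sum>j<m. if j = j1 then c j1 * dotp (row j1 p) v else 0)"
      unfolding dotp_sum_left dotp_simps by (intro sum.cong) (use others in auto)
    finally have "dotp (row j1 p) v = 0" using j1 by simp
    then have "v \<in> levi_kernel M H p0" unfolding kernel_iff[OF p0B] using others p_def by metis
    then obtain b where b: "v = b *s k0" using k0(2) by (auto simp: vec_span_singleton)
    have "dotp a v = 0" using v j1 card by (auto simp: X_def)
    then show "v = 0" using ak0 by (simp add: b dotp_simps)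
  qed
  then have indX: "indep m (\<lambda>j. X j p)" by (simp add: card)
  obtain s Y q where s: "s > 0" "ball p s \<subseteq> \<Omega>" and YX: "\<And>j. j < m \<Longrightarrow> Y j = X j"
    and holq: "\<And>j. j < CARD('m) \<Longrightarrow> holomorphic_field (ball p s) (q j)"
    and dualq: "\<And>i j z. i < CARD('m) \<Longrightarrow> j < CARD('m) \<Longrightarrow> z \<in> ball p s \<Longrightarrow>
       dotp (q i z) (Y j z) = (if i = j then 1 else 0)"
    and expandq: "\<And>z v. z \<in> ball p s \<Longrightarrow> v = (\<Sum>j<CARD('m). dotp (q j z) v *s Y j z)"
    by (rule dual_frame[OF open_ball p\<Omega> holX indX]) (assumption, rule that)
  \<comment> \<open>Vectors and covectors exchange roles: the frame consists of rows, and the dual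
    member at j1 is a vector field killed by every row other than j1.\<close>
  define k where "k = q j1"
  have sr: "s \<le> r" using s r by (simp add: p_def ball_subset_ball_iff)
  have holk: "holomorphic_field (ball p s) k" using holq j1 by (simp add: k_def card)
  have k_nz: "k z \<noteq> 0" if "z \<in> ball p s" for z
    using dualq[OF _ _ that, of j1 j1] j1 by (auto simp: k_def card dotp_simps)
  have k_multiple: "v = dotp a v *s k z" if z: "z \<in> ball p s" and v: "\<And>j. j < m \<Longrightarrow> j \<noteq> j1 \<Longrightarrow> dotp (row j z) v = 0" for z v
  proof -
    have "v $ i = dotp a v * k z $ i" for i
    proof -
      have "v $ i = dotp (axis i 1) v" by (simp add: dotp_axis)
      also have "axis i 1 = (\<Sum>j<m. dotp (q j z) (axis i 1) *s X j z)"
        by (subst expandq[OF z, of "axis i 1"], unfold card, rule sum.cong) (simp_all add: YX)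
      also have "dotp \<dots> v = (\<Sum>j<m. if j = j1 then dotp (k z) (axis i 1) * dotp a v else 0)"
        unfolding dotp_sum_left dotp_simps by (intro sum.cong) (auto simp: X_def v k_def)
      also have "\<dots> = dotp (k z) (axis i 1) * dotp a v" using j1 by simp
      finally show ?thesis by (simp add: dotp_commute[of "k z"] dotp_axis mult.commute)
    qed
    then show ?thesis by (simp add: vec_eq_iff)
  qed
  \<comment> \<open>At a real point the Levi kernel is a line contained in the line of k, so the two
    coincide.\<close>
  have K_span: "levi_kernel M H x = vec.span {k (cvec x)}" if x: "x \<in> ball p0 s" for x
  proof -
    have xB: "x \<in> B" using x sr by auto
    have z: "cvec x \<in> ball p s" using x by (simp add: p_def)
    obtain v where v: "v \<noteq> 0" "levi_kernel M H x = vec.span {v}" using kernel_span[OF xB] by blast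
    then have "v \<in> levi_kernel M H x" by (simp add: vec.span_base)
    then have vk: "v = dotp a v *s k (cvec x)" using k_multiple[OF z] kernel_iff[OF xB] by blast
    define b where "b = dotp a v"
    have b: "v = b *s k (cvec x)" "b \<noteq> 0" using vk v(1) by (auto simp: b_def)
    from b(2) have "k (cvec x) = (1 / b) *s v" unfolding b(1) by simp
    then have "k (cvec x) \<in> vec.span {v}" by (metis insertI1 vec.span_base vec.span_scale)
    moreover have "v \<in> vec.span {k (cvec x)}" using b(1) by (metis insertI1 vec.span_base vec.span_scale)
    ultimately show ?thesis unfolding v(2) by (intro equalityI vec.span_minimal) auto
  qed
  \<comment> \<open>The omitted row may be one of those defining H and is controlled only where k
    spans the Levi kernel. Its vanishing on k is therefore taken from the real points.\<close>
  have k_Hs: "k z \<in> Hs z" if z: "z \<in> ball p s" for z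
  proof -
    have z\<Omega>: "z \<in> \<Omega>" using z s(2) by blast
    have "dotp (Q j z) (k z) = 0" if j: "j \<in> {n..<2 * n + 1}" for j
    proof (rule hol_zero_real[OF open_ball convex_ball _ _ s(1) _ z])
      show "hol (ball p s) (\<lambda>z. dotp (Q j z) (k z))"
        by (intro hol_dotp holk holomorphic_field_subset[OF holQ s(2)]) (use j in simp)
      show "cvec p0 \<in> ball p s" using s by (simp add: p_def)
      fix x assume x: "x \<in> ball p0 s"
      then have xB: "x \<in> B" using sr by auto
      have "k (cvec x) \<in> levi_kernel M H x" unfolding K_span[OF x] by (simp add: vec.span_base)
      then have "k (cvec x) \<in> Hs (cvec x)" using levi_kernel_iff[OF xB] H_Hs[OF xB] by blast
      then show "dotp (Q j (cvec x)) (k (cvec x)) = 0" using mem_Hs[of "cvec x"] xB j by auto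
    qed
    then show ?thesis using mem_Hs[OF z\<Omega>] by blast
  qed
  show thesis
    by (rule that[of s k]) (use s(1) sr holk K_span k_nz k_Hs in \<open>simp_all add: p_def\<close>)
qed

lemma kernel_frame_exists:
  assumes s: "0 < s" "s \<le> r" and holk: "holomorphic_field (ball (cvec p0) s) k"
    and K_span: "\<And>x. x \<in> ball p0 s \<Longrightarrow> levi_kernel M H x = vec.span {k (cvec x)}"
    and k_nz: "\<And>z. z \<in> ball (cvec p0) s \<Longrightarrow> k z \<noteq> 0" and k_Hs: "\<And>z. z \<in> ball (cvec p0) s \<Longrightarrow> k z \<in> Hs z"
  obtains s' G P where "s' \<le> s" "levi_kernel_frame M H n p0 s' E F Q k G P"
proof -
  have card: "CARD('m) = 2 * n + 1" using cr by (simp add: cr_structure_def)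
  define p where "p = cvec p0"
  have p\<Omega>: "p \<in> \<Omega>" and ps: "p \<in> ball p s" using r s by (auto simp: p_def)
  define X where "X j = (if j < n then E j else tau_field k)" for j
  have sub: "ball p s \<subseteq> \<Omega>" using s(2) by (auto simp: p_def)
  have holX: "holomorphic_field (ball p s) (X j)" if "j < Suc n" for j
    using holomorphic_field_subset[OF holE sub] holomorphic_field_tau_field[OF holk, of "ball p s"]
    by (auto simp: X_def p_def cnjv_image_ball)
  have indE: "indep n (\<lambda>j. E j p)"
  proof -
    have "indep (2 * n + 1) (\<lambda>j. F j p)" by (rule dual_indep[of _ "\<lambda>j. Q j p"]) (use dual p\<Omega> in auto)
    then have "indep n (\<lambda>j. F j p)" by (rule indep_mono) simp
    then show ?thesis by (subst indep_cong[of n _ "\<lambda>j. F j p"]) (auto simp: F_E)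
  qed
  have kp: "k p \<noteq> 0" "tau_field k p \<in> Hb p"
    using k_nz[of p] k_Hs[of p] ps by (auto simp: p_def tau_field_cvec cnjv_mem)
  have tkp: "tau_field k p \<noteq> 0" using kp(1) unfolding p_def tau_field_cvec by (metis cnjv_simps(1,5))
  have indX: "indep (Suc n) (\<lambda>j. X j p)" unfolding indep_def
  proof (rule allI, rule impI)
    fix c assume "(\<Sum>j<Suc n. c j *s X j p) = 0"
    then have eq: "(\<Sum>j<n. c j *s E j p) + c n *s tau_field k p = 0" by (simp add: X_def)
    define h where "h = (\<Sum>j<n. c j *s E j p)"
    have "h \<in> Hs p" unfolding h_def Hs_def span_lessThan by blast
    moreover have "h = - (c n *s tau_field k p)" using eq by (simp add: h_def eq_neg_iff_add_eq_0)
    then have "h \<in> Hb p" using kp(2) subspace_Hb by (simp add: vec.subspace_neg vec.subspace_scale)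
    ultimately have h0: "h = 0" using Hs_Hb[OF p\<Omega>] by blast
    then have "c n = 0" using eq tkp by (simp add: h_def)
    moreover have "c j = 0" if "j < n" for j using indepD[OF indE _ that, of c] h0 by (simp add: h_def)
    ultimately show "\<forall>j<Suc n. c j = 0" by (auto simp: less_Suc_eq)
  qed
  obtain s' G P where s': "s' > 0" "ball p s' \<subseteq> ball p s" and GX: "\<And>j. j < Suc n \<Longrightarrow> G j = X j"
    and holG: "\<And>j. j < CARD('m) \<Longrightarrow> holomorphic_field (ball p s') (G j)"
    and holP: "\<And>j. j < CARD('m) \<Longrightarrow> holomorphic_field (ball p s') (P j)"
    and dualP: "\<And>i j z. i < CARD('m) \<Longrightarrow> j < CARD('m) \<Longrightarrow> z \<in> ball p s' \<Longrightarrow>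
       dotp (P i z) (G j z) = (if i = j then 1 else 0)"
    and expandP: "\<And>z v. z \<in> ball p s' \<Longrightarrow> v = (\<Sum>j<CARD('m). dotp (P j z) v *s G j z)"
    by (rule dual_frame[OF open_ball ps holX indX]) (assumption, rule that)
  have le: "s' \<le> s" using s' s by (simp add: ball_subset_ball_iff)
  have "levi_frame M H n p0 s' E F Q"
    by (rule levi_frame_shrink[OF levi_frame_axioms s'(1)]) (use le s(2) in simp)
  moreover have "levi_kernel_frame_axioms M H n p0 s' E k G P"
  proof
    show "holomorphic_field (ball (cvec p0) s') k" using holomorphic_field_subset[OF holk] s'(2) by (simp add: p_def)
    show "levi_kernel M H x = vec.span {k (cvec x)}" if "x \<in> ball p0 s'" for x using K_span le that by auto
    show "k z \<noteq> 0" if "z \<in> ball (cvec p0) s'" for z using k_nz le that by auto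
    show "k z \<in> vec.span ((\<lambda>j. E j z) ` {..<n})" if "z \<in> ball (cvec p0) s'" for z
      using k_Hs[of z] le that by (auto simp: Hs_def)
    show "v = (\<Sum>j<2 * n + 1. dotp (P j z) v *s G j z)" if "z \<in> ball (cvec p0) s'" for z v
      using expandP[of z v] that unfolding card p_def .
  qed (use holP GX dualP in \<open>simp_all add: card X_def p_def\<close>)
  ultimately show thesis using that[OF le] levi_kernel_frame.intro by blast
qed

end

text \<open>For sufficiency the complexification is built from analytic extensions of frames. For
  necessity the frames are taken from the complexification that witnesses recoverability, since the
  second distribution has to violate uniqueness in that very complexification.\<close>

theorem corollary2p8:
  fixes M :: "(real^'m) set" and H :: "real^'m \<Rightarrow> (complex^'m) set" and n :: nat and p\<^sub>0 :: "real^'m"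
  assumes "cr_structure n M H"
    and "two_nondegenerate M H"
    and "\<And>p. p \<in> M \<Longrightarrow> vec.dim (levi_kernel M H p) = 1"
    and "p\<^sub>0 \<in> M"
  shows "recoverable_at n M H p\<^sub>0 \<longleftrightarrow>
    (\<exists>U. open U \<and> p\<^sub>0 \<in> U \<and> U \<subseteq> M \<and>
      (\<exists>G. open G \<and> G \<subseteq> U \<and> U \<subseteq> closure G \<and>
        (\<forall>p\<in>G. \<exists>T\<in>ad_Kbar M H p.
           ad_Kbar M H p = range (\<lambda>c. scale_op M H p c T) \<and> rank_op M H p T > 1)))"
    (is "?L \<longleftrightarrow> ?R")
proof
  assume ?R
  then obtain U0 G0 where U0: "open U0" "p\<^sub>0 \<in> U0" "U0 \<subseteq> closure G0"
    and G0': "\<forall>x\<in>G0. \<exists>T\<in>ad_Kbar M H x. ad_Kbar M H x = range (\<lambda>c. scale_op M H x c T) \<and> rank_op M H x T > 1"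
    by (elim exE conjE) (rule that)
  have G0: "\<exists>T\<in>ad_Kbar M H x. rank_op M H x T > 1" if "x \<in> G0" for x
    using bspec[OF G0' that] by (elim bexE conjE) (rule bexI)
  have "subbundle analytic_field n M H" using assms(1) by (simp add: cr_structure_def)
  then obtain U X where UX: "open U" "p\<^sub>0 \<in> U" "\<And>i. i < n \<Longrightarrow> analytic_field U (X i)"
    "\<And>x. x \<in> U \<Longrightarrow> H x = vec.span ((\<lambda>i. X i x) ` {..<n})"
    using assms(4) unfolding subbundle_def by metis
  obtain s E where s: "s > 0" "ball p\<^sub>0 s \<subseteq> U" "\<And>i. i < n \<Longrightarrow> holomorphic_field (ball (cvec p\<^sub>0) s) (E i)"
    "\<And>i x. i < n \<Longrightarrow> x \<in> ball p\<^sub>0 s \<Longrightarrow> E i (cvec x) = X i x"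
    by (rule analytic_family_extension[OF UX(1,2,3)]) (assumption, rule that)
  have HE: "H x = vec.span ((\<lambda>j. E j (cvec x)) ` {..<n})" if "x \<in> ball p\<^sub>0 s" for x
  proof -
    have "(\<lambda>j. E j (cvec x)) ` {..<n} = (\<lambda>j. X j x) ` {..<n}" by (rule image_cong) (simp_all add: s(4)[OF _ that])
    then show ?thesis using UX(4)[of x] s(2) that by auto
  qed
  obtain r F Q where frame: "levi_frame M H n p\<^sub>0 r E F Q"
    using levi_frame_exists[OF assms(1,4) s(1,3) HE] by blast
  interpret levi_frame M H n p\<^sub>0 r E F Q by (rule frame)
  obtain s' k where s': "0 < s'" "s' \<le> r" "holomorphic_field (ball (cvec p\<^sub>0) s') k"
    "\<And>x. x \<in> ball p\<^sub>0 s' \<Longrightarrow> levi_kernel M H x = vec.span {k (cvec x)}"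
    "\<And>z. z \<in> ball (cvec p\<^sub>0) s' \<Longrightarrow> k z \<noteq> 0" "\<And>z. z \<in> ball (cvec p\<^sub>0) s' \<Longrightarrow> k z \<in> Hs z"
    by (rule kernel_section[OF assms(3)]) (assumption, rule that)
  obtain r' G P where kf: "levi_kernel_frame M H n p\<^sub>0 r' E F Q k G P"
    using kernel_frame_exists[OF s'] by blast
  interpret K: levi_kernel_frame M H n p\<^sub>0 r' E F Q k G P by (rule kf)
  define Kc where "Kc z = vec.span {k z}" for z
  have Hc: "\<forall>z\<in>K.\<Omega>. K.Hs z = K.Hs z" and Kc: "\<forall>z\<in>K.\<Omega>. Kc z = vec.span {k z}" by (simp_all add: Kc_def)
  have "complexification_at n M H p\<^sub>0 K.\<Omega> K.Hs Kc"
    unfolding complexification_at_def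
  proof (intro conjI allI impI)
    show "subbundle holomorphic_field n K.\<Omega> K.Hs"
      using K.reconstruction_Hs[OF Hc Kc] by (simp add: reconstruction_def)
    have img: "(\<lambda>i. k z) ` {..<Suc 0} = {k z}" for z by auto
    have "vec.dim (Kc z) = 1" if "z \<in> K.\<Omega>" for z
      using K.k_nz[OF that] by (simp add: Kc_def vec.dim_eq_card_independent vec.dependent_single)
    then have "subbundle holomorphic_field 1 K.\<Omega> Kc"
      unfolding subbundle_def
      by (intro ballI exI[of _ K.\<Omega>] exI[of _ "\<lambda>i. k"]) (use K.holk in \<open>auto simp: img Kc_def\<close>)
    then show "\<exists>kk. subbundle holomorphic_field kk K.\<Omega> Kc" by blast
    show "cnjv ` K.\<Omega> = K.\<Omega>" by (rule cnjv_image_ball)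
    fix x assume "cvec x \<in> K.\<Omega>"
    then have x: "x \<in> ball p\<^sub>0 r'" by simp
    then show "x \<in> M" using K.ball_M by blast
    show "K.Hs (cvec x) = H x" by (simp add: K.H_Hs[OF x])
    show "Kc (cvec x) = levi_kernel M H x" by (simp add: Kc_def K.K_span[OF x])
  qed (use K.r in auto)
  moreover have "reconstruction n K.\<Omega> K.Hs Kc K.Hs" by (rule K.reconstruction_Hs[OF Hc Kc])
  moreover have "\<exists>W. open W \<and> cvec p\<^sub>0 \<in> W \<and> W \<subseteq> U \<and> (\<forall>z\<in>W. H' z = K.Hs z)"
    if "open U \<and> cvec p\<^sub>0 \<in> U \<and> U \<subseteq> K.\<Omega> \<and> reconstruction n U K.Hs Kc H'" for U H'
    by (rule K.unique_reconstruction[OF Hc Kc U0 G0]) (use that in auto)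
  ultimately show ?L unfolding recoverable_at_def by blast
next
  assume ?L
  then obtain \<Omega>0 Hc Kc where compl: "complexification_at n M H p\<^sub>0 \<Omega>0 Hc Kc"
    and rec: "reconstruction n \<Omega>0 Hc Kc Hc"
    and uniq': "\<forall>U H'. open U \<and> cvec p\<^sub>0 \<in> U \<and> U \<subseteq> \<Omega>0 \<and> reconstruction n U Hc Kc H' \<longrightarrow>
      (\<exists>W. open W \<and> cvec p\<^sub>0 \<in> W \<and> W \<subseteq> U \<and> (\<forall>z\<in>W. H' z = Hc z))"
    unfolding recoverable_at_def by (elim exE conjE) (rule that)
  note uniq = uniq'[rule_format, OF conjI, OF _ conjI, OF _ _ conjI]
  have real: "\<And>x. cvec x \<in> \<Omega>0 \<Longrightarrow> Hc (cvec x) = H x \<and> Kc (cvec x) = levi_kernel M H x"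
    and p\<Omega>0: "cvec p\<^sub>0 \<in> \<Omega>0" and subH: "subbundle holomorphic_field n \<Omega>0 Hc"
    using compl unfolding complexification_at_def by auto
  obtain d where subK: "subbundle holomorphic_field d \<Omega>0 Kc"
    using compl unfolding complexification_at_def by blast
  obtain U1 E where U1: "open U1" "cvec p\<^sub>0 \<in> U1" "U1 \<subseteq> \<Omega>0" "\<And>i. i < n \<Longrightarrow> holomorphic_field U1 (E i)"
    "\<And>z. z \<in> U1 \<Longrightarrow> Hc z = vec.span ((\<lambda>i. E i z) ` {..<n})"
    using subH p\<Omega>0 unfolding subbundle_def by metis
  obtain U2 X where U2: "open U2" "cvec p\<^sub>0 \<in> U2" "U2 \<subseteq> \<Omega>0" "\<And>i. i < d \<Longrightarrow> holomorphic_field U2 (X i)"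
    "\<And>z. z \<in> U2 \<Longrightarrow> vec.dim (Kc z) = d" "\<And>z. z \<in> U2 \<Longrightarrow> Kc z = vec.span ((\<lambda>i. X i z) ` {..<d})"
    using subK p\<Omega>0 unfolding subbundle_def by metis
  \<comment> \<open>The rank of the extended kernel is constant near the point and is read off at
    the point itself.\<close>
  have d: "d = 1" using U2(5)[OF U2(2)] real[OF p\<Omega>0] assms(3)[OF assms(4)] by simp
  define k where "k = X 0"
  have k_span: "Kc z = vec.span {k z}" if "z \<in> U2" for z using U2(6)[OF that] by (simp add: d k_def lessThan_Suc)
  have k_nz: "k z \<noteq> 0" if "z \<in> U2" for z using U2(5)[OF that] k_span[OF that] d by (auto simp: vec.span_insert_0)
  obtain s where s: "s > 0" "ball (cvec p\<^sub>0) s \<subseteq> U1 \<inter> U2"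
    using open_Int[OF U1(1) U2(1)] U1(2) U2(2) open_contains_ball by blast
  have HE: "H x = vec.span ((\<lambda>j. E j (cvec x)) ` {..<n})" if "x \<in> ball p\<^sub>0 s" for x
  proof -
    have "cvec x \<in> U1" using that s(2) by auto
    moreover from this have "cvec x \<in> \<Omega>0" using U1(3) by blast
    ultimately show ?thesis using U1(5)[of "cvec x"] real[of x] by simp
  qed
  have holEs: "holomorphic_field (ball (cvec p\<^sub>0) s) (E j)" if "j < n" for j
    by (rule holomorphic_field_subset[OF U1(4)[OF that]]) (use s in blast)
  obtain r F Q where rs: "r \<le> s" and frame: "levi_frame M H n p\<^sub>0 r E F Q"
    using levi_frame_exists[OF assms(1,4) s(1) holEs HE] by metis
  interpret levi_frame M H n p\<^sub>0 r E F Q by (rule frame)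
  have sub: "\<Omega> \<subseteq> U1" "\<Omega> \<subseteq> U2" using s(2) subset_ball[OF rs] by blast+
  have Hc_Hs: "Hc z = Hs z" if "z \<in> \<Omega>" for z using U1(5)[of z] that sub(1) by (auto simp: Hs_def)
  obtain r' G P where r': "r' \<le> r" and kf: "levi_kernel_frame M H n p\<^sub>0 r' E F Q k G P"
  proof (rule kernel_frame_exists[OF r order_refl])
    show "holomorphic_field \<Omega> k" unfolding k_def by (rule holomorphic_field_subset[OF U2(4) sub(2)]) (simp add: d)
    show "levi_kernel M H x = vec.span {k (cvec x)}" if "x \<in> B" for x
    proof -
      have "cvec x \<in> U2" using that sub(2) by auto
      moreover from this have "cvec x \<in> \<Omega>0" using U2(3) by blast
      ultimately show ?thesis using k_span[of "cvec x"] real[of x] by simp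
    qed
    show "k z \<noteq> 0" if "z \<in> \<Omega>" for z using k_nz that sub(2) by blast
    \<comment> \<open>Off the real points the inclusion of the extended kernel in the extended H
      comes from Hc being a reconstruction of itself.\<close>
    show "k z \<in> Hs z" if "z \<in> \<Omega>" for z
    proof -
      have "z \<in> \<Omega>0" "z \<in> U2" using that sub U1(3) by auto
      then have "k z \<in> Hc z" using rec k_span[of z] unfolding reconstruction_def by (auto simp: vec.span_base subset_iff)
      then show ?thesis using Hc_Hs[OF that] by simp
    qed
  qed (rule that)
  interpret K: levi_kernel_frame M H n p\<^sub>0 r' E F Q k G P by (rule kf)
  have sub': "K.\<Omega> \<subseteq> \<Omega>" by (rule subset_ball[OF r'])
  have HcK: "\<forall>z\<in>K.\<Omega>. Hc z = K.Hs z" using Hc_Hs sub' unfolding Hs_def K.Hs_def by blast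
  have KcK: "\<forall>z\<in>K.\<Omega>. Kc z = vec.span {k z}" using k_span sub sub' by blast
  define minor where "minor i j l l' z = K.ad_row l z (E i z) * K.ad_row l' z (E j z) - K.ad_row l' z (E i z) * K.ad_row l z (E j z)"
    for i j l l' z
  have hol_minor: "hol K.\<Omega> (minor i j l l')" if "i < n" "j < n" "l \<in> K.R" "l' \<in> K.R" for i j l l'
  proof -
    have "hol K.\<Omega> (\<lambda>z. K.ad_row a z (E b z))" if "a \<in> K.R" "b < n" for a b
      by (rule hol_curl[OF open_ball K.holP K.hole K.holE]) (use that in auto)
    then show ?thesis unfolding minor_def[abs_def] using that by (intro hol_diff hol_mult) auto
  qed
  \<comment> \<open>The real points where some minor is nonzero. If they were not dense in the ball,
    all minors would vanish on a real ball, hence identically, and a second reconstruction would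
    exist.\<close>
  define G0 where "G0 = {x \<in> K.B. \<exists>i<n. \<exists>j<n. \<exists>l\<in>K.R. \<exists>l'\<in>K.R. minor i j l l' (cvec x) \<noteq> 0}"
  have "open G0"
  proof -
    have "open (K.B \<inter> (\<lambda>x. minor i j l l' (cvec x)) -` (- {0}))" if "i < n" "j < n" "l \<in> K.R" "l' \<in> K.R" for i j l l'
    proof (rule continuous_open_preimage[OF continuous_on_compose2[OF hol_continuous_on[OF hol_minor[OF that]]]])
      show "continuous_on K.B cvec" by (rule linear_continuous_on[OF bounded_linear_cvec])
    qed auto
    then have "open (\<Union>i\<in>{..<n}. \<Union>j\<in>{..<n}. \<Union>l\<in>K.R. \<Union>l'\<in>K.R. K.B \<inter> (\<lambda>x. minor i j l l' (cvec x)) -` (- {0}))"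
      by (intro open_UN ballI) auto
    moreover have "(\<Union>i\<in>{..<n}. \<Union>j\<in>{..<n}. \<Union>l\<in>K.R. \<Union>l'\<in>K.R. K.B \<inter> (\<lambda>x. minor i j l l' (cvec x)) -` (- {0})) = G0"
      unfolding G0_def by fastforce
    ultimately show ?thesis by simp
  qed
  moreover have "K.B \<subseteq> closure G0"
  proof (rule ccontr)
    assume "\<not> K.B \<subseteq> closure G0"
    then obtain x1 where "x1 \<in> K.B - closure G0" by blast
    moreover have "open (K.B - closure G0)" by (intro open_Diff) auto
    ultimately obtain \<epsilon> where \<epsilon>: "\<epsilon> > 0" "ball x1 \<epsilon> \<subseteq> K.B - closure G0" and x1: "x1 \<in> K.B"
      using open_contains_ball by (metis DiffD1)
    have zero: "minor i j l l' z = 0" if "z \<in> K.\<Omega>" "i < n" "j < n" "l \<in> K.R" "l' \<in> K.R" for z i j l l'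
    proof (rule hol_zero_real[OF open_ball convex_ball hol_minor[OF that(2-5)] _ \<epsilon>(1) _ that(1)])
      show "cvec x1 \<in> K.\<Omega>" using x1 by simp
      fix x assume "x \<in> ball x1 \<epsilon>"
      then have "x \<in> K.B" "x \<notin> G0" using \<epsilon>(2) closure_subset by blast+
      then show "minor i j l l' (cvec x) = 0" unfolding G0_def using that by blast
    qed
    obtain U H' where UH: "open U" "cvec p\<^sub>0 \<in> U" "U \<subseteq> K.\<Omega>" "reconstruction n U Hc Kc H'" "H' (cvec p\<^sub>0) \<noteq> Hc (cvec p\<^sub>0)"
      using K.second_reconstruction[OF assms(2) HcK KcK] zero unfolding minor_def by metis
    have "U \<subseteq> \<Omega>0" using UH(3) sub' sub(1) U1(3) by blast
    then show False using uniq[OF UH(1,2) _ UH(4)] UH(5) by blast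
  qed
  moreover have "\<exists>T\<in>ad_Kbar M H x. ad_Kbar M H x = range (\<lambda>c. scale_op M H x c T) \<and> rank_op M H x T > 1"
    if "x \<in> G0" for x
  proof -
    from that obtain i j l l' where "x \<in> K.B" "i < n" "j < n" "l \<in> K.R" "l' \<in> K.R" "minor i j l l' (cvec x) \<noteq> 0"
      unfolding G0_def by blast
    then show ?thesis using K.rank_condition unfolding minor_def by blast
  qed
  moreover have "G0 \<subseteq> K.B" by (auto simp: G0_def)
  moreover have "p\<^sub>0 \<in> K.B" using K.r by simp
  ultimately show ?R using K.ball_M by (intro exI[of _ K.B] conjI exI[of _ G0] ballI) auto
qed

end
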